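(* Let $F:X\to X$ be an arbitrary map defined on a finite set $X\subset\mathbb{P}^1(\mathbb{C})$ with $|X|\ge 3$. Then there exists a sequence of rigid postcritically finite rational maps $f_n$ such that $|P(f_n)|=|X|$, $$P(f_n)\to X \quad\text{and}\quad f_n|P(f_n)\to F|X$$ as $n\to\infty$.
   Context: Here $\mathbb{P}^1=\mathbb{P}^1(\mathbb{C})$ is the Riemann sphere. Rational maps $f:\mathbb{P}^1\to\mathbb{P}^1$ have complex coefficients and degree $d\ge 2$. $C(f)$ is the set of critical points of $f$, $V(f)=f(C(f))$ is the set of critical values, and the postcritical set is $P(f)=\bigcup_{n\ge 0} f^n(V(f))$, where $f^n$ is the $n$-th iterate. The map $f$ is postcritically finite if $|P(f)|<\infty$. A postcritically finite rational map $f$ is rigid if any postcritically finite rational map $g$ that is uniformly close enough to $f$ (as maps of the sphere) and satisfies $|P(g)|=|P(f)|$ is conformally conjugate to $f$, i.e. $g=\alpha\circ f\circ\alpha^{-1}$ for some $\alpha\in\operatorname{Aut}(\mathbb{P}^1)$. The convergence $P(f_n)\to X$ and $f_n|P(f_n)\to F|X$ means: for all $n$ sufficiently large there are homeomorphisms $\phi_n$ of $\mathbb{P}^1$ such that $\phi_n\to\mathrm{id}$ uniformly, $\phi_n(X)=P(f_n)$, and $\phi_n$ conjugates $F|X$ to $f_n|P(f_n)$, i.e. $f_n(\phi_n(x))=\phi_n(F(x))$ for all $x\in X$. *)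

theory Defs
  imports "HOL-Analysis.Analysis" "HOL-Computational_Algebra.Polynomial"
begin

section \<open>The Riemann sphere\<close>

datatype riemann_sphere = Fin complex | Infty

text \<open>Inverse stereographic projection onto the unit sphere of
  \<open>\<complex> \<times> \<real>\<close>. The chordal metric pulled back along it induces the usual topology of the
  compact space \<open>\<complex> \<union> {\<infinity>}\<close>, so that continuity, homeomorphisms and uniform limits are
  those of the library.\<close>

primrec stereo :: "riemann_sphere \<Rightarrow> complex \<times> real" where
  "stereo (Fin z) =
     (of_real (2 / (1 + (cmod z)\<^sup>2)) * z, ((cmod z)\<^sup>2 - 1) / ((cmod z)\<^sup>2 + 1))"
| "stereo Infty = (0, 1)"

lemma stereo_height: "1 - snd (stereo (Fin z)) = 2 / (1 + (cmod z)\<^sup>2)"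
proof -
  have "1 + (cmod z)\<^sup>2 \<noteq> 0"
    by (smt (verit) zero_le_power2)
  then show ?thesis
    by (simp add: field_simps)
qed

lemma stereo_height_pos: "1 - snd (stereo (Fin z)) > 0"
  unfolding stereo_height by (simp add: add_pos_nonneg)

lemma inj_stereo: "inj stereo"
proof (rule injI)
  fix x y assume eq: "stereo x = stereo y"
  have inv: "fst (stereo (Fin z)) / of_real (1 - snd (stereo (Fin z))) = z" for z
  proof -
    define r where "r = 2 / (1 + (cmod z)\<^sup>2)"
    have "r > 0"
      using stereo_height_pos[of z] unfolding stereo_height r_def .
    moreover have "fst (stereo (Fin z)) = of_real r * z"
      by (simp only: stereo.simps fst_conv r_def)
    ultimately show ?thesis
      by (simp only: stereo_height r_def[symmetric]) simp
  qed
  show "x = y"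
  proof (cases x; cases y)
    fix a b assume "x = Fin a" "y = Fin b"
    then show ?thesis using inv[of a] inv[of b] eq by metis
  next
    fix a assume "x = Fin a" "y = Infty"
    then show ?thesis using stereo_height_pos[of a] eq by simp
  next
    fix b assume "x = Infty" "y = Fin b"
    then show ?thesis using stereo_height_pos[of b] eq[symmetric] by simp
  qed simp
qed

instantiation riemann_sphere :: metric_space
begin

definition dist_riemann_sphere :: "riemann_sphere \<Rightarrow> riemann_sphere \<Rightarrow> real" where
  "dist_riemann_sphere x y = dist (stereo x) (stereo y)"

definition uniformity_riemann_sphere :: "(riemann_sphere \<times> riemann_sphere) filter" where
  "uniformity_riemann_sphere = (INF e\<in>{0<..}. principal {(x, y). dist x y < e})"

definition open_riemann_sphere :: "riemann_sphere set \<Rightarrow> bool" where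
  "open_riemann_sphere U \<longleftrightarrow> (\<forall>x\<in>U. \<forall>\<^sub>F (x', y) in uniformity. x' = x \<longrightarrow> y \<in> U)"

instance
proof
  fix x y z :: riemann_sphere
  show "dist x y = 0 \<longleftrightarrow> x = y"
    by (simp add: dist_riemann_sphere_def inj_eq[OF inj_stereo])
  show "dist x y \<le> dist x z + dist y z"
    unfolding dist_riemann_sphere_def by (rule dist_triangle2)
qed (simp_all only: uniformity_riemann_sphere_def open_riemann_sphere_def)

end

section \<open>Rational maps\<close>

text \<open>The value at infinity is the limit of \<open>p z / q z\<close>: with \<open>d\<close> the larger degree it is
  the ratio of the degree \<open>d\<close> coefficients. For coprime \<open>p\<close>, \<open>q\<close> numerator and
  denominator never vanish simultaneously.\<close>

primrec quotient_map :: "complex poly \<Rightarrow> complex poly \<Rightarrow> riemann_sphere \<Rightarrow> riemann_sphere" where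
  "quotient_map p q (Fin z) = (if poly q z = 0 then Infty else Fin (poly p z / poly q z))"
| "quotient_map p q Infty =
     (let d = max (degree p) (degree q)
      in if coeff q d = 0 then Infty else Fin (coeff p d / coeff q d))"

definition rational_map_of_degree :: "nat \<Rightarrow> (riemann_sphere \<Rightarrow> riemann_sphere) \<Rightarrow> bool" where
  "rational_map_of_degree d f \<longleftrightarrow>
     (\<exists>p q. coprime p q \<and> max (degree p) (degree q) = d \<and> f = quotient_map p q)"

definition sphere_automorphism :: "(riemann_sphere \<Rightarrow> riemann_sphere) \<Rightarrow> bool" where
  "sphere_automorphism \<alpha> \<longleftrightarrow>
     bij \<alpha> \<and> (\<exists>d. rational_map_of_degree d \<alpha>) \<and> (\<exists>d. rational_map_of_degree d (inv \<alpha>))"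

section \<open>Critical points and the postcritical set\<close>

primrec recip :: "riemann_sphere \<Rightarrow> riemann_sphere" where
  "recip (Fin z) = (if z = 0 then Infty else Fin (1 / z))"
| "recip Infty = Fin 0"

text \<open>The value at \<open>Infty\<close> is a dummy: below it only arises away from the base point.\<close>

primrec fin_part :: "riemann_sphere \<Rightarrow> complex" where
  "fin_part (Fin z) = z"
| "fin_part Infty = 0"

text \<open>Coordinates near \<open>x\<close> are \<open>z\<close> if \<open>x\<close> is finite and \<open>1 / z\<close> if \<open>x = Infty\<close>.
  Both coordinate changes are involutions of the sphere, so they serve as their own inverses.\<close>

definition chart_at :: "riemann_sphere \<Rightarrow> riemann_sphere \<Rightarrow> riemann_sphere" where
  "chart_at x = (if x = Infty then recip else id)"

definition local_rep :: "(riemann_sphere \<Rightarrow> riemann_sphere) \<Rightarrow> riemann_sphere \<Rightarrow> complex \<Rightarrow> complex" where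
  "local_rep f x z = fin_part (chart_at (f x) (f (chart_at x (Fin z))))"

definition critical_points :: "(riemann_sphere \<Rightarrow> riemann_sphere) \<Rightarrow> riemann_sphere set" where
  "critical_points f =
     {x. (local_rep f x has_field_derivative 0) (at (fin_part (chart_at x x)))}"

definition critical_values :: "(riemann_sphere \<Rightarrow> riemann_sphere) \<Rightarrow> riemann_sphere set" where
  "critical_values f = f ` critical_points f"

definition postcritical_set :: "(riemann_sphere \<Rightarrow> riemann_sphere) \<Rightarrow> riemann_sphere set" where
  "postcritical_set f = (\<Union>n. (f ^^ n) ` critical_values f)"

definition postcritically_finite :: "(riemann_sphere \<Rightarrow> riemann_sphere) \<Rightarrow> bool" where
  "postcritically_finite f \<longleftrightarrow>
     (\<exists>d\<ge>2. rational_map_of_degree d f) \<and> finite (postcritical_set f)"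

definition conformally_conjugate ::
  "(riemann_sphere \<Rightarrow> riemann_sphere) \<Rightarrow> (riemann_sphere \<Rightarrow> riemann_sphere) \<Rightarrow> bool" where
  "conformally_conjugate f g \<longleftrightarrow> (\<exists>\<alpha>. sphere_automorphism \<alpha> \<and> g = \<alpha> \<circ> f \<circ> inv \<alpha>)"

definition rigid :: "(riemann_sphere \<Rightarrow> riemann_sphere) \<Rightarrow> bool" where
  "rigid f \<longleftrightarrow> postcritically_finite f \<and>
     (\<exists>\<epsilon>>0. \<forall>g. postcritically_finite g \<and> (\<forall>x. dist (g x) (f x) < \<epsilon>) \<and>
        card (postcritical_set g) = card (postcritical_set f)
        \<longrightarrow> conformally_conjugate f g)"

text \<open>Simultaneous convergence \<open>P(f\<^sub>n) \<rightarrow> X\<close> and \<open>f\<^sub>n|P(f\<^sub>n) \<rightarrow> F|X\<close>. Only the values of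
  \<open>F\<close> on \<open>X\<close> matter.\<close>

definition postcritical_dynamics_converge ::
  "(nat \<Rightarrow> riemann_sphere \<Rightarrow> riemann_sphere) \<Rightarrow> (riemann_sphere \<Rightarrow> riemann_sphere)
     \<Rightarrow> riemann_sphere set \<Rightarrow> bool" where
  "postcritical_dynamics_converge f F X \<longleftrightarrow>
     (\<exists>\<phi> :: nat \<Rightarrow> riemann_sphere \<Rightarrow> riemann_sphere.
        (\<forall>\<^sub>F n in sequentially.
           (\<exists>\<psi>. homeomorphism UNIV UNIV (\<phi> n) \<psi>) \<and>
           \<phi> n ` X = postcritical_set (f n) \<and>
           (\<forall>x\<in>X. f n (\<phi> n x) = \<phi> n (F x))) \<and>
        uniform_limit UNIV \<phi> id sequentially)"

end

theory Submission
  imports Defs "HOL-Complex_Analysis.Complex_Analysis"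
    "HOL-Computational_Algebra.Fundamental_Theorem_Algebra"
    "HOL-Computational_Algebra.Polynomial_Factorial"
    "HOL-Computational_Algebra.Field_as_Ring"
begin

text \<open>
  The maps are constructed together with a contraction, so that both the prescribed dynamics and
  rigidity come from the uniqueness of a fixed point.

  \<^emph>\<open>Construction.\<close> After a small perturbation \<open>X\<close> consists of finite nonzero points. For a tuple
  \<open>y\<close> of distinct points near \<open>X\<close>, a tower of Moebius transformations and power maps
  (\<open>tower_family_exists\<close>) provides a map \<open>Q y\<close> such that the critical values of \<open>Q y\<close> and its values
  at \<open>0\<close>, \<open>\<infinity>\<close>, \<open>1\<close> are together exactly the entries of \<open>y\<close>, and points \<open>W j y\<close>, depending
  holomorphically on \<open>y\<close>, with \<open>Q y (W j y) = y j\<close>. A map \<open>B\<close> with critical values \<open>0\<close>, \<open>\<infinity>\<close>, \<open>1\<close>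
  is put underneath: the critical values of \<open>f y = Q y \<circ> B\<close> are exactly the entries of \<open>y\<close>. If
  \<open>f y\<close> takes \<open>y i\<close> to \<open>y (F i)\<close> for all \<open>i\<close>, then these entries are also the postcritical set, with
  the prescribed dynamics. For this it suffices that each \<open>y i\<close> is a preimage of \<open>W (F i) y\<close> under
  \<open>B\<close>. The map \<open>B\<close> is \<open>belyi m M\<close>, and for large \<open>m\<close> it has inverse branches \<open>\<sigma> i\<close> that squeeze a fixed
  disc into a tiny neighbourhood of any chosen point of a dense set (\<open>belyi_section\<close>,
  \<open>imaginary_power_approx\<close>). Hence taking \<open>y\<close> to the tuple of all \<open>\<sigma> i (W (F i) y)\<close> maps a polydisc
  deep into itself, and its fixed point (\<open>contracting_fixed_point\<close>) is the tuple wanted. Since it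
  can be found arbitrarily close to \<open>X\<close>, homeomorphisms near the identity
  (\<open>homeomorphisms_moving_points\<close>) finish the existence part.

  \<^emph>\<open>Rigidity\<close> (\<open>fixed_point_rigid\<close>). Let \<open>g\<close> be close to \<open>f y\<close>, with as many postcritical points.
  Critical values persist under small perturbations, so \<open>g\<close> has at least as many critical values as
  \<open>f y\<close>, and they exhaust its postcritical set. A rational map is determined by its critical values,
  locally and up to precomposition with a Moebius transformation (\<open>equal_up_to_mobius\<close>), so
  \<open>g = f z' \<circ> \<mu>\<close> for the tuple \<open>z'\<close> of critical values of \<open>g\<close>. This is conjugate to
  \<open>\<mu> \<circ> f z' = f z\<close> with \<open>z = \<mu> z'\<close>, as the family is Moebius equivariant. Points of a fibre over a
  critical value do not split under such perturbations (\<open>fibre_point_unique\<close>). It follows that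
  \<open>z\<close> is a fixed point of the same contraction, so \<open>z = y\<close>, and \<open>g\<close> is conjugate to \<open>f y\<close>.

  \<^emph>\<open>Local determination\<close> is proved by counting zeros instead of by coverings or deformation theory.
  Uniform convergence of rational maps forces convergence of the coefficients of numerators and
  denominators (\<open>coefficients_converge\<close>). For two maps \<open>P / Q\<close>, \<open>R / S\<close> near \<open>f\<close>, all of degree
  \<open>d\<close>, with the same critical values, the polynomial \<open>P S - Q R\<close> has degree at most \<open>2 d\<close>. Where
  \<open>f\<close> takes a value \<open>k\<close>-fold it has \<open>k - 1\<close> zeros, in total \<open>2 d - 2\<close>, and three more if three
  critical points are shared, which a Moebius transformation can arrange. This is too much for
  a nonzero polynomial. The count is carried out in the limit of rescaled polynomials
  (\<open>limit_difference_order\<close>, \<open>equal_of_shared_critical_points\<close>).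
\<close>

section \<open>The topology of the sphere and continuous convergence\<close>

lemma tendsto_sphere_iff:
  "(f \<longlongrightarrow> l) F \<longleftrightarrow> ((\<lambda>x. stereo (f x)) \<longlongrightarrow> stereo l) F"
  by (simp add: tendsto_iff dist_riemann_sphere_def)

lemma tendsto_Fin [tendsto_intros]:
  assumes "(z \<longlongrightarrow> l) F"
  shows "((\<lambda>x. Fin (z x)) \<longlongrightarrow> Fin l) F"
proof -
  have "1 + (cmod l)\<^sup>2 \<noteq> 0" "(cmod l)\<^sup>2 + 1 \<noteq> 0"
    by (smt (verit) zero_le_power2)+
  then show ?thesis
    unfolding tendsto_sphere_iff stereo.simps by (intro tendsto_intros assms)
qed

text \<open>Stereographic projection read backwards. The formula is continuous away from the north pole,
  which transfers convergence near finite points from the sphere to the plane.\<close>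

lemma stereo_inverse: "fst (stereo (Fin z)) / of_real (1 - snd (stereo (Fin z))) = z"
proof -
  define r where "r = 2 / (1 + (cmod z)\<^sup>2)"
  have "r > 0"
    using stereo_height_pos[of z] unfolding stereo_height r_def .
  moreover have "fst (stereo (Fin z)) = of_real r * z"
    by (simp only: stereo.simps fst_conv r_def)
  ultimately show ?thesis
    by (simp only: stereo_height r_def[symmetric]) simp
qed

lemma eventually_finite:
  assumes "(f \<longlongrightarrow> Fin l) F"
  shows "\<forall>\<^sub>F x in F. f x \<noteq> Infty" "((\<lambda>x. fin_part (f x)) \<longlongrightarrow> l) F"
    "\<forall>\<^sub>F x in F. f x = Fin (fin_part (f x))"
proof -
  have "Fin l \<noteq> Infty" by simp
  then show ev: "\<forall>\<^sub>F x in F. f x \<noteq> Infty"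
    using assms tendsto_imp_eventually_ne by blast
  then show ev2: "\<forall>\<^sub>F x in F. f x = Fin (fin_part (f x))"
    by eventually_elim (metis fin_part.simps(1) riemann_sphere.exhaust)
  have st: "((\<lambda>x. stereo (f x)) \<longlongrightarrow> stereo (Fin l)) F"
    using assms tendsto_sphere_iff by blast
  have ne: "complex_of_real (1 - snd (stereo (Fin l))) \<noteq> 0"
    using stereo_height_pos[of l] by (simp only: of_real_eq_0_iff less_imp_neq[symmetric] not_False_eq_True)
  have "((\<lambda>x. fst (stereo (f x)) / of_real (1 - snd (stereo (f x)))) \<longlongrightarrow>
      fst (stereo (Fin l)) / of_real (1 - snd (stereo (Fin l)))) F"
    by (intro tendsto_divide tendsto_fst tendsto_snd st tendsto_of_real tendsto_diff
         tendsto_const ne)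
  then have "((\<lambda>x. fst (stereo (f x)) / of_real (1 - snd (stereo (f x)))) \<longlongrightarrow> l) F"
    by (simp only: stereo_inverse)
  moreover have "\<forall>\<^sub>F x in F. fst (stereo (f x)) / of_real (1 - snd (stereo (f x))) = fin_part (f x)"
    using ev2 by eventually_elim (metis stereo_inverse)
  ultimately show "((\<lambda>x. fin_part (f x)) \<longlongrightarrow> l) F"
    by (rule Lim_transform_eventually)
qed

lemma tendsto_Fin_iff [simp]: "((\<lambda>x. Fin (z x)) \<longlongrightarrow> Fin l) F \<longleftrightarrow> (z \<longlongrightarrow> l) F"
  using eventually_finite(2)[of "\<lambda>x. Fin (z x)" l F] tendsto_Fin[of z l F] by auto

text \<open>A rotation of the unit sphere: \<open>recip\<close> is an isometry of the chordal metric, so that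
  everything known near \<open>0\<close> transfers to infinity.\<close>

lemma stereo_recip: "stereo (recip x) = (cnj (fst (stereo x)), - snd (stereo x))"
proof (cases x)
  case (Fin z)
  show ?thesis
  proof (cases "z = 0")
    case False
    define n where "n = (cmod z)\<^sup>2"
    have n: "n > 0" using False by (simp add: n_def)
    have zz: "z * cnj z = of_real n"
      by (simp only: n_def complex_norm_square)
    have a: "cmod (1 / z) ^ 2 = 1 / n"
      by (simp add: n_def norm_divide power_divide)
    have 1: "complex_of_real (2 / (1 + 1 / n)) * (1 / z) = of_real (2 / (1 + n)) * cnj z"
    proof -
      have c: "2 / (1 + 1 / n) = 2 / (1 + n) * n" using n by (simp add: field_simps)
      have "of_real n * (1 / z) = cnj z" using zz False by (simp add: field_simps)
      then show ?thesis unfolding c of_real_mult mult.assoc by simp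
    qed
    have 2: "(1 / n - 1) / (1 / n + 1) = - ((n - 1) / (n + 1))"
    proof -
      have "(1 / n - 1) = (1 - n) / n" "(1 / n + 1) = (n + 1) / n" using n by (auto simp: field_simps)
      then have "(1 / n - 1) / (1 / n + 1) = (1 - n) / (n + 1)" using n by simp
      then show ?thesis by (simp add: minus_divide_left)
    qed
    have "stereo (recip x) = (of_real (2 / (1 + 1 / n)) * (1 / z), (1 / n - 1) / (1 / n + 1))"
      using Fin False by (simp only: recip.simps if_False stereo.simps a)
    moreover have "stereo x = (of_real (2 / (1 + n)) * z, (n - 1) / (n + 1))"
      using Fin by (simp only: stereo.simps n_def)
    ultimately show ?thesis
      by (simp only: 1 2 fst_conv snd_conv complex_cnj_mult complex_cnj_complex_of_real)
  qed (simp add: Fin)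
qed simp

lemma recip_recip [simp]: "recip (recip x) = x"
  by (cases x) auto

lemma tendsto_recip [tendsto_intros]:
  assumes "(f \<longlongrightarrow> l) F"
  shows "((\<lambda>x. recip (f x)) \<longlongrightarrow> recip l) F"
proof -
  have "((\<lambda>x. (cnj (fst (stereo (f x))), - snd (stereo (f x)))) \<longlongrightarrow>
      (cnj (fst (stereo l)), - snd (stereo l))) F"
    by (intro tendsto_intros) (use assms tendsto_sphere_iff in blast)+
  then show ?thesis by (simp only: tendsto_sphere_iff stereo_recip)
qed

lemma tendsto_recip_iff: "((\<lambda>x. recip (f x)) \<longlongrightarrow> recip l) F \<longleftrightarrow> (f \<longlongrightarrow> l) F"
  using tendsto_recip[of f l F] tendsto_recip[of "\<lambda>x. recip (f x)" "recip l" F] by auto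

lemma tendsto_Infty_iff:
  "((\<lambda>x. Fin (z x)) \<longlongrightarrow> Infty) F \<longleftrightarrow> filterlim z at_infinity F"
proof
  assume "((\<lambda>x. Fin (z x)) \<longlongrightarrow> Infty) F"
  then have l: "((\<lambda>x. recip (Fin (z x))) \<longlongrightarrow> Fin 0) F"
    using tendsto_recip by fastforce
  have "((\<lambda>x. fin_part (recip (Fin (z x)))) \<longlongrightarrow> 0) F"
    using eventually_finite(2)[OF l] .
  moreover have "\<forall>\<^sub>F x in F. z x \<noteq> 0"
    using eventually_finite(1)[OF l] by eventually_elim auto
  moreover have "\<forall>\<^sub>F x in F. fin_part (recip (Fin (z x))) = inverse (z x)"
    using calculation(2) by eventually_elim (auto simp: divide_inverse)
  ultimately have "((\<lambda>x. inverse (z x)) \<longlongrightarrow> 0) F" "\<forall>\<^sub>F x in F. z x \<noteq> 0"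
    by (auto intro: Lim_transform_eventually)
  then have "filterlim (\<lambda>x. inverse (z x)) (at 0) F"
    by (auto simp: filterlim_at elim: eventually_mono)
  then show "filterlim z at_infinity F"
    using filterlim_inverse_at_iff by blast
next
  assume a: "filterlim z at_infinity F"
  then have "filterlim (\<lambda>x. inverse (z x)) (at 0) F"
    using filterlim_inverse_at_iff by blast
  then have 1: "((\<lambda>x. inverse (z x)) \<longlongrightarrow> 0) F" and 2: "\<forall>\<^sub>F x in F. inverse (z x) \<noteq> 0"
    by (auto simp: filterlim_at)
  have "((\<lambda>x. recip (Fin (z x))) \<longlongrightarrow> Fin 0) F"
  proof (rule Lim_transform_eventually)
    show "((\<lambda>x. Fin (inverse (z x))) \<longlongrightarrow> Fin 0) F" using 1 by simp
    show "\<forall>\<^sub>F x in F. Fin (inverse (z x)) = recip (Fin (z x))"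
      using 2 by eventually_elim (auto simp: divide_inverse)
  qed
  then show "((\<lambda>x. Fin (z x)) \<longlongrightarrow> Infty) F"
    using tendsto_recip_iff[of "\<lambda>x. Fin (z x)" Infty F] by simp
qed

text \<open>One of the coordinates \<open>z\<close> and \<open>1 / z\<close> has absolute value at most \<open>1\<close> for infinitely many
  terms of a given sequence, and the closed unit disc is compact.\<close>

lemma seq_compact_sphere: "seq_compact (UNIV :: riemann_sphere set)"
  unfolding seq_compact_def
proof (intro allI impI)
  fix f :: "nat \<Rightarrow> riemann_sphere"
  show "\<exists>l\<in>UNIV. \<exists>r::nat \<Rightarrow> nat. strict_mono r \<and> (f \<circ> r) \<longlonglongrightarrow> l"
  proof -
    have key: "\<exists>l r. strict_mono r \<and> (g \<circ> (r::nat\<Rightarrow>nat)) \<longlonglongrightarrow> l"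
      if "\<forall>n. \<exists>z. g n = Fin z \<and> cmod z \<le> 1" for g :: "nat \<Rightarrow> riemann_sphere"
    proof -
      define z where "z n = fin_part (g n)" for n
      have z: "g n = Fin (z n)" "cmod (z n) \<le> 1" for n
        using that[rule_format, of n] by (auto simp: z_def)
      have "bounded (range z)" using z(2) by (auto intro: boundedI)
      then obtain l r where "strict_mono (r::nat\<Rightarrow>nat)" "(z \<circ> r) \<longlonglongrightarrow> l"
        using bounded_imp_convergent_subsequence by blast
      moreover from this have "(g \<circ> r) \<longlonglongrightarrow> Fin l"
        using tendsto_Fin[of "z \<circ> r" l] z(1) by (simp add: o_def)
      ultimately show ?thesis by blast
    qed
    have c: "(\<exists>z. x = Fin z \<and> cmod z \<le> 1) \<or> (\<exists>z. recip x = Fin z \<and> cmod z \<le> 1)" for x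
    proof (cases x)
      case (Fin z)
      show ?thesis
      proof (cases "cmod z \<le> 1")
        case False
        then have "recip x = Fin (1/z) \<and> cmod (1/z) \<le> 1"
          using Fin by (auto simp: norm_divide)
        then show ?thesis by blast
      qed (use Fin in auto)
    qed auto
    define A where "A = {n. \<exists>z. f n = Fin z \<and> cmod z \<le> 1}"
    show ?thesis
    proof (cases "infinite A")
      case True
      let ?s = "enumerate A"
      have s: "strict_mono ?s" using strict_mono_enumerate[OF True] .
      have "\<forall>n. \<exists>z. (f \<circ> ?s) n = Fin z \<and> cmod z \<le> 1"
        using enumerate_in_set[OF True] by (auto simp: A_def)
      from key[OF this] obtain l r where "strict_mono r" "((f \<circ> ?s) \<circ> (r::nat\<Rightarrow>nat)) \<longlonglongrightarrow> l" by blast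
      then show ?thesis using s by (metis UNIV_I o_assoc strict_mono_o)
    next
      case False
      have "UNIV = A \<union> (- A)" by blast
      then have inf: "infinite (- A)" using False by (metis finite_Un infinite_UNIV_nat)
      let ?s = "enumerate (- A)"
      have s: "strict_mono ?s" using strict_mono_enumerate[OF inf] .
      have "\<forall>n. \<exists>z. (\<lambda>n. recip (f (?s n))) n = Fin z \<and> cmod z \<le> 1"
        using enumerate_in_set[OF inf] c[of "f (?s _)"] unfolding A_def by blast
      from key[OF this] obtain l r where r: "strict_mono r"
        "((\<lambda>n. recip (f (?s n))) \<circ> (r::nat\<Rightarrow>nat)) \<longlonglongrightarrow> l" by blast
      have "(f \<circ> (?s \<circ> r)) \<longlonglongrightarrow> recip l"
        using tendsto_recip[OF r(2)] by (simp add: o_def)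
      then show ?thesis using s r(1) by (metis UNIV_I strict_mono_o)
    qed
  qed
qed

lemma sphere_convergent_subseq:
  fixes f :: "nat \<Rightarrow> riemann_sphere"
  obtains r l where "strict_mono (r::nat\<Rightarrow>nat)" "(f \<circ> r) \<longlonglongrightarrow> l"
proof -
  obtain l r where "strict_mono (r::nat\<Rightarrow>nat)" "(f \<circ> r) \<longlonglongrightarrow> l"
    by (rule seq_compactE[OF seq_compact_sphere, of f]) auto
  then show ?thesis by (rule that)
qed

text \<open>Continuous convergence. On a compact space it amounts to uniform convergence to a continuous
  limit, but it passes through compositions without any estimate and can be checked pointwise
  in charts.\<close>

definition cconv :: "(nat \<Rightarrow> 'a::metric_space \<Rightarrow> 'b::metric_space) \<Rightarrow> ('a \<Rightarrow> 'b) \<Rightarrow> bool" where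
  "cconv g f \<longleftrightarrow> (\<forall>z l. z \<longlonglongrightarrow> l \<longrightarrow> (\<lambda>n. g n (z n)) \<longlonglongrightarrow> f l)"

lemma cconvD: "cconv g f \<Longrightarrow> z \<longlonglongrightarrow> l \<Longrightarrow> (\<lambda>n. g n (z n)) \<longlonglongrightarrow> f l"
  by (simp add: cconv_def)

lemma cconv_comp: "cconv g f \<Longrightarrow> cconv g' f' \<Longrightarrow> cconv (\<lambda>n. g n \<circ> g' n) (f \<circ> f')"
  by (auto simp: cconv_def)

lemma cconv_const: "continuous_on UNIV f \<Longrightarrow> cconv (\<lambda>n. f) f"
  by (auto simp: cconv_def continuous_on_eq_continuous_at isCont_tendsto_compose)

text \<open>A sequence of points belonging to a subsequence of maps is extended to all indices by its
  limit.\<close>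

lemma cconv_subseq:
  fixes g :: "nat \<Rightarrow> 'a::metric_space \<Rightarrow> 'b::metric_space"
  assumes "cconv g f" "strict_mono r"
  shows "cconv (\<lambda>n. g (r n)) f"
  unfolding cconv_def
proof (intro allI impI)
  fix z and l :: 'a assume z: "z \<longlonglongrightarrow> l"
  define z' where "z' m = (if m \<in> range r then z (inv r m) else l)" for m
  have z'r: "z' (r n) = z n" for n
    using strict_mono_imp_inj_on[OF assms(2)] by (simp add: z'_def)
  have "z' \<longlonglongrightarrow> l"
  proof (rule tendstoI)
    fix e :: real assume "0 < e"
    then obtain N where N: "\<And>n. n \<ge> N \<Longrightarrow> dist (z n) l < e"
      using z by (meson metric_LIMSEQ_D)
    have "dist (z' m) l < e" if "m \<ge> r N" for m
    proof (cases "m \<in> range r")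
      case True
      then obtain n where n: "m = r n" by blast
      then have "n \<ge> N" using that assms(2) by (simp add: strict_mono_less_eq)
      then show ?thesis using N n z'r by simp
    qed (simp add: z'_def \<open>0 < e\<close>)
    then show "\<forall>\<^sub>F n in sequentially. dist (z' n) l < e" by (auto simp: eventually_sequentially)
  qed
  then have "(\<lambda>n. g n (z' n)) \<longlonglongrightarrow> f l" using assms(1) by (simp add: cconv_def)
  from LIMSEQ_subseq_LIMSEQ[OF this assms(2)] show "(\<lambda>n. g (r n) (z n)) \<longlonglongrightarrow> f l"
    by (simp add: o_def z'r)
qed

text \<open>Each \<open>f (z n)\<close> is close to \<open>g m (z n)\<close> for large \<open>m\<close>; choosing these indices increasingly,
  continuous convergence along the resulting subsequence gives the claim.\<close>

lemma cconv_cont: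
  assumes "cconv g f" shows "continuous_on UNIV f"
proof -
  have "(\<lambda>n. f (z n)) \<longlonglongrightarrow> f l" if z: "z \<longlonglongrightarrow> l" for z l
  proof (rule tendstoI)
    fix e :: real assume e: "0 < e"
    have "\<exists>k. \<forall>m\<ge>k. dist (g m (z n)) (f (z n)) < e / 2" for n
      using metric_LIMSEQ_D[OF cconvD[OF assms tendsto_const], of "e/2"] e by auto
    then obtain K where K: "\<And>n m. m \<ge> K n \<Longrightarrow> dist (g m (z n)) (f (z n)) < e / 2" by metis
    define s where "s = rec_nat (K 0) (\<lambda>n a. max (Suc a) (K (Suc n)))"
    have s: "strict_mono s" "\<And>n. s n \<ge> K n"
    proof -
      show "strict_mono s" by (rule strict_monoI_Suc) (simp add: s_def less_max_iff_disj)
      show "s n \<ge> K n" for n by (cases n) (auto simp: s_def)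
    qed
    have "(\<lambda>n. g (s n) (z n)) \<longlonglongrightarrow> f l"
      using cconvD[OF cconv_subseq[OF assms s(1)] z] .
    then obtain N where N: "\<And>n. n \<ge> N \<Longrightarrow> dist (g (s n) (z n)) (f l) < e / 2"
      using e by (meson half_gt_zero metric_LIMSEQ_D)
    have "dist (f (z n)) (f l) < e" if "n \<ge> N" for n
      using N[OF that] K[OF s(2)[of n]] by (metis dist_commute dist_triangle_half_l)
    then show "\<forall>\<^sub>F n in sequentially. dist (f (z n)) (f l) < e" by (auto simp: eventually_sequentially)
  qed
  then show ?thesis
    by (simp add: continuous_on_sequentially o_def)
qed

text \<open>Points at which the distance stays above \<open>e\<close> would accumulate, by compactness, at a point
  where continuous convergence fails.\<close>

lemma cconv_uniform:
  fixes g :: "nat \<Rightarrow> riemann_sphere \<Rightarrow> riemann_sphere"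
  assumes "cconv g f" "e > 0"
  shows "\<forall>\<^sub>F n in sequentially. \<forall>x. dist (g n x) (f x) < e"
proof (rule ccontr)
  assume "\<not> ?thesis"
  then have "\<exists>\<^sub>F n in sequentially. \<exists>x. \<not> dist (g n x) (f x) < e"
    by (simp add: not_eventually)
  then have inf: "infinite {n. \<exists>x. \<not> dist (g n x) (f x) < e}"
    by (simp add: frequently_cofinite[symmetric] cofinite_eq_sequentially)
  define s where "s = enumerate {n. \<exists>x. \<not> dist (g n x) (f x) < e}"
  have s: "strict_mono s" "\<And>n. \<exists>x. \<not> dist (g (s n) x) (f x) < e"
    using strict_mono_enumerate[OF inf] enumerate_in_set[OF inf] by (auto simp: s_def)
  then obtain x where x: "\<And>n. \<not> dist (g (s n) (x n)) (f (x n)) < e" by metis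
  obtain r l where r: "strict_mono (r::nat\<Rightarrow>nat)" "(x \<circ> r) \<longlonglongrightarrow> l"
    using sphere_convergent_subseq by blast
  have a: "(\<lambda>n. g (s (r n)) (x (r n))) \<longlonglongrightarrow> f l"
    using cconvD[OF cconv_subseq[OF cconv_subseq[OF assms(1) s(1)] r(1)] r(2)] by (simp add: o_def)
  have b: "(\<lambda>n. f (x (r n))) \<longlonglongrightarrow> f l"
    using cconv_cont[OF assms(1)] r(2)
    by (auto simp: continuous_on_sequentially o_def)
  have "(\<lambda>n. dist (g (s (r n)) (x (r n))) (f (x (r n)))) \<longlonglongrightarrow> 0"
    using tendsto_dist[OF a b] by simp
  then have "\<forall>\<^sub>F n in sequentially. dist (g (s (r n)) (x (r n))) (f (x (r n))) < e"
    using assms(2) by (auto dest: order_tendstoD(2))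
  then show False using x by (simp add: eventually_sequentially)
qed

lemma cconvI_uniform:
  fixes g :: "nat \<Rightarrow> 'a::metric_space \<Rightarrow> 'b::metric_space"
  assumes "continuous_on UNIV f" "\<And>e. e > 0 \<Longrightarrow> \<forall>\<^sub>F n in sequentially. \<forall>x. dist (g n x) (f x) < e"
  shows "cconv g f"
  unfolding cconv_def
proof (intro allI impI tendstoI)
  fix z and l :: 'a and e :: real assume z: "z \<longlonglongrightarrow> l" and e: "0 < e"
  have "(\<lambda>n. f (z n)) \<longlonglongrightarrow> f l"
    using assms(1) z by (auto simp: continuous_on_sequentially o_def)
  then have "\<forall>\<^sub>F n in sequentially. dist (f (z n)) (f l) < e / 2"
    using e tendstoD by (metis half_gt_zero)
  moreover have "\<forall>\<^sub>F n in sequentially. \<forall>x. dist (g n x) (f x) < e / 2"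
    using assms(2)[of "e / 2"] e by linarith
  ultimately show "\<forall>\<^sub>F n in sequentially. dist (g n (z n)) (f l) < e"
  proof eventually_elim
    case (elim n)
    then show ?case using dist_triangle[of "g n (z n)" "f l" "f (z n)"] by (smt (verit) field_sum_of_halves)
  qed
qed

lemma finite_separated:
  fixes V :: "'a::metric_space set"
  assumes "finite V"
  obtains \<delta> where "\<delta> > 0" "\<And>u u'. u \<in> V \<Longrightarrow> u' \<in> V \<Longrightarrow> u \<noteq> u' \<Longrightarrow> \<delta> \<le> dist u u'"
proof -
  let ?D = "(\<lambda>(u, u'). dist u u') ` {(u, u'). u \<in> V \<and> u' \<in> V \<and> u \<noteq> u'}"
  have fin: "finite ?D"
    by (rule finite_imageI, rule finite_subset[of _ "V \<times> V"]) (use assms in auto)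
  show ?thesis
  proof (rule that[of "Min (insert 1 ?D)"])
    show "Min (insert 1 ?D) > 0" using fin by (subst Min_gr_iff) auto
    fix u u' assume "u \<in> V" "u' \<in> V" "u \<noteq> u'"
    then show "Min (insert 1 ?D) \<le> dist u u'" using fin by (intro Min_le) auto
  qed
qed

lemma eventually_inverse_Suc_less:
  "e > 0 \<Longrightarrow> \<forall>\<^sub>F n in sequentially. 1 / real (Suc n) < e"
  by (rule order_tendstoD(2)[OF LIMSEQ_Suc[OF lim_1_over_n]])

lemma frequently_subseq:
  assumes "\<exists>\<^sub>F n in sequentially. P n"
  obtains r where "strict_mono (r::nat\<Rightarrow>nat)" "\<And>n. P (r n)"
proof -
  have inf: "infinite {n. P n}"
    using assms by (simp add: frequently_cofinite[symmetric] cofinite_eq_sequentially)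
  show ?thesis
    using that[of "enumerate {n. P n}"] strict_mono_enumerate[OF inf] enumerate_in_set[OF inf] by auto
qed

section \<open>Rational maps as continuous self-maps of the sphere\<close>

text \<open>Reversing the coefficients with respect to degree \<open>d\<close> gives \<open>z ^ d * p (1 / z)\<close>, the form that
  numerators and denominators of degree at most \<open>d\<close> take in the coordinate \<open>1 / z\<close>.\<close>

definition refl_poly :: "nat \<Rightarrow> complex poly \<Rightarrow> complex poly" where
  "refl_poly d p = (\<Sum>i\<le>d. monom (coeff p (d - i)) i)"

lemma coeff_refl_poly: "coeff (refl_poly d p) i = (if i \<le> d then coeff p (d - i) else 0)"
  unfolding refl_poly_def coeff_sum coeff_monom by (simp add: sum.delta)

lemma degree_refl_poly: "degree (refl_poly d p) \<le> d"
  by (rule degree_le) (simp add: coeff_refl_poly)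

lemma refl_poly_refl_poly: "degree p \<le> d \<Longrightarrow> refl_poly d (refl_poly d p) = p"
  by (rule poly_eqI) (auto simp: coeff_refl_poly coeff_eq_0)

lemma poly_altdef_le:
  fixes p :: "complex poly"
  assumes "degree p \<le> d" shows "poly p z = (\<Sum>i\<le>d. coeff p i * z ^ i)"
proof -
  have "(\<Sum>i\<le>degree p. coeff p i * z ^ i) = (\<Sum>i\<le>d. coeff p i * z ^ i)"
    using assms by (intro sum.mono_neutral_left) (auto simp: coeff_eq_0)
  then show ?thesis by (simp add: poly_altdef)
qed

lemma poly_refl_poly:
  assumes "degree p \<le> d" "z \<noteq> 0"
  shows "poly (refl_poly d p) z = z ^ d * poly p (1 / z)"
proof -
  have "poly (refl_poly d p) z = (\<Sum>i\<le>d. coeff (refl_poly d p) i * z ^ i)"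
    using degree_refl_poly by (rule poly_altdef_le)
  also have "\<dots> = (\<Sum>i\<le>d. coeff p (d - i) * z ^ i)"
    by (intro sum.cong) (auto simp: coeff_refl_poly)
  also have "\<dots> = (\<Sum>i\<le>d. coeff p i * z ^ (d - i))"
    by (rule sum.reindex_bij_witness[of _ "\<lambda>i. d - i" "\<lambda>i. d - i"]) auto
  also have "\<dots> = z ^ d * (\<Sum>i\<le>d. coeff p i * (1 / z) ^ i)"
    unfolding sum_distrib_left
    by (intro sum.cong) (use assms(2) in \<open>auto simp: power_diff power_one_over field_simps\<close>)
  finally show ?thesis using poly_altdef_le[OF assms(1)] by simp
qed

lemma poly_refl_poly_0: "poly (refl_poly d p) 0 = coeff p d"
  by (simp add: poly_0_coeff_0 coeff_refl_poly)

lemma coprime_no_common_root: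
  fixes p q :: "complex poly"
  assumes "coprime p q" "poly p z = 0" "poly q z = 0" shows False
proof -
  have "[:-z, 1:] dvd p" "[:-z, 1:] dvd q" using assms by (auto simp: poly_eq_0_iff_dvd)
  then have "is_unit [:-z, 1:]" using assms(1) coprime_common_divisor by blast
  then show False by (simp add: is_unit_iff_degree)
qed

lemma coprimeI_no_common_root:
  fixes p q :: "complex poly"
  assumes "\<And>z. poly p z = 0 \<Longrightarrow> poly q z = 0 \<Longrightarrow> False" "q \<noteq> 0 \<or> p \<noteq> 0"
  shows "coprime p q"
proof (rule ccontr)
  assume "\<not> coprime p q"
  then obtain c where c: "c dvd p" "c dvd q" "\<not> is_unit c" by (rule not_coprimeE)
  then have "c \<noteq> 0" using assms(2) by auto
  then have "degree c \<noteq> 0" using c(3) by (simp add: is_unit_iff_degree)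
  then obtain z where "poly c z = 0"
    using alg_closed_imp_poly_has_root by (metis gr0I)
  then have "poly p z = 0" "poly q z = 0" using c by (auto elim!: dvdE)
  then show False using assms(1) by blast
qed

lemma coprime_refl_poly:
  assumes "coprime p q" "max (degree p) (degree q) = d"
  shows "coprime (refl_poly d p) (refl_poly d q)"
    "max (degree (refl_poly d p)) (degree (refl_poly d q)) = d"
proof -
  have dp: "degree p \<le> d" "degree q \<le> d" using assms(2) by auto
  have nz: "p \<noteq> 0 \<or> q \<noteq> 0" using assms(1) by auto
  then have lead: "coeff p d \<noteq> 0 \<or> coeff q d \<noteq> 0"
  proof (cases "p = 0 \<or> q = 0")
    case True
    then have "(p = 0 \<and> q \<noteq> 0 \<and> d = degree q) \<or> (q = 0 \<and> p \<noteq> 0 \<and> d = degree p)"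
      using nz assms(2) by auto
    then show ?thesis by auto
  next
    case False
    then show ?thesis using assms(2) by (cases "degree q \<le> degree p") auto
  qed
  show "coprime (refl_poly d p) (refl_poly d q)"
  proof (rule coprimeI_no_common_root)
    fix z assume z: "poly (refl_poly d p) z = 0" "poly (refl_poly d q) z = 0"
    show False
    proof (cases "z = 0")
      case True then show ?thesis using lead z by (simp add: poly_refl_poly_0)
    next
      case False
      then have "poly p (1/z) = 0" "poly q (1/z) = 0"
        using z poly_refl_poly[OF dp(1)] poly_refl_poly[OF dp(2)] by auto
      then show ?thesis using coprime_no_common_root assms(1) by blast
    qed
  next
    show "refl_poly d q \<noteq> 0 \<or> refl_poly d p \<noteq> 0"
      using refl_poly_refl_poly[OF dp(1)] refl_poly_refl_poly[OF dp(2)] nz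
      by (metis coeff_0 coeff_refl_poly diff_self_eq_0 lead poly_0 poly_refl_poly_0)
  qed
  have "coeff p 0 \<noteq> 0 \<or> coeff q 0 \<noteq> 0"
    using coprime_no_common_root[OF assms(1), of 0] by (auto simp: poly_0_coeff_0)
  then have "coeff (refl_poly d p) d \<noteq> 0 \<or> coeff (refl_poly d q) d \<noteq> 0"
    by (simp add: coeff_refl_poly)
  then show "max (degree (refl_poly d p)) (degree (refl_poly d q)) = d"
    using degree_refl_poly[of d p] degree_refl_poly[of d q] le_degree[of "refl_poly d p" d]
      le_degree[of "refl_poly d q" d] by linarith
qed

lemma quotient_map_recip:
  assumes "coprime p q" "max (degree p) (degree q) = d"
  shows "quotient_map p q (recip x) = quotient_map (refl_poly d p) (refl_poly d q) x"
proof (cases x)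
  case (Fin z)
  have dp: "degree p \<le> d" "degree q \<le> d" using assms(2) by auto
  show ?thesis
  proof (cases "z = 0")
    case True then show ?thesis using Fin assms(2) by (simp add: Let_def poly_refl_poly_0)
  next
    case False
    then show ?thesis using Fin poly_refl_poly[OF dp(1)] poly_refl_poly[OF dp(2)] by simp
  qed
next
  case Infty
  then show ?thesis using coprime_refl_poly[OF assms]
    by (simp add: Let_def coeff_refl_poly poly_0_coeff_0)
qed

lemma recip_quotient_map:
  assumes "coprime p q"
  shows "recip (quotient_map p q x) = quotient_map q p x"
proof (cases x)
  case (Fin z)
  then show ?thesis using coprime_no_common_root[OF assms, of z] by auto
next
  case Infty
  define d where "d = max (degree p) (degree q)"
  have "coeff p d \<noteq> 0 \<or> coeff q d \<noteq> 0"
    using coprime_refl_poly(1)[OF assms d_def[symmetric]]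
      coprime_no_common_root[of "refl_poly d p" "refl_poly d q" 0] by (auto simp: poly_refl_poly_0)
  moreover have "max (degree q) (degree p) = d" by (simp add: d_def max.commute)
  ultimately show ?thesis using Infty by (auto simp: Let_def d_def[symmetric])
qed

text \<open>At finite points with finite values this is the continuity of a quotient of polynomials. The
  remaining points reduce to this case: reversing coefficients moves infinity to \<open>0\<close>, and
  exchanging numerator and denominator turns poles into zeros.\<close>

lemma cconv_quotient_map:
  assumes cop: "\<And>n. coprime (P n) (Q n)" "\<And>n. max (degree (P n)) (degree (Q n)) = d"
    and cop': "coprime p q" "max (degree p) (degree q) = d"
    and lim: "\<And>i. (\<lambda>n. coeff (P n) i) \<longlonglongrightarrow> coeff p i" "\<And>i. (\<lambda>n. coeff (Q n) i) \<longlonglongrightarrow> coeff q i"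
  shows "cconv (\<lambda>n. quotient_map (P n) (Q n)) (quotient_map p q)"
proof -
  have poly_lim: "(\<lambda>n. poly (P n) (w n)) \<longlonglongrightarrow> poly p l"
    if "w \<longlonglongrightarrow> l" "\<And>i. (\<lambda>n. coeff (P n) i) \<longlonglongrightarrow> coeff p i" "\<And>n. degree (P n) \<le> d" "degree p \<le> d"
    for P and p :: "complex poly" and w and l :: complex
  proof -
    have "(\<lambda>n. \<Sum>i\<le>d. coeff (P n) i * w n ^ i) \<longlonglongrightarrow> (\<Sum>i\<le>d. coeff p i * l ^ i)"
      by (intro tendsto_intros that)
    then show ?thesis unfolding poly_altdef_le[OF that(3)] poly_altdef_le[OF that(4)] .
  qed
  have fin: "(\<lambda>n. quotient_map (P n) (Q n) (z n)) \<longlonglongrightarrow> quotient_map p q (Fin l)"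
    if cop: "\<And>n. coprime (P n) (Q n)" "\<And>n. max (degree (P n)) (degree (Q n)) = d"
    and cop': "coprime p q" "max (degree p) (degree q) = d"
    and lim: "\<And>i. (\<lambda>n. coeff (P n) i) \<longlonglongrightarrow> coeff p i" "\<And>i. (\<lambda>n. coeff (Q n) i) \<longlonglongrightarrow> coeff q i"
    and z: "z \<longlonglongrightarrow> Fin l"
    for P Q p q l and z :: "nat \<Rightarrow> riemann_sphere"
  proof -
    have deg: "\<And>n. degree (P n) \<le> d" "\<And>n. degree (Q n) \<le> d" "degree p \<le> d" "degree q \<le> d"
      subgoal for n using cop(2)[of n] by linarith
      subgoal for n using cop(2)[of n] by linarith
      using cop'(2) by linarith+
    define w where "w n = fin_part (z n)" for n
    have w: "w \<longlonglongrightarrow> l" "\<forall>\<^sub>F n in sequentially. z n = Fin (w n)"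
      using eventually_finite(2,3)[OF z] unfolding w_def by auto
    have lP: "(\<lambda>n. poly (P n) (w n)) \<longlonglongrightarrow> poly p l" and lQ: "(\<lambda>n. poly (Q n) (w n)) \<longlonglongrightarrow> poly q l"
      using poly_lim[OF w(1)] lim deg by auto
    have *: "(\<lambda>n. quotient_map (P n) (Q n) (z n)) \<longlonglongrightarrow> quotient_map p q (Fin l)"
      if nz: "poly q l \<noteq> 0" and lP: "(\<lambda>n. poly (P n) (w n)) \<longlonglongrightarrow> poly p l" and lQ: "(\<lambda>n. poly (Q n) (w n)) \<longlonglongrightarrow> poly q l"
      for P Q p q
    proof -
      have "\<forall>\<^sub>F n in sequentially. poly (Q n) (w n) \<noteq> 0"
        using lQ nz tendsto_imp_eventually_ne by blast
      then have "\<forall>\<^sub>F n in sequentially. Fin (poly (P n) (w n) / poly (Q n) (w n)) = quotient_map (P n) (Q n) (z n)"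
        using w(2) by eventually_elim simp
      moreover have "(\<lambda>n. Fin (poly (P n) (w n) / poly (Q n) (w n))) \<longlonglongrightarrow> Fin (poly p l / poly q l)"
        using lP lQ nz by (intro tendsto_intros)
      ultimately have "(\<lambda>n. quotient_map (P n) (Q n) (z n)) \<longlonglongrightarrow> Fin (poly p l / poly q l)"
        by (rule Lim_transform_eventually[rotated])
      then show ?thesis using nz by simp
    qed
    show ?thesis
    proof (cases "poly q l = 0")
      case False then show ?thesis using * lP lQ by blast
    next
      case True
      then have "poly p l \<noteq> 0" using coprime_no_common_root[OF cop'(1)] by blast
      from *[OF this lQ lP] have "(\<lambda>n. recip (quotient_map (P n) (Q n) (z n))) \<longlonglongrightarrow> recip (quotient_map p q (Fin l))"
        using cop(1) cop'(1) by (simp only: recip_quotient_map)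
      then show ?thesis by (simp only: tendsto_recip_iff)
    qed
  qed
  show ?thesis unfolding cconv_def
  proof (intro allI impI)
    fix z and l :: riemann_sphere assume z: "z \<longlonglongrightarrow> l"
    show "(\<lambda>n. quotient_map (P n) (Q n) (z n)) \<longlonglongrightarrow> quotient_map p q l"
    proof (cases l)
      case (Fin x)
      then show ?thesis using fin[OF assms] z by blast
    next
      case Infty
      have "(\<lambda>n. recip (z n)) \<longlonglongrightarrow> Fin 0" using tendsto_recip[OF z] Infty by simp
      from fin[OF coprime_refl_poly(1)[OF cop] coprime_refl_poly(2)[OF cop]
        coprime_refl_poly(1)[OF cop'] coprime_refl_poly(2)[OF cop'] _ _ this]
      have "(\<lambda>n. quotient_map (refl_poly d (P n)) (refl_poly d (Q n)) (recip (z n)))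
         \<longlonglongrightarrow> quotient_map (refl_poly d p) (refl_poly d q) (Fin 0)"
        using lim by (auto simp: coeff_refl_poly)
      then show ?thesis
        using quotient_map_recip[OF cop] quotient_map_recip[OF cop', of "Fin 0"] Infty
        by (simp flip: quotient_map_recip[OF cop])
    qed
  qed
qed

lemma continuous_quotient_map: "coprime p q \<Longrightarrow> continuous_on UNIV (quotient_map p q)"
  by (rule cconv_cont, rule cconv_quotient_map) auto

text \<open>Every point, infinity included, is a limit of finite points that avoid a given finite set.\<close>

lemma continuous_eq_off_finite:
  fixes f g :: "riemann_sphere \<Rightarrow> riemann_sphere"
  assumes "continuous_on UNIV f" "continuous_on UNIV g" "finite S" "\<And>z. z \<notin> S \<Longrightarrow> f (Fin z) = g (Fin z)"
  shows "f = g"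
proof
  fix x
  obtain w :: "nat \<Rightarrow> complex" where w: "\<And>n. w n \<notin> S" "(\<lambda>n. Fin (w n)) \<longlonglongrightarrow> x"
  proof (cases x)
    case (Fin z)
    have inj: "inj (\<lambda>n::nat. z + 1 / of_nat (Suc n))"
      by (auto simp: inj_on_def)
    have "finite ((\<lambda>n::nat. z + 1 / of_nat (Suc n)) -` S)" using finite_vimageI[OF assms(3) inj] .
    then obtain N where "(\<lambda>n::nat. z + 1 / of_nat (Suc n)) -` S \<subseteq> {..<N}"
      using finite_nat_bounded by blast
    then have N: "z + 1 / of_nat (Suc n) \<in> S \<Longrightarrow> n < N" for n by auto
    have "(\<lambda>n. 1 / of_nat n :: complex) \<longlonglongrightarrow> 0" by (rule lim_1_over_n)
    then have "(\<lambda>n. 1 / of_nat (Suc n) :: complex) \<longlonglongrightarrow> 0" by (rule LIMSEQ_Suc)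
    then have l: "(\<lambda>n. z + 1 / of_nat (Suc n)) \<longlonglongrightarrow> z + 0"
      by (intro tendsto_add tendsto_const)
    show ?thesis
    proof (rule that[of "\<lambda>n. z + 1 / of_nat (Suc (n + N))"])
      show "z + 1 / of_nat (Suc (n + N)) \<notin> S" for n using N[of "n + N"] by force
      show "(\<lambda>n. Fin (z + 1 / of_nat (Suc (n + N)))) \<longlonglongrightarrow> x"
        using LIMSEQ_ignore_initial_segment[OF l, of N] Fin by (intro tendsto_Fin[of _ z, folded Fin]) simp
    qed
  next
    case Infty
    have "finite ((of_nat :: nat \<Rightarrow> complex) -` S)" using finite_vimageI[OF assms(3)] inj_of_nat by blast
    then obtain N where "(of_nat :: nat \<Rightarrow> complex) -` S \<subseteq> {..<N}"
      using finite_nat_bounded by blast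
    then have N: "of_nat n \<in> S \<Longrightarrow> n < N" for n by auto
    show ?thesis
    proof (rule that[of "\<lambda>n. of_nat (n + N)"])
      show "of_nat (n + N) \<notin> S" for n using N[of "n + N"] by force
      have "filterlim (\<lambda>n. of_nat n :: complex) at_infinity sequentially"
        by (rule tendsto_of_nat)
      then have "filterlim (\<lambda>n. of_nat (n + N) :: complex) at_infinity sequentially"
        by (rule filterlim_compose) (rule filterlim_add_const_nat_at_top)
      then show "(\<lambda>n. Fin (of_nat (n + N))) \<longlonglongrightarrow> x" unfolding Infty tendsto_Infty_iff .
    qed
  qed
  have "(\<lambda>n. f (Fin (w n))) \<longlonglongrightarrow> f x" "(\<lambda>n. g (Fin (w n))) \<longlonglongrightarrow> g x"
    using assms(1,2) w(2) by (auto simp: continuous_on_sequentially o_def)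
  then show "f x = g x" using LIMSEQ_unique assms(4) w(1) by fastforce
qed

text \<open>Constants are excluded: the remaining maps are surjective, which makes the class closed under
  composition and is what the formula for critical values of a composition relies on.\<close>

definition rat :: "(riemann_sphere \<Rightarrow> riemann_sphere) \<Rightarrow> bool" where
  "rat f \<longleftrightarrow> (\<exists>d\<ge>1. rational_map_of_degree d f)"

lemma ratE:
  assumes "rat f"
  obtains p q where "coprime p q" "max (degree p) (degree q) \<ge> 1" "f = quotient_map p q"
  using assms unfolding rat_def rational_map_of_degree_def by blast

lemma ratI: "coprime p q \<Longrightarrow> max (degree p) (degree q) \<ge> 1 \<Longrightarrow> rat (quotient_map p q)"
  unfolding rat_def rational_map_of_degree_def by blast

lemma rat_continuous: "rat f \<Longrightarrow> continuous_on UNIV f"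
  by (metis ratE continuous_quotient_map)

text \<open>Either \<open>p - a q\<close> has a root, or it is constant and \<open>a\<close> is the value at infinity.\<close>

lemma rat_surj:
  assumes "rat f" shows "\<exists>x. f x = y"
proof -
  obtain p q where pq: "coprime p q" "max (degree p) (degree q) \<ge> 1" "f = quotient_map p q"
    using assms ratE by metis
  have *: "\<exists>x. quotient_map p q x = Fin a" if pq: "coprime p q" "max (degree p) (degree q) \<ge> 1" for p q a
  proof (cases "degree (p - smult a q) = 0")
    case False
    then obtain z where z: "poly (p - smult a q) z = 0"
      using alg_closed_imp_poly_has_root by (metis gr0I)
    then have "poly q z \<noteq> 0" using coprime_no_common_root[OF pq(1), of z] by auto
    then have "quotient_map p q (Fin z) = Fin a" using z by (simp add: field_simps)
    then show ?thesis by blast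
  next
    case True
    define d where "d = max (degree p) (degree q)"
    then have e: "coeff p d = a * coeff q d" using True pq(2) coeff_eq_0[of "p - smult a q" d] by simp
    moreover have "coeff p d \<noteq> 0 \<or> coeff q d \<noteq> 0"
      using  coprime_refl_poly(1)[OF pq(1) d_def[symmetric]]
       coprime_no_common_root[of "refl_poly d p" "refl_poly d q" 0] by (auto simp: poly_refl_poly_0)
    ultimately have "quotient_map p q Infty = Fin a" by (auto simp: Let_def d_def[symmetric])
    then show ?thesis by blast
  qed
  show ?thesis
  proof (cases y)
    case (Fin a) then show ?thesis using *[OF pq(1,2)] pq(3) by blast
  next
    case Infty
    have "\<exists>x. quotient_map q p x = Fin 0"
      using *[of q p 0] pq by (simp add: coprime_commute max.commute)
    then obtain x where "recip (f x) = Fin 0" using recip_quotient_map[OF pq(1)] pq(3) by auto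
    then have "f x = Infty" by (metis recip_recip recip.simps(1))
    then show ?thesis using Infty by blast
  qed
qed

text \<open>Continuity determines the values at the exceptional points, so that recognising a rational map
  requires neither coprime polynomials nor a discussion of poles.\<close>

lemma rat_of_formula:
  fixes p q :: "complex poly"
  assumes cont: "continuous_on UNIV f" and "q \<noteq> 0" and "finite S"
    and "\<And>z. z \<notin> S \<Longrightarrow> poly q z \<noteq> 0 \<Longrightarrow> f (Fin z) = Fin (poly p z / poly q z)"
    and nc: "\<exists>x y. f x \<noteq> f y"
  shows "rat f"
proof -
  obtain p' q' g where p': "p = g * p'" "q = g * q'" "coprime p' q'"
    using gcd_coprime_exists[of p q] assms(2) by (metis gcd_eq_0_iff mult.commute)
  have fin: "finite (S \<union> {z. poly q z = 0})" using assms(2,3) poly_roots_finite by blast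
  have "f = quotient_map p' q'"
  proof (rule continuous_eq_off_finite[OF cont continuous_quotient_map[OF p'(3)] fin])
    fix z assume "z \<notin> S \<union> {z. poly q z = 0}"
    then show "f (Fin z) = quotient_map p' q' (Fin z)"
      using assms(4)[of z] p'(1,2) by auto
  qed
  moreover have "max (degree p') (degree q') \<ge> 1"
  proof (rule ccontr)
    assume "\<not> ?thesis"
    then have "degree p' = 0" "degree q' = 0" by auto
    then obtain a b where "p' = [:a:]" "q' = [:b:]" by (metis degree_eq_zeroE)
    then have "quotient_map p' q' x = quotient_map p' q' y" for x y by (cases x; cases y) (auto simp: Let_def)
    then show False using nc calculation by metis
  qed
  ultimately show ?thesis using ratI[OF p'(3)] by blast
qed

lemma rat_nonconst:
  assumes "rat f" shows "\<exists>x y. f x \<noteq> f y"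
  using rat_surj[OF assms, of "Fin 0"] rat_surj[OF assms, of Infty] by (metis riemann_sphere.distinct(1))

lemma rat_finite_fibre:
  assumes "rat f" shows "finite {x. f x = y}"
proof -
  obtain p q where pq: "coprime p q" "max (degree p) (degree q) \<ge> 1" "f = quotient_map p q"
    using assms ratE by metis
  have fin: "finite {z. f (Fin z) = y}"
  proof (cases y)
    case (Fin a)
    have "p - smult a q \<noteq> 0"
    proof
      assume "p - smult a q = 0"
      then have p: "p = smult a q" by simp
      then have "is_unit q" using pq(1) coprime_common_divisor[of p q q] by (simp add: dvd_smult)
      moreover from this have "q \<noteq> 0" by auto
      ultimately have "degree q = 0" by (simp add: is_unit_iff_degree)
      then show False using pq(2) p by (simp split: if_splits)
    qed
    then have "finite {z. poly (p - smult a q) z = 0}" using poly_roots_finite by blast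
    moreover have "{z. f (Fin z) = y} \<subseteq> {z. poly (p - smult a q) z = 0}"
      using pq(3) Fin by (auto simp: field_simps split: if_splits)
    ultimately show ?thesis by (rule finite_subset[rotated])
  next
    case Infty
    have "q \<noteq> 0"
    proof
      assume "q = 0"
      then have "is_unit p" using pq(1) by simp
      moreover from this have "p \<noteq> 0" by auto
      ultimately have "degree p = 0" by (simp add: is_unit_iff_degree)
      then show False using pq(2) \<open>q = 0\<close> by simp
    qed
    then have "finite {z. poly q z = 0}" using poly_roots_finite by blast
    then show ?thesis using pq(3) Infty by (auto elim!: rev_finite_subset split: if_splits)
  qed
  have "{x. f x = y} \<subseteq> insert Infty (Fin ` {z. f (Fin z) = y})"
  proof
    fix x assume "x \<in> {x. f x = y}"
    then show "x \<in> insert Infty (Fin ` {z. f (Fin z) = y})" by (cases x) auto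
  qed
  then show ?thesis using fin finite_subset by blast
qed

lemma rat_comp:
  assumes "rat f" "rat g" shows "rat (f \<circ> g)"
proof -
  obtain p q where pq: "coprime p q" "max (degree p) (degree q) \<ge> 1" "f = quotient_map p q"
    using assms(1) ratE by metis
  obtain r s where rs: "coprime r s" "max (degree r) (degree s) \<ge> 1" "g = quotient_map r s"
    using assms(2) ratE by metis
  define d where "d = max (degree p) (degree q)"
  have d: "degree p \<le> d" "degree q \<le> d" by (auto simp: d_def)
  (* H homogenises a polynomial of degree at most d and evaluates it at (r, s); clearing
     denominators in the composition gives H p / H q. *)
  define H where "H u = (\<Sum>i\<le>d. smult (coeff u i) (r ^ i * s ^ (d - i)))" for u
  have H: "poly (H u) z = poly s z ^ d * poly u (poly r z / poly s z)"
    if "poly s z \<noteq> 0" "degree u \<le> d" for u z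
  proof -
    have "poly (H u) z = (\<Sum>i\<le>d. coeff u i * (poly r z ^ i * poly s z ^ (d - i)))"
      by (simp add: H_def poly_sum)
    also have "\<dots> = poly s z ^ d * (\<Sum>i\<le>d. coeff u i * (poly r z / poly s z) ^ i)"
      unfolding sum_distrib_left
      by (intro sum.cong) (use that in \<open>auto simp: power_diff power_divide field_simps\<close>)
    finally show ?thesis using poly_altdef_le[OF that(2)] by simp
  qed
  define S where "S = {z. g (Fin z) \<in> {x. f x = Infty} \<union> {Infty}}"
  have "finite S"
  proof -
    have "S \<subseteq> Fin -` (\<Union>y\<in>{x. f x = Infty} \<union> {Infty}. {x. g x = y})" by (auto simp: S_def)
    moreover have "finite (\<Union>y\<in>{x. f x = Infty} \<union> {Infty}. {x. g x = y})"
      using rat_finite_fibre[OF assms(1)] rat_finite_fibre[OF assms(2)] by blast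
    moreover have "inj Fin" by (simp add: inj_def)
    ultimately show ?thesis using finite_vimageI finite_subset by metis
  qed
  have off: "poly s z \<noteq> 0 \<and> poly q (poly r z / poly s z) \<noteq> 0" if "z \<notin> S" for z
    using that unfolding S_def rs(3) pq(3) by (auto split: if_splits)
  show ?thesis
  proof (rule rat_of_formula[where p = "H p" and q = "H q" and S = S])
    show "continuous_on UNIV (f \<circ> g)"
      using rat_continuous assms by (metis continuous_on_compose continuous_on_subset top_greatest)
    obtain z where z: "z \<notin> S" using \<open>finite S\<close> infinite_UNIV_char_0 ex_new_if_finite by metis
    then have "poly (H q) z \<noteq> 0" using H[OF _ d(2)] off by auto
    then show "H q \<noteq> 0" by auto
    show "finite S" by fact
    show "\<exists>x y. (f \<circ> g) x \<noteq> (f \<circ> g) y" using rat_nonconst[OF assms(1)] rat_surj[OF assms(2)] by (metis comp_apply)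
    fix z assume "z \<notin> S"
    then show "(f \<circ> g) (Fin z) = Fin (poly (H p) z / poly (H q) z)"
      using H[OF _ d(1)] H[OF _ d(2)] off[of z] by (auto simp: rs(3) pq(3))
  qed
qed

lemma rat_recip: "rat recip"
proof -
  have "recip = quotient_map 1 [:0, 1:]"
    by (rule ext, rename_tac x, case_tac x) (auto simp: Let_def)
  then show ?thesis using ratI[of 1 "[:0,1:]"] by simp
qed

definition pow_map :: "nat \<Rightarrow> riemann_sphere \<Rightarrow> riemann_sphere" where
  "pow_map m = quotient_map (monom 1 m) 1"

lemma pow_map_Fin [simp]: "pow_map m (Fin z) = Fin (z ^ m)"
  by (simp add: pow_map_def poly_monom)

lemma pow_map_Infty [simp]: "m > 0 \<Longrightarrow> pow_map m Infty = Infty"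
  by (simp add: pow_map_def degree_monom_eq Let_def)

lemma rat_pow_map: "m > 0 \<Longrightarrow> rat (pow_map m)"
  unfolding pow_map_def by (rule ratI) (auto simp: degree_monom_eq)

section \<open>Moebius transformations\<close>

definition mob :: "complex \<Rightarrow> complex \<Rightarrow> complex \<Rightarrow> complex \<Rightarrow> riemann_sphere \<Rightarrow> riemann_sphere" where
  "mob a b c d x = (case x of Infty \<Rightarrow> if c = 0 then Infty else Fin (a / c)
     | Fin z \<Rightarrow> if c * z + d = 0 then Infty else Fin ((a * z + b) / (c * z + d)))"

lemma mob_quotient_map:
  assumes "a * d - b * c \<noteq> 0"
  shows "mob a b c d = quotient_map [:b, a:] [:d, c:]" "coprime [:b, a:] [:d, c:]"
    "max (degree [:b, a:]) (degree [:d, c:]) = 1"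
proof -
  have ac: "a \<noteq> 0 \<or> c \<noteq> 0" using assms by auto
  then show m: "max (degree [:b, a:]) (degree [:d, c:]) = 1" by auto
  show "mob a b c d = quotient_map [:b, a:] [:d, c:]"
  proof
    fix x show "mob a b c d x = quotient_map [:b, a:] [:d, c:] x"
    proof (cases x)
      case Infty
      then show ?thesis using m ac unfolding mob_def by (auto simp del: degree_pCons_eq_if)
    qed (auto simp: mob_def add.commute mult.commute)
  qed
  show "coprime [:b, a:] [:d, c:]"
  proof (rule coprimeI_no_common_root)
    fix z assume "poly [:b, a:] z = 0" "poly [:d, c:] z = 0"
    then have "b = - (z * a)" "d = - (z * c)" by (auto simp: eq_neg_iff_add_eq_0)
    then show False using assms by (simp add: algebra_simps)
  qed (use ac in auto)
qed

lemma rat_mob: "a * d - b * c \<noteq> 0 \<Longrightarrow> rat (mob a b c d)"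
  using mob_quotient_map ratI by (metis order_refl)

lemma mob_comp:
  assumes "a * d - b * c \<noteq> 0" "a' * d' - b' * c' \<noteq> 0"
  shows "mob a b c d (mob a' b' c' d' x) =
    mob (a * a' + b * c') (a * b' + b * d') (c * a' + d * c') (c * b' + d * d') x"
proof (cases x)
  case (Fin z)
  show ?thesis
  proof (cases "c' * z + d' = 0")
    case True
    have nz: "a' * z + b' \<noteq> 0"
    proof
      assume "a' * z + b' = 0"
      then have "a' * d' - b' * c' = 0" using True by algebra
      then show False using assms(2) by simp
    qed
    have 1: "(a * a' + b * c') * z + (a * b' + b * d') = a * (a' * z + b')"
      "(c * a' + d * c') * z + (c * b' + d * d') = c * (a' * z + b')"
      using True by algebra+
    show ?thesis using Fin True nz by (simp add: mob_def 1)
  next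
    case False
    define w where "w = (a' * z + b') / (c' * z + d')"
    have w: "w * (c' * z + d') = a' * z + b'" using False by (simp add: w_def)
    have 1: "(a * a' + b * c') * z + (a * b' + b * d') = (a * w + b) * (c' * z + d')"
      "(c * a' + d * c') * z + (c * b' + d * d') = (c * w + d) * (c' * z + d')"
      using w by algebra+
    have "mob a' b' c' d' x = Fin w" using Fin False by (simp add: mob_def w_def)
    then show ?thesis using Fin False by (simp add: mob_def 1)
  qed
next
  case Infty
  show ?thesis
  proof (cases "c' = 0")
    case True
    then have "a' \<noteq> 0" using assms(2) by auto
    then show ?thesis using Infty True by (simp add: mob_def)
  next
    case False
    define w where "w = a' / c'"
    have w: "w * c' = a'" using False by (simp add: w_def)
    have 1: "a * a' + b * c' = (a * w + b) * c'" "c * a' + d * c' = (c * w + d) * c'"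
      unfolding w[symmetric] by (simp_all add: algebra_simps)
    have "mob a' b' c' d' x = Fin w" using Infty False by (simp add: mob_def w_def)
    then show ?thesis using Infty False by (simp add: mob_def 1)
  qed
qed

lemma mob_id: "a \<noteq> 0 \<Longrightarrow> mob a 0 0 a = id"
  by (rule ext, rename_tac x, case_tac x) (auto simp: mob_def)

definition mobius :: "(riemann_sphere \<Rightarrow> riemann_sphere) \<Rightarrow> bool" where
  "mobius M \<longleftrightarrow> (\<exists>a b c d. a * d - b * c \<noteq> 0 \<and> M = mob a b c d)"

lemma mobius_comp: assumes "mobius M" "mobius N" shows "mobius (M \<circ> N)"
proof -
  obtain a b c d where M: "a * d - b * c \<noteq> 0" "M = mob a b c d" using assms(1) mobius_def by auto
  obtain a' b' c' d' where N: "a' * d' - b' * c' \<noteq> 0" "N = mob a' b' c' d'" using assms(2) mobius_def by auto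
  have "M \<circ> N = mob (a * a' + b * c') (a * b' + b * d') (c * a' + d * c') (c * b' + d * d')"
    using mob_comp[OF M(1) N(1)] M(2) N(2) by auto
  moreover have "(a * a' + b * c') * (c * b' + d * d') - (a * b' + b * d') * (c * a' + d * c') =
     (a * d - b * c) * (a' * d' - b' * c')" by algebra
  ultimately show ?thesis using M(1) N(1) unfolding mobius_def by (metis mult_eq_0_iff)
qed

lemma mob_inverse:
  assumes "a * d - b * c \<noteq> 0"
  shows "mob a b c d \<circ> mob d (-b) (-c) a = id" "mob d (-b) (-c) a \<circ> mob a b c d = id"
    "inv (mob a b c d) = mob d (-b) (-c) a"
proof -
  have 1: "d * a - (- b) * (- c) \<noteq> 0" using assms by (simp add: mult.commute)
  show a: "mob a b c d \<circ> mob d (-b) (-c) a = id"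
    using mob_id[OF assms] mob_comp[OF assms 1] by (auto simp: algebra_simps)
  show b: "mob d (-b) (-c) a \<circ> mob a b c d = id"
    using mob_id[OF assms] mob_comp[OF 1 assms] by (auto simp: algebra_simps)
  show "inv (mob a b c d) = mob d (-b) (-c) a" using inv_unique_comp[OF a b] .
qed

lemma mobius_inv: assumes "mobius M" shows "mobius (inv M)" "M \<circ> inv M = id" "inv M \<circ> M = id" "bij M"
proof -
  obtain a b c d where M: "a * d - b * c \<noteq> 0" "M = mob a b c d" using assms mobius_def by auto
  have 1: "d * a - (- b) * (- c) \<noteq> 0" using M(1) by (simp add: mult.commute)
  show "mobius (inv M)" using M mob_inverse(3)[OF M(1)] 1 unfolding mobius_def by blast
  show "M \<circ> inv M = id" "inv M \<circ> M = id" using mob_inverse[OF M(1)] M(2) by auto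
  then show "bij M" using o_bij by blast
qed

lemma mobius_inv_apply: assumes "mobius M" shows "M (inv M x) = x" "inv M (M x) = x"
  using mobius_inv(2,3)[OF assms] by (metis comp_apply id_apply)+

lemma mobius_rat: "mobius M \<Longrightarrow> rat M"
  using rat_mob unfolding mobius_def by auto

lemma mobius_automorphism: "mobius M \<Longrightarrow> sphere_automorphism M"
  unfolding sphere_automorphism_def using mobius_inv mobius_rat rat_def by metis

text \<open>The Moebius transformation taking \<open>0\<close>, \<open>\<infinity>\<close>, \<open>1\<close> to \<open>a\<close>, \<open>b\<close>, \<open>c\<close>: the ratios of its matrix
  entries give the first two values, and at \<open>1\<close> numerator and denominator are \<open>c * (b - a)\<close> and
  \<open>b - a\<close>.\<close>

definition mob3 :: "complex \<Rightarrow> complex \<Rightarrow> complex \<Rightarrow> riemann_sphere \<Rightarrow> riemann_sphere" where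
  "mob3 a b c = mob (b * (c - a)) (a * (b - c)) (c - a) (b - c)"

lemma mob3_det: "(b * (c - a)) * (b - c) - (a * (b - c)) * (c - a) = (b - a) * (c - a) * (b - c)"
  for a b c :: complex by algebra

lemma mob3:
  assumes "a \<noteq> b" "b \<noteq> c" "c \<noteq> a"
  shows "mobius (mob3 a b c)" "mob3 a b c (Fin 0) = Fin a" "mob3 a b c Infty = Fin b" "mob3 a b c (Fin 1) = Fin c"
proof -
  show "mobius (mob3 a b c)" unfolding mobius_def mob3_def
    using mob3_det[of b c a] assms by (metis mult_eq_0_iff right_minus_eq)
  show "mob3 a b c (Fin 0) = Fin a" "mob3 a b c Infty = Fin b" using assms by (auto simp: mob3_def mob_def)
  have "c - a + (b - c) = b - a" "b * (c - a) + a * (b - c) = c * (b - a)" by algebra+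
  then show "mob3 a b c (Fin 1) = Fin c" using assms by (auto simp: mob3_def mob_def)
qed

text \<open>Three values determine the matrix of a Moebius transformation up to a factor \<open>k\<close>.\<close>

lemma mobius_eq_mob3:
  assumes "mobius M" "M (Fin 0) = Fin a" "M Infty = Fin b" "M (Fin 1) = Fin c"
  shows "M = mob3 a b c"
proof -
  obtain p q r s where M: "p * s - q * r \<noteq> 0" "M = mob p q r s" using assms(1) mobius_def by auto
  have 1: "s \<noteq> 0" "r \<noteq> 0" "r + s \<noteq> 0" "q / s = a" "p / r = b" "(p + q) / (r + s) = c"
    using assms(2-4) M(2) by (auto simp: mob_def split: if_splits)
  have 2: "q = a * s" "p = b * r" "p + q = c * (r + s)"
    using 1 by (metis nonzero_eq_divide_eq)+
  have bc: "b \<noteq> c"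
  proof
    assume "b = c"
    then have "a * s = b * s" using 2 by (simp add: algebra_simps)
    then show False using 1(1) 2(1,2) M(1) by simp
  qed
  define k where "k = s / (b - c)"
  have s: "s = k * (b - c)" using bc by (simp add: k_def)
  have "r * (b - c) = k * (c - a) * (b - c)" using 2 s by algebra
  then have r: "r = k * (c - a)" using bc by simp
  have k: "k \<noteq> 0" using 1 s by auto
  have *: "k * (c - a) * z + k * (b - c) = k * ((c - a) * z + (b - c))"
    "b * (k * (c - a)) * z + a * (k * (b - c)) = k * (b * (c - a) * z + a * (b - c))" for z by algebra+
  show ?thesis
  proof
    fix x show "M x = mob3 a b c x"
      unfolding M(2) mob3_def mob_def 2(1,2) r s using k *
      by (cases x) auto
  qed
qed

lemma mob_cconv:
  assumes "A \<longlonglongrightarrow> a" "B \<longlonglongrightarrow> b" "C \<longlonglongrightarrow> c" "D \<longlonglongrightarrow> d" "\<And>n. A n * D n - B n * C n \<noteq> 0" "a * d - b * c \<noteq> 0"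
  shows "cconv (\<lambda>n. mob (A n) (B n) (C n) (D n)) (mob a b c d)"
proof -
  have "(\<lambda>n. coeff [:B n, A n:] i) \<longlonglongrightarrow> coeff [:b, a:] i" "(\<lambda>n. coeff [:D n, C n:] i) \<longlonglongrightarrow> coeff [:d, c:] i" for i
    using assms(1-4) by (auto simp: coeff_pCons split: nat.split)
  then show ?thesis
    unfolding mob_quotient_map(1)[OF assms(5)] mob_quotient_map(1)[OF assms(6)]
    by (intro cconv_quotient_map[where d = 1] mob_quotient_map assms(5,6))
qed

lemma mob3_cconv:
  assumes "A \<longlonglongrightarrow> a" "B \<longlonglongrightarrow> b" "C \<longlonglongrightarrow> c"
    "\<And>n. A n \<noteq> B n" "\<And>n. B n \<noteq> C n" "\<And>n. C n \<noteq> A n" "a \<noteq> b" "b \<noteq> c" "c \<noteq> a"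
  shows "cconv (\<lambda>n. mob3 (A n) (B n) (C n)) (mob3 a b c)"
    "cconv (\<lambda>n. inv (mob3 (A n) (B n) (C n))) (inv (mob3 a b c))"
proof -
  have n0: "(B n * (C n - A n)) * (B n - C n) - (A n * (B n - C n)) * (C n - A n) \<noteq> 0"
    "(b * (c - a)) * (b - c) - (a * (b - c)) * (c - a) \<noteq> 0" for n
    unfolding mob3_det using assms(4-9) by (metis mult_eq_0_iff right_minus_eq)+
  show "cconv (\<lambda>n. mob3 (A n) (B n) (C n)) (mob3 a b c)"
    unfolding mob3_def using assms(1-3) n0 by (intro mob_cconv tendsto_intros)
  have n1: "(B n - C n) * (B n * (C n - A n)) - (- (A n * (B n - C n))) * (- (C n - A n)) \<noteq> 0"
    "(b - c) * (b * (c - a)) - (- (a * (b - c))) * (- (c - a)) \<noteq> 0" for n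
    using n0(1)[of n] n0(2) by (simp_all add: algebra_simps)
  show "cconv (\<lambda>n. inv (mob3 (A n) (B n) (C n))) (inv (mob3 a b c))"
    unfolding mob3_def mob_inverse(3)[OF n0(1)] mob_inverse(3)[OF n0(2)]
    using assms(1-3) n1 by (intro mob_cconv tendsto_intros)
qed

section \<open>Critical points and the chain rule\<close>

text \<open>The numerator of the derivative of \<open>p / q\<close>.\<close>

definition wronskian :: "complex poly \<Rightarrow> complex poly \<Rightarrow> complex poly" where
  "wronskian p q = pderiv p * q - p * pderiv q"

abbreviation base_point :: "riemann_sphere \<Rightarrow> complex" where
  "base_point x \<equiv> fin_part (chart_at x x)"

lemma chart_at_chart_at [simp]: "chart_at x (chart_at x y) = y"
  by (simp add: chart_at_def)

lemma chart_at_self: "chart_at x x = Fin (base_point x)"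
  by (cases x) (auto simp: chart_at_def)

lemma local_rep_Infty: "local_rep f Infty = local_rep (f \<circ> recip) (Fin 0)"
  by (rule ext) (simp add: local_rep_def chart_at_def)

lemma local_rep_Fin:
  "local_rep f (Fin z) w = fin_part (if f (Fin z) = Infty then recip (f (Fin w)) else f (Fin w))"
  by (simp add: local_rep_def chart_at_def)

lemma critical_Infty: "Infty \<in> critical_points f \<longleftrightarrow> Fin 0 \<in> critical_points (f \<circ> recip)"
  by (simp add: critical_points_def local_rep_Infty chart_at_def)

text \<open>At a pole the chart of the target replaces \<open>p / q\<close> by \<open>q / p\<close>, and exchanging the two
  polynomials changes the sign of the Wronskian.\<close>

lemma deriv_local_rep_quotient_map:
  assumes "coprime p q"
  shows "(local_rep (quotient_map p q) (Fin z) has_field_derivative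
    (if poly q z = 0 then - poly (wronskian p q) z / (poly p z)^2
     else poly (wronskian p q) z / (poly q z)^2)) (at z)"
proof -
  have *: "((\<lambda>w. fin_part (quotient_map p q (Fin w))) has_field_derivative
    (poly (wronskian p q) z / (poly q z)^2)) (at z)" if nz: "poly q z \<noteq> 0" for p q
  proof -
    have "((\<lambda>w. poly p w / poly q w) has_field_derivative
       (poly (pderiv p) z * poly q z - poly p z * poly (pderiv q) z) / (poly q z * poly q z)) (at z)"
      by (rule DERIV_divide[OF poly_DERIV poly_DERIV nz])
    moreover have "\<forall>\<^sub>F w in nhds z. poly p w / poly q w = fin_part (quotient_map p q (Fin w))"
    proof -
      have "((\<lambda>w. poly q w) \<longlongrightarrow> poly q z) (nhds z)"
        by (metis filterlim_ident isCont_def poly_isCont tendsto_at_iff_tendsto_nhds)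
      then have "\<forall>\<^sub>F w in nhds z. poly q w \<noteq> 0" using nz tendsto_imp_eventually_ne by blast
      then show ?thesis by eventually_elim simp
    qed
    ultimately show ?thesis
      by (simp add: wronskian_def power2_eq_square DERIV_cong_ev)
  qed
  show ?thesis
  proof (cases "poly q z = 0")
    case False
    then show ?thesis using *[OF False, of p] by (simp add: local_rep_Fin[abs_def])
  next
    case True
    then have "poly p z \<noteq> 0" using coprime_no_common_root[OF assms] by blast
    note D = *[OF this, of q]
    show ?thesis
    proof -
      have l: "local_rep (quotient_map p q) (Fin z) = (\<lambda>w. fin_part (quotient_map q p (Fin w)))"
        by (rule ext) (simp only: local_rep_Fin recip_quotient_map[OF assms] quotient_map.simps(1)[of p q z] True simp_thms if_True)
      have "poly (wronskian q p) z = - poly (wronskian p q) z" by (simp add: wronskian_def)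
      then show ?thesis using D True by (simp add: l del: quotient_map.simps)
    qed
  qed
qed

lemma critical_Fin_iff:
  assumes "coprime p q"
  shows "Fin z \<in> critical_points (quotient_map p q) \<longleftrightarrow> poly (wronskian p q) z = 0"
proof -
  have c: "critical_points (quotient_map p q) =
    {x. (local_rep (quotient_map p q) x has_field_derivative 0) (at (base_point x))}"
    by (simp add: critical_points_def)
  have b: "base_point (Fin z) = z" by (simp add: chart_at_def)
  note D = deriv_local_rep_quotient_map[OF assms, of z]
  show ?thesis
  proof
    assume "Fin z \<in> critical_points (quotient_map p q)"
    then have "(local_rep (quotient_map p q) (Fin z) has_field_derivative 0) (at z)" by (simp add: c b)
    from DERIV_unique[OF this D] show "poly (wronskian p q) z = 0"
      using coprime_no_common_root[OF assms, of z] by (auto split: if_splits)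
  next
    assume "poly (wronskian p q) z = 0"
    then have "(local_rep (quotient_map p q) (Fin z) has_field_derivative 0) (at z)"
      using D by (simp split: if_splits)
    then show "Fin z \<in> critical_points (quotient_map p q)" by (simp add: c b)
  qed
qed

lemma rat_local_derivative:
  assumes "rat f" shows "\<exists>D. (local_rep f x has_field_derivative D) (at (base_point x))"
proof (cases x)
  case (Fin z)
  obtain p q where "coprime p q" "f = quotient_map p q" using assms ratE by metis
  then show ?thesis using deriv_local_rep_quotient_map[of p q z] Fin
    by (auto simp: chart_at_def)
next
  case Infty
  obtain p q where "coprime p q" "f \<circ> recip = quotient_map p q"
    using rat_comp[OF assms rat_recip] ratE by metis
  then show ?thesis using deriv_local_rep_quotient_map[of p q 0] Infty
    by (auto simp: chart_at_def local_rep_Infty)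
qed

text \<open>Near the base point all values stay finite in the chart at \<open>g x\<close>. There the two copies of this
  chart, which is an involution, cancel, and the ordinary chain rule applies.\<close>

lemma local_rep_chain:
  assumes "rat f" "rat g"
    and "(local_rep f (g x) has_field_derivative D) (at (base_point (g x)))"
    and "(local_rep g x has_field_derivative E) (at (base_point x))"
  shows "(local_rep (f \<circ> g) x has_field_derivative D * E) (at (base_point x))"
proof -
  let ?b = "base_point x"
  have gb: "local_rep g x ?b = base_point (g x)"
    unfolding local_rep_def chart_at_self[symmetric] by simp
  have ev: "\<forall>\<^sub>F w in nhds ?b. local_rep f (g x) (local_rep g x w) = local_rep (f \<circ> g) x w"
  proof -
    have ch: "((\<lambda>y. chart_at x (u y)) \<longlongrightarrow> chart_at x l) F" if "(u \<longlongrightarrow> l) F" for x u l and F :: "complex filter"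
      using that tendsto_recip by (auto simp: chart_at_def)
    have "((\<lambda>w. chart_at x (Fin w)) \<longlongrightarrow> chart_at x (Fin ?b)) (nhds ?b)"
      by (intro ch tendsto_Fin) (rule filterlim_ident)
    then have "((\<lambda>w. chart_at x (Fin w)) \<longlongrightarrow> x) (nhds ?b)"
      by (simp add: chart_at_self[symmetric])
    then have "((\<lambda>w. g (chart_at x (Fin w))) \<longlongrightarrow> g x) (nhds ?b)"
      by (rule isCont_tendsto_compose[rotated])
        (use rat_continuous[OF assms(2)] in \<open>simp add: continuous_on_eq_continuous_at\<close>)
    then have "((\<lambda>w. chart_at (g x) (g (chart_at x (Fin w)))) \<longlongrightarrow> Fin (base_point (g x))) (nhds ?b)"
      unfolding chart_at_self[symmetric] by (rule ch)
    from eventually_finite(3)[OF this] show ?thesis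
    proof eventually_elim
      case (elim w)
      have "chart_at (g x) (Fin (local_rep g x w)) = g (chart_at x (Fin w))"
        unfolding local_rep_def elim[symmetric] by simp
      then show ?case by (simp add: local_rep_def[of f] local_rep_def[of "f \<circ> g"])
    qed
  qed
  have "((\<lambda>w. local_rep f (g x) (local_rep g x w)) has_field_derivative D * E) (at ?b)"
    using DERIV_chain2[of "local_rep f (g x)" D "local_rep g x" ?b] assms(3,4) gb by simp
  then show ?thesis using DERIV_cong_ev[OF refl ev refl] by simp
qed

lemma critical_points_comp:
  assumes "rat f" "rat g"
  shows "critical_points (f \<circ> g) = critical_points g \<union> g -` critical_points f"
proof -
  have "x \<in> critical_points (f \<circ> g) \<longleftrightarrow> x \<in> critical_points g \<or> g x \<in> critical_points f" for x
  proof -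
    obtain D where D: "(local_rep f (g x) has_field_derivative D) (at (base_point (g x)))"
      using rat_local_derivative[OF assms(1)] by blast
    obtain E where E: "(local_rep g x has_field_derivative E) (at (base_point x))"
      using rat_local_derivative[OF assms(2)] by blast
    note DE = local_rep_chain[OF assms D E]
    have crit: "(h has_field_derivative 0) (at b) \<longleftrightarrow> A = 0"
      if "(h has_field_derivative A) (at b)" for h and A b :: complex
      using that DERIV_unique by blast
    have "x \<in> critical_points (f \<circ> g) \<longleftrightarrow> D * E = 0"
      "x \<in> critical_points g \<longleftrightarrow> E = 0" "g x \<in> critical_points f \<longleftrightarrow> D = 0"
      unfolding critical_points_def mem_Collect_eq by (rule crit[OF DE] crit[OF E] crit[OF D])+
    then show ?thesis by auto
  qed
  then show ?thesis by blast
qed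

lemma critical_values_comp:
  assumes "rat f" "rat g"
  shows "critical_values (f \<circ> g) = critical_values f \<union> f ` critical_values g"
  unfolding critical_values_def critical_points_comp[OF assms]
proof (intro equalityI subsetI)
  fix y assume "y \<in> f ` critical_points f \<union> f ` g ` critical_points g"
  then show "y \<in> (f \<circ> g) ` (critical_points g \<union> g -` critical_points f)"
  proof
    assume "y \<in> f ` critical_points f"
    then obtain x where x: "x \<in> critical_points f" "y = f x" by blast
    obtain u where "g u = x" using rat_surj[OF assms(2)] by blast
    then show ?thesis using x by force
  qed auto
qed auto

text \<open>Subtracting a constant from \<open>p / q\<close> does not change its derivative.\<close>

lemma wronskian_shift: "wronskian (p - smult y q) q = wronskian p q"
  by (simp add: wronskian_def pderiv_diff pderiv_smult algebra_simps)

lemma order_eqI: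
  assumes "p = [:-e, 1:] ^ k * h" "poly h e \<noteq> (0::complex)"
  shows "order e p = k" "p \<noteq> 0"
proof -
  have h: "h \<noteq> 0" using assms(2) by auto
  then show p: "p \<noteq> 0" using assms(1) by auto
  have "order e p = order e ([:-e, 1:] ^ k) + order e h" using assms(1) p order_mult by blast
  moreover have "order e h = 0" using assms(2) order_root by blast
  ultimately show "order e p = k" by (simp add: order_power_n_n)
qed

text \<open>Differentiating \<open>F / q\<close> lowers the order of its zero at \<open>e\<close> by one. With \<open>F = p - y q\<close> this
  compares the multiplicity of a point in its fibre with its multiplicity as a critical point.\<close>

lemma order_wronskian:
  assumes "F \<noteq> 0" "poly F e = 0" "poly q e \<noteq> 0"
  shows "order e (wronskian F q) = order e F - 1" "wronskian F q \<noteq> 0" "order e F \<ge> 1"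
proof -
  define k where "k = order e F"
  obtain G where G: "F = [:-e, 1:] ^ k * G" "poly G e \<noteq> 0"
    using order_decomp[OF assms(1), of e] unfolding k_def by (metis poly_eq_0_iff_dvd)
  show k1: "order e F \<ge> 1" using assms(1,2) order_root by (metis One_nat_def Suc_leI neq0_conv)
  then obtain j where j: "k = Suc j" unfolding k_def by (metis Suc_le_D One_nat_def)
  define L where "L = [:-e, 1:]"
  have dL: "pderiv L = 1" by (simp add: L_def pderiv_pCons)
  have F: "F = L ^ j * (L * G)" by (simp only: G(1)[folded L_def] j power_Suc2 mult.assoc)
  have dF: "pderiv F = L ^ j * (smult (of_nat (Suc j)) G + L * pderiv G)"
    unfolding G(1)[folded L_def] j by (simp only: pderiv_mult pderiv_power_Suc dL) (simp add: algebra_simps)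
  have W: "wronskian F q = L ^ j * (smult (of_nat (Suc j)) (G * q) + L * (pderiv G * q - G * pderiv q))"
    unfolding wronskian_def dF by (subst F) (simp add: algebra_simps)
  have nz: "poly (smult (of_nat (Suc j)) (G * q) + L * (pderiv G * q - G * pderiv q)) e \<noteq> 0"
    using G(2) assms(3) by (simp add: L_def del: of_nat_Suc)
  show "order e (wronskian F q) = order e F - 1" "wronskian F q \<noteq> 0"
    using order_eqI[OF W[unfolded L_def] nz[unfolded L_def]] j k_def by auto
qed

text \<open>A nonconstant numerator has a zero, where the derivative of the quotient vanishes to finite
  order only.\<close>

lemma wronskian_nonzero:
  assumes "coprime p q" "max (degree p) (degree q) \<ge> 1"
  shows "wronskian p q \<noteq> 0"
proof -
  have *: "wronskian p q \<noteq> 0" if pq: "coprime p q" "degree p \<ge> 1" for p q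
  proof -
    obtain e where "poly p e = 0" using alg_closed_imp_poly_has_root[of p] pq(2) by auto
    moreover have "p \<noteq> 0" using pq(2) by auto
    ultimately show ?thesis using order_wronskian(2) coprime_no_common_root[OF pq(1)] by blast
  qed
  have "wronskian q p = - wronskian p q" by (simp add: wronskian_def algebra_simps)
  then show ?thesis using *[of p q] *[of q p] assms by (auto simp: coprime_commute max_def split: if_splits)
qed

lemma finite_critical_points: assumes "rat f" shows "finite (critical_points f)"
proof -
  obtain p q where pq: "coprime p q" "max (degree p) (degree q) \<ge> 1" "f = quotient_map p q"
    using assms ratE by metis
  have "critical_points f \<subseteq> insert Infty (Fin ` {z. poly (wronskian p q) z = 0})"
  proof
    fix x assume "x \<in> critical_points f"
    then show "x \<in> insert Infty (Fin ` {z. poly (wronskian p q) z = 0})"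
      using critical_Fin_iff[OF pq(1)] pq(3) by (cases x) auto
  qed
  moreover have "finite {z. poly (wronskian p q) z = 0}"
    using poly_roots_finite[OF wronskian_nonzero[OF pq(1,2)]] .
  ultimately show ?thesis using finite_subset by blast
qed

lemma finite_critical_values: "rat f \<Longrightarrow> finite (critical_values f)"
  by (simp add: critical_values_def finite_critical_points)

lemma recip_mob: "recip = mob 0 1 1 0"
  by (rule ext, rename_tac x, case_tac x) (auto simp: mob_def)

lemma mobius_recip: "mobius recip"
proof -
  have "(0::complex) * 0 - 1 * 1 \<noteq> 0" by simp
  then show ?thesis unfolding mobius_def recip_mob by blast
qed

lemma critical_points_mobius: assumes "mobius M" shows "critical_points M = {}"
proof -
  have *: "Fin z \<notin> critical_points M" if mM: "mobius M" for M z
  proof -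
    obtain a b c d where M: "a * d - b * c \<noteq> 0" "M = mob a b c d" using mM unfolding mobius_def by blast
    have "poly (wronskian [:b, a:] [:d, c:]) z = a * d - b * c"
      by (simp add: wronskian_def pderiv_pCons algebra_simps)
    then show ?thesis using critical_Fin_iff[OF mob_quotient_map(2)[OF M(1)]] M
      by (simp add: mob_quotient_map(1)[OF M(1)])
  qed
  have "x \<notin> critical_points M" for x
    using *[OF assms] *[OF mobius_comp[OF assms mobius_recip]] critical_Infty by (cases x) auto
  then show ?thesis by blast
qed

lemma critical_points_mobius_comp:
  assumes "mobius M" "rat f"
  shows "critical_points (M \<circ> f) = critical_points f"
    "critical_points (f \<circ> M) = M -` critical_points f"
    "critical_values (M \<circ> f) = M ` critical_values f"
    "critical_values (f \<circ> M) = critical_values f"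
  using critical_points_comp[OF mobius_rat[OF assms(1)] assms(2)]
    critical_points_comp[OF assms(2) mobius_rat[OF assms(1)]]
    critical_values_comp[OF mobius_rat[OF assms(1)] assms(2)]
    critical_values_comp[OF assms(2) mobius_rat[OF assms(1)]]
  by (auto simp: critical_points_mobius[OF assms(1)] critical_values_def)

lemma critical_points_pow_map:
  assumes "m \<ge> 2" shows "critical_points (pow_map m) = {Fin 0, Infty}"
    "critical_values (pow_map m) = {Fin 0, Infty}"
proof -
  have m: "m > 0" using assms by simp
  have fin: "Fin z \<in> critical_points (pow_map m) \<longleftrightarrow> z = 0" for z
  proof -
    have "Fin z \<in> critical_points (pow_map m) \<longleftrightarrow> poly (wronskian (monom 1 m) 1) z = 0"
      unfolding pow_map_def by (rule critical_Fin_iff) simp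
    also have "poly (wronskian (monom 1 m) 1) z = of_nat m * z ^ (m - 1)"
      by (simp add: wronskian_def pderiv_monom poly_monom)
    finally show ?thesis using assms by auto
  qed
  have "pow_map m \<circ> recip = recip \<circ> pow_map m"
  proof
    fix x show "(pow_map m \<circ> recip) x = (recip \<circ> pow_map m) x"
      using m by (cases x) (auto simp: power_one_over)
  qed
  then have "Fin 0 \<in> critical_points (pow_map m \<circ> recip)"
    using critical_points_mobius_comp(1)[OF mobius_recip rat_pow_map[OF m]] fin by simp
  then have inf: "Infty \<in> critical_points (pow_map m)" using critical_Infty by blast
  show *: "critical_points (pow_map m) = {Fin 0, Infty}"
  proof (intro equalityI subsetI)
    fix x assume "x \<in> critical_points (pow_map m)"
    then show "x \<in> {Fin 0, Infty}" using fin by (cases x) auto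
  qed (use fin inf in auto)
  show "critical_values (pow_map m) = {Fin 0, Infty}"
    using m by (auto simp: critical_values_def *)
qed

lemma degree_one_mobius:
  assumes "coprime p q" "max (degree p) (degree q) = 1" shows "mobius (quotient_map p q)"
proof -
  have "degree p \<le> 1" "degree q \<le> 1" using assms(2) by auto
  then obtain a b c d where pq: "p = [:b, a:]" "q = [:d, c:]"
    by (metis One_nat_def degree_eq_zeroE degree1_coeffs le_Suc_eq le_zero_eq pCons_0_0)
  have "a * d - b * c \<noteq> 0"
  proof
    assume 0: "a * d - b * c = 0"
    show False
    proof (cases "c = 0")
      case False
      have "poly q (- d / c) = 0" using False by (simp add: pq)
      moreover have "poly p (- d / c) = - (a * d - b * c) / c" using False by (simp add: pq field_simps)
      ultimately show False using 0 coprime_no_common_root[OF assms(1)] by simp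
    next
      case True
      then have "a \<noteq> 0" using assms(2) pq by auto
      then have "d = 0" using True 0 by simp
      then have "q = 0" using True pq by simp
      then have "is_unit p" using assms(1) by simp
      moreover from this have "p \<noteq> 0" by auto
      ultimately show False using \<open>a \<noteq> 0\<close> pq by (simp add: is_unit_iff_degree)
    qed
  qed
  then show ?thesis unfolding mobius_def using mob_quotient_map(1) pq by metis
qed

lemma rat_degree_ge_2:
  assumes "rat f" "critical_values f \<noteq> {}"
  shows "\<exists>d\<ge>2. rational_map_of_degree d f"
proof -
  obtain p q where pq: "coprime p q" "max (degree p) (degree q) \<ge> 1" "f = quotient_map p q"
    using assms(1) ratE by metis
  have "max (degree p) (degree q) \<noteq> 1"
    using degree_one_mobius[OF pq(1)] pq(3) critical_points_mobius assms(2) by (auto simp: critical_values_def)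
  then have "max (degree p) (degree q) \<ge> 2" using pq(2) by linarith
  then show ?thesis unfolding rational_map_of_degree_def using pq(1,3) by blast
qed

lemma postcritically_finite_rat: "postcritically_finite f \<Longrightarrow> rat f"
  unfolding postcritically_finite_def rat_def by (meson one_le_numeral order_trans)

section \<open>Convergence of polynomials and of their roots\<close>

text \<open>Convergence of coefficients. The degree of the limit may be smaller than those of the
  polynomials in the sequence.\<close>

definition pconv :: "(nat \<Rightarrow> complex poly) \<Rightarrow> complex poly \<Rightarrow> bool" where
  "pconv P p \<longleftrightarrow> (\<forall>i. (\<lambda>n. coeff (P n) i) \<longlonglongrightarrow> coeff p i)"

lemma pconvD: "pconv P p \<Longrightarrow> (\<lambda>n. coeff (P n) i) \<longlonglongrightarrow> coeff p i"
  by (simp add: pconv_def)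

lemma pconv_const: "pconv (\<lambda>n. p) p"
  by (simp add: pconv_def)

lemma pconv_diff: "pconv P p \<Longrightarrow> pconv Q q \<Longrightarrow> pconv (\<lambda>n. P n - Q n) (p - q)"
  by (simp add: pconv_def tendsto_diff)

lemma pconv_smult: "pconv P p \<Longrightarrow> c \<longlonglongrightarrow> a \<Longrightarrow> pconv (\<lambda>n. smult (c n) (P n)) (smult a p)"
  by (simp add: pconv_def tendsto_mult)

lemma pconv_mult: "pconv P p \<Longrightarrow> pconv Q q \<Longrightarrow> pconv (\<lambda>n. P n * Q n) (p * q)"
  by (auto simp: pconv_def coeff_mult intro!: tendsto_intros)

lemma pconv_power: "pconv P p \<Longrightarrow> pconv (\<lambda>n. P n ^ k) (p ^ k)"
  by (induction k) (auto intro: pconv_mult pconv_const)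

lemma pconv_sum: "(\<And>i. i \<in> A \<Longrightarrow> pconv (P i) (p i)) \<Longrightarrow> pconv (\<lambda>n. \<Sum>i\<in>A. P i n) (\<Sum>i\<in>A. p i)"
  by (auto simp: pconv_def coeff_sum intro!: tendsto_intros)

lemma pconv_pCons: "c \<longlonglongrightarrow> a \<Longrightarrow> pconv P p \<Longrightarrow> pconv (\<lambda>n. pCons (c n) (P n)) (pCons a p)"
  by (auto simp: pconv_def coeff_pCons split: nat.split)

lemma pconv_pderiv: "pconv P p \<Longrightarrow> pconv (\<lambda>n. pderiv (P n)) (pderiv p)"
  by (auto simp: pconv_def coeff_pderiv intro!: tendsto_intros)

lemma pconv_linear: "c \<longlonglongrightarrow> a \<Longrightarrow> pconv (\<lambda>n. [:- c n, 1:]) [:- a, 1:]"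
  by (intro pconv_pCons pconv_const tendsto_intros)

lemma pconv_wronskian: "pconv P p \<Longrightarrow> pconv Q q \<Longrightarrow> pconv (\<lambda>n. wronskian (P n) (Q n)) (wronskian p q)"
  unfolding wronskian_def by (intro pconv_diff pconv_mult pconv_pderiv)

lemma pconv_subseq: "pconv P p \<Longrightarrow> strict_mono r \<Longrightarrow> pconv (\<lambda>n. P (r n)) p"
  unfolding pconv_def using LIMSEQ_subseq_LIMSEQ by (fastforce simp: o_def)

lemma pconv_eventually_cong:
  assumes "pconv P p" "\<forall>\<^sub>F n in sequentially. P n = Q n" shows "pconv Q p"
  unfolding pconv_def
proof
  fix i
  have "\<forall>\<^sub>F n in sequentially. coeff (P n) i = coeff (Q n) i"
    using assms(2) by eventually_elim simp
  from Lim_transform_eventually[OF pconvD[OF assms(1), of i] this]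
  show "(\<lambda>n. coeff (Q n) i) \<longlonglongrightarrow> coeff p i" .
qed

lemma pconv_unique: "pconv P p \<Longrightarrow> pconv P q \<Longrightarrow> p = q"
  unfolding pconv_def by (intro poly_eqI) (use LIMSEQ_unique in blast)

lemma pconv_degree:
  assumes "pconv P p" "\<And>n. degree (P n) \<le> D" shows "degree p \<le> D"
proof (rule degree_le, intro allI impI)
  fix i assume i: "D < i"
  have "coeff (P n) i = 0" for n using i assms(2)[of n] by (intro coeff_eq_0) linarith
  then have "(\<lambda>n. coeff (P n) i) \<longlonglongrightarrow> 0" by simp
  then show "coeff p i = 0" using assms(1) LIMSEQ_unique unfolding pconv_def by blast
qed

lemma poly_pconv:
  assumes "pconv P p" "\<And>n. degree (P n) \<le> D" "w \<longlonglongrightarrow> l"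
  shows "(\<lambda>n. poly (P n) (w n)) \<longlonglongrightarrow> poly p l"
proof -
  have "(\<lambda>n. \<Sum>i\<le>D. coeff (P n) i * w n ^ i) \<longlonglongrightarrow> (\<Sum>i\<le>D. coeff p i * l ^ i)"
    by (intro tendsto_intros assms(3) pconvD[OF assms(1)])
  then show ?thesis
    by (simp only: poly_altdef_le[OF assms(2)] poly_altdef_le[OF pconv_degree[OF assms(1,2)]])
qed

lemma coeff_linear_mult: "coeff ([:- c, 1:] * G) (Suc i) = coeff G i - c * coeff G (Suc i)" for c :: complex
  by (simp add: coeff_pCons)

text \<open>Synthetic division computes the coefficients of the quotient, starting with the highest, by a
  recursion that is continuous in the coefficients of \<open>F n\<close> and in \<open>c n\<close>.\<close>

lemma pconv_divide_linear:
  assumes "pconv F f" "c \<longlonglongrightarrow> a" "\<And>n. degree (G n) \<le> D"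
    and "\<forall>\<^sub>F n in sequentially. F n = [:- c n, 1:] * G n"
  shows "\<exists>g. pconv G g \<and> f = [:- a, 1:] * g"
proof -
  have conv: "convergent (\<lambda>n. coeff (G n) i)" for i
  proof (induction "D - i" arbitrary: i rule: less_induct)
    case less
    show ?case
    proof (cases "i \<le> D")
      case False
      then have "coeff (G n) i = 0" for n using assms(3)[of n] by (intro coeff_eq_0) linarith
      then show ?thesis by (simp add: convergent_const)
    next
      case True
      have IH: "convergent (\<lambda>n. coeff (G n) (Suc i))"
      proof (cases "Suc i \<le> D")
        case True then show ?thesis using less by simp
      next
        case False
        then have "coeff (G n) (Suc i) = 0" for n using assms(3)[of n] by (intro coeff_eq_0) linarith
        then show ?thesis by (simp add: convergent_const)
      qed
      then obtain b where b: "(\<lambda>n. coeff (G n) (Suc i)) \<longlonglongrightarrow> b" by (auto simp: convergent_def)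
      have "(\<lambda>n. coeff (F n) (Suc i) + c n * coeff (G n) (Suc i)) \<longlonglongrightarrow> coeff f (Suc i) + a * b"
        by (intro tendsto_intros b assms(2) pconvD[OF assms(1)])
      moreover have "\<forall>\<^sub>F n in sequentially. coeff (F n) (Suc i) + c n * coeff (G n) (Suc i) = coeff (G n) i"
        using assms(4)
      proof eventually_elim
        case (elim n)
        show ?case unfolding elim coeff_linear_mult by simp
      qed
      ultimately have "(\<lambda>n. coeff (G n) i) \<longlonglongrightarrow> coeff f (Suc i) + a * b"
        by (rule Lim_transform_eventually)
      then show ?thesis unfolding convergent_def by blast
    qed
  qed
  then obtain l where l: "\<And>i. (\<lambda>n. coeff (G n) i) \<longlonglongrightarrow> l i" unfolding convergent_def by metis
  define g where "g = (\<Sum>i\<le>D. monom (l i) i)"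
  have "l i = 0" if "\<not> i \<le> D" for i
  proof -
    have "coeff (G n) i = 0" for n using assms(3)[of n] that by (intro coeff_eq_0) linarith
    then show ?thesis using l[of i] by (simp add: LIMSEQ_const_iff)
  qed
  then have "coeff g i = l i" for i by (simp add: g_def coeff_sum)
  then have g: "pconv G g" using l by (simp add: pconv_def)
  have "pconv (\<lambda>n. [:- c n, 1:] * G n) ([:- a, 1:] * g)" by (intro pconv_mult g pconv_linear assms(2))
  moreover have "pconv (\<lambda>n. [:- c n, 1:] * G n) f" using pconv_eventually_cong[OF assms(1,4)] .
  ultimately show ?thesis using g pconv_unique by blast
qed

lemma pconv_divide_power:
  assumes "pconv F f" "c \<longlonglongrightarrow> a" "\<And>n. degree (G n) \<le> D"
    and "\<forall>\<^sub>F n in sequentially. F n = [:- c n, 1:] ^ k * G n"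
  shows "\<exists>g. pconv G g \<and> f = [:- a, 1:] ^ k * g"
  using assms(1,4)
proof (induction k arbitrary: F f)
  case 0
  then show ?case using pconv_eventually_cong by auto
next
  case (Suc k)
  have deg: "degree ([:- c n, 1:] ^ k * G n) \<le> k + D" for n
    using degree_mult_le[of "[:- c n, 1:] ^ k" "G n"] assms(3)[of n] degree_power_le[of "[:- c n, 1:]" k]
    by (simp add: degree_linear_power)
  have "\<forall>\<^sub>F n in sequentially. F n = [:- c n, 1:] * ([:- c n, 1:] ^ k * G n)"
    using Suc.prems(2) by eventually_elim (simp only: power_Suc mult.assoc)
  from pconv_divide_linear[OF Suc.prems(1) assms(2) deg this] obtain h where
    h: "pconv (\<lambda>n. [:- c n, 1:] ^ k * G n) h" "f = [:- a, 1:] * h" by blast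
  from Suc.IH[OF h(1)] obtain g where "pconv G g" "h = [:- a, 1:] ^ k * g" by auto
  then show ?case using h(2) by (auto simp only: power_Suc mult.assoc)
qed

text \<open>Compare the linear factors at \<open>c\<close> and at \<open>e\<close>: if \<open>z\<close> has distance at least \<open>\<rho>\<close> from \<open>c\<close>,
  then \<open>dist c z\<close> is at least \<open>\<rho> / (\<rho> + dist e c)\<close> times \<open>dist e z\<close>.\<close>

lemma poly_lower_bound_no_roots:
  fixes F :: "complex poly"
  assumes "\<rho> > 0" "\<forall>z. poly F z = 0 \<longrightarrow> dist z c \<ge> \<rho>"
  shows "cmod (poly F c) \<ge> (\<rho> / (\<rho> + dist e c)) ^ degree F * cmod (poly F e)"
  using assms(2)
proof (induction "degree F" arbitrary: F)
  case 0
  then obtain a where "F = [:a:]" by (metis degree_eq_zeroE)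
  then show ?case by simp
next
  case (Suc k)
  then obtain z where z: "poly F z = 0" using alg_closed_imp_poly_has_root[of F] by auto
  then obtain G where G: "F = [:-z, 1:] * G" by (metis dvdE poly_eq_0_iff_dvd)
  have "F \<noteq> 0" using Suc.hyps(2) by auto
  then have "G \<noteq> 0" using G by auto
  then have dF: "degree F = Suc (degree G)" unfolding G by (subst degree_mult_eq) auto
  let ?t = "\<rho> / (\<rho> + dist e c)"
  have IH: "?t ^ degree G * cmod (poly G e) \<le> cmod (poly G c)"
  proof (rule Suc.hyps(1))
    show "k = degree G" using dF Suc.hyps(2) by simp
    show "\<forall>z. poly G z = 0 \<longrightarrow> \<rho> \<le> dist z c" using Suc.prems G by simp
  qed
  have zc: "dist z c \<ge> \<rho>" using Suc.prems z by blast
  have "\<rho> * dist e z \<le> \<rho> * (dist e c + dist z c)"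
    using assms(1) dist_triangle2[of e z c] by (intro mult_left_mono) auto
  also have "\<dots> \<le> dist z c * (\<rho> + dist e c)"
  proof -
    have "\<rho> * dist e c \<le> dist z c * dist e c" by (rule mult_right_mono[OF zc]) simp
    then show ?thesis by (simp add: algebra_simps)
  qed
  finally have "\<rho> * dist e z / (\<rho> + dist e c) \<le> dist z c"
    using assms(1) zero_le_dist[of e c] by (subst pos_divide_le_eq) linarith+
  then have "?t * dist e z \<le> dist c z"
    by (simp add: dist_commute)
  then have t: "?t * cmod (e - z) \<le> cmod (c - z)" by (simp add: dist_norm)
  have "?t ^ degree F * cmod (poly F e) = (?t * cmod (e - z)) * (?t ^ degree G * cmod (poly G e))"
  proof -
    have "cmod (poly F e) = cmod (e - z) * cmod (poly G e)"
      by (simp add: G norm_mult[symmetric] algebra_simps)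
    then show ?thesis unfolding dF power_Suc by (simp only: mult_ac)
  qed
  also have "\<dots> \<le> cmod (c - z) * cmod (poly G c)"
    by (intro mult_mono t IH) (use assms(1) zero_le_dist[of e c] in auto)
  also have "\<dots> = cmod (poly F c)"
    by (simp add: G norm_mult[symmetric] algebra_simps)
  finally show ?case .
qed

text \<open>Choose \<open>e\<close> with \<open>f e \<noteq> 0\<close>. Without a root of \<open>F n\<close> near \<open>c\<close>, the values at \<open>c\<close> would be bounded
  below by a fixed fraction of those at \<open>e\<close>, whereas they tend to \<open>f c = 0\<close>.\<close>

lemma root_near:
  assumes "pconv F f" "\<And>n. degree (F n) \<le> D" "f \<noteq> 0" "poly f c = 0" "\<rho> > 0"
  shows "\<forall>\<^sub>F n in sequentially. \<exists>z. dist z c < \<rho> \<and> poly (F n) z = 0"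
proof -
  obtain e where e: "poly f e \<noteq> 0" using assms(3) poly_all_0_iff_0 by blast
  define t where "t = \<rho> / (\<rho> + dist e c)"
  have t: "0 < t" "t \<le> 1" proof -
    have "\<rho> + dist e c > 0" "\<rho> \<le> \<rho> + dist e c" using assms(5) zero_le_dist[of e c] by linarith+
    note p = this
    show "0 < t" unfolding t_def by (rule divide_pos_pos[OF assms(5) p(1)])
    show "t \<le> 1" unfolding t_def using p by (subst pos_divide_le_eq) auto
  qed
  have "(\<lambda>n. cmod (poly (F n) c)) \<longlonglongrightarrow> 0"
    using tendsto_norm[OF poly_pconv[OF assms(1,2) tendsto_const[of c]]] assms(4) by simp
  moreover have "t ^ D * (cmod (poly f e) / 2) > 0" using t e by simp
  ultimately have 1: "\<forall>\<^sub>F n in sequentially. cmod (poly (F n) c) < t ^ D * (cmod (poly f e) / 2)"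
    by (rule order_tendstoD(2))
  have 2: "\<forall>\<^sub>F n in sequentially. cmod (poly (F n) e) > cmod (poly f e) / 2"
    using tendsto_norm[OF poly_pconv[OF assms(1,2) tendsto_const[of e]]] e
    by (intro order_tendstoD(1)) auto
  from 1 2 show ?thesis
  proof eventually_elim
    case (elim n)
    show ?case
    proof (rule ccontr)
      assume "\<not> ?thesis"
      then have "\<forall>z. poly (F n) z = 0 \<longrightarrow> dist z c \<ge> \<rho>" by force
      from poly_lower_bound_no_roots[OF assms(5) this, of e]
      have "t ^ degree (F n) * cmod (poly (F n) e) \<le> cmod (poly (F n) c)" by (simp add: t_def)
      moreover have "t ^ D * cmod (poly (F n) e) \<le> t ^ degree (F n) * cmod (poly (F n) e)"
        using t assms(2) by (intro mult_right_mono power_decreasing) auto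
      moreover have "t ^ D * (cmod (poly f e) / 2) \<le> t ^ D * cmod (poly (F n) e)"
        using t elim(2) by (intro mult_left_mono) auto
      ultimately show False using elim(1) by linarith
    qed
  qed
qed

text \<open>Choose points that nearly realise the distance from \<open>c\<close> to the set of points satisfying \<open>P n\<close>;
  this distance tends to \<open>0\<close>.\<close>

lemma sequence_choice:
  fixes c :: "'a::metric_space"
  assumes "\<And>e. e > 0 \<Longrightarrow> \<forall>\<^sub>F n in sequentially. \<exists>z. dist z c < e \<and> P n z"
  shows "\<exists>z. z \<longlonglongrightarrow> c \<and> (\<forall>\<^sub>F n in sequentially. P n (z n))"
proof -
  define d where "d n = Inf ((\<lambda>z. dist z c) ` {z. P n z})" for n
  have ex: "\<exists>z. (\<exists>z. P n z) \<longrightarrow> P n z \<and> dist z c < d n + 1 / Suc n" for n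
  proof (cases "\<exists>z. P n z")
    case True
    then have "(\<lambda>z. dist z c) ` {z. P n z} \<noteq> {}" by blast
    moreover have "Inf ((\<lambda>z. dist z c) ` {z. P n z}) < d n + 1 / Suc n" by (simp add: d_def)
    ultimately obtain x where "x \<in> (\<lambda>z. dist z c) ` {z. P n z}" "x < d n + 1 / Suc n"
      using cInf_lessD by metis
    then show ?thesis by auto
  qed auto
  then obtain z where z: "\<And>n. (\<exists>z. P n z) \<Longrightarrow> P n (z n) \<and> dist (z n) c < d n + 1 / Suc n" by metis
  have d: "d n \<le> dist y c" if "P n y" for n y
  proof -
    have "bdd_below ((\<lambda>z. dist z c) ` {z. P n z})" by (rule bdd_belowI[of _ 0]) auto
    then show ?thesis unfolding d_def using that by (intro cInf_lower) auto
  qed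
  have "\<forall>\<^sub>F n in sequentially. P n (z n)"
    using assms[of 1] z by (auto elim!: eventually_mono)
  moreover have "z \<longlonglongrightarrow> c"
  proof (rule tendstoI)
    fix e :: real assume e: "e > 0"
    have "\<forall>\<^sub>F n in sequentially. 1 / real (Suc n) < e / 2"
      by (rule eventually_inverse_Suc_less) (use e in simp)
    with assms[of "e / 2"] e have "\<forall>\<^sub>F n in sequentially. 1 / real (Suc n) < e / 2 \<and> (\<exists>z. dist z c < e / 2 \<and> P n z)"
      by (simp add: eventually_conj)
    then show "\<forall>\<^sub>F n in sequentially. dist (z n) c < e"
    proof eventually_elim
      case (elim n)
      then obtain y where "dist y c < e / 2" "P n y" by blast
      moreover from this have "dist (z n) c < d n + 1 / Suc n" using z[of n] by blast
      ultimately show ?case using d[of n y] elim by linarith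
    qed
  qed
  ultimately show ?thesis by blast
qed

lemma root_sequence:
  assumes "pconv F f" "\<And>n. degree (F n) \<le> D" "f \<noteq> 0" "poly f c = 0"
  shows "\<exists>z. z \<longlonglongrightarrow> c \<and> (\<forall>\<^sub>F n in sequentially. poly (F n) (z n) = 0)"
  by (rule sequence_choice) (rule root_near[OF assms])

definition root_count :: "complex \<Rightarrow> real \<Rightarrow> complex poly \<Rightarrow> nat" where
  "root_count c \<rho> F = size (filter_mset (\<lambda>z. dist z c < \<rho>) (proots F))"

lemma root_count_mult:
  "F \<noteq> 0 \<Longrightarrow> G \<noteq> 0 \<Longrightarrow> root_count c \<rho> (F * G) = root_count c \<rho> F + root_count c \<rho> G"
  by (simp add: root_count_def proots_mult)

lemma root_count_sum:
  assumes "F \<noteq> 0"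
  shows "root_count c \<rho> F = (\<Sum>z | poly F z = 0 \<and> dist z c < \<rho>. order z F)"
proof -
  have "set_mset (filter_mset (\<lambda>z. dist z c < \<rho>) (proots F)) = {z. poly F z = 0 \<and> dist z c < \<rho>}"
    using assms by auto
  then show ?thesis unfolding root_count_def size_multiset_overloaded_eq
    using assms by (intro sum.cong) auto
qed

lemma nonvanishing_near:
  assumes "pconv F f" "\<And>n. degree (F n) \<le> D" "\<forall>z. dist z c \<le> \<rho> \<longrightarrow> poly f z \<noteq> 0"
  shows "\<forall>\<^sub>F n in sequentially. \<forall>z. dist z c \<le> \<rho> \<longrightarrow> poly (F n) z \<noteq> 0"
proof (rule ccontr)
  assume "\<not> ?thesis"
  then have "\<exists>\<^sub>F n in sequentially. \<exists>z. dist z c \<le> \<rho> \<and> poly (F n) z = 0"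
    by (simp add: not_eventually)
  then obtain r :: "nat \<Rightarrow> nat" where r: "strict_mono r" "\<And>n. \<exists>z. dist z c \<le> \<rho> \<and> poly (F (r n)) z = 0"
    by (rule frequently_subseq) blast
  then obtain z where z: "\<And>n. dist (z n) c \<le> \<rho>" "\<And>n. poly (F (r n)) (z n) = 0" by metis
  have "compact (cball c \<rho>)" by simp
  moreover have "\<forall>n. z n \<in> cball c \<rho>" using z(1) by (simp add: dist_commute)
  ultimately obtain l and s :: "nat \<Rightarrow> nat" where s: "l \<in> cball c \<rho>" "strict_mono s" "(z \<circ> s) \<longlonglongrightarrow> l"
    unfolding compact_def by blast
  have "(\<lambda>n. poly (F (r (s n))) ((z \<circ> s) n)) \<longlonglongrightarrow> poly f l"
    by (rule poly_pconv[OF pconv_subseq[OF pconv_subseq[OF assms(1) r(1)] s(2)] _ s(3)]) (rule assms(2))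
  then have "poly f l = 0" using z(2) by (simp add: LIMSEQ_const_iff)
  then show False using s(1) assms(3) by (auto simp: dist_commute)
qed

text \<open>Induction on the order of the zero of \<open>f\<close> at \<open>c\<close>: splitting off one root of \<open>F n\<close> near \<open>c\<close> and
  the factor of \<open>f\<close> that it converges to lowers both sides by one, until neither polynomial has a
  zero near \<open>c\<close>.\<close>

lemma root_count_stable:
  assumes "pconv F f" "\<And>n. degree (F n) \<le> D" "f \<noteq> 0" "\<rho> > 0"
    and "\<And>z. dist z c \<le> \<rho> \<Longrightarrow> poly f z = 0 \<Longrightarrow> z = c"
  shows "\<forall>\<^sub>F n in sequentially. F n \<noteq> 0 \<and> root_count c \<rho> (F n) = order c f"
  using assms
proof (induction "order c f" arbitrary: F f)
  case 0
  then have "poly f c \<noteq> 0" by (simp add: order_root)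
  then have "\<forall>z. dist z c \<le> \<rho> \<longrightarrow> poly f z \<noteq> 0" using 0(6) by metis
  from nonvanishing_near[OF 0(2,3) this] show ?case
  proof eventually_elim
    case (elim n)
    have "poly (F n) c \<noteq> 0" using elim[rule_format, of c] 0(5) by simp
    then have nz: "F n \<noteq> 0" by auto
    have "{z. poly (F n) z = 0 \<and> dist z c < \<rho>} = {}" using elim by force
    then have "root_count c \<rho> (F n) = 0" unfolding root_count_sum[OF nz] by (simp only: sum.empty)
    then show ?case using nz 0(1) by simp
  qed
next
  case (Suc k)
  have c0: "poly f c = 0" using Suc(2) order_root by (metis nat.distinct(1))
  obtain z where z: "z \<longlonglongrightarrow> c" "\<forall>\<^sub>F n in sequentially. poly (F n) (z n) = 0"
    using root_sequence[OF Suc(3-5) c0] by blast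
  define G where "G n = synthetic_div (F n) (z n)" for n
  have FG: "\<forall>\<^sub>F n in sequentially. F n = [:- z n, 1:] * G n"
    using z(2)
  proof eventually_elim
    case (elim n)
    then show ?case using synthetic_div_correct'[of "z n" "F n"] by (simp add: G_def)
  qed
  have dG: "degree (G n) \<le> D" for n using Suc(4)[of n] by (simp add: G_def degree_synthetic_div)
  from pconv_divide_linear[OF Suc(3) z(1) dG FG] obtain g where g: "pconv G g" "f = [:- c, 1:] * g" by blast
  have g0: "g \<noteq> 0" using g(2) Suc(5) by auto
  have "order c f = order c [:- c, 1:] + order c g" using g(2) Suc(5) order_mult by blast
  then have og: "order c f = Suc (order c g)" using order_power_n_n[of c 1] by simp
  have "\<forall>\<^sub>F n in sequentially. G n \<noteq> 0 \<and> root_count c \<rho> (G n) = order c g"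
  proof (rule Suc(1)[OF _ g(1) dG g0 Suc(6)])
    show "k = order c g" using og Suc(2) by simp
    show "\<And>z. dist z c \<le> \<rho> \<Longrightarrow> poly g z = 0 \<Longrightarrow> z = c" using Suc(7) g(2) by simp
  qed
  moreover have "\<forall>\<^sub>F n in sequentially. dist (z n) c < \<rho>" using z(1) Suc(6) by (rule tendstoD)
  ultimately show ?case using FG
  proof eventually_elim
    case (elim n)
    have l: "[:- z n, 1:] \<noteq> 0" by simp
    have "root_count c \<rho> [:- z n, 1:] = 1" using elim(2) by (simp add: root_count_def)
    then have "root_count c \<rho> ([:- z n, 1:] * G n) = Suc (order c g)"
      using elim(1) by (subst root_count_mult) auto
    moreover have "[:- z n, 1:] * G n \<noteq> 0" using elim(1) l by (metis mult_eq_0_iff)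
    ultimately show ?case using elim(3) og by simp
  qed
qed

lemma pconv_subseq_exists:
  assumes "\<And>n. degree (F n) \<le> D" "\<And>n i. cmod (coeff (F n) i) \<le> B"
  shows "\<exists>r f. strict_mono (r::nat\<Rightarrow>nat) \<and> pconv (\<lambda>n. F (r n)) f"
proof -
  have *: "\<exists>r::nat\<Rightarrow>nat. strict_mono r \<and> (\<forall>i<m. convergent (\<lambda>n. coeff (F (r n)) i))" for m
  proof (induction m)
    case 0 show ?case by (rule exI[of _ id]) (auto simp: strict_mono_def)
  next
    case (Suc m)
    then obtain r where r: "strict_mono (r::nat\<Rightarrow>nat)" "\<And>i. i < m \<Longrightarrow> convergent (\<lambda>n. coeff (F (r n)) i)" by blast
    have "bounded (range (\<lambda>n. coeff (F (r n)) m))" using assms(2) by (auto intro: boundedI)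
    then obtain l s where s: "strict_mono (s::nat\<Rightarrow>nat)" "((\<lambda>n. coeff (F (r n)) m) \<circ> s) \<longlonglongrightarrow> l"
      using bounded_imp_convergent_subsequence by blast
    have "convergent (\<lambda>n. coeff (F ((r \<circ> s) n)) i)" if "i < Suc m" for i
    proof (cases "i = m")
      case True then show ?thesis using s(2) by (auto simp: convergent_def o_def)
    next
      case False
      then have "convergent (\<lambda>n. coeff (F (r n)) i)" using r(2) that by simp
      then show ?thesis using LIMSEQ_subseq_LIMSEQ[OF _ s(1)] unfolding convergent_def by (fastforce simp: o_def)
    qed
    then show ?case using strict_mono_o[OF r(1) s(1)] by blast
  qed
  obtain r where r: "strict_mono (r::nat\<Rightarrow>nat)" "\<And>i. i < Suc D \<Longrightarrow> convergent (\<lambda>n. coeff (F (r n)) i)"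
    using *[of "Suc D"] by blast
  define l where "l i = lim (\<lambda>n. coeff (F (r n)) i)" for i
  have l: "(\<lambda>n. coeff (F (r n)) i) \<longlonglongrightarrow> l i" if "i \<le> D" for i
    using r(2)[of i] that by (simp add: l_def convergent_LIMSEQ_iff)
  define f where "f = (\<Sum>i\<le>D. monom (l i) i)"
  have cf: "coeff f i = (if i \<le> D then l i else 0)" for i
    unfolding f_def coeff_sum coeff_monom by (simp add: sum.delta)
  have "(\<lambda>n. coeff (F (r n)) i) \<longlonglongrightarrow> coeff f i" for i
  proof (cases "i \<le> D")
    case False
    then have "coeff (F (r n)) i = 0" for n using assms(1)[of "r n"] by (intro coeff_eq_0) linarith
    then show ?thesis using False cf by simp
  qed (use l cf in simp)
  then show ?thesis using r(1) pconv_def by blast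
qed

text \<open>The unit sphere of a finite-dimensional space is compact: divide by the sum of the absolute
  values of the coefficients, which is then \<open>1\<close> for the limit as well.\<close>

lemma normalized_limit:
  assumes "\<And>n. degree (F n) \<le> D" "\<And>n. F n \<noteq> 0"
  shows "\<exists>r c f. strict_mono (r::nat\<Rightarrow>nat) \<and> (\<forall>n. c n \<noteq> 0) \<and> f \<noteq> 0 \<and>
    pconv (\<lambda>n. smult (c n) (F (r n))) f"
proof -
  define N where "N n = (\<Sum>i\<le>D. cmod (coeff (F n) i))" for n
  have N: "N n > 0" for n
  proof -
    have "cmod (coeff (F n) (degree (F n))) \<le> N n" unfolding N_def
      by (rule member_le_sum) (use assms(1) in auto)
    moreover have "cmod (coeff (F n) (degree (F n))) > 0" using assms(2) by simp
    ultimately show ?thesis by linarith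
  qed
  define G where "G n = smult (of_real (1 / N n)) (F n)" for n
  have sumG: "(\<Sum>i\<le>D. cmod (coeff (G n) i)) = 1" for n
  proof -
    have "(\<Sum>i\<le>D. cmod (coeff (G n) i)) = (\<Sum>i\<le>D. cmod (coeff (F n) i) / N n)"
      using N[of n] by (intro sum.cong) (auto simp: G_def norm_mult norm_divide)
    also have "\<dots> = 1" using N[of n] by (simp add: sum_divide_distrib[symmetric] N_def)
    finally show ?thesis .
  qed
  have dG: "degree (G n) \<le> D" for n using assms(1)[of n] degree_smult_le by (metis G_def order_trans)
  have "cmod (coeff (G n) i) \<le> 1" for n i
  proof (cases "i \<le> D")
    case True
    then have "cmod (coeff (G n) i) \<le> (\<Sum>i\<le>D. cmod (coeff (G n) i))"
      by (intro member_le_sum) auto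
    then show ?thesis using sumG by simp
  next
    case False
    then have "coeff (G n) i = 0" using dG[of n] by (intro coeff_eq_0) linarith
    then show ?thesis by simp
  qed
  from pconv_subseq_exists[of G, OF dG this] obtain r f where
    r: "strict_mono (r::nat\<Rightarrow>nat)" "pconv (\<lambda>n. G (r n)) f" by blast
  have "(\<lambda>n. \<Sum>i\<le>D. cmod (coeff (G (r n)) i)) \<longlonglongrightarrow> (\<Sum>i\<le>D. cmod (coeff f i))"
    by (intro tendsto_intros pconvD[OF r(2)])
  then have "(\<Sum>i\<le>D. cmod (coeff f i)) = 1" using sumG by (simp add: LIMSEQ_const_iff)
  then have "f \<noteq> 0" by auto
  moreover have "complex_of_real (1 / N (r n)) \<noteq> 0" for n using N[of "r n"] by simp
  ultimately show ?thesis using r unfolding G_def by (intro exI[of _ r] exI[of _ "\<lambda>n. complex_of_real (1 / N (r n))"] exI[of _ f]) simp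
qed

section \<open>Convergence of maps forces convergence of coefficients\<close>

lemma size_mset_le_sum_filter:
  assumes "finite B" "set_mset M \<subseteq> (\<Union>b\<in>B. A b)"
  shows "size M \<le> (\<Sum>b\<in>B. size (filter_mset (\<lambda>z. z \<in> A b) M))"
  using assms(2)
proof (induction M)
  case (add x M)
  obtain b where b: "b \<in> B" "x \<in> A b" using add.prems by auto
  have "(\<Sum>b\<in>B. size (filter_mset (\<lambda>z. z \<in> A b) (add_mset x M))) =
     (\<Sum>b\<in>B. size (filter_mset (\<lambda>z. z \<in> A b) M) + (if x \<in> A b then 1 else 0))"
    by (intro sum.cong) auto
  also have "\<dots> = (\<Sum>b\<in>B. size (filter_mset (\<lambda>z. z \<in> A b) M)) + (\<Sum>b\<in>B. if x \<in> A b then 1 else 0)"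
    by (rule sum.distrib)
  finally have 1: "(\<Sum>b\<in>B. size (filter_mset (\<lambda>z. z \<in> A b) (add_mset x M))) =
    (\<Sum>b\<in>B. size (filter_mset (\<lambda>z. z \<in> A b) M)) + (\<Sum>b\<in>B. if x \<in> A b then 1 else 0)" .
  have "(if x \<in> A b then 1 else 0) \<le> (\<Sum>b\<in>B. if x \<in> A b then 1 else 0::nat)"
    by (rule member_le_sum) (use b assms(1) in auto)
  moreover have "size M \<le> (\<Sum>b\<in>B. size (filter_mset (\<lambda>z. z \<in> A b) M))"
    using add by simp
  ultimately show ?case unfolding 1 using b by simp
qed simp

lemma quotient_map_smult:
  assumes "c \<noteq> 0" shows "quotient_map (smult c p) (smult c q) = quotient_map p q"
proof
  fix x show "quotient_map (smult c p) (smult c q) x = quotient_map p q x"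
    using assms by (cases x) (auto simp: Let_def)
qed

lemma coprime_smult:
  assumes "c \<noteq> (0::complex)" "coprime p q" shows "coprime (smult c p) (smult c q)"
proof (rule coprimeI_no_common_root)
  fix z assume "poly (smult c p) z = 0" "poly (smult c q) z = 0"
  then show False using coprime_no_common_root[OF assms(2), of z] assms(1) by auto
next
  show "smult c q \<noteq> 0 \<or> smult c p \<noteq> 0" using assms by auto
qed

text \<open>Precomposition with a Moebius transformation brings every map without critical value infinity
  to this form. All points of fibres over critical values are then finite and have finite values,
  so that polynomials can replace charts.\<close>

locale normal_map =
  fixes f :: "riemann_sphere \<Rightarrow> riemann_sphere" and p q :: "complex poly" and d :: nat
  assumes f: "f = quotient_map p q" and cop: "coprime p q"
    and dq: "degree q = d" and dp: "degree p \<le> d" and d1: "d \<ge> 1"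
    and inf_not_crit: "Infty \<notin> critical_values f"
    and f_inf_not_crit: "f Infty \<notin> critical_values f"
begin

lemma rat_f: "rat f" using f cop dq d1 ratI by auto

lemma q0: "q \<noteq> 0" using dq d1 by auto

lemma f_Infty: "f Infty = Fin (coeff p d / coeff q d)"
  using dq dp q0 by (auto simp: f Let_def max_def)

lemma simple_pole: assumes "poly q b = 0" shows "poly (wronskian p q) b \<noteq> 0"
proof
  assume "poly (wronskian p q) b = 0"
  then have "Fin b \<in> critical_points f" using critical_Fin_iff[OF cop] f by simp
  moreover have "f (Fin b) = Infty" using assms f by simp
  ultimately show False using inf_not_crit by (force simp: critical_values_def)
qed

end

text \<open>Where \<open>p\<close> has no zeros, the reciprocal maps have finite values on a compact disc, and
  continuous convergence there is uniform convergence of complex functions.\<close>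

lemma uniform_near_pole:
  assumes conv: "cconv (\<lambda>n. quotient_map (P n) (Q n)) (quotient_map p q)"
    and cop: "\<And>n. coprime (P n) (Q n)" "coprime p q" and e: "e > 0"
    and nz: "\<And>w. w \<in> cball b r \<Longrightarrow> poly p w \<noteq> 0"
  shows "\<forall>\<^sub>F n in sequentially. \<forall>w\<in>cball b r. poly (P n) w \<noteq> 0 \<and>
    cmod (poly (Q n) w / poly (P n) w - poly q w / poly p w) < e"
proof (rule ccontr)
  assume "\<not> ?thesis"
  then have "\<exists>\<^sub>F n in sequentially. \<exists>w\<in>cball b r. \<not> (poly (P n) w \<noteq> 0 \<and>
    cmod (poly (Q n) w / poly (P n) w - poly q w / poly p w) < e)"
    by (simp add: not_eventually)
  then obtain s :: "nat \<Rightarrow> nat" where s: "strict_mono s" "\<And>n. \<exists>w\<in>cball b r. \<not> (poly (P (s n)) w \<noteq> 0 \<and>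
    cmod (poly (Q (s n)) w / poly (P (s n)) w - poly q w / poly p w) < e)"
    by (rule frequently_subseq) blast
  then obtain w where w: "\<And>n. w n \<in> cball b r" "\<And>n. \<not> (poly (P (s n)) (w n) \<noteq> 0 \<and>
    cmod (poly (Q (s n)) (w n) / poly (P (s n)) (w n) - poly q (w n) / poly p (w n)) < e)" by metis
  have "compact (cball b r)" by simp
  moreover have "\<forall>n. w n \<in> cball b r" using w(1) by blast
  ultimately obtain l and t :: "nat \<Rightarrow> nat" where t: "l \<in> cball b r" "strict_mono t" "(w \<circ> t) \<longlonglongrightarrow> l"
    unfolding compact_def by blast
  have "(\<lambda>n. quotient_map (P (s (t n))) (Q (s (t n))) (Fin ((w \<circ> t) n))) \<longlonglongrightarrow> quotient_map p q (Fin l)"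
    using cconvD[OF cconv_subseq[OF cconv_subseq[OF conv s(1)] t(2)] tendsto_Fin[OF t(3)]] .
  from tendsto_recip[OF this]
  have l: "(\<lambda>n. quotient_map (Q (s (t n))) (P (s (t n))) (Fin ((w \<circ> t) n))) \<longlonglongrightarrow> Fin (poly q l / poly p l)"
    using nz[OF t(1)] cop by (simp only: recip_quotient_map) simp
  have "(\<lambda>n. poly q ((w \<circ> t) n) / poly p ((w \<circ> t) n)) \<longlonglongrightarrow> poly q l / poly p l"
    using nz[OF t(1)] by (intro tendsto_divide isCont_tendsto_compose[OF poly_isCont] t(3))
  from tendsto_diff[OF eventually_finite(2)[OF l] this]
  have "(\<lambda>n. cmod (fin_part (quotient_map (Q (s (t n))) (P (s (t n))) (Fin ((w \<circ> t) n)))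
     - poly q ((w \<circ> t) n) / poly p ((w \<circ> t) n))) \<longlonglongrightarrow> 0" using tendsto_norm by fastforce
  then have "\<forall>\<^sub>F n in sequentially. cmod (fin_part (quotient_map (Q (s (t n))) (P (s (t n))) (Fin ((w \<circ> t) n)))
     - poly q ((w \<circ> t) n) / poly p ((w \<circ> t) n)) < e"
    using e by (rule order_tendstoD(2))
  with eventually_finite(1)[OF l] have "\<forall>\<^sub>F n in sequentially. False"
  proof eventually_elim
    case (elim n)
    then show ?case using w(2)[of "t n"] by (auto split: if_splits)
  qed
  then show False by simp
qed

text \<open>At a simple pole the reciprocal \<open>q / p\<close> has a nonzero derivative \<open>A\<close>. By Cauchy's inequality
  the reciprocals of maps that are uniformly close have derivatives within \<open>cmod A / 2\<close> of \<open>A\<close> on a small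
  disc. They are therefore injective on it and have no multiple zeros.\<close>

lemma at_most_one_pole_near:
  assumes conv: "cconv (\<lambda>n. quotient_map (P n) (Q n)) (quotient_map p q)"
    and cop: "\<And>n. coprime (P n) (Q n)" "coprime p q"
    and b: "poly q b = 0" "poly (wronskian p q) b \<noteq> 0"
  shows "\<exists>r>0. \<forall>\<^sub>F n in sequentially. Q n \<noteq> 0 \<longrightarrow> root_count b r (Q n) \<le> 1"
proof -
  have pb: "poly p b \<noteq> 0" using coprime_no_common_root[OF cop(2)] b(1) by blast
  have "open {w. poly p w \<noteq> 0}"
    by (rule open_Collect_neq) (auto intro: continuous_intros)
  then obtain R where R: "R > 0" "cball b R \<subseteq> {w. poly p w \<noteq> 0}"
    using pb open_contains_cball by (metis (mono_tags, lifting) mem_Collect_eq)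
  define h where "h w = poly q w / poly p w" for w
  define h' where "h' w = - poly (wronskian p q) w / (poly p w)^2" for w
  have der: "((\<lambda>w. poly q w / poly p w) has_field_derivative - poly (wronskian p q) w / (poly p w)^2) (at w)"
    if "poly p w \<noteq> 0" for w and p q :: "complex poly"
    using DERIV_divide[OF poly_DERIV[of q w] poly_DERIV[of p w] that]
    by (simp add: wronskian_def power2_eq_square algebra_simps)
  define A where "A = h' b"
  have A0: "A \<noteq> 0" using b(2) pb by (simp add: A_def h'_def)
  have "isCont h' b" unfolding h'_def using pb by (intro continuous_intros) auto
  then obtain r0 where r0: "r0 > 0" "\<And>w. dist w b < r0 \<Longrightarrow> dist (h' w) A < cmod A / 4"
    unfolding A_def by (metis A_def A0 continuous_at_eps_delta zero_less_divide_iff zero_less_norm_iff zero_less_numeral)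
  define r where "r = min r0 (R / 2)"
  have r: "r > 0" "r \<le> r0" "r \<le> R / 2" using r0 R by (auto simp: r_def)
  (* Cauchy's inequality on discs of radius R / 2 turns the error e into cmod A / 4. *)
  define e where "e = (R / 2) * (cmod A / 4)"
  have e: "e > 0" using R A0 by (simp add: e_def)
  have "\<And>w. w \<in> cball b R \<Longrightarrow> poly p w \<noteq> 0" using R(2) by blast
  from uniform_near_pole[OF conv cop e this]
  have "\<forall>\<^sub>F n in sequentially. \<forall>w\<in>cball b R. poly (P n) w \<noteq> 0 \<and>
    cmod (poly (Q n) w / poly (P n) w - poly q w / poly p w) < e" .
  then have "\<forall>\<^sub>F n in sequentially. Q n \<noteq> 0 \<longrightarrow> root_count b r (Q n) \<le> 1"
  proof eventually_elim
    case (elim n)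
    define k where "k w = poly (Q n) w / poly (P n) w" for w
    define k' where "k' w = - poly (wronskian (P n) (Q n)) w / (poly (P n) w)^2" for w
    have dk: "(k has_field_derivative k' w) (at w)" if "w \<in> cball b R" for w
      unfolding k_def k'_def using der elim that by blast
    have dh: "(h has_field_derivative h' w) (at w)" if "w \<in> cball b R" for w
      unfolding h_def h'_def using der R(2) that by blast
    have close: "cmod (k' w - A) \<le> cmod A / 2" if w: "w \<in> ball b r" for w
    proof -
      have sub: "cball w (R / 2) \<subseteq> cball b R"
      proof
        fix x assume "x \<in> cball w (R / 2)"
        then show "x \<in> cball b R" using w r(3) dist_triangle[of b x w] by auto
      qed
      have dkh: "((\<lambda>x. k x - h x) has_field_derivative k' x - h' x) (at x)" if "x \<in> cball w (R / 2)" for x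
        using dk dh sub that by (intro derivative_intros) auto
      have "cmod ((deriv ^^ 1) (\<lambda>x. k x - h x) w) \<le> fact 1 * e / (R / 2) ^ 1"
      proof (rule Cauchy_inequality)
        show "(\<lambda>x. k x - h x) holomorphic_on ball w (R / 2)"
          using dkh by (intro holomorphic_onI) (meson field_differentiable_at_within field_differentiable_def ball_subset_cball subsetD)
        show "continuous_on (cball w (R / 2)) (\<lambda>x. k x - h x)"
          using dkh by (intro continuous_at_imp_continuous_on) (meson DERIV_isCont)
        show "0 < R / 2" using R by simp
        show "\<And>x. cmod (w - x) = R / 2 \<Longrightarrow> cmod (k x - h x) \<le> e"
          using elim sub by (simp add: k_def h_def subset_iff dist_norm less_imp_le)
      qed
      moreover have "deriv (\<lambda>x. k x - h x) w = k' w - h' w"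
        using dkh[of w] R by (intro DERIV_imp_deriv) auto
      ultimately have "cmod (k' w - h' w) \<le> cmod A / 4" using R by (simp add: e_def)
      moreover have "cmod (h' w - A) \<le> cmod A / 4"
        using r0(2)[of w] w r(2) by (simp add: dist_norm norm_minus_commute less_imp_le)
      ultimately show ?thesis using norm_triangle_ineq[of "k' w - h' w" "h' w - A"] by simp
    qed
    have sub: "w \<in> cball b R" if "w \<in> ball b r" for w using that r R by auto
    have ord: "order u (Q n) \<le> 1" if u: "u \<in> ball b r" "Q n \<noteq> 0" for u
    proof (rule ccontr)
      assume "\<not> ?thesis"
      then have "2 \<le> order u (Q n)" by simp
      then have "[:-u, 1:]^2 dvd Q n" using order_1[of u "Q n"] le_imp_power_dvd dvd_trans by blast
      then obtain G where G: "Q n = [:-u, 1:]^2 * G" by (rule dvdE)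
      have "pderiv (L * L * G) = L * ((G + G) + L * pderiv G)" if "pderiv L = 1" for L
        by (simp only: pderiv_mult that) (simp add: algebra_simps)
      from this[of "[:-u, 1:]"] have "pderiv (Q n) = [:-u, 1:] * ((G + G) + [:-u, 1:] * pderiv G)"
        unfolding G power2_eq_square by (simp only: pderiv_pCons pderiv_1) simp
      then have "poly (Q n) u = 0" "poly (pderiv (Q n)) u = 0" unfolding G by (simp_all del: mult_pCons_left)
      then have "k' u = 0" by (simp add: k'_def wronskian_def)
      then show False using close[OF u(1)] A0 by simp
    qed
    have uniq: "u = v" if "u \<in> ball b r" "v \<in> ball b r" "poly (Q n) u = 0" "poly (Q n) v = 0" for u v
    proof (rule ccontr)
      assume uv: "u \<noteq> v"
      have "cmod ((k u - A * u) - (k v - A * v)) \<le> cmod A / 2 * cmod (u - v)"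
      proof (rule field_differentiable_bound[of "ball b r" _ "\<lambda>w. k' w - A"])
        show "((\<lambda>w. k w - A * w) has_field_derivative k' w - A) (at w within ball b r)" if "w \<in> ball b r" for w
          by (rule has_field_derivative_at_within) (use dk[OF sub[OF that]] in \<open>auto intro!: derivative_eq_intros\<close>)
      qed (use close that in auto)
      moreover have "k u = 0" "k v = 0" using that by (auto simp: k_def)
      ultimately have "cmod (A * (v - u)) \<le> cmod A / 2 * cmod (u - v)" by (simp add: algebra_simps)
      then have "cmod A * cmod (u - v) \<le> cmod A / 2 * cmod (u - v)" by (simp add: norm_mult norm_minus_commute)
      then show False using A0 uv by simp
    qed
    show ?case
    proof
      assume Q: "Q n \<noteq> 0"
      let ?S = "{z. poly (Q n) z = 0 \<and> dist z b < r}"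
      have S: "?S \<subseteq> ball b r" by (auto simp: dist_commute)
      show "root_count b r (Q n) \<le> 1"
      proof (cases "?S = {}")
        case True then show ?thesis unfolding root_count_sum[OF Q] True by simp
      next
        case False
        then obtain u where "?S = {u}" using uniq S by blast
        then show ?thesis unfolding root_count_sum[OF Q] using ord[OF _ Q, of u] S by auto
      qed
    qed
  qed
  then show ?thesis using r(1) by blast
qed

context normal_map
begin

text \<open>The poles of the approximating maps lie near the at most \<open>d\<close> poles of \<open>f\<close>, and near each of
  them there is at most one, which is simple. Since the value at infinity is finite, the number
  of poles is the degree of the map.\<close>

lemma degree_bound:
  assumes conv: "cconv (\<lambda>n. quotient_map (P n) (Q n)) f" and copn: "\<And>n. coprime (P n) (Q n)"
  shows "\<forall>\<^sub>F n in sequentially. degree (P n) \<le> d \<and> degree (Q n) \<le> d"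
proof -
  let ?B = "{b. poly q b = 0}"
  have finB: "finite ?B" using poly_roots_finite[OF q0] .
  have cardB: "card ?B \<le> d" using card_poly_roots_bound[OF q0] dq by simp
  have "\<forall>b\<in>?B. \<exists>r>0. \<forall>\<^sub>F n in sequentially. Q n \<noteq> 0 \<longrightarrow> root_count b r (Q n) \<le> 1"
    using at_most_one_pole_near[OF conv[unfolded f] copn cop] simple_pole by blast
  from bchoice[OF this] obtain r where r': "\<forall>b\<in>?B. r b > 0 \<and>
    (\<forall>\<^sub>F n in sequentially. Q n \<noteq> 0 \<longrightarrow> root_count b (r b) (Q n) \<le> 1)" by blast
  have r: "\<And>b. b \<in> ?B \<Longrightarrow> r b > 0"
    "\<forall>b\<in>?B. \<forall>\<^sub>F n in sequentially. Q n \<noteq> 0 \<longrightarrow> root_count b (r b) (Q n) \<le> 1"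
    using r' by auto
  have ev1: "\<forall>\<^sub>F n in sequentially. \<forall>b\<in>?B. Q n \<noteq> 0 \<longrightarrow> root_count b (r b) (Q n) \<le> 1"
    by (rule eventually_ball_finite[OF finB r(2)])
  have "(\<lambda>n. quotient_map (P n) (Q n) Infty) \<longlonglongrightarrow> Fin (coeff p d / coeff q d)"
    using cconvD[OF conv tendsto_const[of Infty]] f_Infty by simp
  from eventually_finite(1)[OF this]
  have ev2: "\<forall>\<^sub>F n in sequentially. Q n \<noteq> 0 \<and> degree (P n) \<le> degree (Q n)"
  proof eventually_elim
    case (elim n)
    then have c: "coeff (Q n) (max (degree (P n)) (degree (Q n))) \<noteq> 0" by (auto simp: Let_def)
    then have "max (degree (P n)) (degree (Q n)) \<le> degree (Q n)" by (rule le_degree)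
    then show ?case using c by auto
  qed
  have ev3: "\<forall>\<^sub>F n in sequentially. \<forall>w. poly (Q n) w = 0 \<longrightarrow> w \<in> (\<Union>b\<in>?B. ball b (r b))"
  proof (rule ccontr)
    assume "\<not> ?thesis"
    then have "\<exists>\<^sub>F n in sequentially. \<exists>w. poly (Q n) w = 0 \<and> w \<notin> (\<Union>b\<in>?B. ball b (r b))"
      by (simp add: not_eventually)
    then obtain s :: "nat \<Rightarrow> nat" where s: "strict_mono s" "\<And>n. \<exists>w. poly (Q (s n)) w = 0 \<and> w \<notin> (\<Union>b\<in>?B. ball b (r b))"
      by (rule frequently_subseq) blast
    then obtain w where w: "\<And>n. poly (Q (s n)) (w n) = 0" "\<And>n. w n \<notin> (\<Union>b\<in>?B. ball b (r b))" by metis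
    obtain t l where t: "strict_mono (t::nat\<Rightarrow>nat)" "((\<lambda>n. Fin (w n)) \<circ> t) \<longlonglongrightarrow> l"
      using sphere_convergent_subseq by blast
    have "(\<lambda>n. quotient_map (P (s (t n))) (Q (s (t n))) (((\<lambda>n. Fin (w n)) \<circ> t) n)) \<longlonglongrightarrow> f l"
      using cconvD[OF cconv_subseq[OF cconv_subseq[OF conv s(1)] t(1)] t(2)] .
    then have fl: "f l = Infty" using w(1) by (simp add: LIMSEQ_const_iff)
    then obtain v where v: "l = Fin v" using f_Infty by (cases l) auto
    then have vB: "v \<in> ?B" using fl f by (auto split: if_splits)
    have "(\<lambda>n. w (t n)) \<longlonglongrightarrow> v" using t(2) v by (simp add: o_def)
    then have "\<forall>\<^sub>F n in sequentially. dist (w (t n)) v < r v" using r(1)[OF vB] by (rule tendstoD)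
    then obtain n where "dist (w (t n)) v < r v" by (auto simp: eventually_sequentially)
    then show False using w(2)[of "t n"] vB by (auto simp: dist_commute)
  qed
  from ev1 ev2 ev3 show ?thesis
  proof eventually_elim
    case (elim n)
    then have Q: "Q n \<noteq> 0" by blast
    have "degree (Q n) = size (proots (Q n))" by (simp add: size_proots_complex)
    also have "\<dots> \<le> (\<Sum>b\<in>?B. size (filter_mset (\<lambda>z. z \<in> ball b (r b)) (proots (Q n))))"
      by (rule size_mset_le_sum_filter[OF finB]) (use elim(3) Q in auto)
    also have "\<dots> = (\<Sum>b\<in>?B. root_count b (r b) (Q n))"
      unfolding root_count_def by (simp add: dist_commute)
    also have "\<dots> \<le> (\<Sum>b\<in>?B. 1)" using elim(1) Q by (intro sum_mono) auto
    also have "\<dots> \<le> d" using cardB by simp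
    finally show ?case using elim(2) by simp
  qed
qed

text \<open>Rescaled coefficients have a convergent subsequence with nonzero limits \<open>pl\<close>, \<open>ql\<close>, by
  \<open>normalized_limit\<close>. Both \<open>pl / ql\<close> and \<open>p / q\<close> describe \<open>f\<close>, so \<open>pl * q = ql * p\<close>. As \<open>p\<close>, \<open>q\<close>
  are coprime and \<open>ql\<close> has degree at most \<open>d = degree q\<close>, the limits are a constant multiple of \<open>p\<close>,
  \<open>q\<close>.\<close>

lemma coefficients_converge:
  assumes conv: "cconv g f" and rat: "\<And>n. rat (g n)"
  shows "\<exists>r P Q. strict_mono (r::nat\<Rightarrow>nat) \<and> (\<forall>n. coprime (P n) (Q n) \<and> g (r n) = quotient_map (P n) (Q n) \<and>
     degree (P n) \<le> d \<and> degree (Q n) \<le> d) \<and> pconv P p \<and> pconv Q q"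
proof -
  have "\<forall>n. \<exists>P Q. coprime P Q \<and> g n = quotient_map P Q" using rat by (metis ratE)
  then obtain P Q where PQ: "\<And>n. coprime (P n) (Q n)" "\<And>n. g n = quotient_map (P n) (Q n)" by metis
  have "cconv (\<lambda>n. quotient_map (P n) (Q n)) f" using conv PQ(2) by (simp add: cconv_def)
  from degree_bound[OF this PQ(1)] obtain N where
    N: "\<And>n. n \<ge> N \<Longrightarrow> degree (P n) \<le> d \<and> degree (Q n) \<le> d" by (auto simp: eventually_sequentially)
  (* Stacking numerator and denominator in one polynomial scales both by the same factor. *)
  define F where "F n = P (n + N) + monom 1 (Suc d) * Q (n + N)" for n
  have deg: "degree (P (n + N)) \<le> d" "degree (Q (n + N)) \<le> d" for n using N[of "n + N"] by auto
  have cF: "coeff (F n) i = (if i \<le> d then coeff (P (n + N)) i else coeff (Q (n + N)) (i - Suc d))" for n i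
    using deg(1)[of n] by (auto simp: F_def coeff_monom_mult coeff_eq_0)
  have dF: "degree (F n) \<le> 2 * d + 1" for n
    by (rule degree_le) (use deg[of n] in \<open>auto simp: cF intro!: coeff_eq_0\<close>)
  have F0: "F n \<noteq> 0" for n
  proof
    assume F: "F n = 0"
    have "P (n + N) = 0"
    proof (rule poly_eqI)
      fix i show "coeff (P (n + N)) i = coeff 0 i" using cF[of n i] F deg(1)[of n] by (cases "i \<le> d") (auto simp: coeff_eq_0)
    qed
    moreover have "Q (n + N) = 0"
      by (rule poly_eqI) (use cF[of n "i + Suc d" for i] F in simp)
    ultimately show False using PQ(1)[of "n + N"] by simp
  qed
  from normalized_limit[of F, OF dF F0] obtain r c Fl where r: "strict_mono (r::nat\<Rightarrow>nat)" "\<And>n. c n \<noteq> 0"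
    "Fl \<noteq> 0" "pconv (\<lambda>n. smult (c n) (F (r n))) Fl" by blast
  define P' where "P' n = smult (c n) (P (r n + N))" for n
  define Q' where "Q' n = smult (c n) (Q (r n + N))" for n
  define pl where "pl = (\<Sum>i\<le>d. monom (coeff Fl i) i)"
  define ql where "ql = (\<Sum>i\<le>d. monom (coeff Fl (i + Suc d)) i)"
  have cpl: "coeff pl i = (if i \<le> d then coeff Fl i else 0)"
    and cql: "coeff ql i = (if i \<le> d then coeff Fl (i + Suc d) else 0)" for i
    unfolding pl_def ql_def coeff_sum coeff_monom by (simp_all add: sum.delta)
  have Fi: "(\<lambda>n. c n * coeff (F (r n)) i) \<longlonglongrightarrow> coeff Fl i" for i
    using pconvD[OF r(4), of i] by simp
  have z0: "coeff (P' n) i = 0" "coeff (Q' n) i = 0" if "\<not> i \<le> d" for n i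
    using that deg[of "r n"] by (simp_all add: P'_def Q'_def coeff_eq_0)
  have cP: "pconv P' pl" unfolding pconv_def
  proof
    fix i show "(\<lambda>n. coeff (P' n) i) \<longlonglongrightarrow> coeff pl i"
    proof (cases "i \<le> d")
      case True then show ?thesis using Fi[of i] by (simp add: cpl cF P'_def)
    next
      case False then show ?thesis using z0(1)[OF False] by (simp add: cpl)
    qed
  qed
  have cQ: "pconv Q' ql" unfolding pconv_def
  proof
    fix i show "(\<lambda>n. coeff (Q' n) i) \<longlonglongrightarrow> coeff ql i"
    proof (cases "i \<le> d")
      case True then show ?thesis using Fi[of "i + Suc d"] by (simp add: cql cF Q'_def)
    next
      case False then show ?thesis using z0(2)[OF False] by (simp add: cql)
    qed
  qed
  have dP': "degree (P' n) \<le> d" "degree (Q' n) \<le> d" for n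
    using deg[of "r n"] by (auto simp: P'_def Q'_def)
  have dpl: "degree pl \<le> d" "degree ql \<le> d" using pconv_degree cP cQ dP' by blast+
  have conv': "cconv (\<lambda>n. quotient_map (P' n) (Q' n)) f"
  proof -
    have "strict_mono (\<lambda>n. r n + N)" using r(1) by (simp add: strict_mono_def)
    from cconv_subseq[OF conv this] show ?thesis
      using r(2) PQ(2) by (simp add: P'_def Q'_def quotient_map_smult cconv_def)
  qed
  have "poly ((pl * q - ql * p) * q) z = 0" for z
  proof (cases "poly q z = 0")
    case False
    have "(\<lambda>n. quotient_map (P' n) (Q' n) (Fin z)) \<longlonglongrightarrow> Fin (poly p z / poly q z)"
      using cconvD[OF conv' tendsto_const[of "Fin z"]] False f by simp
    note lim = eventually_finite(1,2)[OF this]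
    have lP: "(\<lambda>n. poly (P' n) z) \<longlonglongrightarrow> poly pl z" and lQ: "(\<lambda>n. poly (Q' n) z) \<longlonglongrightarrow> poly ql z"
      using poly_pconv[OF cP dP'(1) tendsto_const] poly_pconv[OF cQ dP'(2) tendsto_const] by auto
    have "(\<lambda>n. fin_part (quotient_map (P' n) (Q' n) (Fin z)) * poly (Q' n) z) \<longlonglongrightarrow> poly p z / poly q z * poly ql z"
      by (intro tendsto_mult lim(2) lQ)
    moreover have "\<forall>\<^sub>F n in sequentially. fin_part (quotient_map (P' n) (Q' n) (Fin z)) * poly (Q' n) z = poly (P' n) z"
      using lim(1) by eventually_elim (auto split: if_splits)
    ultimately have "(\<lambda>n. poly (P' n) z) \<longlonglongrightarrow> poly p z / poly q z * poly ql z"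
      by (rule Lim_transform_eventually)
    from LIMSEQ_unique[OF lP this] show ?thesis using False by (simp add: field_simps)
  qed simp
  then have "(pl * q - ql * p) * q = 0" using poly_all_0_iff_0 by blast
  then have rel: "pl * q = ql * p" using q0 by (metis mult_eq_0_iff right_minus_eq)
  have "q dvd p * ql" using rel by (metis dvd_triv_right mult.commute)
  then have "q dvd ql" using cop by (simp add: coprime_dvd_mult_right_iff coprime_commute)
  then obtain h where h: "ql = q * h" by (rule dvdE)
  have ql0: "ql \<noteq> 0"
  proof
    assume "ql = 0"
    moreover from this have "pl = 0" using rel q0 by simp
    moreover have "degree Fl \<le> 2 * d + 1"
      by (rule pconv_degree[OF r(4)]) (rule order_trans[OF degree_smult_le dF])
    ultimately have "coeff Fl i = 0" for i
      using cpl[of i] cql[of "i - Suc d"]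
      by (cases "i \<le> d"; cases "i \<le> 2 * d + 1") (auto simp: coeff_eq_0 split: if_splits)
    then show False using r(3) by (simp add: poly_eq_iff)
  qed
  have "degree ql = degree q + degree h" unfolding h by (rule degree_mult_eq) (use ql0 h in auto)
  then have "degree h = 0" using dpl(2) dq by simp
  then obtain a where a: "h = [:a:]" by (metis degree_eq_zeroE)
  have ql: "ql = smult a q" using h a by simp
  have a0: "a \<noteq> 0" using ql ql0 by auto
  have "pl * q = smult a p * q" using rel ql by (simp add: mult.commute)
  then have pl: "pl = smult a p" using q0 by (metis mult_right_cancel)
  define P'' where "P'' n = smult (1 / a) (P' n)" for n
  define Q'' where "Q'' n = smult (1 / a) (Q' n)" for n
  have "pconv P'' (smult (1 / a) pl)" "pconv Q'' (smult (1 / a) ql)"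
    unfolding P''_def Q''_def by (intro pconv_smult cP cQ tendsto_const)+
  then have c: "pconv P'' p" "pconv Q'' q" using pl ql a0 by auto
  have e: "P'' n = smult (c n / a) (P (r n + N))" "Q'' n = smult (c n / a) (Q (r n + N))" for n
    by (simp_all add: P''_def Q''_def P'_def Q'_def)
  have ca: "c n / a \<noteq> 0" for n using r(2) a0 by simp
  have "coprime (P'' n) (Q'' n) \<and> g (r n + N) = quotient_map (P'' n) (Q'' n) \<and>
     degree (P'' n) \<le> d \<and> degree (Q'' n) \<le> d" for n
    unfolding e using coprime_smult[OF ca PQ(1)] quotient_map_smult[OF ca] PQ(2) deg[of "r n"] ca[of n] by simp
  moreover have "strict_mono (\<lambda>n. r n + N)" using r(1) by (simp add: strict_mono_def)
  ultimately show ?thesis using c by (intro exI[of _ "\<lambda>n. r n + N"] exI[of _ P''] exI[of _ Q'']) simp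
qed

end

section \<open>A rational map is locally determined by its critical values\<close>

lemma coeff_mult_top:
  fixes p q :: "complex poly"
  assumes "degree p \<le> m" "degree q \<le> n"
  shows "coeff (p * q) (m + n) = coeff p m * coeff q n"
proof -
  have "coeff (p * q) (m + n) = (\<Sum>i\<le>m + n. coeff p i * coeff q (m + n - i))" by (rule coeff_mult)
  also have "\<dots> = (\<Sum>i\<in>{m}. coeff p i * coeff q (m + n - i))"
  proof (rule sum.mono_neutral_right)
    show "\<forall>i\<in>{..m + n} - {m}. coeff p i * coeff q (m + n - i) = 0"
    proof
      fix i assume i: "i \<in> {..m + n} - {m}"
      show "coeff p i * coeff q (m + n - i) = 0"
      proof (cases "i < m")
        case True then have "coeff q (m + n - i) = 0" using assms(2) by (intro coeff_eq_0) linarith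
        then show ?thesis by simp
      next
        case False
        then have "coeff p i = 0" using assms(1) i by (intro coeff_eq_0) auto
        then show ?thesis by simp
      qed
    qed
  qed auto
  finally show ?thesis by simp
qed

context normal_map
begin

lemma wronskian0: "wronskian p q \<noteq> 0"
  using wronskian_nonzero[OF cop] dq d1 by auto

text \<open>By Riemann-Hurwitz there are \<open>2 * d - 2\<close> critical points with multiplicity. None is lost at
  infinity, because the coefficient of degree \<open>2 * d - 2\<close> vanishes only if infinity is critical.\<close>

lemma degree_wronskian: "degree (wronskian p q) \<ge> 2 * d - 2"
proof -
  have md: "max (degree p) (degree q) = d" using dp dq by simp
  have "Infty \<notin> critical_points f" using f_inf_not_crit by (auto simp: critical_values_def)
  moreover have "f \<circ> recip = quotient_map (refl_poly d p) (refl_poly d q)"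
    using quotient_map_recip[OF cop md] f by auto
  ultimately have "poly (wronskian (refl_poly d p) (refl_poly d q)) 0 \<noteq> 0"
    using critical_Infty critical_Fin_iff[OF coprime_refl_poly(1)[OF cop md], of 0] by auto
  then have nz: "coeff p (d - 1) * coeff q d - coeff p d * coeff q (d - 1) \<noteq> 0"
    using d1 by (simp add: wronskian_def poly_0_coeff_0 coeff_mult coeff_pderiv coeff_refl_poly)
  define a where "a = coeff p d / coeff q d"
  have qd: "coeff q d \<noteq> 0" using dq q0 by auto
  (* Subtracting the value a at infinity lowers the degree of the numerator, and what is left
     as its coefficient of degree d - 1 is, up to a factor, the derivative at infinity. *)
  define p1 where "p1 = p - smult a q"
  define c where "c = coeff p1 (d - 1)"
  have cq: "c * coeff q d \<noteq> 0" using nz qd by (simp add: c_def p1_def a_def field_simps)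
  have p1d: "coeff p1 d = 0" using qd by (simp add: p1_def a_def)
  have "degree p1 \<le> d" unfolding p1_def using dp dq by (intro degree_diff_le) (auto intro: order_trans[OF degree_smult_le])
  then have dp1: "degree p1 \<le> d - 1"
    using p1d by (metis Suc_pred' d1 degree_0 diff_is_0_eq' le_SucE leading_coeff_0_iff less_eq_Suc_le nat_le_linear One_nat_def zero_le)
  have "coeff (pderiv p1 * q) (2 * d - 2) = of_nat (d - 1) * c * coeff q d"
  proof -
    have "degree (pCons 0 (pderiv p1)) \<le> d - 1"
    proof (cases "pderiv p1 = 0")
      case False
      then have "degree p1 \<noteq> 0" by (simp add: pderiv_eq_0_iff)
      then show ?thesis using dp1 False by (simp add: degree_pderiv)
    qed simp
    from coeff_mult_top[OF this, of q d] dq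
    have "coeff (pCons 0 (pderiv p1) * q) (d - 1 + d) = coeff (pCons 0 (pderiv p1)) (d - 1) * coeff q d" by simp
    moreover have "coeff (pCons 0 (pderiv p1)) (d - 1) = of_nat (d - 1) * c"
    proof (cases "d - 1")
      case (Suc j)
      then show ?thesis by (simp add: coeff_pderiv c_def)
    qed simp
    moreover have "coeff (pCons 0 (pderiv p1) * q) (d - 1 + d) = coeff (pderiv p1 * q) (2 * d - 2)"
    proof -
      have "d - 1 + d = Suc (2 * d - 2)" using d1 by simp
      then show ?thesis by simp
    qed
    ultimately show ?thesis by simp
  qed
  moreover have "coeff (p1 * pderiv q) (2 * d - 2) = c * (of_nat d * coeff q d)"
  proof -
    have "degree (pderiv q) \<le> d - 1" using dq by (simp add: degree_pderiv)
    from coeff_mult_top[OF dp1 this]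
    have "coeff (p1 * pderiv q) (d - 1 + (d - 1)) = c * coeff (pderiv q) (d - 1)" by (simp add: c_def)
    moreover have "d - 1 + (d - 1) = 2 * d - 2" by simp
    moreover have "coeff (pderiv q) (d - 1) = of_nat d * coeff q d" using d1 by (simp add: coeff_pderiv)
    ultimately show ?thesis by simp
  qed
  ultimately have "coeff (wronskian p1 q) (2 * d - 2) = of_nat (d - 1) * c * coeff q d - c * (of_nat d * coeff q d)"
    by (simp add: wronskian_def)
  also have "\<dots> = - (c * coeff q d)" using d1 by (simp add: of_nat_diff algebra_simps)
  finally have "coeff (wronskian p q) (2 * d - 2) \<noteq> 0"
    using cq wronskian_shift[of p a q] by (simp add: p1_def)
  then show ?thesis by (rule le_degree)
qed

lemma critical_point_finite: "x \<in> critical_points f \<Longrightarrow> \<exists>c. x = Fin c \<and> poly (wronskian p q) c = 0"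
proof (cases x)
  case (Fin c)
  assume "x \<in> critical_points f"
  then show ?thesis using critical_Fin_iff[OF cop, of c] f Fin by auto
next
  case Infty
  assume "x \<in> critical_points f"
  then show ?thesis using f_inf_not_crit Infty unfolding critical_values_def by blast
qed

lemma fibre_finite: "f x \<in> critical_values f \<Longrightarrow> \<exists>c y. x = Fin c \<and> f x = Fin y \<and> poly q c \<noteq> 0 \<and> poly (p - smult y q) c = 0"
  using f_inf_not_crit inf_not_crit f by (cases x) (auto split: if_splits)

end

lemma degree_wronskian_le: "degree p \<le> d \<Longrightarrow> degree q \<le> d \<Longrightarrow> degree (wronskian p q) \<le> 2 * d"
  unfolding wronskian_def
  by (intro degree_diff_le order_trans[OF degree_mult_le])
    (auto simp: degree_pderiv)

text \<open>The situation that every sequence of rational maps converging to \<open>f\<close> reaches along a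
  subsequence. Here zeros of polynomials can be counted.\<close>

locale normal_sequence = normal_map +
  fixes g :: "nat \<Rightarrow> riemann_sphere \<Rightarrow> riemann_sphere" and P Q :: "nat \<Rightarrow> complex poly"
  assumes g: "\<And>n. g n = quotient_map (P n) (Q n)" and copn: "\<And>n. coprime (P n) (Q n)"
    and degP: "\<And>n. degree (P n) \<le> d" and degQ: "\<And>n. degree (Q n) \<le> d"
    and convP: "pconv P p" and convQ: "pconv Q q" and gf: "cconv g f"
begin

lemma critical_near:
  assumes "poly (wronskian p q) c = 0" "\<rho> > 0"
  shows "\<forall>\<^sub>F n in sequentially. \<exists>z. dist z c < \<rho> \<and> Fin z \<in> critical_points (g n)"
  using root_near[OF pconv_wronskian[OF convP convQ] degree_wronskian_le[OF degP degQ] wronskian0 assms]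
  by eventually_elim (use critical_Fin_iff[OF copn] g in auto)

text \<open>Let \<open>k\<close> be the order of \<open>F0 = p - y q\<close> at \<open>c\<close>. Near \<open>c\<close> there are \<open>k\<close> zeros of
  \<open>F n = P n - Y n Q n\<close> and \<open>k - 1\<close> zeros of the Wronskian, with multiplicity. Critical points of
  \<open>g n\<close> near \<open>c\<close> have values near \<open>y\<close> and hence the value \<open>Y n\<close>, so that these zeros of the Wronskian
  are zeros of \<open>F n\<close>. A zero of \<open>F n\<close> has order one more than as a zero of the Wronskian, so exactly
  one point carries all \<open>k\<close> zeros.\<close>

lemma fibre_point_persists:
  assumes c: "f (Fin c) = Fin y" and y: "Y \<longlonglongrightarrow> y"
    and \<eta>: "\<eta> > 0" "\<forall>\<^sub>F n in sequentially. \<forall>v\<in>critical_values (g n). dist v (Fin y) < \<eta> \<longrightarrow> v = Fin (Y n)"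
  shows "\<exists>C. C \<longlonglongrightarrow> c \<and>
    (\<forall>\<^sub>F n in sequentially. P n - smult (Y n) (Q n) \<noteq> 0 \<and>
       order (C n) (P n - smult (Y n) (Q n)) = order c (p - smult y q)) \<and>
    (\<forall>A. A \<longlonglongrightarrow> c \<longrightarrow> (\<forall>\<^sub>F n in sequentially. poly (P n - smult (Y n) (Q n)) (A n) = 0 \<longrightarrow> A n = C n))"
    "order c (wronskian p q) = order c (p - smult y q) - 1" "order c (p - smult y q) \<ge> 1"
    "p - smult y q \<noteq> 0"
proof -
  define F where "F n = P n - smult (Y n) (Q n)" for n
  define F0 where "F0 = p - smult y q"
  have qc: "poly q c \<noteq> 0" and F0c: "poly F0 c = 0"
    using c f by (auto simp: F0_def split: if_splits)
  have F00: "F0 \<noteq> 0"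
  proof
    assume "F0 = 0"
    then have "wronskian p q = 0" using wronskian_shift[of p y q] by (simp add: F0_def wronskian_def)
    then show False using wronskian0 by simp
  qed
  have W: "wronskian F0 q = wronskian p q" by (simp add: F0_def wronskian_shift)
  note ow = order_wronskian[OF F00 F0c qc, unfolded W]
  show "order c (wronskian p q) = order c (p - smult y q) - 1" "order c (p - smult y q) \<ge> 1"
    "p - smult y q \<noteq> 0"
    using ow F00 by (auto simp: F0_def)
  have convF: "pconv F F0" unfolding F_def[abs_def] F0_def
    by (intro pconv_diff pconv_smult convP convQ y)
  have degF: "degree (F n) \<le> d" for n unfolding F_def
    using degP[of n] degQ[of n] by (intro degree_diff_le order_trans[OF degree_smult_le])
  have "\<forall>\<^sub>F r in at_right (0::real). \<forall>z. dist z c \<le> r \<longrightarrow> poly (F0 * wronskian p q) z = 0 \<longrightarrow> z = c"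
  proof -
    let ?S = "{z. poly (F0 * wronskian p q) z = 0} - {c}"
    have "finite ?S" using F00 wronskian0 by (intro finite_Diff poly_roots_finite) auto
    then obtain e where e: "e > 0" "\<forall>z\<in>?S. z \<noteq> c \<longrightarrow> e \<le> dist c z"
      using finite_set_avoid[of ?S c] by blast
    show ?thesis
      using eventually_at_right_less[of 0] eventually_at_right_real[OF e(1)]
    proof eventually_elim
      case (elim r)
      then show ?case using e(2) by (force simp: dist_commute)
    qed
  qed
  moreover have "\<forall>\<^sub>F r in at_right (0::real). \<forall>z. dist z c \<le> r \<longrightarrow> dist (f (Fin z)) (Fin y) < \<eta> / 2"
  proof -
    have "((\<lambda>z. f (Fin z)) \<longlongrightarrow> f (Fin c)) (nhds c)"
      by (rule isCont_tendsto_compose[of _ f])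
       (use rat_continuous[OF rat_f] in \<open>auto simp: continuous_on_eq_continuous_at filterlim_ident\<close>)
    then have "\<forall>\<^sub>F z in nhds c. dist (f (Fin z)) (Fin y) < \<eta> / 2"
      using c \<eta>(1) tendstoD[of _ "Fin y" "nhds c" "\<eta> / 2"] by simp
    then obtain e where e: "e > 0" "\<And>z. dist z c < e \<Longrightarrow> dist (f (Fin z)) (Fin y) < \<eta> / 2"
      by (auto simp: eventually_nhds_metric)
    show ?thesis using eventually_at_right_real[OF e(1)] by eventually_elim (use e(2) in auto)
  qed
  moreover have "\<forall>\<^sub>F r in at_right (0::real). r > 0" by (rule eventually_at_right_less)
  ultimately have "\<forall>\<^sub>F r in at_right (0::real). r > 0 \<and>
    (\<forall>z. dist z c \<le> r \<longrightarrow> poly (F0 * wronskian p q) z = 0 \<longrightarrow> z = c) \<and>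
    (\<forall>z. dist z c \<le> r \<longrightarrow> dist (f (Fin z)) (Fin y) < \<eta> / 2)"
    by eventually_elim auto
  then obtain \<rho> where \<rho>: "\<rho> > 0" "\<And>z. dist z c \<le> \<rho> \<Longrightarrow> poly (F0 * wronskian p q) z = 0 \<Longrightarrow> z = c"
    "\<And>z. dist z c \<le> \<rho> \<Longrightarrow> dist (f (Fin z)) (Fin y) < \<eta> / 2"
    using eventually_happens[of _ "at_right (0::real)"] trivial_limit_at_right_real by blast
  define k where "k = order c F0"
  have evF: "\<forall>\<^sub>F n in sequentially. F n \<noteq> 0 \<and> root_count c \<rho> (F n) = k" unfolding k_def
    by (rule root_count_stable[OF convF degF F00 \<rho>(1)]) (use \<rho>(2) in auto)
  have evW: "\<forall>\<^sub>F n in sequentially. wronskian (P n) (Q n) \<noteq> 0 \<and> root_count c \<rho> (wronskian (P n) (Q n)) = k - 1"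
    unfolding k_def ow(1)[symmetric]
    by (rule root_count_stable[OF pconv_wronskian[OF convP convQ] degree_wronskian_le[OF degP degQ] wronskian0 \<rho>(1)])
      (use \<rho>(2) in auto)
  have evu: "\<forall>\<^sub>F n in sequentially. \<forall>x. dist (g n x) (f x) < \<eta> / 2"
    using cconv_uniform[OF gf, of "\<eta> / 2"] \<eta>(1) by linarith
  define E where "E n = {z. poly (F n) z = 0 \<and> dist z c < \<rho>}" for n
  have evE: "\<forall>\<^sub>F n in sequentially. F n \<noteq> 0 \<and> (\<exists>z. E n = {z} \<and> order z (F n) = k)"
    using evF evW evu \<eta>(2)
  proof eventually_elim
    case (elim n)
    have F: "F n \<noteq> 0" using elim by blast
    have finE: "finite (E n)" unfolding E_def using poly_roots_finite[OF F] by auto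
    have Wn: "wronskian (F n) (Q n) = wronskian (P n) (Q n)" by (simp add: F_def wronskian_shift)
    have ordE: "order e (F n) = Suc (order e (wronskian (P n) (Q n)))" if "e \<in> E n" for e
    proof -
      have "poly (Q n) e \<noteq> 0"
        using that coprime_no_common_root[OF copn[of n], of e] by (auto simp: E_def F_def)
      from order_wronskian[OF F _ this] that show ?thesis by (auto simp: E_def Wn)
    qed
    have sub: "{z. poly (wronskian (P n) (Q n)) z = 0 \<and> dist z c < \<rho>} \<subseteq> E n"
    proof
      fix z assume "z \<in> {z. poly (wronskian (P n) (Q n)) z = 0 \<and> dist z c < \<rho>}"
      then have z: "poly (wronskian (P n) (Q n)) z = 0" "dist z c < \<rho>" by auto
      then have "Fin z \<in> critical_points (g n)" using critical_Fin_iff[OF copn] g by simp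
      then have v: "g n (Fin z) \<in> critical_values (g n)" by (simp add: critical_values_def)
      have "dist (g n (Fin z)) (Fin y) < \<eta>"
        using dist_triangle[of "g n (Fin z)" "Fin y" "f (Fin z)"] elim(3) \<rho>(3)[of z] z(2)
        by (smt (verit) field_sum_of_halves)
      then have "g n (Fin z) = Fin (Y n)" using elim(4) v by blast
      then have "poly (F n) z = 0" unfolding g F_def by (auto simp: field_simps split: if_splits)
      then show "z \<in> E n" using z(2) by (simp add: E_def)
    qed
    have "k - 1 = (\<Sum>z | poly (wronskian (P n) (Q n)) z = 0 \<and> dist z c < \<rho>. order z (wronskian (P n) (Q n)))"
      using elim(2) root_count_sum by auto
    also have "\<dots> = (\<Sum>z\<in>E n. order z (wronskian (P n) (Q n)))"
    proof (rule sum.mono_neutral_left[OF finE sub])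
      show "\<forall>i\<in>E n - {z. poly (wronskian (P n) (Q n)) z = 0 \<and> dist z c < \<rho>}. order i (wronskian (P n) (Q n)) = 0"
        by (auto simp: E_def order_root)
    qed
    finally have 1: "k - 1 = (\<Sum>z\<in>E n. order z (wronskian (P n) (Q n)))" .
    have "k = (\<Sum>z\<in>E n. order z (F n))"
      using elim(1) root_count_sum[OF F, of c \<rho>] by (simp add: E_def)
    also have "\<dots> = (\<Sum>z\<in>E n. order z (wronskian (P n) (Q n)) + 1)"
      by (intro sum.cong) (use ordE in auto)
    also have "\<dots> = (k - 1) + card (E n)" unfolding sum.distrib 1 by simp
    finally have "card (E n) = 1" using ow(3) by (simp add: k_def)
    then obtain z where z: "E n = {z}" by (rule card_1_singletonE)
    then have "order z (F n) = k" using \<open>k = (\<Sum>z\<in>E n. order z (F n))\<close> by simp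
    then show ?case using z F by blast
  qed
  define C where "C n = (THE z. z \<in> E n)" for n
  have evC: "\<forall>\<^sub>F n in sequentially. F n \<noteq> 0 \<and> E n = {C n} \<and> order (C n) (F n) = k"
    using evE by eventually_elim (auto simp: C_def)
  have uniq: "\<forall>\<^sub>F n in sequentially. poly (F n) (A n) = 0 \<longrightarrow> A n = C n" if "A \<longlonglongrightarrow> c" for A
    using evC tendstoD[OF that \<rho>(1)]
  proof eventually_elim
    case (elim n)
    then show ?case by (auto simp: E_def)
  qed
  obtain A where A: "A \<longlonglongrightarrow> c" "\<forall>\<^sub>F n in sequentially. poly (F n) (A n) = 0"
    using root_sequence[OF convF degF F00 F0c] by blast
  have "\<forall>\<^sub>F n in sequentially. A n = C n" using A(2) uniq[OF A(1)] by eventually_elim auto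
  with A(1) have "C \<longlonglongrightarrow> c" by (rule Lim_transform_eventually)
  moreover have "\<forall>\<^sub>F n in sequentially. F n \<noteq> 0 \<and> order (C n) (F n) = k"
    using evC by eventually_elim auto
  ultimately show "\<exists>C. C \<longlonglongrightarrow> c \<and>
    (\<forall>\<^sub>F n in sequentially. P n - smult (Y n) (Q n) \<noteq> 0 \<and>
       order (C n) (P n - smult (Y n) (Q n)) = order c (p - smult y q)) \<and>
    (\<forall>A. A \<longlonglongrightarrow> c \<longrightarrow> (\<forall>\<^sub>F n in sequentially. poly (P n - smult (Y n) (Q n)) (A n) = 0 \<longrightarrow> A n = C n))"
    using uniq unfolding k_def F_def F0_def by blast
qed

end

lemma order_factor:
  assumes "F \<noteq> (0 :: complex poly)" "order c F = k"
  shows "\<exists>G. F = [:-c, 1:] ^ k * G \<and> degree G \<le> degree F \<and> poly G c \<noteq> 0"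
proof -
  obtain G where G: "F = [:-c, 1:] ^ k * G" "\<not> [:-c, 1:] dvd G"
    using order_decomp[OF assms(1), of c] assms(2) by auto
  have "G \<noteq> 0" using G assms(1) by auto
  then have "degree F = degree ([:-c, 1:] ^ k) + degree G" unfolding G(1)
    by (intro degree_mult_eq) auto
  then show ?thesis using G poly_eq_0_iff_dvd by (intro exI[of _ G]) auto
qed

text \<open>Write \<open>A n = (z - a n) ^ k * X n\<close> and \<open>B n = (z - b n) ^ k * Z n\<close>. Then \<open>A n * S n - Q n * B n\<close>
  is a multiple of \<open>(z - a n) ^ k\<close> plus \<open>(b n - a n) * E n\<close>, where \<open>E n\<close> converges to a polynomial
  \<open>e\<close> that vanishes at \<open>c\<close> to order exactly \<open>k - 1\<close>. The first summand contributes a zero of order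
  \<open>k\<close> to the limit, the second one of order \<open>k - 1\<close>, or nothing if \<open>a n = b n\<close>.\<close>

lemma limit_difference_order:
  fixes c :: complex
  assumes A: "pconv A F" "\<And>n. degree (A n) \<le> D" and B: "pconv B F" "\<And>n. degree (B n) \<le> D"
    and S: "pconv S q" "\<And>n. degree (S n) \<le> D" and Q: "pconv Q q" "\<And>n. degree (Q n) \<le> D"
    and ord: "\<forall>\<^sub>F n in sequentially. A n \<noteq> 0 \<and> order (a n) (A n) = k"
      "\<forall>\<^sub>F n in sequentially. B n \<noteq> 0 \<and> order (b n) (B n) = k"
    and ab: "a \<longlonglongrightarrow> c" "b \<longlonglongrightarrow> c" and F: "F \<noteq> 0" "order c F = k" "k \<ge> 1" and qc: "poly q c \<noteq> 0"
    and lim: "pconv (\<lambda>n. smult (l n) (A n * S n - Q n * B n)) G"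
  shows "[:-c, 1:] ^ (k - 1) dvd G"
    "(\<forall>\<^sub>F n in sequentially. a n = b n) \<Longrightarrow> [:-c, 1:] ^ k dvd G"
proof -
  have "\<exists>X. (A n \<noteq> 0 \<and> order (a n) (A n) = k \<longrightarrow> A n = [:-a n, 1:] ^ k * X) \<and> degree X \<le> D" for n
    using order_factor[of "A n" "a n" k] A(2)[of n] by (metis degree_0 le0 order_trans)
  then obtain X where X: "\<And>n. A n \<noteq> 0 \<and> order (a n) (A n) = k \<Longrightarrow> A n = [:-a n, 1:] ^ k * X n"
    "\<And>n. degree (X n) \<le> D" by metis
  have "\<exists>X. (B n \<noteq> 0 \<and> order (b n) (B n) = k \<longrightarrow> B n = [:-b n, 1:] ^ k * X) \<and> degree X \<le> D" for n
    using order_factor[of "B n" "b n" k] B(2)[of n] by (metis degree_0 le0 order_trans)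
  then obtain Z where Z: "\<And>n. B n \<noteq> 0 \<and> order (b n) (B n) = k \<Longrightarrow> B n = [:-b n, 1:] ^ k * Z n"
    "\<And>n. degree (Z n) \<le> D" by metis
  have evA: "\<forall>\<^sub>F n in sequentially. A n = [:-a n, 1:] ^ k * X n"
    using ord(1) by eventually_elim (rule X(1))
  have evB: "\<forall>\<^sub>F n in sequentially. B n = [:-b n, 1:] ^ k * Z n"
    using ord(2) by eventually_elim (rule Z(1))
  obtain x where x: "pconv X x" "F = [:-c, 1:] ^ k * x"
    using pconv_divide_power[OF A(1) ab(1) X(2) evA] by blast
  obtain z where z: "pconv Z z" "F = [:-c, 1:] ^ k * z"
    using pconv_divide_power[OF B(1) ab(2) Z(2) evB] by blast
  have zc: "poly z c \<noteq> 0"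
  proof
    assume "poly z c = 0"
    then obtain w where "z = [:-c, 1:] * w" by (metis dvdE poly_eq_0_iff_dvd)
    then have "F = [:-c, 1:] ^ Suc k * w" unfolding z(2) by (simp only: mult.assoc power_Suc2)
    then have "[:-c, 1:] ^ Suc k dvd F" by (simp only: dvd_triv_left)
    then show False using order_2[OF F(1), of c] unfolding F(2) by simp
  qed
  have dX: "degree (smult t (X n * S n - Z n * Q n)) \<le> 2 * D" for t n
    using X(2)[of n] Z(2)[of n] S(2)[of n] Q(2)[of n]
    by (intro order_trans[OF degree_smult_le] degree_diff_le order_trans[OF degree_mult_le]) auto
  define T where "T n = (\<Sum>i<k. [:-a n, 1:] ^ i * [:-b n, 1:] ^ (k - 1 - i))" for n
  define E where "E n = T n * (Z n * Q n)" for n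
  have diff: "[:-a n, 1:] ^ k - [:-b n, 1:] ^ k = smult (b n - a n) (T n)" for n
  proof -
    have "[:-a n, 1:] ^ k - [:-b n, 1:] ^ k = ([:-a n, 1:] - [:-b n, 1:]) * (\<Sum>i<k. [:-b n, 1:] ^ (k - Suc i) * [:-a n, 1:] ^ i)"
      by (rule power_diff_sumr2)
    also have "(\<Sum>i<k. [:-b n, 1:] ^ (k - Suc i) * [:-a n, 1:] ^ i) = T n"
      unfolding T_def by (intro sum.cong) (auto simp: mult.commute)
    also have "[:-a n, 1:] - [:-b n, 1:] = [:b n - a n:]" by simp
    finally show ?thesis by simp
  qed
  have "pconv T (\<Sum>i<k. [:-c, 1:] ^ i * [:-c, 1:] ^ (k - 1 - i))"
    unfolding T_def[abs_def] by (intro pconv_sum pconv_mult pconv_power pconv_linear ab)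
  also have "(\<Sum>i<k. [:-c, 1:] ^ i * [:-c, 1:] ^ (k - 1 - i)) = (\<Sum>i<k. [:-c, 1:] ^ (k - 1))"
    by (intro sum.cong) (auto simp flip: power_add)
  also have "\<dots> = smult (of_nat k) ([:-c, 1:] ^ (k - 1))"
    by (simp add: of_nat_poly)
  finally have convT: "pconv T (smult (of_nat k) ([:-c, 1:] ^ (k - 1)))" .
  define e where "e = smult (of_nat k) ([:-c, 1:] ^ (k - 1)) * (z * q)"
  have convE: "pconv E e" unfolding E_def[abs_def] e_def by (intro pconv_mult convT z(1) Q(1))
  have main: "\<forall>\<^sub>F n in sequentially. A n * S n - Q n * B n =
     [:-a n, 1:] ^ k * (X n * S n - Z n * Q n) + smult (b n - a n) (E n)"
    using evA evB
  proof eventually_elim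
    case (elim n)
    have "A n * S n - Q n * B n = [:-a n, 1:] ^ k * (X n * S n - Z n * Q n) + ([:-a n, 1:] ^ k - [:-b n, 1:] ^ k) * (Z n * Q n)"
      by (subst elim(1), subst elim(2)) (simp only: algebra_simps)
    then show ?case unfolding diff E_def by simp
  qed
  show "[:-c, 1:] ^ k dvd G" if eq: "\<forall>\<^sub>F n in sequentially. a n = b n"
  proof -
    have "\<forall>\<^sub>F n in sequentially. smult (l n) (A n * S n - Q n * B n) = [:-a n, 1:] ^ k * smult (l n) (X n * S n - Z n * Q n)"
      using main eq by eventually_elim (simp del: power_Suc)
    from pconv_divide_power[OF lim ab(1) dX this] show ?thesis by auto
  qed
  define m where "m n = l n * (b n - a n)" for n
  have main': "\<forall>\<^sub>F n in sequentially. smult (l n) (A n * S n - Q n * B n) - smult (m n) (E n) =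
     [:-a n, 1:] ^ k * smult (l n) (X n * S n - Z n * Q n)"
    using main
  proof eventually_elim
    case (elim n)
    show ?case unfolding elim m_def by (simp add: smult_add_right)
  qed
  have ek: "[:-c, 1:] ^ (k - 1) dvd e" unfolding e_def by (simp add: dvd_smult)
  show "[:-c, 1:] ^ (k - 1) dvd G"
  (* m n is the coefficient of the second summand after scaling. If it tended to infinity,
     dividing by it would show that e vanishes to order k. Otherwise it converges along a
     subsequence. *)
  proof (cases "filterlim (\<lambda>n. cmod (m n)) at_top sequentially")
    case True
    have inv: "(\<lambda>n. inverse (m n)) \<longlonglongrightarrow> 0"
      using True filterlim_at_infinity_conv_norm_at_top tendsto_inverse_0 filterlim_compose by blast
    have nz: "\<forall>\<^sub>F n in sequentially. m n \<noteq> 0"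
      using filterlim_at_top_dense[THEN iffD1, OF True, rule_format, of 0] by eventually_elim auto
    have c1: "pconv (\<lambda>n. smult (inverse (m n)) (smult (l n) (A n * S n - Q n * B n)) - E n) (smult 0 G - e)"
      by (intro pconv_diff pconv_smult lim inv convE)
    have e1: "\<forall>\<^sub>F n in sequentially. smult (inverse (m n)) (smult (l n) (A n * S n - Q n * B n)) - E n =
       [:-a n, 1:] ^ k * smult (inverse (m n) * l n) (X n * S n - Z n * Q n)"
      using main' nz
    proof eventually_elim
      case (elim n)
      have "smult (inverse (m n)) (smult (l n) (A n * S n - Q n * B n) - smult (m n) (E n)) =
        smult (inverse (m n)) (smult (l n) (A n * S n - Q n * B n)) - E n"
        using elim(2) by (simp add: smult_diff_right)
      then show ?case unfolding elim(1) by simp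
    qed
    obtain w where "smult 0 G - e = [:-c, 1:] ^ k * w"
      using pconv_divide_power[OF c1 ab(1) dX e1] by blast
    then have "[:-c, 1:] ^ k dvd e" by (metis diff_0 dvd_minus_iff dvd_triv_left smult_0_left)
    then obtain w where "e = [:-c, 1:] ^ k * w" by (rule dvdE)
    then have "[:-c, 1:] ^ (k - 1) * (smult (of_nat k) (z * q)) = [:-c, 1:] ^ (k - 1) * ([:-c, 1:] * w)"
      using F(3) unfolding e_def by (metis (no_types, lifting) mult.assoc mult_smult_left mult_smult_right power_minus_mult less_eq_Suc_le One_nat_def)
    moreover have "[:-c, 1:] ^ (k - 1) \<noteq> 0" by simp
    ultimately have "smult (of_nat k) (z * q) = [:-c, 1:] * w" using mult_left_cancel by blast
    then have "poly (smult (of_nat k) (z * q)) c = poly ([:-c, 1:] * w) c" by simp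
    then show ?thesis using zc qc F(3) by simp
  next
    case False
    then obtain K where "\<exists>\<^sub>F n in sequentially. cmod (m n) \<le> K"
      by (auto simp: filterlim_at_top_dense not_eventually not_less)
    then obtain r :: "nat \<Rightarrow> nat" where r: "strict_mono r" "\<And>n. cmod (m (r n)) \<le> K"
      by (rule frequently_subseq) blast
    have "bounded (range (\<lambda>n. m (r n)))" using r(2) by (auto intro: boundedI)
    then obtain M s where s: "strict_mono (s::nat\<Rightarrow>nat)" "((\<lambda>n. m (r n)) \<circ> s) \<longlonglongrightarrow> M"
      using bounded_imp_convergent_subsequence by blast
    define t where "t = r \<circ> s"
    have t: "strict_mono t" "(\<lambda>n. m (t n)) \<longlonglongrightarrow> M"
      using strict_mono_o[OF r(1) s(1)] s(2) by (auto simp: t_def o_def)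
    have c1: "pconv (\<lambda>n. smult (l (t n)) (A (t n) * S (t n) - Q (t n) * B (t n)) - smult (m (t n)) (E (t n))) (G - smult M e)"
      by (intro pconv_diff pconv_smult t(2) pconv_subseq[OF lim t(1)] pconv_subseq[OF convE t(1)])
    have a1: "(\<lambda>n. a (t n)) \<longlonglongrightarrow> c" using LIMSEQ_subseq_LIMSEQ[OF ab(1) t(1)] by (simp add: o_def)
    have e1: "\<forall>\<^sub>F n in sequentially. smult (l (t n)) (A (t n) * S (t n) - Q (t n) * B (t n)) - smult (m (t n)) (E (t n)) =
     [:-a (t n), 1:] ^ k * smult (l (t n)) (X (t n) * S (t n) - Z (t n) * Q (t n))"
      using eventually_subseq[OF t(1) main'] .
    obtain w where "G - smult M e = [:-c, 1:] ^ k * w"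
      using pconv_divide_power[OF c1 a1 dX e1] by blast
    then have G: "G = [:-c, 1:] ^ k * w + smult M e" by (metis diff_add_cancel)
    have "[:-c, 1:] ^ (k - 1) dvd [:-c, 1:] ^ k" by (rule le_imp_power_dvd) simp
    then show ?thesis unfolding G using ek by (simp add: dvd_smult dvd_mult2)
  qed
qed

text \<open>Sequences in \<open>S n\<close> converging to the different points of \<open>V\<close> are eventually distinct, so they
  account for all of \<open>S n\<close> by the count.\<close>

lemma close_points_unique:
  fixes V :: "'a::metric_space set" and S :: "nat \<Rightarrow> 'a set"
  assumes "finite V" "\<And>n. finite (S n)" "\<And>n. card (S n) = card V"
    and approx: "\<And>u. u \<in> V \<Longrightarrow> \<exists>s. s \<longlonglongrightarrow> u \<and> (\<forall>\<^sub>F n in sequentially. s n \<in> S n)"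
    and v: "v \<in> V" "s \<longlonglongrightarrow> v" "\<forall>\<^sub>F n in sequentially. s n \<in> S n"
  shows "\<exists>\<eta>>0. \<forall>\<^sub>F n in sequentially. \<forall>w\<in>S n. dist w v < \<eta> \<longrightarrow> w = s n"
proof -
  have "\<exists>s'. \<forall>u\<in>V. s' u \<longlonglongrightarrow> u \<and> (\<forall>\<^sub>F n in sequentially. s' u n \<in> S n)"
    by (rule bchoice) (use approx in blast)
  then obtain s' where s': "\<And>u. u \<in> V \<Longrightarrow> s' u \<longlonglongrightarrow> u \<and> (\<forall>\<^sub>F n in sequentially. s' u n \<in> S n)" by blast
  define t where "t u = (if u = v then s else s' u)" for u
  have t: "t u \<longlonglongrightarrow> u" "\<forall>\<^sub>F n in sequentially. t u n \<in> S n" if "u \<in> V" for u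
    using that s' v by (auto simp: t_def)
  obtain \<delta> where \<delta>: "\<delta> > 0" "\<And>u u'. u \<in> V \<Longrightarrow> u' \<in> V \<Longrightarrow> u \<noteq> u' \<Longrightarrow> \<delta> \<le> dist u u'"
    using finite_separated[OF assms(1)] by blast
  have "\<forall>\<^sub>F n in sequentially. \<forall>u\<in>V. t u n \<in> S n \<and> dist (t u n) u < \<delta> / 4"
  proof (rule eventually_ball_finite[OF assms(1)], rule ballI)
    fix u assume u: "u \<in> V"
    have "\<forall>\<^sub>F n in sequentially. dist (t u n) u < \<delta> / 4"
      by (rule tendstoD[OF t(1)[OF u]]) (use \<delta>(1) in simp)
    with t(2)[OF u] show "\<forall>\<^sub>F n in sequentially. t u n \<in> S n \<and> dist (t u n) u < \<delta> / 4"
      by (rule eventually_conj)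
  qed
  then have "\<forall>\<^sub>F n in sequentially. \<forall>w\<in>S n. dist w v < \<delta> / 2 \<longrightarrow> w = s n"
  proof eventually_elim
    case (elim n)
    have inj: "inj_on (\<lambda>u. t u n) V"
    proof (rule inj_onI, rule ccontr)
      fix u u' assume u: "u \<in> V" "u' \<in> V" "t u n = t u' n" "u \<noteq> u'"
      have "dist u u' \<le> dist (t u n) u + dist (t u' n) u'"
        using dist_triangle[of u u' "t u n"] u(3) by (simp add: dist_commute)
      then show False using elim[rule_format, OF u(1)] elim[rule_format, OF u(2)] \<delta>(2)[OF u(1,2,4)] \<delta>(1) by linarith
    qed
    have "(\<lambda>u. t u n) ` V \<subseteq> S n" using elim by auto
    then have S: "(\<lambda>u. t u n) ` V = S n"
      using card_subset_eq[OF assms(2)] card_image[OF inj] assms(3) by metis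
    show ?case
    proof (intro ballI impI)
      fix w assume w: "w \<in> S n" "dist w v < \<delta> / 2"
      then obtain u where u: "u \<in> V" "w = t u n" using S by blast
      have "dist u v \<le> dist w u + dist w v" using dist_triangle[of u v w] by (simp add: dist_commute)
      moreover have "dist w u < \<delta> / 4" using elim[rule_format, OF u(1)] u(2) by simp
      ultimately have "dist u v < \<delta>" using w(2) \<delta>(1) by linarith
      then have "u = v" using \<delta>(2)[OF u(1) v(1)] by fastforce
      then show "w = s n" using u(2) by (simp add: t_def)
    qed
  qed
  then show ?thesis using \<delta>(1) by (intro exI[of _ "\<delta> / 2"]) simp
qed

text \<open>Move infinity to a preimage of a finite point that is not a critical value.\<close>

lemma exists_normal_form:
  assumes "rat f" "Infty \<notin> critical_values f"
  shows "\<exists>M p q d. mobius M \<and> normal_map (f \<circ> M) p q d"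
proof -
  have "finite {a. Fin a \<in> critical_values f}"
    using finite_vimageI[OF finite_critical_values[OF assms(1)], of Fin] by (simp add: vimage_def inj_def)
  then obtain a where a: "Fin a \<notin> critical_values f" using infinite_UNIV_char_0 ex_new_if_finite by (metis mem_Collect_eq)
  obtain x where x: "f x = Fin a" using rat_surj[OF assms(1)] by blast
  obtain M where M: "mobius M" "M Infty = x"
  proof (cases x)
    case (Fin e)
    have "e * 0 - 1 * 1 \<noteq> (0::complex)" by simp
    then have "mobius (mob e 1 1 0)" unfolding mobius_def by blast
    then show ?thesis using that[of "mob e 1 1 0"] Fin by (simp add: mob_def)
  next
    case Infty
    have "mobius id" using mobius_inv(2)[OF mobius_recip] mobius_comp[OF mobius_recip mobius_inv(1)[OF mobius_recip]] by simp
    then show ?thesis using that[of id] Infty by simp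
  qed
  have rfM: "rat (f \<circ> M)" by (rule rat_comp[OF assms(1) mobius_rat[OF M(1)]])
  then obtain p q where pq: "coprime p q" "max (degree p) (degree q) \<ge> 1" "f \<circ> M = quotient_map p q" using ratE by metis
  define d where "d = max (degree p) (degree q)"
  have "quotient_map p q Infty = Fin a" using fun_cong[OF pq(3), of Infty] M(2) x by simp
  then have "coeff q d \<noteq> 0" by (auto simp: Let_def d_def split: if_splits)
  then have dq: "degree q = d" using le_degree[of q d] unfolding d_def by linarith
  have "normal_map (f \<circ> M) p q d"
  proof unfold_locales
    show "degree q = d" by (rule dq)
    show "f \<circ> M = quotient_map p q" "coprime p q" "1 \<le> d" using pq by (simp_all add: d_def)
    show "degree p \<le> d" by (simp add: d_def)
    show "Infty \<notin> critical_values (f \<circ> M)" "(f \<circ> M) Infty \<notin> critical_values (f \<circ> M)"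
      unfolding critical_points_mobius_comp(4)[OF M(1) assms(1)] using assms(2) a M(2) x by simp_all
  qed
  then show ?thesis using M(1) by blast
qed

lemma (in normal_map) subsequence_coefficients:
  assumes conv: "cconv g f" and rat: "\<And>n. rat (g n)"
  shows "\<exists>r P Q. strict_mono (r::nat\<Rightarrow>nat) \<and> normal_sequence f p q d (\<lambda>n. g (r n)) P Q"
proof -
  obtain r P Q where r: "strict_mono (r::nat\<Rightarrow>nat)" "\<And>n. coprime (P n) (Q n) \<and> g (r n) = quotient_map (P n) (Q n) \<and>
     degree (P n) \<le> d \<and> degree (Q n) \<le> d" "pconv P p" "pconv Q q"
    using coefficients_converge[OF conv rat] by blast
  have "normal_sequence f p q d (\<lambda>n. g (r n)) P Q"
    by unfold_locales (use r cconv_subseq[OF conv r(1)] in auto)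
  then show ?thesis using r(1) by blast
qed

lemma normal_sequence_subseq:
  assumes "normal_sequence f p q d g P Q" "strict_mono r"
  shows "normal_sequence f p q d (\<lambda>n. g (r n)) (\<lambda>n. P (r n)) (\<lambda>n. Q (r n))"
proof -
  interpret normal_sequence f p q d g P Q by fact
  show ?thesis
    by unfold_locales (use g copn degP degQ pconv_subseq[OF convP assms(2)] pconv_subseq[OF convQ assms(2)] cconv_subseq[OF gf assms(2)] in auto)
qed

text \<open>In normal form the critical points are the zeros of the Wronskian, which persist when the
  coefficients converge. Since the latter is known along subsequences only, the argument is by
  contradiction.\<close>

lemma critical_sequence:
  assumes "rat f" "Infty \<notin> critical_values f" "cconv g f" "\<And>n. rat (g n)" "x \<in> critical_points f"
  shows "\<exists>z. z \<longlonglongrightarrow> x \<and> (\<forall>\<^sub>F n in sequentially. z n \<in> critical_points (g n))"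
proof -
  obtain M p q d where M: "mobius M" "normal_map (f \<circ> M) p q d" using exists_normal_form[OF assms(1,2)] by blast
  interpret normal_map "f \<circ> M" p q d by fact
  have cM: "cconv (\<lambda>n. M) M" by (rule cconv_const[OF rat_continuous[OF mobius_rat[OF M(1)]]])
  have conv: "cconv (\<lambda>n. g n \<circ> M) (f \<circ> M)" by (rule cconv_comp[OF assms(3) cM])
  have rat: "rat (g n \<circ> M)" for n by (rule rat_comp[OF assms(4) mobius_rat[OF M(1)]])
  have "inv M x \<in> critical_points (f \<circ> M)"
    using critical_points_mobius_comp(2)[OF M(1) assms(1)] assms(5) mobius_inv_apply[OF M(1)] by simp
  then obtain c where c: "inv M x = Fin c" "poly (wronskian p q) c = 0" using critical_point_finite by blast
  have "\<exists>z. z \<longlonglongrightarrow> c \<and> (\<forall>\<^sub>F n in sequentially. Fin (z n) \<in> critical_points (g n \<circ> M))"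
  proof (rule sequence_choice, rule ccontr)
    fix e :: real assume e: "e > 0"
    assume "\<not> (\<forall>\<^sub>F n in sequentially. \<exists>z. dist z c < e \<and> Fin z \<in> critical_points (g n \<circ> M))"
    then have "\<exists>\<^sub>F n in sequentially. \<not> (\<exists>z. dist z c < e \<and> Fin z \<in> critical_points (g n \<circ> M))"
      by (simp add: not_eventually)
    then obtain r :: "nat \<Rightarrow> nat" where r: "strict_mono r" "\<And>n. \<not> (\<exists>z. dist z c < e \<and> Fin z \<in> critical_points (g (r n) \<circ> M))"
      by (rule frequently_subseq) blast
    obtain s P Q where s: "strict_mono (s::nat\<Rightarrow>nat)" "normal_sequence (f \<circ> M) p q d (\<lambda>n. g (r (s n)) \<circ> M) P Q"
      using subsequence_coefficients[OF cconv_subseq[OF conv r(1)] rat] by blast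
    interpret normal_sequence "f \<circ> M" p q d "\<lambda>n. g (r (s n)) \<circ> M" P Q by fact
    have "\<forall>\<^sub>F n in sequentially. False"
      using critical_near[OF c(2) e] by eventually_elim (use r(2) in blast)
    then show False by simp
  qed
  then obtain z where z: "z \<longlonglongrightarrow> c" "\<forall>\<^sub>F n in sequentially. Fin (z n) \<in> critical_points (g n \<circ> M)" by blast
  have "(\<lambda>n. M (Fin (z n))) \<longlonglongrightarrow> M (Fin c)" by (rule cconvD[OF cM tendsto_Fin[OF z(1)]])
  moreover have "M (Fin c) = x" using c(1) mobius_inv_apply(1)[OF M(1), of x] by simp
  moreover have "\<forall>\<^sub>F n in sequentially. M (Fin (z n)) \<in> critical_points (g n)"
    using z(2) by eventually_elim (use critical_points_mobius_comp(2)[OF M(1) assms(4)] in simp)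
  ultimately show ?thesis by (intro exI[of _ "\<lambda>n. M (Fin (z n))"]) simp
qed

lemma critical_value_sequence:
  assumes "rat f" "Infty \<notin> critical_values f" "cconv g f" "\<And>n. rat (g n)" "v \<in> critical_values f"
  shows "\<exists>s. s \<longlonglongrightarrow> v \<and> (\<forall>\<^sub>F n in sequentially. s n \<in> critical_values (g n))"
proof -
  obtain x where x: "x \<in> critical_points f" "v = f x" using assms(5) by (auto simp: critical_values_def)
  obtain z where z: "z \<longlonglongrightarrow> x" "\<forall>\<^sub>F n in sequentially. z n \<in> critical_points (g n)"
    using critical_sequence[OF assms(1-4) x(1)] by blast
  have "(\<lambda>n. g n (z n)) \<longlonglongrightarrow> v" using cconvD[OF assms(3) z(1)] x(2) by simp
  moreover have "\<forall>\<^sub>F n in sequentially. g n (z n) \<in> critical_values (g n)"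
    using z(2) by eventually_elim (simp add: critical_values_def)
  ultimately show ?thesis by blast
qed

lemma critical_value_unique:
  assumes "rat f" "Infty \<notin> critical_values f" "cconv g f" "\<And>n. rat (g n)"
    and "\<And>n. card (critical_values (g n)) = card (critical_values f)"
    and "v \<in> critical_values f" "s \<longlonglongrightarrow> v" "\<forall>\<^sub>F n in sequentially. s n \<in> critical_values (g n)"
  shows "\<exists>\<eta>>0. \<forall>\<^sub>F n in sequentially. \<forall>w\<in>critical_values (g n). dist w v < \<eta> \<longrightarrow> w = s n"
  by (rule close_points_unique[OF finite_critical_values[OF assms(1)] finite_critical_values[OF assms(4)] assms(5)
     critical_value_sequence[OF assms(1-4)] assms(6-8)])

lemma critical_value_coordinate:
  assumes "s \<longlonglongrightarrow> Fin y" "\<exists>\<eta>>0. \<forall>\<^sub>F n in sequentially. \<forall>w\<in>S n. dist w (Fin y) < \<eta> \<longrightarrow> w = s n"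
  shows "(\<lambda>n. fin_part (s n)) \<longlonglongrightarrow> y" "\<forall>\<^sub>F n in sequentially. s n = Fin (fin_part (s n))"
    "\<exists>\<eta>>0. \<forall>\<^sub>F n in sequentially. \<forall>w\<in>S n. dist w (Fin y) < \<eta> \<longrightarrow> w = Fin (fin_part (s n))"
proof -
  show "(\<lambda>n. fin_part (s n)) \<longlonglongrightarrow> y" and ev: "\<forall>\<^sub>F n in sequentially. s n = Fin (fin_part (s n))"
    using eventually_finite[OF assms(1)] by auto
  obtain \<eta> where \<eta>: "\<eta> > 0" "\<forall>\<^sub>F n in sequentially. \<forall>w\<in>S n. dist w (Fin y) < \<eta> \<longrightarrow> w = s n" using assms(2) by blast
  have "\<forall>\<^sub>F n in sequentially. \<forall>w\<in>S n. dist w (Fin y) < \<eta> \<longrightarrow> w = Fin (fin_part (s n))"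
    using \<eta>(2) ev by eventually_elim auto
  then show "\<exists>\<eta>>0. \<forall>\<^sub>F n in sequentially. \<forall>w\<in>S n. dist w (Fin y) < \<eta> \<longrightarrow> w = Fin (fin_part (s n))" using \<eta>(1) by blast
qed

text \<open>As the number of critical values is preserved, only one critical value of \<open>g n\<close> is near \<open>f x\<close>,
  and by \<open>fibre_point_persists\<close> its fibre has a single point near \<open>x\<close>.\<close>

lemma fibre_point_unique:
  assumes fr: "rat f" "Infty \<notin> critical_values f" and gr: "cconv g f" "\<And>n. rat (g n)"
    and card: "\<And>n. card (critical_values (g n)) = card (critical_values f)"
    and x: "f x \<in> critical_values f" and a: "a \<longlonglongrightarrow> x" and b: "b \<longlonglongrightarrow> x"
    and ab: "\<forall>\<^sub>F n in sequentially. g n (a n) = g n (b n) \<and> g n (a n) \<in> critical_values (g n)"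
  shows "\<forall>\<^sub>F n in sequentially. a n = b n"
proof (rule ccontr)
  assume "\<not> ?thesis"
  then have "\<exists>\<^sub>F n in sequentially. a n \<noteq> b n" by (simp add: not_eventually)
  then have "\<exists>\<^sub>F n in sequentially. a n \<noteq> b n \<and> g n (a n) = g n (b n) \<and> g n (a n) \<in> critical_values (g n)"
    using frequently_eventually_frequently[OF _ ab] by blast
  then obtain r :: "nat \<Rightarrow> nat" where r: "strict_mono r"
    "\<And>n. a (r n) \<noteq> b (r n) \<and> g (r n) (a (r n)) = g (r n) (b (r n)) \<and> g (r n) (a (r n)) \<in> critical_values (g (r n))"
    by (rule frequently_subseq) blast
  obtain M p q d where M: "mobius M" "normal_map (f \<circ> M) p q d" using exists_normal_form[OF fr] by blast
  interpret normal_map "f \<circ> M" p q d by fact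
  have cM: "cconv (\<lambda>n. M) M" by (rule cconv_const[OF rat_continuous[OF mobius_rat[OF M(1)]]])
  have cM': "cconv (\<lambda>n. inv M) (inv M)"
    by (rule cconv_const[OF rat_continuous[OF mobius_rat[OF mobius_inv(1)[OF M(1)]]]])
  have conv: "cconv (\<lambda>n. g n \<circ> M) (f \<circ> M)" by (rule cconv_comp[OF gr(1) cM])
  have rat: "rat (g n \<circ> M)" for n by (rule rat_comp[OF gr(2) mobius_rat[OF M(1)]])
  have VM: "critical_values (h \<circ> M) = critical_values h" if "rat h" for h
    using critical_points_mobius_comp(4)[OF M(1) that] .
  obtain s P Q where s: "strict_mono (s::nat\<Rightarrow>nat)" "normal_sequence (f \<circ> M) p q d (\<lambda>n. g (r (s n)) \<circ> M) P Q"
    using subsequence_coefficients[OF cconv_subseq[OF conv r(1)] rat] by blast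
  interpret S: normal_sequence "f \<circ> M" p q d "\<lambda>n. g (r (s n)) \<circ> M" P Q by fact
  define t where "t n = r (s n)" for n
  have t: "strict_mono t" unfolding t_def using r(1) s(1) by (simp add: strict_mono_def)
  note tn = r(2)[of "s n" for n, folded t_def]
  have gt: "cconv (\<lambda>n. g (t n)) f" by (rule cconv_subseq[OF gr(1) t])
  have "(f \<circ> M) (inv M x) \<in> critical_values (f \<circ> M)" using x VM[OF fr(1)] mobius_inv_apply[OF M(1)] by simp
  from fibre_finite[OF this] obtain c y where c: "inv M x = Fin c" "f x = Fin y"
    using mobius_inv_apply[OF M(1)] by auto
  have at: "(\<lambda>n. a (t n)) \<longlonglongrightarrow> x" and bt: "(\<lambda>n. b (t n)) \<longlonglongrightarrow> x"
    using LIMSEQ_subseq_LIMSEQ[OF a t] LIMSEQ_subseq_LIMSEQ[OF b t] by (simp_all add: o_def)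
  define v where "v n = g (t n) (a (t n))" for n
  have v: "v \<longlonglongrightarrow> Fin y" unfolding v_def using cconvD[OF gt at] c(2) by simp
  have vV: "\<forall>\<^sub>F n in sequentially. v n \<in> critical_values (g (t n))" unfolding v_def using tn by (intro always_eventually) blast
  have "Fin y \<in> critical_values f" using x c(2) by simp
  note Y = critical_value_coordinate[OF v critical_value_unique[OF fr gt gr(2) card this v vV]]
  obtain \<eta> where \<eta>: "\<eta> > 0" "\<forall>\<^sub>F n in sequentially. \<forall>w\<in>critical_values (g (t n) \<circ> M). dist w (Fin y) < \<eta> \<longrightarrow> w = Fin (fin_part (v n))"
    using Y(3) VM[OF gr(2)] by auto
  have fc: "(f \<circ> M) (Fin c) = Fin y" using c mobius_inv_apply(1)[OF M(1), of x] by simp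
  from S.fibre_point_persists(1)[OF fc Y(1) \<eta>[unfolded t_def]] obtain C where
    C: "\<And>A. A \<longlonglongrightarrow> c \<Longrightarrow> \<forall>\<^sub>F n in sequentially. poly (P n - smult (fin_part (v n)) (Q n)) (A n) = 0 \<longrightarrow> A n = C n"
    by blast
  have key: "\<forall>\<^sub>F n in sequentially. inv M (e (t n)) = Fin (C n)"
    if e: "(\<lambda>n. e (t n)) \<longlonglongrightarrow> x" "\<And>n. g (t n) (e (t n)) = v n" for e
  proof -
    have l: "(\<lambda>n. inv M (e (t n))) \<longlonglongrightarrow> Fin c" using cconvD[OF cM' e(1)] c(1) by simp
    note l2 = eventually_finite(2,3)[OF l]
    from C[OF l2(1)] l2(2) Y(2) show ?thesis
    proof eventually_elim
      case (elim n)
      define A where "A = fin_part (inv M (e (t n)))"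
      have "(g (r (s n)) \<circ> M) (Fin A) = Fin (fin_part (v n))"
        using e(2)[of n] elim(2,3) mobius_inv_apply(1)[OF M(1), of "e (t n)"] by (simp add: A_def t_def)
      then have "poly (P n - smult (fin_part (v n)) (Q n)) A = 0"
        unfolding S.g by (auto simp: field_simps split: if_splits)
      then show ?case using elim(1,2) by (simp add: A_def)
    qed
  qed
  have "\<forall>\<^sub>F n in sequentially. False"
    using key[OF at v_def[symmetric]] key[OF bt]
  proof (rule eventually_elim2)
    show "\<And>n. g (t n) (b (t n)) = v n" using tn by (simp add: v_def)
    fix n assume "inv M (a (t n)) = Fin (C n)" "inv M (b (t n)) = Fin (C n)"
    then have "a (t n) = b (t n)" using mobius_inv_apply(1)[OF M(1)] by metis
    then show False using tn by blast
  qed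
  then show False by simp
qed

lemma quotient_map_eq_of_cross:
  assumes "coprime p q" "coprime r s" "p * s - q * r = 0"
  shows "quotient_map p q = quotient_map r s"
proof (rule continuous_eq_off_finite[OF continuous_quotient_map[OF assms(1)] continuous_quotient_map[OF assms(2)] finite.emptyI])
  fix z
  have e: "poly p z * poly s z = poly q z * poly r z"
    using arg_cong[OF assms(3), of "\<lambda>u. poly u z"] by simp
  have c: "poly p z \<noteq> 0 \<or> poly q z \<noteq> 0" "poly r z \<noteq> 0 \<or> poly s z \<noteq> 0"
    using coprime_no_common_root assms(1,2) by blast+
  show "quotient_map p q (Fin z) = quotient_map r s (Fin z)"
    using e c by (auto simp: field_simps)
qed

text \<open>If \<open>g n = P / Q\<close> and \<open>h n = R / S\<close> were different, then the polynomials \<open>P * S - Q * R\<close>, suitably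
  scaled, would converge to some \<open>G \<noteq> 0\<close> of degree at most \<open>2 * d\<close>. By \<open>limit_difference_order\<close>
  every zero of the Wronskian is a zero of \<open>G\<close> of at least the same order, and the three shared
  critical points have order at least one more. In total this makes \<open>2 * d - 2 + 3\<close> zeros.\<close>

lemma (in normal_map) equal_of_shared_critical_points:
  assumes g: "cconv g f" "\<And>n. rat (g n)" and h: "cconv h f" "\<And>n. rat (h n)"
    and V: "\<And>n. critical_values (g n) = critical_values (h n)"
      "\<And>n. card (critical_values (g n)) = card (critical_values f)"
    and c: "\<And>i. i < 3 \<Longrightarrow> poly (wronskian p q) (c i) = 0" "inj_on c {..<3::nat}"
    and C: "\<And>i. i < 3 \<Longrightarrow> C i \<longlonglongrightarrow> c i"
      "\<And>i. i < 3 \<Longrightarrow> \<forall>\<^sub>F n in sequentially. Fin (C i n) \<in> critical_points (g n) \<and> Fin (C i n) \<in> critical_points (h n)"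
  shows "\<forall>\<^sub>F n in sequentially. g n = h n"
proof (rule ccontr)
  assume "\<not> ?thesis"
  then have "\<exists>\<^sub>F n in sequentially. g n \<noteq> h n" by (simp add: not_eventually)
  then obtain r0 :: "nat \<Rightarrow> nat" where r0: "strict_mono r0" "\<And>n. g (r0 n) \<noteq> h (r0 n)"
    by (rule frequently_subseq) blast
  obtain r1 P1 Q1 where r1: "strict_mono (r1::nat\<Rightarrow>nat)" "normal_sequence f p q d (\<lambda>n. g (r0 (r1 n))) P1 Q1"
    using subsequence_coefficients[OF cconv_subseq[OF g(1) r0(1)] g(2)] by blast
  obtain r2 R1 S1 where r2: "strict_mono (r2::nat\<Rightarrow>nat)" "normal_sequence f p q d (\<lambda>n. h (r0 (r1 (r2 n)))) R1 S1"
    using subsequence_coefficients[OF cconv_subseq[OF cconv_subseq[OF h(1) r0(1)] r1(1)] h(2)] by blast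
  define D1 where "D1 n = P1 (r2 n) * S1 n - Q1 (r2 n) * R1 n" for n
  interpret A: normal_sequence f p q d "\<lambda>n. g (r0 (r1 n))" P1 Q1 by fact
  interpret B: normal_sequence f p q d "\<lambda>n. h (r0 (r1 (r2 n)))" R1 S1 by fact
  have D0: "D1 n \<noteq> 0" for n
    using quotient_map_eq_of_cross[OF A.copn B.copn, of "r2 n" n] r0(2)[of "r1 (r2 n)"] A.g[of "r2 n"] B.g[of n]
    by (auto simp: D1_def)
  have dD: "degree (D1 n) \<le> 2 * d" for n unfolding D1_def
    using A.degP[of "r2 n"] A.degQ[of "r2 n"] B.degP[of n] B.degQ[of n]
    by (intro degree_diff_le order_trans[OF degree_mult_le]) auto
  obtain r3 l G where r3: "strict_mono (r3::nat\<Rightarrow>nat)" "G \<noteq> 0" "pconv (\<lambda>n. smult (l n) (D1 (r3 n))) G"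
    using normalized_limit[of D1, OF dD D0] by blast
  define t where "t n = r0 (r1 (r2 (r3 n)))" for n
  have t: "strict_mono t" using r0(1) r1(1) r2(1) r3(1) by (simp add: strict_mono_def t_def)
  define P where "P n = P1 (r2 (r3 n))" for n
  define Q where "Q n = Q1 (r2 (r3 n))" for n
  define R where "R n = R1 (r3 n)" for n
  define S where "S n = S1 (r3 n)" for n
  have nsA: "normal_sequence f p q d (\<lambda>n. g (t n)) P Q"
    using normal_sequence_subseq[OF normal_sequence_subseq[OF r1(2) r2(1)] r3(1)]
    unfolding t_def P_def[abs_def] Q_def[abs_def] .
  have nsB: "normal_sequence f p q d (\<lambda>n. h (t n)) R S"
    using normal_sequence_subseq[OF r2(2) r3(1)] unfolding t_def R_def[abs_def] S_def[abs_def] .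
  interpret A: normal_sequence f p q d "\<lambda>n. g (t n)" P Q by (rule nsA)
  interpret B: normal_sequence f p q d "\<lambda>n. h (t n)" R S by (rule nsB)
  have lim: "pconv (\<lambda>n. smult (l n) (P n * S n - Q n * R n)) G"
    using r3(3) by (simp add: D1_def P_def Q_def R_def S_def)
  have dG: "degree G \<le> 2 * d"
    by (rule pconv_degree[OF r3(3)]) (rule order_trans[OF degree_smult_le dD])
  have order_le: "order z (wronskian p q) + (if z \<in> c ` {..<3} then 1 else 0) \<le> order z G" for z
  proof (cases "poly (wronskian p q) z = 0")
    case False
    then have "z \<notin> c ` {..<3}" using c(1) by auto
    then show ?thesis using False by (simp add: order_root)
  next
    case True
    then have zc: "Fin z \<in> critical_points f" using critical_Fin_iff[OF cop] f by simp
    then have fz: "f (Fin z) \<in> critical_values f" by (simp add: critical_values_def)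
    from fibre_finite[OF this] obtain y where y: "f (Fin z) = Fin y" "poly q z \<noteq> 0" by auto
    then have yV: "Fin y \<in> critical_values f" using fz by simp
    obtain s where s: "s \<longlonglongrightarrow> Fin y" "\<forall>\<^sub>F n in sequentially. s n \<in> critical_values (g (t n))"
      using critical_value_sequence[OF rat_f inf_not_crit A.gf g(2) yV] by blast
    note Y = critical_value_coordinate[OF s(1) critical_value_unique[OF rat_f inf_not_crit A.gf g(2) V(2) yV s]]
    define Y where "Y n = fin_part (s n)" for n
    have Ylim: "Y \<longlonglongrightarrow> y" using Y(1) by (simp add: Y_def[abs_def])
    obtain \<eta> where \<eta>: "\<eta> > 0" "\<forall>\<^sub>F n in sequentially. \<forall>w\<in>critical_values (g (t n)). dist w (Fin y) < \<eta> \<longrightarrow> w = Fin (Y n)"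
      using Y(3) unfolding Y_def by blast
    have \<eta>': "\<forall>\<^sub>F n in sequentially. \<forall>w\<in>critical_values (h (t n)). dist w (Fin y) < \<eta> \<longrightarrow> w = Fin (Y n)"
      using \<eta>(2) V(1) by simp
    define k where "k = order z (p - smult y q)"
    note FA = A.fibre_point_persists[OF y(1) Ylim \<eta>]
    note FB = B.fibre_point_persists[OF y(1) Ylim \<eta>(1) \<eta>']
    obtain E where E: "E \<longlonglongrightarrow> z" "\<forall>\<^sub>F n in sequentially. P n - smult (Y n) (Q n) \<noteq> 0 \<and> order (E n) (P n - smult (Y n) (Q n)) = k"
      "\<And>A. A \<longlonglongrightarrow> z \<Longrightarrow> \<forall>\<^sub>F n in sequentially. poly (P n - smult (Y n) (Q n)) (A n) = 0 \<longrightarrow> A n = E n"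
      using FA(1) unfolding k_def by blast
    obtain E' where E': "E' \<longlonglongrightarrow> z" "\<forall>\<^sub>F n in sequentially. R n - smult (Y n) (S n) \<noteq> 0 \<and> order (E' n) (R n - smult (Y n) (S n)) = k"
      "\<And>A. A \<longlonglongrightarrow> z \<Longrightarrow> \<forall>\<^sub>F n in sequentially. poly (R n - smult (Y n) (S n)) (A n) = 0 \<longrightarrow> A n = E' n"
      using FB(1) unfolding k_def by blast
    have degA: "degree (P n - smult (Y n) (Q n)) \<le> d" "degree (R n - smult (Y n) (S n)) \<le> d" for n
      using A.degP[of n] A.degQ[of n] B.degP[of n] B.degQ[of n]
      by (intro degree_diff_le order_trans[OF degree_smult_le]; simp)+
    have id: "P n * S n - Q n * R n = (P n - smult (Y n) (Q n)) * S n - Q n * (R n - smult (Y n) (S n))" for n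
      by (simp add: algebra_simps)
    note LD = limit_difference_order[OF pconv_diff[OF A.convP pconv_smult[OF A.convQ Ylim]] degA(1)
      pconv_diff[OF B.convP pconv_smult[OF B.convQ Ylim]] degA(2) B.convQ B.degQ A.convQ A.degQ
      E(2) E'(2) E(1) E'(1) FA(4) k_def[symmetric] FA(3)[folded k_def] y(2) lim[unfolded id]]
    have ow: "order z (wronskian p q) = k - 1" using FA(2) by (simp add: k_def)
    have k1: "k \<ge> 1" using FA(3) by (simp add: k_def)
    show ?thesis
    proof (cases "z \<in> c ` {..<3}")
      case False
      then show ?thesis using order_divides[THEN iffD1, OF LD(1)] r3(2) ow by simp
    next
      case True
      then obtain i where i: "i < 3" "z = c i" by auto
      have Ci: "(\<lambda>n. C i (t n)) \<longlonglongrightarrow> z"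
        using LIMSEQ_subseq_LIMSEQ[OF C(1)[OF i(1)] t] i(2) by (simp add: o_def)
      have evC: "\<forall>\<^sub>F n in sequentially. Fin (C i (t n)) \<in> critical_points (g (t n)) \<and> Fin (C i (t n)) \<in> critical_points (h (t n))"
        using eventually_subseq[OF t C(2)[OF i(1)]] .
      have "(\<lambda>n. g (t n) (Fin (C i (t n)))) \<longlonglongrightarrow> Fin y" using cconvD[OF A.gf tendsto_Fin[OF Ci]] y(1) by simp
      then have d1: "\<forall>\<^sub>F n in sequentially. dist (g (t n) (Fin (C i (t n)))) (Fin y) < \<eta>" using \<eta>(1) by (rule tendstoD)
      have "(\<lambda>n. h (t n) (Fin (C i (t n)))) \<longlonglongrightarrow> Fin y" using cconvD[OF B.gf tendsto_Fin[OF Ci]] y(1) by simp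
      then have d2: "\<forall>\<^sub>F n in sequentially. dist (h (t n) (Fin (C i (t n)))) (Fin y) < \<eta>" using \<eta>(1) by (rule tendstoD)
      have "\<forall>\<^sub>F n in sequentially. E n = E' n"
        using E(3)[OF Ci] E'(3)[OF Ci] evC d1 d2 \<eta>(2) \<eta>'
      proof eventually_elim
        case (elim n)
        have "g (t n) (Fin (C i (t n))) \<in> critical_values (g (t n))" "h (t n) (Fin (C i (t n))) \<in> critical_values (h (t n))"
          using elim(3) by (auto simp: critical_values_def)
        then have "g (t n) (Fin (C i (t n))) = Fin (Y n)" "h (t n) (Fin (C i (t n))) = Fin (Y n)"
          using elim(4-7) by blast+
        then have "poly (P n - smult (Y n) (Q n)) (C i (t n)) = 0" "poly (R n - smult (Y n) (S n)) (C i (t n)) = 0"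
          unfolding A.g B.g by (auto simp: field_simps split: if_splits)
        then show ?case using elim(1,2) by simp
      qed
      from order_divides[THEN iffD1, OF LD(2)[OF this]] show ?thesis using r3(2) True ow k1 by simp
    qed
  qed
  have "proots (wronskian p q) + mset_set (c ` {..<3}) \<subseteq># proots G"
  proof (rule mset_subset_eqI)
    fix z
    show "count (proots (wronskian p q) + mset_set (c ` {..<3})) z \<le> count (proots G) z"
      using order_le[of z] wronskian0 r3(2) by (simp add: count_mset_set' split: if_splits)
  qed
  from size_mset_mono[OF this] have "degree (wronskian p q) + card (c ` {..<3}) \<le> degree G"
    by (simp add: size_proots_complex)
  moreover have "card (c ` {..<3}) = 3" using card_image[OF c(2)] by simp
  ultimately show False using degree_wronskian dG d1 by linarith
qed

text \<open>Three critical points of \<open>g n\<close> and three of \<open>h n\<close> converge to the same three critical points of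
  \<open>f\<close>. Matching them by Moebius transformations near the identity reduces the statement to
  \<open>equal_of_shared_critical_points\<close>.\<close>

theorem equal_up_to_mobius:
  assumes fr: "rat f" "Infty \<notin> critical_values f" "card (critical_values f) \<ge> 3"
    and gr: "cconv g f" "\<And>n. rat (g n)" and hr: "cconv h f" "\<And>n. rat (h n)"
    and V: "\<And>n. critical_values (g n) = critical_values (h n)"
      "\<And>n. card (critical_values (g n)) = card (critical_values f)"
  shows "\<exists>M. (\<forall>n. mobius (M n)) \<and> cconv M id \<and> (\<forall>\<^sub>F n in sequentially. g n = h n \<circ> M n)"
proof -
  obtain N p q d where N: "mobius N" "normal_map (f \<circ> N) p q d" using exists_normal_form[OF fr(1,2)] by blast
  interpret normal_map "f \<circ> N" p q d by fact
  have cN: "cconv (\<lambda>n. N) N" by (rule cconv_const[OF rat_continuous[OF mobius_rat[OF N(1)]]])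
  have cN': "cconv (\<lambda>n. inv N) (inv N)"
    by (rule cconv_const[OF rat_continuous[OF mobius_rat[OF mobius_inv(1)[OF N(1)]]]])
  have VN: "critical_values (h \<circ> N) = critical_values h" if "rat h" for h
    using critical_points_mobius_comp(4)[OF N(1) that] .
  have rN: "rat (h \<circ> N)" if "rat h" for h using that mobius_rat[OF N(1)] by (rule rat_comp)
  have gN: "cconv (\<lambda>n. g n \<circ> N) (f \<circ> N)" and hN: "cconv (\<lambda>n. h n \<circ> N) (f \<circ> N)"
    using cconv_comp[OF gr(1) cN] cconv_comp[OF hr(1) cN] by auto
  let ?Z = "{z. poly (wronskian p q) z = 0}"
  have finZ: "finite ?Z" using poly_roots_finite[OF wronskian0] .
  have critZ: "critical_points (f \<circ> N) = Fin ` ?Z"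
  proof (intro equalityI subsetI)
    fix x assume "x \<in> critical_points (f \<circ> N)"
    then show "x \<in> Fin ` ?Z" using critical_point_finite by blast
  next
    fix x assume "x \<in> Fin ` ?Z"
    then show "x \<in> critical_points (f \<circ> N)" using critical_Fin_iff[OF cop] f by auto
  qed
  have "card (critical_values (f \<circ> N)) \<le> card (critical_points (f \<circ> N))"
    unfolding critical_values_def by (rule card_image_le[OF finite_critical_points[OF rat_f]])
  also have "\<dots> \<le> card ?Z" unfolding critZ by (rule card_image_le[OF finZ])
  finally have "card ?Z \<ge> 3" using fr(3) VN[OF fr(1)] by simp
  then obtain T where T: "T \<subseteq> ?Z" "card T = 3" "finite T" using obtain_subset_with_card_n by metis
  obtain c where c: "bij_betw c {0..<3::nat} T" using ex_bij_betw_nat_finite[OF T(3)] T(2) by metis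
  have cW: "poly (wronskian p q) (c i) = 0" if "i < 3" for i
    using bij_betwE[OF c] that T(1) by force
  have cinj: "inj_on c {..<3}" using c by (simp add: bij_betw_def atLeast0LessThan)
  have cne: "c 0 \<noteq> c 1" "c 1 \<noteq> c 2" "c 2 \<noteq> c 0"
    using inj_onD[OF cinj, of 0 1] inj_onD[OF cinj, of 1 2] inj_onD[OF cinj, of 2 0] by auto
  have seq: "\<exists>A. \<forall>i. i < 3 \<longrightarrow> A i \<longlonglongrightarrow> c i \<and> (\<forall>\<^sub>F n in sequentially. Fin (A i n) \<in> critical_points (k n \<circ> N))"
    if k: "cconv (\<lambda>n. k n \<circ> N) (f \<circ> N)" "\<And>n. rat (k n)" for k
  proof -
    have "\<exists>A. A \<longlonglongrightarrow> c i \<and> (\<forall>\<^sub>F n in sequentially. Fin (A n) \<in> critical_points (k n \<circ> N))" if i: "i < 3" for i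
    proof -
      have "Fin (c i) \<in> critical_points (f \<circ> N)" using cW[OF i] critZ by auto
      from critical_sequence[OF rat_f inf_not_crit k(1) rN[OF k(2)] this] obtain z where
        z: "z \<longlonglongrightarrow> Fin (c i)" "\<forall>\<^sub>F n in sequentially. z n \<in> critical_points (k n \<circ> N)" by blast
      have "\<forall>\<^sub>F n in sequentially. Fin (fin_part (z n)) \<in> critical_points (k n \<circ> N)"
        using eventually_finite(3)[OF z(1)] z(2) by eventually_elim simp
      then show ?thesis using eventually_finite(2)[OF z(1)] by blast
    qed
    then show ?thesis by (intro choice) blast
  qed
  obtain A where A: "\<And>i. i < 3 \<Longrightarrow> A i \<longlonglongrightarrow> c i" "\<And>i. i < 3 \<Longrightarrow> \<forall>\<^sub>F n in sequentially. Fin (A i n) \<in> critical_points (g n \<circ> N)"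
    using seq[OF gN gr(2)] by blast
  obtain A' where A': "\<And>i. i < 3 \<Longrightarrow> A' i \<longlonglongrightarrow> c i" "\<And>i. i < 3 \<Longrightarrow> \<forall>\<^sub>F n in sequentially. Fin (A' i n) \<in> critical_points (h n \<circ> N)"
    using seq[OF hN hr(2)] by blast
  (* mob3 needs distinct points for every n, so the finitely many bad terms are replaced by the
     limits. *)
  have dist: "\<exists>B. (\<forall>n. B 0 n \<noteq> B 1 n \<and> B 1 n \<noteq> B 2 n \<and> B 2 n \<noteq> B 0 n) \<and>
     (\<forall>i. i < 3 \<longrightarrow> B i \<longlonglongrightarrow> c i \<and> (\<forall>\<^sub>F n in sequentially. B i n = A i n))"
    if A: "\<And>i. i < 3 \<Longrightarrow> A i \<longlonglongrightarrow> c i" for A :: "nat \<Rightarrow> nat \<Rightarrow> complex"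
  proof -
    define good where "good n \<longleftrightarrow> A 0 n \<noteq> A 1 n \<and> A 1 n \<noteq> A 2 n \<and> A 2 n \<noteq> A 0 n" for n
    have ne: "\<forall>\<^sub>F n in sequentially. A i n \<noteq> A j n" if "i < 3" "j < 3" "c i \<noteq> c j" for i j
    proof -
      have "(\<lambda>n. A i n - A j n) \<longlonglongrightarrow> c i - c j" by (intro tendsto_diff A that)
      then have "\<forall>\<^sub>F n in sequentially. A i n - A j n \<noteq> 0" by (rule tendsto_imp_eventually_ne) (use that in simp)
      then show ?thesis by eventually_elim simp
    qed
    have ev: "\<forall>\<^sub>F n in sequentially. good n" unfolding good_def
      by (intro eventually_conj ne) (use cne in auto)
    define B where "B i n = (if good n then A i n else c i)" for i n
    have "\<forall>n. B 0 n \<noteq> B 1 n \<and> B 1 n \<noteq> B 2 n \<and> B 2 n \<noteq> B 0 n" using cne by (auto simp: B_def good_def)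
    moreover have evB: "\<forall>\<^sub>F n in sequentially. B i n = A i n" for i using ev by eventually_elim (simp add: B_def)
    moreover have "B i \<longlonglongrightarrow> c i" if "i < 3" for i
      by (rule Lim_transform_eventually[OF A[OF that]]) (use evB[of i] in eventually_elim, simp)
    ultimately show ?thesis by blast
  qed
  obtain B where B: "\<And>n. B 0 n \<noteq> B 1 n" "\<And>n. B 1 n \<noteq> B 2 n" "\<And>n. B 2 n \<noteq> B 0 n"
    "\<And>i. i < 3 \<Longrightarrow> B i \<longlonglongrightarrow> c i" "\<And>i. i < 3 \<Longrightarrow> \<forall>\<^sub>F n in sequentially. B i n = A i n" using dist[OF A(1)] by blast
  obtain B' where B': "\<And>n. B' 0 n \<noteq> B' 1 n" "\<And>n. B' 1 n \<noteq> B' 2 n" "\<And>n. B' 2 n \<noteq> B' 0 n"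
    "\<And>i. i < 3 \<Longrightarrow> B' i \<longlonglongrightarrow> c i" "\<And>i. i < 3 \<Longrightarrow> \<forall>\<^sub>F n in sequentially. B' i n = A' i n" using dist[OF A'(1)] by blast
  define \<alpha> where "\<alpha> n = mob3 (B 0 n) (B 1 n) (B 2 n)" for n
  define \<alpha>' where "\<alpha>' n = mob3 (B' 0 n) (B' 1 n) (B' 2 n)" for n
  note m = mob3[OF B(1-3), folded \<alpha>_def] and m' = mob3[OF B'(1-3), folded \<alpha>'_def]
  have mc: "mobius (mob3 (c 0) (c 1) (c 2))" using mob3(1)[OF cne] .
  define K where "K n = \<alpha>' n \<circ> inv (\<alpha> n)" for n
  have mK: "mobius (K n)" for n unfolding K_def by (intro mobius_comp mobius_inv(1) m m')
  have "cconv K (mob3 (c 0) (c 1) (c 2) \<circ> inv (mob3 (c 0) (c 1) (c 2)))"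
    unfolding K_def[abs_def] \<alpha>_def \<alpha>'_def
    by (intro cconv_comp mob3_cconv B B' cne) auto
  then have cK: "cconv K id" using mobius_inv(2)[OF mc] by simp
  have KB: "K n (Fin (B i n)) = Fin (B' i n)" if "i < 3" for i n
  proof -
    have "inv (\<alpha> n) (\<alpha> n x) = x" for x using mobius_inv_apply(2)[OF m(1)] .
    then have "inv (\<alpha> n) (Fin (B 0 n)) = Fin 0" "inv (\<alpha> n) (Fin (B 1 n)) = Infty" "inv (\<alpha> n) (Fin (B 2 n)) = Fin 1"
      using m(2-4) by metis+
    moreover have "i = 0 \<or> i = 1 \<or> i = 2" using that by auto
    ultimately show ?thesis using m'(2-4) by (auto simp: K_def)
  qed
  have hK: "cconv (\<lambda>n. h n \<circ> N \<circ> K n) (f \<circ> N)" using cconv_comp[OF hN cK] by simp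
  have "\<forall>\<^sub>F n in sequentially. g n \<circ> N = h n \<circ> N \<circ> K n"
  proof (rule equal_of_shared_critical_points[OF gN rN[OF gr(2)] hK])
    show "rat (h n \<circ> N \<circ> K n)" for n by (rule rat_comp[OF rN[OF hr(2)] mobius_rat[OF mK]])
    show "critical_values (g n \<circ> N) = critical_values (h n \<circ> N \<circ> K n)" for n
      using critical_points_mobius_comp(4)[OF mK rN[OF hr(2)]] VN[OF gr(2)] VN[OF hr(2)] V(1) by simp
    show "card (critical_values (g n \<circ> N)) = card (critical_values (f \<circ> N))" for n
      using VN[OF gr(2)] VN[OF fr(1)] V(2) by simp
    show "poly (wronskian p q) (c i) = 0" if "i < 3" for i by (rule cW[OF that])
    show "inj_on c {..<3}" by (rule cinj)
    show "B i \<longlonglongrightarrow> c i" if "i < 3" for i by (rule B(4)[OF that])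
    show "\<forall>\<^sub>F n in sequentially. Fin (B i n) \<in> critical_points (g n \<circ> N) \<and> Fin (B i n) \<in> critical_points (h n \<circ> N \<circ> K n)" if i: "i < 3" for i
      using B(5)[OF i] B'(5)[OF i] A(2)[OF i] A'(2)[OF i]
    proof eventually_elim
      case (elim n)
      then show ?case using critical_points_mobius_comp(2)[OF mK rN[OF hr(2)], of n n] KB[OF i, of n] by simp
    qed
  qed
  then have "\<forall>\<^sub>F n in sequentially. g n = h n \<circ> (N \<circ> K n \<circ> inv N)"
  proof eventually_elim
    case (elim n)
    then have "g n \<circ> (N \<circ> inv N) = h n \<circ> (N \<circ> K n \<circ> inv N)" by (metis comp_assoc)
    then show ?case using mobius_inv(2)[OF N(1)] by simp
  qed
  moreover have "mobius (N \<circ> K n \<circ> inv N)" for n by (intro mobius_comp mobius_inv(1) N(1) mK)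
  moreover have "cconv (\<lambda>n. N \<circ> K n \<circ> inv N) (N \<circ> id \<circ> inv N)" by (intro cconv_comp cN cN' cK)
  ultimately show ?thesis using mobius_inv(2)[OF N(1)] by (intro exI[of _ "\<lambda>n. N \<circ> K n \<circ> inv N"]) simp
qed

section \<open>Holomorphic functions of tuples\<close>

text \<open>A tuple of length \<open>N\<close> is a function of which only the first \<open>N\<close> entries matter, so that
  dimensions are numbers that can be computed with. This predicate describes an open polydisc.\<close>

definition tnear :: "nat \<Rightarrow> (nat \<Rightarrow> complex) \<Rightarrow> real \<Rightarrow> (nat \<Rightarrow> complex) \<Rightarrow> bool" where
  "tnear N u \<delta> y \<longleftrightarrow> (\<forall>i<N. cmod (y i - u i) < \<delta>)"

definition tfilter :: "nat \<Rightarrow> (nat \<Rightarrow> complex) \<Rightarrow> (nat \<Rightarrow> complex) filter" where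
  "tfilter N u = (INF \<delta>\<in>{0<..}. principal {y. tnear N u \<delta> y})"

lemma eventually_tfilter: "eventually P (tfilter N u) \<longleftrightarrow> (\<exists>\<delta>>0. \<forall>y. tnear N u \<delta> y \<longrightarrow> P y)"
proof -
  have "eventually P (tfilter N u) \<longleftrightarrow> (\<exists>\<delta>\<in>{0<..}. eventually P (principal {y. tnear N u \<delta> y}))"
    unfolding tfilter_def
  proof (rule eventually_INF_base)
    fix a b :: real assume "a \<in> {0<..}" "b \<in> {0<..}"
    then show "\<exists>x\<in>{0<..}. principal {y. tnear N u x y} \<le> inf (principal {y. tnear N u a y}) (principal {y. tnear N u b y})"
      by (intro bexI[of _ "min a b"]) (auto simp: tnear_def)
  qed auto
  then show ?thesis by (simp add: eventually_principal) blast
qed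

lemma tnear_refl: "\<delta> > 0 \<Longrightarrow> tnear N u \<delta> u"
  by (simp add: tnear_def)

lemma tnear_mono: "tnear N u \<delta> y \<Longrightarrow> \<delta> \<le> \<epsilon> \<Longrightarrow> tnear N u \<epsilon> y"
  by (auto simp: tnear_def)

lemma tendsto_tfilter_proj: "i < N \<Longrightarrow> ((\<lambda>y. y i) \<longlongrightarrow> u i) (tfilter N u)"
  unfolding tendsto_iff eventually_tfilter by (auto simp: tnear_def dist_norm)

lemma filterlim_tfilter:
  assumes "\<And>i. i < N \<Longrightarrow> ((\<lambda>x. X x i) \<longlongrightarrow> v i) F"
  shows "filterlim X (tfilter N v) F"
  unfolding filterlim_iff
proof (intro allI impI)
  fix P assume "eventually P (tfilter N v)"
  then obtain \<delta> where \<delta>: "\<delta> > 0" "\<And>y. tnear N v \<delta> y \<Longrightarrow> P y" by (auto simp: eventually_tfilter)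
  have "\<forall>\<^sub>F x in F. \<forall>i\<in>{..<N}. cmod (X x i - v i) < \<delta>"
  proof (rule eventually_ball_finite, simp, rule ballI)
    fix i assume "i \<in> {..<N}"
    then show "\<forall>\<^sub>F x in F. cmod (X x i - v i) < \<delta>"
      using tendstoD[OF assms \<delta>(1), of i] by (simp add: dist_norm)
  qed
  then show "\<forall>\<^sub>F x in F. P (X x)" by eventually_elim (use \<delta>(2) in \<open>simp add: tnear_def\<close>)
qed

text \<open>Holomorphy in several variables is tested along holomorphic curves. This makes it stable under
  composition by definition, and all estimates only involve functions of one variable.\<close>

definition thol_on :: "nat \<Rightarrow> (nat \<Rightarrow> complex) \<Rightarrow> real \<Rightarrow> ((nat \<Rightarrow> complex) \<Rightarrow> complex) \<Rightarrow> bool" where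
  "thol_on N u \<delta> w \<longleftrightarrow> (\<forall>\<gamma> S. open S \<longrightarrow> (\<forall>i<N. (\<lambda>t. \<gamma> t i) holomorphic_on S) \<longrightarrow>
     (\<forall>t\<in>S. tnear N u \<delta> (\<gamma> t)) \<longrightarrow> (\<lambda>t. w (\<gamma> t)) holomorphic_on S)"

text \<open>Continuity at the base point keeps compositions inside the domain of the outer function.\<close>

definition tgerm :: "nat \<Rightarrow> (nat \<Rightarrow> complex) \<Rightarrow> ((nat \<Rightarrow> complex) \<Rightarrow> complex) \<Rightarrow> bool" where
  "tgerm N u w \<longleftrightarrow> (w \<longlongrightarrow> w u) (tfilter N u) \<and> (\<exists>\<delta>>0. thol_on N u \<delta> w)"

lemma thol_onD: "thol_on N u \<delta> w \<Longrightarrow> open S \<Longrightarrow> (\<And>i. i < N \<Longrightarrow> (\<lambda>t. \<gamma> t i) holomorphic_on S) \<Longrightarrow>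
  (\<And>t. t \<in> S \<Longrightarrow> tnear N u \<delta> (\<gamma> t)) \<Longrightarrow> (\<lambda>t. w (\<gamma> t)) holomorphic_on S"
  unfolding thol_on_def by blast

lemma thol_on_mono: "thol_on N u \<delta> w \<Longrightarrow> \<epsilon> \<le> \<delta> \<Longrightarrow> thol_on N u \<epsilon> w"
  unfolding thol_on_def by (meson tnear_mono)

lemma tgerm_const: "tgerm N u (\<lambda>y. c)"
  unfolding tgerm_def thol_on_def by (auto intro!: exI[of _ 1] holomorphic_intros)

lemma tgerm_proj: "i < N \<Longrightarrow> tgerm N u (\<lambda>y. y i)"
  unfolding tgerm_def thol_on_def by (auto intro!: exI[of _ 1] tendsto_tfilter_proj)

lemma tgerm_comp:
  assumes "h holomorphic_on T" "open T" "w u \<in> T" "tgerm N u w"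
  shows "tgerm N u (\<lambda>y. h (w y))"
proof -
  obtain \<delta> where \<delta>: "\<delta> > 0" "thol_on N u \<delta> w" using assms(4) by (auto simp: tgerm_def)
  have lim: "(w \<longlongrightarrow> w u) (tfilter N u)" using assms(4) by (simp add: tgerm_def)
  have "\<forall>\<^sub>F y in tfilter N u. w y \<in> T" using lim assms(2,3) by (rule topological_tendstoD)
  then obtain \<delta>' where \<delta>': "\<delta>' > 0" "\<And>y. tnear N u \<delta>' y \<Longrightarrow> w y \<in> T" by (auto simp: eventually_tfilter)
  have "isCont h (w u)"
    using holomorphic_on_imp_continuous_on[OF assms(1)] assms(2,3) continuous_on_eq_continuous_at by blast
  then have "((\<lambda>y. h (w y)) \<longlongrightarrow> h (w u)) (tfilter N u)" by (rule isCont_tendsto_compose[OF _ lim])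
  moreover have "thol_on N u (min \<delta> \<delta>') (\<lambda>y. h (w y))"
    unfolding thol_on_def
  proof (intro allI impI)
    fix \<gamma> S assume a: "open S" "\<forall>i<N. (\<lambda>t. \<gamma> t i) holomorphic_on S" "\<forall>t\<in>S. tnear N u (min \<delta> \<delta>') (\<gamma> t)"
    have "(\<lambda>t. w (\<gamma> t)) holomorphic_on S"
      by (rule thol_onD[OF \<delta>(2) a(1)]) (use a tnear_mono in \<open>auto dest: bspec\<close>)
    moreover have "w (\<gamma> t) \<in> T" if "t \<in> S" for t using a(3) that \<delta>'(2) tnear_mono[of N u "min \<delta> \<delta>'" "\<gamma> t" \<delta>'] by auto
    ultimately show "(\<lambda>t. h (w (\<gamma> t))) holomorphic_on S"
      using holomorphic_on_compose_gen[OF _ assms(1), of "\<lambda>t. w (\<gamma> t)" S] by (auto simp: o_def)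
  qed
  ultimately show ?thesis using \<delta>(1) \<delta>'(1) unfolding tgerm_def by (intro conjI exI[of _ "min \<delta> \<delta>'"]) auto
qed

lemma tgerm_binop:
  assumes "tgerm N u v" "tgerm N u w"
  shows "tgerm N u (\<lambda>y. v y + w y)" "tgerm N u (\<lambda>y. v y - w y)" "tgerm N u (\<lambda>y. v y * w y)"
proof -
  obtain \<delta> \<delta>' where \<delta>: "\<delta> > 0" "thol_on N u \<delta> v" "\<delta>' > 0" "thol_on N u \<delta>' w" using assms by (auto simp: tgerm_def)
  have lim: "(v \<longlongrightarrow> v u) (tfilter N u)" "(w \<longlongrightarrow> w u) (tfilter N u)" using assms by (auto simp: tgerm_def)
  have h: "thol_on N u (min \<delta> \<delta>') v" "thol_on N u (min \<delta> \<delta>') w" using thol_on_mono[OF \<delta>(2)] thol_on_mono[OF \<delta>(4)] by auto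
  have m: "min \<delta> \<delta>' > 0" using \<delta> by simp
  have "thol_on N u (min \<delta> \<delta>') (\<lambda>y. v y + w y)" "thol_on N u (min \<delta> \<delta>') (\<lambda>y. v y - w y)"
    "thol_on N u (min \<delta> \<delta>') (\<lambda>y. v y * w y)"
    using h unfolding thol_on_def by (auto intro!: holomorphic_intros)
  then show "tgerm N u (\<lambda>y. v y + w y)" "tgerm N u (\<lambda>y. v y - w y)" "tgerm N u (\<lambda>y. v y * w y)"
    unfolding tgerm_def using m tendsto_add[OF lim] tendsto_diff[OF lim] tendsto_mult[OF lim] by blast+
qed

lemma tgerm_inverse: "tgerm N u w \<Longrightarrow> w u \<noteq> 0 \<Longrightarrow> tgerm N u (\<lambda>y. inverse (w y))"
  by (rule tgerm_comp[where T = "- {0}"]) (auto intro!: holomorphic_intros)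

lemma tgerm_divide: "tgerm N u v \<Longrightarrow> tgerm N u w \<Longrightarrow> w u \<noteq> 0 \<Longrightarrow> tgerm N u (\<lambda>y. v y / w y)"
  unfolding divide_inverse by (intro tgerm_binop tgerm_inverse)

lemma thol_common:
  fixes n :: nat
  assumes "\<And>i. i < n \<Longrightarrow> tgerm N u (w i)"
  shows "\<exists>\<delta>>0. \<forall>i<n. thol_on N u \<delta> (w i)"
  using assms
proof (induction n)
  case 0 then show ?case by (intro exI[of _ 1]) simp
next
  case (Suc m)
  then obtain a where a: "a > 0" "\<forall>i<m. thol_on N u a (w i)" by auto
  obtain b where b: "b > 0" "thol_on N u b (w m)" using Suc.prems[of m] by (auto simp: tgerm_def)
  have "thol_on N u (min a b) (w i)" if "i < Suc m" for i
    using a(2) b(2) that thol_on_mono[of N u a _ "min a b"] thol_on_mono[of N u b _ "min a b"] by (cases "i = m") auto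
  then show ?case using a(1) b(1) by (intro exI[of _ "min a b"]) auto
qed

lemma tgerm_tuple_comp:
  assumes "tgerm n (X u) w" "\<And>i. i < n \<Longrightarrow> tgerm N u (\<lambda>y. X y i)"
  shows "tgerm N u (\<lambda>y. w (X y))" "filterlim X (tfilter n (X u)) (tfilter N u)"
proof -
  show fl: "filterlim X (tfilter n (X u)) (tfilter N u)"
    by (rule filterlim_tfilter) (use assms(2) in \<open>simp add: tgerm_def\<close>)
  have "(w \<longlongrightarrow> w (X u)) (tfilter n (X u))" using assms(1) by (simp add: tgerm_def)
  then have 1: "((\<lambda>y. w (X y)) \<longlongrightarrow> w (X u)) (tfilter N u)" by (rule filterlim_compose[OF _ fl])
  obtain \<delta> where \<delta>: "\<delta> > 0" "thol_on n (X u) \<delta> w" using assms(1) by (auto simp: tgerm_def)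
  have "\<forall>\<^sub>F x in tfilter n (X u). tnear n (X u) \<delta> x" unfolding eventually_tfilter using \<delta>(1) by blast
  then have "\<forall>\<^sub>F y in tfilter N u. tnear n (X u) \<delta> (X y)" using fl by (simp add: filterlim_iff)
  then obtain \<delta>1 where \<delta>1: "\<delta>1 > 0" "\<And>y. tnear N u \<delta>1 y \<Longrightarrow> tnear n (X u) \<delta> (X y)" by (auto simp: eventually_tfilter)
  have "\<exists>\<delta>2>0. \<forall>i<n. thol_on N u \<delta>2 (\<lambda>y. X y i)" by (rule thol_common) (rule assms(2))
  then obtain \<delta>2 where \<delta>2: "\<delta>2 > 0" "\<And>i. i < n \<Longrightarrow> thol_on N u \<delta>2 (\<lambda>y. X y i)" by auto
  have "thol_on N u (min \<delta>1 \<delta>2) (\<lambda>y. w (X y))"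
    unfolding thol_on_def
  proof (intro allI impI)
    fix \<gamma> S assume a: "open S" "\<forall>i<N. (\<lambda>t. \<gamma> t i) holomorphic_on S" "\<forall>t\<in>S. tnear N u (min \<delta>1 \<delta>2) (\<gamma> t)"
    show "(\<lambda>t. w (X (\<gamma> t))) holomorphic_on S"
    proof (rule thol_onD[OF \<delta>(2) a(1)])
      show "(\<lambda>t. X (\<gamma> t) i) holomorphic_on S" if "i < n" for i
        by (rule thol_onD[OF \<delta>2(2)[OF that] a(1)]) (use a tnear_mono in \<open>auto dest: bspec\<close>)
      show "tnear n (X u) \<delta> (X (\<gamma> t))" if "t \<in> S" for t
        using \<delta>1(2) a(3) that tnear_mono[of N u "min \<delta>1 \<delta>2" "\<gamma> t" \<delta>1] by auto
    qed
  qed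
  then show "tgerm N u (\<lambda>y. w (X y))" using 1 \<delta>1(1) \<delta>2(1) unfolding tgerm_def by (intro conjI exI[of _ "min \<delta>1 \<delta>2"]) auto
qed

text \<open>Cauchy's inequality on discs of radius \<open>R / 3\<close> about the points of the unit disc bounds the
  derivative there.\<close>

lemma bounded_holomorphic_difference:
  assumes "\<phi> holomorphic_on ball 0 R" "\<And>t. t \<in> ball 0 R \<Longrightarrow> cmod (\<phi> t) \<le> B" "R \<ge> 2"
  shows "cmod (\<phi> 1 - \<phi> 0) \<le> 3 * B / R"
proof -
  have "cmod (\<phi> 1 - \<phi> 0) \<le> 3 * B / R * cmod (1 - 0)"
  proof (rule field_differentiable_bound[of "cball 0 1" \<phi> "deriv \<phi>"])
    fix t :: complex assume t: "t \<in> cball 0 1"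
    have sub: "cball t (R / 3) \<subseteq> ball 0 R"
    proof
      fix z assume "z \<in> cball t (R / 3)"
      then have "cmod z \<le> cmod t + R / 3" using norm_triangle_sub[of z t] by (simp add: dist_norm norm_minus_commute)
      then show "z \<in> ball 0 R" using t assms(3) by simp
    qed
    have "t \<in> ball 0 R" using t assms(3) by simp
    then have "(\<phi> has_field_derivative deriv \<phi> t) (at t)" using holomorphic_derivI[OF assms(1)] by blast
    then show "(\<phi> has_field_derivative deriv \<phi> t) (at t within cball 0 1)" by (rule has_field_derivative_at_within)
    have "cmod ((deriv ^^ 1) \<phi> t) \<le> fact 1 * B / (R / 3) ^ 1"
    proof (rule Cauchy_inequality)
      show "\<phi> holomorphic_on ball t (R / 3)" using assms(1) sub by (rule holomorphic_on_subset[OF _ subset_trans[OF ball_subset_cball]])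
      show "continuous_on (cball t (R / 3)) \<phi>" using holomorphic_on_imp_continuous_on[OF assms(1)] sub by (rule continuous_on_subset)
      show "0 < R / 3" using assms(3) by simp
      fix x assume "cmod (t - x) = R / 3"
      then have "x \<in> cball t (R / 3)" by (simp add: dist_norm)
      then show "cmod (\<phi> x) \<le> B" using assms(2) sub by blast
    qed
    then show "cmod (deriv \<phi> t) \<le> 3 * B / R" by (simp add: mult.commute)
  qed auto
  then show ?thesis by simp
qed

text \<open>Restrict \<open>w\<close> to the complex line through \<open>y'\<close> and \<open>y\<close>, with these points at parameters \<open>0\<close> and
  \<open>1\<close>. As the two are close, the line stays in the polydisc up to parameters of size about
  \<open>\<delta> / e\<close>, and a bounded function on so large a disc varies little between \<open>0\<close> and \<open>1\<close>.\<close>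

lemma thol_on_difference:
  assumes h: "thol_on N u \<delta> w" and B: "\<And>y. tnear N u \<delta> y \<Longrightarrow> cmod (w y - b) \<le> B"
    and e: "0 < e" "e \<le> \<delta> / 4"
    and y: "\<And>i. i < N \<Longrightarrow> cmod (y i - u i) \<le> \<delta> / 8" "\<And>i. i < N \<Longrightarrow> cmod (y' i - u i) \<le> \<delta> / 8"
      "\<And>i. i < N \<Longrightarrow> cmod (y i - y' i) \<le> e"
  shows "cmod (w y - w y') \<le> 4 * B / \<delta> * e"
proof -
  define \<gamma> where "\<gamma> t i = y' i + t * (y i - y' i)" for t i
  (* R solves \<delta> / 8 + R * e = \<delta>. *)
  define R where "R = 7 / 8 * \<delta> / e"
  have \<delta>: "\<delta> > 0" using e by simp
  have R: "R \<ge> 2" using e \<delta> by (simp add: R_def field_simps)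
  have near: "tnear N u \<delta> (\<gamma> t)" if "t \<in> ball 0 R" for t
    unfolding tnear_def
  proof (intro allI impI)
    fix i assume i: "i < N"
    have "cmod (\<gamma> t i - u i) \<le> cmod (y' i - u i) + cmod t * cmod (y i - y' i)"
      unfolding \<gamma>_def norm_mult[symmetric]
      using norm_triangle_ineq[of "y' i - u i" "t * (y i - y' i)"] by (simp add: algebra_simps)
    also have "\<dots> \<le> \<delta> / 8 + cmod t * e"
      using y(2,3)[OF i] by (intro add_mono mult_left_mono) auto
    also have "\<dots> < \<delta> / 8 + R * e" using that e(1) by (intro add_strict_left_mono mult_strict_right_mono) auto
    also have "\<dots> = \<delta>" using e(1) by (simp add: R_def)
    finally show "cmod (\<gamma> t i - u i) < \<delta>" .
  qed
  have hol: "(\<lambda>t. w (\<gamma> t)) holomorphic_on ball 0 R"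
    by (rule thol_onD[OF h]) (auto simp: near \<gamma>_def intro!: holomorphic_intros)
  have "cmod ((w (\<gamma> 1) - b) - (w (\<gamma> 0) - b)) \<le> 3 * B / R"
    by (rule bounded_holomorphic_difference[of "\<lambda>t. w (\<gamma> t) - b", OF _ _ R])
      (use hol near B in \<open>auto intro!: holomorphic_intros\<close>)
  moreover have "\<gamma> 1 = y" "\<gamma> 0 = y'" by (auto simp: \<gamma>_def)
  moreover have "3 * B / R \<le> 4 * B / \<delta> * e"
  proof -
    have "B \<ge> 0" using B[OF tnear_refl[OF \<delta>]] norm_ge_zero order_trans by blast
    moreover have "3 * B / R = 24 / 7 * (B / \<delta> * e)" using e \<delta> by (simp add: R_def field_simps)
    moreover have "4 * B / \<delta> * e = 4 * (B / \<delta> * e)" by simp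
    moreover have "0 \<le> B / \<delta> * e" using calculation(1) e \<delta> by simp
    ultimately show ?thesis by linarith
  qed
  ultimately show ?thesis by simp
qed

text \<open>A germ is bounded near its base point, hence Lipschitz on a smaller polydisc.\<close>

lemma tgerm_continuous_near:
  assumes "tgerm N u w"
  shows "\<forall>\<^sub>F y in tfilter N u. (w \<longlongrightarrow> w y) (tfilter N y)"
proof -
  obtain \<delta>0 where \<delta>0: "\<delta>0 > 0" "thol_on N u \<delta>0 w" using assms by (auto simp: tgerm_def)
  have "\<forall>\<^sub>F y in tfilter N u. cmod (w y - w u) < 1"
    using assms tendstoD[of w "w u" "tfilter N u" 1] by (simp add: tgerm_def dist_norm)
  then obtain \<delta>1 where \<delta>1: "\<delta>1 > 0" "\<And>y. tnear N u \<delta>1 y \<Longrightarrow> cmod (w y - w u) < 1" by (auto simp: eventually_tfilter)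
  define \<delta> where "\<delta> = min \<delta>0 \<delta>1"
  have \<delta>: "\<delta> > 0" using \<delta>0 \<delta>1 by (simp add: \<delta>_def)
  have h: "thol_on N u \<delta> w" using thol_on_mono[OF \<delta>0(2)] by (simp add: \<delta>_def)
  have B: "cmod (w y - w u) \<le> 1" if "tnear N u \<delta> y" for y
    using \<delta>1(2)[of y] tnear_mono[OF that, of \<delta>1] by (simp add: \<delta>_def)
  have "(w \<longlongrightarrow> w y) (tfilter N y)" if y: "tnear N u (\<delta> / 16) y" for y
  proof (rule tendstoI)
    fix \<epsilon> :: real assume \<epsilon>: "\<epsilon> > 0"
    define e where "e = min (\<delta> / 16) (\<epsilon> * \<delta> / 8)"
    have e: "e > 0" "e \<le> \<delta> / 16" "e \<le> \<epsilon> * \<delta> / 8" using \<delta> \<epsilon> by (auto simp: e_def)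
    have "dist (w y') (w y) < \<epsilon>" if y': "tnear N y e y'" for y'
    proof -
      have "cmod (w y' - w y) \<le> 4 * 1 / \<delta> * e"
      proof (rule thol_on_difference[OF h B e(1)])
        show "e \<le> \<delta> / 4" using e(2) \<delta> by simp
        fix i assume i: "i < N"
        show "cmod (y' i - y i) \<le> e" using y' i by (simp add: tnear_def less_imp_le)
        show "cmod (y i - u i) \<le> \<delta> / 8" using y i \<delta> by (fastforce simp: tnear_def)
        show "cmod (y' i - u i) \<le> \<delta> / 8"
          using y' y i e(2) norm_triangle_ineq[of "y' i - y i" "y i - u i"] by (fastforce simp: tnear_def)
      qed
      also have "\<dots> \<le> 4 * 1 / \<delta> * (\<epsilon> * \<delta> / 8)" using e(3) \<delta> by (intro mult_left_mono) auto
      also have "\<dots> < \<epsilon>" using \<delta> \<epsilon> by simp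
      finally show ?thesis by (simp add: dist_norm)
    qed
    then show "\<forall>\<^sub>F y' in tfilter N y. dist (w y') (w y) < \<epsilon>" unfolding eventually_tfilter using e(1) by blast
  qed
  then show ?thesis unfolding eventually_tfilter using \<delta> by (intro exI[of _ "\<delta> / 16"]) auto
qed

text \<open>On the polydisc of radius \<open>\<delta> / 8\<close>, which contains the image, \<open>\<Phi>\<close> halves distances by
  \<open>thol_on_difference\<close> with \<open>B = \<delta> / 8\<close>. The iterates of the centre converge to the fixed point.\<close>

lemma contracting_fixed_point:
  fixes \<Phi> :: "(nat \<Rightarrow> complex) \<Rightarrow> nat \<Rightarrow> complex"
  assumes \<delta>: "\<delta> > 0" and h: "\<And>i. i < N \<Longrightarrow> thol_on N u \<delta> (\<lambda>y. \<Phi> y i)"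
    and B: "\<And>y i. tnear N u \<delta> y \<Longrightarrow> i < N \<Longrightarrow> cmod (\<Phi> y i - u i) \<le> \<delta> / 8"
  shows "\<exists>y. tnear N u \<delta> y \<and> (\<forall>i<N. \<Phi> y i = y i)"
    "\<And>y y' i. tnear N u \<delta> y \<Longrightarrow> tnear N u \<delta> y' \<Longrightarrow> (\<And>i. i < N \<Longrightarrow> \<Phi> y i = y i) \<Longrightarrow>
       (\<And>i. i < N \<Longrightarrow> \<Phi> y' i = y' i) \<Longrightarrow> i < N \<Longrightarrow> y i = y' i"
proof -
  have contr: "cmod (\<Phi> y i - \<Phi> y' i) \<le> e / 2"
    if "i < N" "0 < e" "e \<le> \<delta> / 4" "\<And>i. i < N \<Longrightarrow> cmod (y i - u i) \<le> \<delta> / 8"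
     "\<And>i. i < N \<Longrightarrow> cmod (y' i - u i) \<le> \<delta> / 8" "\<And>i. i < N \<Longrightarrow> cmod (y i - y' i) \<le> e" for y y' e i
    using thol_on_difference[OF h[OF that(1)] B[OF _ that(1)] that(2-6)] \<delta> by simp
  have near: "tnear N u \<delta> y" if "\<And>i. i < N \<Longrightarrow> cmod (y i - u i) \<le> \<delta> / 8" for y
    using that \<delta> by (force simp: tnear_def)
  define Y where "Y k = (\<Phi> ^^ k) u" for k
  have YS: "Y (Suc k) = \<Phi> (Y k)" for k by (simp add: Y_def)
  have Y8: "cmod (Y k i - u i) \<le> \<delta> / 8" if "i < N" for k i
    using that
  proof (induction k arbitrary: i)
    case 0 then show ?case using \<delta> by (simp add: Y_def)
  next
    case (Suc k) then show ?case unfolding YS by (intro B near) auto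
  qed
  have tri: "cmod (a - b) \<le> \<delta> / 4" if "cmod (a - u i) \<le> \<delta> / 8" "cmod (b - u i) \<le> \<delta> / 8" for a b :: complex and i
    using norm_triangle_ineq4[of "a - u i" "b - u i"] that by simp
  have step: "cmod (Y (Suc k) i - Y k i) \<le> \<delta> / 4 * (1 / 2) ^ k" if "i < N" for k i
    using that
  proof (induction k arbitrary: i)
    case 0 then show ?case using tri[OF Y8[OF 0] Y8[OF 0]] by simp
  next
    case (Suc k)
    have "cmod (\<Phi> (Y (Suc k)) i - \<Phi> (Y k) i) \<le> (\<delta> / 4 * (1 / 2) ^ k) / 2"
    proof (rule contr[OF Suc.prems])
      show "0 < \<delta> / 4 * (1 / 2) ^ k" using \<delta> by simp
      have "(1 / 2 :: real) ^ k \<le> 1" by (simp add: power_le_one)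
      then show "\<delta> / 4 * (1 / 2) ^ k \<le> \<delta> / 4" using \<delta> by (intro mult_left_le) auto
    qed (use Y8 Suc.IH in auto)
    then show ?case by (simp add: YS)
  qed
  have conv: "convergent (\<lambda>k. Y k i)" if "i < N" for i
  proof -
    have "summable (\<lambda>k. Y (Suc k) i - Y k i)"
    proof (rule summable_comparison_test)
      show "\<exists>M. \<forall>k\<ge>M. cmod (Y (Suc k) i - Y k i) \<le> \<delta> / 4 * (1 / 2) ^ k" using step[OF that] by blast
      show "summable (\<lambda>k. \<delta> / 4 * (1 / 2 :: real) ^ k)" by (intro summable_mult summable_geometric) simp
    qed
    then have "convergent (\<lambda>n. \<Sum>k<n. Y (Suc k) i - Y k i)" using summable_iff_convergent by blast
    then have "convergent (\<lambda>n. Y n i - Y 0 i)" using sum_lessThan_telescope[of "\<lambda>k. Y k i"] by simp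
    then obtain l where "(\<lambda>n. Y n i - Y 0 i) \<longlonglongrightarrow> l" by (auto simp: convergent_def)
    from tendsto_add[OF this tendsto_const[of "Y 0 i"]] show ?thesis by (auto simp: convergent_def)
  qed
  define y where "y i = lim (\<lambda>k. Y k i)" for i
  have lim: "(\<lambda>k. Y k i) \<longlonglongrightarrow> y i" if "i < N" for i
    using conv[OF that] by (simp add: y_def convergent_LIMSEQ_iff)
  have y8: "cmod (y i - u i) \<le> \<delta> / 8" if "i < N" for i
  proof (rule tendsto_upperbound)
    show "(\<lambda>k. cmod (Y k i - u i)) \<longlonglongrightarrow> cmod (y i - u i)" by (intro tendsto_intros lim that)
  qed (use Y8[OF that] in auto)
  have "\<Phi> y i = y i" if i: "i < N" for i
  proof -
    have "(\<lambda>k. Y (Suc k) i) \<longlonglongrightarrow> \<Phi> y i"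
    proof (rule tendstoI)
      fix e :: real assume e: "e > 0"
      define e' where "e' = min e (\<delta> / 4)"
      have e': "e' > 0" "e' \<le> \<delta> / 4" "e' \<le> e" using e \<delta> by (auto simp: e'_def)
      have "filterlim Y (tfilter N y) sequentially" by (rule filterlim_tfilter) (rule lim)
      moreover have "\<forall>\<^sub>F x in tfilter N y. tnear N y e' x" unfolding eventually_tfilter using e'(1) by blast
      ultimately have "\<forall>\<^sub>F k in sequentially. tnear N y e' (Y k)" by (simp add: filterlim_iff)
      then show "\<forall>\<^sub>F k in sequentially. dist (Y (Suc k) i) (\<Phi> y i) < e"
      proof eventually_elim
        case (elim k)
        have "cmod (\<Phi> (Y k) i - \<Phi> y i) \<le> e' / 2"
          by (rule contr[OF i e'(1,2)]) (use Y8 y8 elim in \<open>auto simp: tnear_def less_imp_le\<close>)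
        then show ?case using e'(1,3) by (simp add: dist_norm YS)
      qed
    qed
    then show ?thesis using LIMSEQ_Suc[OF lim[OF i]] LIMSEQ_unique by blast
  qed
  then show "\<exists>y. tnear N u \<delta> y \<and> (\<forall>i<N. \<Phi> y i = y i)" using near[OF y8] by blast
  fix a b i assume ab: "tnear N u \<delta> a" "tnear N u \<delta> b" "\<And>i. i < N \<Longrightarrow> \<Phi> a i = a i" "\<And>i. i < N \<Longrightarrow> \<Phi> b i = b i" "i < N"
  have a8: "cmod (a i - u i) \<le> \<delta> / 8" "cmod (b i - u i) \<le> \<delta> / 8" if "i < N" for i
    using B[OF ab(1) that] B[OF ab(2) that] ab(3,4)[OF that] by auto
  have "cmod (a i - b i) \<le> \<delta> / 4 * (1 / 2) ^ k" if "i < N" for k i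
    using that
  proof (induction k arbitrary: i)
    case 0 then show ?case using tri[OF a8[OF 0]] by simp
  next
    case (Suc k)
    have "cmod (\<Phi> a i - \<Phi> b i) \<le> (\<delta> / 4 * (1 / 2) ^ k) / 2"
    proof (rule contr[OF Suc.prems])
      show "0 < \<delta> / 4 * (1 / 2) ^ k" using \<delta> by simp
      have "(1 / 2 :: real) ^ k \<le> 1" by (simp add: power_le_one)
      then show "\<delta> / 4 * (1 / 2) ^ k \<le> \<delta> / 4" using \<delta> by (intro mult_left_le) auto
    qed (use a8 Suc.IH in auto)
    then show ?case using ab(3,4) Suc.prems by simp
  qed
  then have "cmod (a i - b i) \<le> \<delta> / 4 * (1 / 2) ^ k" for k using ab(5) by blast
  moreover have "(\<lambda>k. \<delta> / 4 * (1 / 2 :: real) ^ k) \<longlonglongrightarrow> \<delta> / 4 * 0"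
    by (intro tendsto_intros LIMSEQ_realpow_zero) auto
  ultimately have "cmod (a i - b i) \<le> 0" using LIMSEQ_le_const[of "\<lambda>k. \<delta> / 4 * (1 / 2 :: real) ^ k" 0 "cmod (a i - b i)"] by simp
  then show "a i = b i" by simp
qed

section \<open>Towers with prescribed critical values\<close>

lemma cconv_offset:
  fixes g :: "nat \<Rightarrow> 'a::metric_space \<Rightarrow> 'b::metric_space"
  assumes "cconv (\<lambda>n. g (n + N)) f" shows "cconv g f"
  unfolding cconv_def
proof (intro allI impI)
  fix z and l :: 'a assume "z \<longlonglongrightarrow> l"
  then have "(\<lambda>n. z (n + N)) \<longlonglongrightarrow> l" by (rule LIMSEQ_ignore_initial_segment)
  from cconvD[OF assms this] show "(\<lambda>n. g n (z n)) \<longlonglongrightarrow> f l" by (rule LIMSEQ_offset)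
qed

lemma mob_cconv_eventually:
  assumes "A \<longlonglongrightarrow> a" "B \<longlonglongrightarrow> b" "C \<longlonglongrightarrow> c" "D \<longlonglongrightarrow> d" "a * d - b * c \<noteq> 0"
  shows "cconv (\<lambda>n. mob (A n) (B n) (C n) (D n)) (mob a b c d)"
proof -
  have "(\<lambda>n. A n * D n - B n * C n) \<longlonglongrightarrow> a * d - b * c" by (intro tendsto_intros assms)
  then have "\<forall>\<^sub>F n in sequentially. A n * D n - B n * C n \<noteq> 0" using assms(5) by (rule tendsto_imp_eventually_ne)
  then obtain N where N: "\<And>n. n \<ge> N \<Longrightarrow> A n * D n - B n * C n \<noteq> 0" by (auto simp: eventually_sequentially)
  show ?thesis
    by (rule cconv_offset[where N = N], rule mob_cconv) (use N assms in \<open>auto intro: LIMSEQ_ignore_initial_segment\<close>)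
qed

text \<open>The three points \<open>0\<close>, \<open>\<infinity>\<close>, \<open>1\<close> have the indices \<open>0\<close>, \<open>1\<close>, \<open>2\<close>; the free marked points follow.\<close>

definition marked :: "(nat \<Rightarrow> complex) \<Rightarrow> nat \<Rightarrow> riemann_sphere" where
  "marked x i = (if i = 0 then Fin 0 else if i = 1 then Infty else if i = 2 then Fin 1 else Fin (x (i - 3)))"

lemma marked_image: "marked x ` {..<n + 3} = {Fin 0, Infty, Fin 1} \<union> (\<lambda>i. Fin (x i)) ` {..<n}"
proof (intro equalityI subsetI)
  fix y assume "y \<in> {Fin 0, Infty, Fin 1} \<union> (\<lambda>i. Fin (x i)) ` {..<n}"
  then consider "y = marked x 0" | "y = marked x 1" | "y = marked x 2" | i where "i < n" "y = marked x (i + 3)"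
    by (auto simp: marked_def)
  then show "y \<in> marked x ` {..<n + 3}" by cases auto
qed (auto simp: marked_def)

text \<open>It takes the imaginary axis to the unit circle, and \<open>0\<close>, \<open>\<infinity>\<close>, \<open>1\<close> to \<open>1\<close>, \<open>-1\<close>, \<open>\<infinity>\<close>.\<close>

definition cayley :: "riemann_sphere \<Rightarrow> riemann_sphere" where
  "cayley = mob 1 1 (-1) 1"

lemma mobius_cayley: "mobius cayley"
proof -
  have "(1::complex) * 1 - 1 * (-1) \<noteq> 0" by simp
  then show ?thesis unfolding cayley_def mobius_def by blast
qed

lemma cayley_values: "cayley (Fin 0) = Fin 1" "cayley Infty = Fin (-1)" "cayley (Fin 1) = Infty"
  "cayley (Fin (-1)) = Fin 0" "cayley (Fin \<i>) = Fin \<i>"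
proof -
  have "\<i> \<noteq> 1" by (metis complex_i_not_one)
  then have "(1 + \<i>) / (1 - \<i>) = \<i>" by (simp add: field_simps)
  then show "cayley (Fin \<i>) = Fin \<i>" using \<open>\<i> \<noteq> 1\<close> by (simp add: cayley_def mob_def add.commute)
qed (auto simp: cayley_def mob_def)

lemma cayley_inverse: "v \<noteq> -1 \<Longrightarrow> cayley (Fin ((v - 1) / (v + 1))) = Fin v"
proof -
  assume "v \<noteq> -1"
  then have v: "v + 1 \<noteq> 0" by (simp add: eq_neg_iff_add_eq_0)
  have 1: "-1 * ((v - 1) / (v + 1)) + 1 = 2 / (v + 1)" "1 * ((v - 1) / (v + 1)) + 1 = 2 * v / (v + 1)"
    using v by (simp_all add: field_simps)
  show ?thesis unfolding cayley_def mob_def using v by (simp add: 1[simplified])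
qed

text \<open>A branch of the square root of the entry \<open>x i\<close> near \<open>x0 i\<close>: the quotient by \<open>x0 i\<close> is near \<open>1\<close>
  and thus away from the branch cut of \<open>csqrt\<close>.\<close>

definition root_germ :: "(nat \<Rightarrow> complex) \<Rightarrow> nat \<Rightarrow> (nat \<Rightarrow> complex) \<Rightarrow> complex" where
  "root_germ x0 i x = csqrt (x0 i) * csqrt (x i / x0 i)"

lemma root_germ_square: "x0 i \<noteq> 0 \<Longrightarrow> (root_germ x0 i x)\<^sup>2 = x i"
  by (simp add: root_germ_def power_mult_distrib)

lemma tgerm_csqrt:
  assumes "tgerm N u w" "w u = 1" shows "tgerm N u (\<lambda>x. csqrt (w x))"
proof (rule tgerm_comp[where T = "- \<real>\<^sub>\<le>\<^sub>0" and h = csqrt])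
  show "csqrt holomorphic_on - \<real>\<^sub>\<le>\<^sub>0" by (rule holomorphic_on_csqrt)
  show "open (- \<real>\<^sub>\<le>\<^sub>0 :: complex set)" by (simp add: open_Compl)
qed (use assms in auto)

lemma tgerm_root_germ:
  assumes "i < m" "x0 i \<noteq> 0" shows "tgerm m x0 (root_germ x0 i)"
  unfolding root_germ_def[abs_def]
  by (intro tgerm_binop tgerm_const tgerm_csqrt tgerm_divide tgerm_proj) (use assms in auto)

text \<open>A family of maps parametrised by the \<open>m\<close> free marked points \<open>x\<close>, which vary near \<open>x0\<close>. Since \<open>q x\<close>
  is going to be precomposed with a map with critical values \<open>0\<close>, \<open>\<infinity>\<close>, \<open>1\<close>, its values at these
  points count as critical values too; together they have to be \<open>0\<close>, \<open>\<infinity>\<close>, \<open>1\<close> and the first \<open>n\<close>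
  free points. The functions \<open>w i\<close> are holomorphic sections of the fibres over all marked points,
  including the \<open>m - n\<close> points that are still to become critical values. They are nonzero at \<open>x0\<close>
  because roots of them will be taken.\<close>

definition tower_family :: "nat \<Rightarrow> nat \<Rightarrow> (nat \<Rightarrow> complex) \<Rightarrow> ((nat \<Rightarrow> complex) \<Rightarrow> riemann_sphere \<Rightarrow> riemann_sphere) \<Rightarrow>
    (nat \<Rightarrow> (nat \<Rightarrow> complex) \<Rightarrow> complex) \<Rightarrow> bool" where
  "tower_family m n x0 q w \<longleftrightarrow>
    (\<forall>\<^sub>F x in tfilter m x0. rat (q x) \<and>
       critical_values (q x) \<union> q x ` {Fin 0, Infty, Fin 1} = marked x ` {..<n + 3} \<and>
       (\<forall>i<m + 3. q x (Fin (w i x)) = marked x i) \<and>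
       (\<forall>X. (\<forall>i<m. (\<lambda>k. X k i) \<longlonglongrightarrow> x i) \<longrightarrow> cconv (\<lambda>k. q (X k)) (q x))) \<and>
    (\<forall>i<m + 3. tgerm m x0 (w i) \<and> w i x0 \<noteq> 0)"

text \<open>The fourth power of the Cayley transform works for all \<open>x\<close>: it is ramified only over \<open>0\<close> and
  \<open>\<infinity>\<close>, takes \<open>0\<close>, \<open>\<infinity>\<close>, \<open>1\<close> to \<open>1\<close>, \<open>1\<close>, \<open>\<infinity>\<close>, and has the preimages \<open>-1\<close>, \<open>1\<close>, \<open>\<i>\<close> of \<open>0\<close>,
  \<open>\<infinity>\<close>, \<open>1\<close>. For the square the fibre over \<open>1\<close> would be \<open>0\<close> and \<open>\<infinity>\<close>, which leaves no finite
  nonzero point for the section.\<close>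

lemma tower_family_base:
  assumes x0: "\<And>i. i < m \<Longrightarrow> x0 i \<noteq> 0 \<and> x0 i \<noteq> 1"
  shows "\<exists>q w. tower_family m 0 x0 q w"
proof -
  define T where "T = pow_map 4 \<circ> cayley"
  have rT: "rat T" unfolding T_def by (intro rat_comp rat_pow_map mobius_rat mobius_cayley) simp
  have VT: "critical_values T = {Fin 0, Infty}"
    unfolding T_def critical_points_mobius_comp(4)[OF mobius_cayley rat_pow_map[of 4, simplified]]
    by (rule critical_points_pow_map(2)) simp
  have T3: "T ` {Fin 0, Infty, Fin 1} = {Fin 1, Infty}" by (auto simp: T_def cayley_values)
  define s where "s i x = csqrt (csqrt (x0 i)) * csqrt (csqrt (x i / x0 i))" for i and x :: "nat \<Rightarrow> complex"
  have s4: "s i x ^ 4 = x i" if "x0 i \<noteq> 0" for i x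
  proof -
    have "s i x ^ 4 = ((s i x)\<^sup>2)\<^sup>2" by (simp flip: power_mult)
    also have "\<dots> = x i" unfolding s_def power_mult_distrib power2_csqrt using that by simp
    finally show ?thesis .
  qed
  have sg: "tgerm m x0 (s i)" if "i < m" for i
    unfolding s_def[abs_def]
    by (intro tgerm_binop tgerm_const tgerm_csqrt tgerm_divide tgerm_proj) (use x0[OF that] that in auto)
  have s1: "s i x0 \<noteq> 1 \<and> s i x0 \<noteq> -1" if "i < m" for i
    using s4[of i x0] x0[OF that] by auto
  define w where "w i x = (if i = 0 then -1 else if i = 1 then 1 else if i = 2 then \<i> else (s (i - 3) x - 1) / (s (i - 3) x + 1))" for i x
  have g3: "tgerm m x0 (w i) \<and> w i x0 \<noteq> 0" if "i < m + 3" for i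
  proof (cases "i < 3")
    case True
    then consider "i = 0" | "i = 1" | "i = 2" by linarith
    then show ?thesis by cases (simp_all add: w_def[abs_def] tgerm_const)
  next
    case False
    then have i: "i - 3 < m" using that by simp
    have nz: "s (i - 3) x0 + 1 \<noteq> 0" "s (i - 3) x0 - 1 \<noteq> 0" using s1[OF i] by (simp_all add: eq_neg_iff_add_eq_0)
    have "w i = (\<lambda>x. (s (i - 3) x - 1) / (s (i - 3) x + 1))" using False by (auto simp: w_def)
    then show ?thesis using nz by (auto intro!: tgerm_divide tgerm_binop tgerm_const sg i)
  qed
  have ev: "\<forall>\<^sub>F x in tfilter m x0. \<forall>i\<in>{..<m}. s i x \<noteq> -1"
  proof (rule eventually_ball_finite, simp, rule ballI)
    fix i assume "i \<in> {..<m}"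
    then have "(s i \<longlongrightarrow> s i x0) (tfilter m x0)" "s i x0 \<noteq> -1" using sg s1 by (auto simp: tgerm_def)
    then show "\<forall>\<^sub>F x in tfilter m x0. s i x \<noteq> -1" by (rule tendsto_imp_eventually_ne)
  qed
  have "tower_family m 0 x0 (\<lambda>x. T) w"
    unfolding tower_family_def
  proof (intro conjI)
    show "\<forall>i<m + 3. tgerm m x0 (w i) \<and> w i x0 \<noteq> 0" using g3 by blast
    show "\<forall>\<^sub>F x in tfilter m x0. rat T \<and>
       critical_values T \<union> T ` {Fin 0, Infty, Fin 1} = marked x ` {..<0 + 3} \<and>
       (\<forall>i<m + 3. T (Fin (w i x)) = marked x i) \<and>
       (\<forall>X. (\<forall>i<m. (\<lambda>k. X k i) \<longlonglongrightarrow> x i) \<longrightarrow> cconv (\<lambda>k. T) T)"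
      using ev
    proof eventually_elim
      case (elim x)
      have "T (Fin (w i x)) = marked x i" if i: "i < m + 3" for i
      proof (cases "i < 3")
        case True
        then consider "i = 0" | "i = 1" | "i = 2" by linarith
        then show ?thesis by cases (simp_all add: w_def T_def cayley_values marked_def)
      next
        case False
        then have i3: "i - 3 < m" using i by simp
        have "T (Fin (w i x)) = Fin (s (i - 3) x ^ 4)"
          using False elim i3 cayley_inverse[of "s (i - 3) x"] by (simp add: w_def T_def)
        then show ?thesis using False s4[of "i - 3" x] x0[OF i3] by (simp add: marked_def)
      qed
      moreover have "critical_values T \<union> T ` {Fin 0, Infty, Fin 1} = marked x ` {..<0 + 3}"
        unfolding VT T3 marked_image by auto
      ultimately show ?case using rT cconv_const[OF rat_continuous[OF rT]] by blast
    qed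
  qed
  then show ?thesis by blast
qed

text \<open>Put one layer on top of a tower: the Moebius transformation \<open>a r\<close> taking \<open>0\<close>, \<open>\<infinity>\<close>, \<open>1\<close> to \<open>0\<close>,
  \<open>1\<close>, \<open>r\<close>, followed by squaring, where \<open>r\<close> is a square root of \<open>x 0\<close>. Squaring is ramified over
  \<open>0\<close> and \<open>\<infinity>\<close> only. The marked points \<open>0\<close>, \<open>\<infinity>\<close>, \<open>1\<close> of the lower tower are taken to \<open>0\<close>, \<open>1\<close>,
  \<open>x 0\<close>, and its free marked points \<open>x'\<close> are chosen in the fibres over \<open>x 1\<close>, \<open>x 2\<close>, ... and finally
  \<open>\<infinity>\<close>. In this way one more free point has become a critical value.\<close>

lemma tower_family_step:
  assumes n: "n < m" and x0: "\<And>i. i < m \<Longrightarrow> x0 i \<noteq> 0 \<and> x0 i \<noteq> 1" "inj_on x0 {..<m}"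
    and IH: "\<And>x0. (\<And>i. i < m \<Longrightarrow> x0 i \<noteq> 0 \<and> x0 i \<noteq> 1) \<Longrightarrow> inj_on x0 {..<m} \<Longrightarrow> \<exists>q w. tower_family m n x0 q w"
  shows "\<exists>q w. tower_family m (Suc n) x0 q w"
proof -
  define r where "r = root_germ x0 0"
  define s where "s i = root_germ x0 i" for i
  define a where "a \<rho> = mob \<rho> 0 \<rho> (1 - \<rho>)" for \<rho>
  define x' where "x' x i = (if Suc i < m then s (Suc i) x * (1 - r x) / (r x * (1 - s (Suc i) x)) else (r x - 1) / r x)" for x i
  have m0: "0 < m" using n by simp
  have sq: "(s i x)\<^sup>2 = x i" if "i < m" for i x using root_germ_square x0(1)[OF that] by (simp add: s_def)
  have rq: "(r x)\<^sup>2 = x 0" for x using sq[OF m0, of x] by (simp add: r_def s_def)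
  have sg: "tgerm m x0 (s i)" if "i < m" for i using tgerm_root_germ[OF that] x0(1)[OF that] by (simp add: s_def)
  have rg: "tgerm m x0 r" using sg[OF m0] by (simp add: r_def s_def)
  have r0: "r x0 \<noteq> 0" "r x0 \<noteq> 1" using rq[of x0] x0(1)[OF m0] by auto
  have s0: "s i x0 \<noteq> 0" "s i x0 \<noteq> 1" if "i < m" for i using sq[OF that, of x0] x0(1)[OF that] by auto
  have ma: "mobius (a \<rho>)" if "\<rho> \<noteq> 0" "\<rho> \<noteq> 1" for \<rho>
  proof -
    have "\<rho> * (1 - \<rho>) - 0 * \<rho> \<noteq> 0" using that by simp
    then show ?thesis unfolding a_def mobius_def by blast
  qed
  have aval: "a \<rho> (Fin 0) = Fin 0" "a \<rho> Infty = Fin 1" "a \<rho> (Fin 1) = Fin \<rho>" "a \<rho> (Fin ((\<rho> - 1) / \<rho>)) = Infty"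
    if "\<rho> \<noteq> 0" "\<rho> \<noteq> 1" for \<rho>
    using that by (auto simp: a_def mob_def)
  have ainv: "a \<rho> (Fin (t * (1 - \<rho>) / (\<rho> * (1 - t)))) = Fin t" if "\<rho> \<noteq> 0" "\<rho> \<noteq> 1" "t \<noteq> 1" for \<rho> t
  proof -
    have t1: "1 - t \<noteq> 0" "1 - \<rho> \<noteq> 0" using that by auto
    define z where "z = t * (1 - \<rho>) / (\<rho> * (1 - t))"
    have 1: "\<rho> * z + 0 = t * ((1 - \<rho>) / (1 - t))" using that(1) by (simp add: z_def)
    have 2: "\<rho> * z + (1 - \<rho>) = (1 - \<rho>) / (1 - t)"
    proof -
      have "\<rho> * z = t * (1 - \<rho>) / (1 - t)" using that(1) by (simp add: z_def)
      then show ?thesis using t1 by (simp add: field_simps)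
    qed
    have nz: "(1 - \<rho>) / (1 - t) \<noteq> 0" using t1 by simp
    then have "a \<rho> (Fin z) = Fin t" unfolding a_def mob_def by (simp only: riemann_sphere.case 1 2 if_False) simp
    then show ?thesis by (simp only: z_def)
  qed
  have ax': "a (r x) (Fin (x' x i)) = (if Suc i < m then Fin (s (Suc i) x) else Infty)"
    if "r x \<noteq> 0" "r x \<noteq> 1" "\<And>i. i < m \<Longrightarrow> s i x \<noteq> 1" for x i
    using ainv[OF that(1,2)] aval(4)[OF that(1,2)] that(3) by (simp add: x'_def)
  have ax0: "a (r x0) (Fin (x' x0 i)) = (if Suc i < m then Fin (s (Suc i) x0) else Infty)" for i
    by (rule ax'[OF r0]) (rule s0(2))
  have inj_a: "a (r x0) y = a (r x0) z \<Longrightarrow> y = z" for y z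
    using mobius_inv(4)[OF ma[OF r0]] by (metis bij_def injD)
  have x'0: "x' x0 i \<noteq> 0 \<and> x' x0 i \<noteq> 1" if "i < m" for i
  proof (cases "Suc i < m")
    case True
    have "s (Suc i) x0 \<noteq> r x0"
    proof
      assume "s (Suc i) x0 = r x0"
      then have "x0 (Suc i) = x0 0" using sq[OF True, of x0] rq[of x0] by simp
      then show False using inj_onD[OF x0(2), of "Suc i" 0] True m0 by simp
    qed
    then show ?thesis using ax0[of i] True aval[OF r0] s0(1)[OF True] by auto
  next
    case False
    then show ?thesis using ax0[of i] aval[OF r0] by auto
  qed
  have x'inj: "inj_on (x' x0) {..<m}"
  proof (rule inj_onI)
    fix i j assume ij: "i \<in> {..<m}" "j \<in> {..<m}" "x' x0 i = x' x0 j"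
    then have "(if Suc i < m then Fin (s (Suc i) x0) else Infty) = (if Suc j < m then Fin (s (Suc j) x0) else Infty)"
      using ax0 by metis
    then consider "Suc i < m" "Suc j < m" "s (Suc i) x0 = s (Suc j) x0" | "\<not> Suc i < m" "\<not> Suc j < m"
      by (auto split: if_splits)
    then show "i = j"
    proof cases
      case 1
      then have "x0 (Suc i) = x0 (Suc j)" using sq[of "Suc i" x0] sq[of "Suc j" x0] by simp
      then show ?thesis using inj_onD[OF x0(2), of "Suc i" "Suc j"] 1 by simp
    qed (use ij in auto)
  qed
  obtain q w where qw: "tower_family m n (x' x0) q w" using IH[OF x'0 x'inj] by blast
  have xg: "tgerm m x0 (\<lambda>x. x' x i)" if "i < m" for i
  proof (cases "Suc i < m")
    case True
    then have "(\<lambda>x. x' x i) = (\<lambda>x. s (Suc i) x * (1 - r x) / (r x * (1 - s (Suc i) x)))" by (simp add: x'_def)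
    then show ?thesis using r0 s0(2)[OF True] by (auto intro!: tgerm_divide tgerm_binop tgerm_const sg rg True)
  next
    case False
    then have "(\<lambda>x. x' x i) = (\<lambda>x. (r x - 1) / r x)" by (simp add: x'_def)
    then show ?thesis using r0 by (auto intro!: tgerm_divide tgerm_binop tgerm_const rg)
  qed
  have wg: "tgerm m x0 (\<lambda>x. w j (x' x))" "w j (x' x0) \<noteq> 0" if "j < m + 3" for j
    using tgerm_tuple_comp(1)[of m x' x0 "w j" m] xg qw that by (auto simp: tower_family_def)
  have fl: "filterlim x' (tfilter m (x' x0)) (tfilter m x0)"
    by (rule filterlim_tfilter) (use xg in \<open>simp add: tgerm_def\<close>)
  define q2 where "q2 x = pow_map 2 \<circ> a (r x) \<circ> q (x' x)" for x
  (* j i is the index, in the lower tower, of the marked point over the marked point i. *)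
  define j where "j i = (if i = 0 then 0 else if i = 1 then m + 2 else if i = 2 then 1 else if i = 3 then 2 else i - 1 :: nat)" for i
  define w2 where "w2 i x = w (j i) (x' x)" for i x
  have jm: "j i < m + 3" if "i < m + 3" for i using that m0 by (auto simp: j_def)
  have evq: "\<forall>\<^sub>F x in tfilter m x0. rat (q (x' x)) \<and>
       critical_values (q (x' x)) \<union> q (x' x) ` {Fin 0, Infty, Fin 1} = marked (x' x) ` {..<n + 3} \<and>
       (\<forall>i<m + 3. q (x' x) (Fin (w i (x' x))) = marked (x' x) i) \<and>
       (\<forall>X. (\<forall>i<m. (\<lambda>k. X k i) \<longlonglongrightarrow> x' x i) \<longrightarrow> cconv (\<lambda>k. q (X k)) (q (x' x)))"
    using qw fl unfolding tower_family_def filterlim_iff by blast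
  have evs: "\<forall>\<^sub>F x in tfilter m x0. \<forall>i\<in>{..<m}. s i x \<noteq> 1"
  proof (rule eventually_ball_finite, simp, rule ballI)
    fix i assume "i \<in> {..<m}"
    then have "(s i \<longlongrightarrow> s i x0) (tfilter m x0)" "s i x0 \<noteq> 1" using sg s0 by (auto simp: tgerm_def)
    then show "\<forall>\<^sub>F x in tfilter m x0. s i x \<noteq> 1" by (rule tendsto_imp_eventually_ne)
  qed
  have evr: "\<forall>\<^sub>F x in tfilter m x0. r x \<noteq> 0 \<and> r x \<noteq> 1"
    using rg r0 unfolding tgerm_def by (auto intro!: eventually_conj elim!: tendsto_imp_eventually_ne)
  have evc: "\<forall>\<^sub>F x in tfilter m x0. \<forall>i\<in>{..<m}. ((\<lambda>y. x' y i) \<longlongrightarrow> x' x i) (tfilter m x)"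
    by (rule eventually_ball_finite, simp, rule ballI, rule tgerm_continuous_near, rule xg) simp
  have evcr: "\<forall>\<^sub>F x in tfilter m x0. (r \<longlongrightarrow> r x) (tfilter m x)" by (rule tgerm_continuous_near[OF rg])
  have "tower_family m (Suc n) x0 q2 w2"
    unfolding tower_family_def
  proof (intro conjI)
    show "\<forall>i<m + 3. tgerm m x0 (w2 i) \<and> w2 i x0 \<noteq> 0"
      using wg jm by (auto simp: w2_def[abs_def])
    show "\<forall>\<^sub>F x in tfilter m x0. rat (q2 x) \<and>
       critical_values (q2 x) \<union> q2 x ` {Fin 0, Infty, Fin 1} = marked x ` {..<Suc n + 3} \<and>
       (\<forall>i<m + 3. q2 x (Fin (w2 i x)) = marked x i) \<and>
       (\<forall>X. (\<forall>i<m. (\<lambda>k. X k i) \<longlonglongrightarrow> x i) \<longrightarrow> cconv (\<lambda>k. q2 (X k)) (q2 x))"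
      using evq evs evr evc evcr
    proof eventually_elim
      case (elim x)
      have rx: "r x \<noteq> 0" "r x \<noteq> 1" using elim(3) by auto
      have sx: "s i x \<noteq> 1" if "i < m" for i using elim(2) that by auto
      have rq': "rat (q (x' x))" using elim(1) by blast
      have raq: "rat (a (r x) \<circ> q (x' x))" by (rule rat_comp[OF mobius_rat[OF ma[OF rx]] rq'])
      have rp: "rat (pow_map 2)" by (rule rat_pow_map) simp
      have cq2: "q2 x = pow_map 2 \<circ> (a (r x) \<circ> q (x' x))" by (simp add: q2_def comp_assoc)
      have r1: "rat (q2 x)" unfolding cq2 by (rule rat_comp[OF rp raq])
      have img: "pow_map 2 (a (r x) (marked (x' x) i)) = (if i = 0 then Fin 0 else if i = 1 then Fin 1 else if i = 2 then Fin (x 0)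
         else if i - 2 < m then Fin (x (i - 2)) else Infty)" for i
      proof (cases "i < 3")
        case True
        then consider "i = 0" | "i = 1" | "i = 2" by linarith
        then show ?thesis by cases (simp_all add: marked_def aval[OF rx] rq)
      next
        case False
        then have "Suc (i - 3) = i - 2" by simp
        then show ?thesis using False ax'[OF rx sx, of "i - 3"] sq[of "i - 2" x] by (simp add: marked_def)
      qed
      have "critical_values (q2 x) \<union> q2 x ` {Fin 0, Infty, Fin 1} =
        {Fin 0, Infty} \<union> (\<lambda>y. pow_map 2 (a (r x) y)) ` (critical_values (q (x' x)) \<union> q (x' x) ` {Fin 0, Infty, Fin 1})"
        unfolding cq2 critical_values_comp[OF rp raq] critical_points_mobius_comp(3)[OF ma[OF rx] rq'] critical_points_pow_map(2)[of 2, simplified]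
        by (auto simp: image_image)
      also have "\<dots> = {Fin 0, Infty} \<union> (\<lambda>y. pow_map 2 (a (r x) y)) ` marked (x' x) ` {..<n + 3}" using elim(1) by simp
      also have "\<dots> = {Fin 0, Infty} \<union> (\<lambda>i. if i = 0 then Fin 0 else if i = 1 then Fin 1 else if i = 2 then Fin (x 0)
         else if i - 2 < m then Fin (x (i - 2)) else Infty) ` {..<n + 3}"
        unfolding image_image by (simp only: img)
      also have "\<dots> = marked x ` {..<Suc n + 3}"
      proof (intro equalityI subsetI)
        fix y assume "y \<in> {Fin 0, Infty} \<union> (\<lambda>i. if i = 0 then Fin 0 else if i = 1 then Fin 1 else if i = 2 then Fin (x 0)
         else if i - 2 < m then Fin (x (i - 2)) else Infty) ` {..<n + 3}"
        then show "y \<in> marked x ` {..<Suc n + 3}" unfolding marked_image by (auto split: if_splits)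
      next
        fix y assume "y \<in> marked x ` {..<Suc n + 3}"
        then consider "y \<in> {Fin 0, Infty}" | "y = Fin 1" | i where "i < Suc n" "y = Fin (x i)"
          unfolding marked_image by auto
        then show "y \<in> {Fin 0, Infty} \<union> (\<lambda>i. if i = 0 then Fin 0 else if i = 1 then Fin 1 else if i = 2 then Fin (x 0)
         else if i - 2 < m then Fin (x (i - 2)) else Infty) ` {..<n + 3}"
        proof cases
          case 2 then show ?thesis by (intro UnI2 image_eqI[of _ _ 1]) auto
        next
          case (3 i)
          then show ?thesis using n by (intro UnI2 image_eqI[of _ _ "i + 2"]) auto
        qed auto
      qed
      finally have r2: "critical_values (q2 x) \<union> q2 x ` {Fin 0, Infty, Fin 1} = marked x ` {..<Suc n + 3}" .
      have r3: "q2 x (Fin (w2 i x)) = marked x i" if i: "i < m + 3" for i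
      proof -
        have "q2 x (Fin (w2 i x)) = pow_map 2 (a (r x) (marked (x' x) (j i)))"
          using elim(1) jm[OF i] by (simp add: q2_def w2_def)
        also have "\<dots> = marked x i"
          using i m0 unfolding img by (auto simp: j_def marked_def numeral_3_eq_3)
        finally show ?thesis .
      qed
      have r4: "cconv (\<lambda>k. q2 (X k)) (q2 x)" if X: "\<forall>i<m. (\<lambda>k. X k i) \<longlonglongrightarrow> x i" for X
      proof -
        have flX: "filterlim X (tfilter m x) sequentially" by (rule filterlim_tfilter) (use X in blast)
        have "(\<lambda>k. r (X k)) \<longlonglongrightarrow> r x" by (rule filterlim_compose[OF elim(5) flX])
        then have ca: "cconv (\<lambda>k. a (r (X k))) (a (r x))" unfolding a_def
          by (intro mob_cconv_eventually tendsto_intros) (use rx in auto)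
        have lx: "\<forall>i<m. (\<lambda>k. x' (X k) i) \<longlonglongrightarrow> x' x i"
        proof (intro allI impI)
          fix i assume "i < m"
          then have "((\<lambda>y. x' y i) \<longlongrightarrow> x' x i) (tfilter m x)" using elim(4) by simp
          from filterlim_compose[OF this flX] show "(\<lambda>k. x' (X k) i) \<longlonglongrightarrow> x' x i" .
        qed
        have all: "\<forall>X. (\<forall>i<m. (\<lambda>k. X k i) \<longlonglongrightarrow> x' x i) \<longrightarrow> cconv (\<lambda>k. q (X k)) (q (x' x))"
          using elim(1) by (elim conjE)
        have cq: "cconv (\<lambda>k. q (x' (X k))) (q (x' x))"
          by (rule all[THEN spec, of "\<lambda>k. x' (X k)", THEN mp, OF lx])
        show ?thesis unfolding q2_def
          by (intro cconv_comp ca cq cconv_const rat_continuous rp)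
      qed
      have r3': "\<forall>i<m + 3. q2 x (Fin (w2 i x)) = marked x i" using r3 by simp
      have r4': "\<forall>X. (\<forall>i<m. (\<lambda>k. X k i) \<longlonglongrightarrow> x i) \<longrightarrow> cconv (\<lambda>k. q2 (X k)) (q2 x)"
        by (rule allI, rule impI, rule r4)
      show ?case by (intro conjI r1 r2 r3' r4')
    qed
  qed
  then show ?thesis by blast
qed

lemma tower_family_exists:
  assumes "n \<le> m" "\<And>i. i < m \<Longrightarrow> x0 i \<noteq> 0 \<and> x0 i \<noteq> 1" "inj_on x0 {..<m}"
  shows "\<exists>q w. tower_family m n x0 q w"
  using assms
proof (induction n arbitrary: x0)
  case 0 then show ?case using tower_family_base by blast
next
  case (Suc n)
  show ?case by (rule tower_family_step) (use Suc in auto)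
qed

section \<open>An expanding map with critical values 0, 1 and infinity\<close>

text \<open>For even \<open>m\<close> a Belyi map: the inner power is ramified over \<open>0\<close> and \<open>\<infinity>\<close>, which the Cayley
  transform takes to \<open>1\<close> and \<open>-1\<close>, so that after the outer power only \<open>0\<close>, \<open>\<infinity>\<close>, \<open>1\<close> remain.\<close>

definition belyi :: "nat \<Rightarrow> nat \<Rightarrow> riemann_sphere \<Rightarrow> riemann_sphere" where
  "belyi m M = pow_map m \<circ> cayley \<circ> pow_map M"

lemma belyi:
  assumes "even m" "m \<ge> 2" "M \<ge> 2"
  shows "rat (belyi m M)" "critical_values (belyi m M) = {Fin 0, Infty, Fin 1}"
proof -
  have r: "rat (pow_map m)" "rat (pow_map M)" using assms by (auto intro!: rat_pow_map)
  then have r3: "rat (cayley \<circ> pow_map M)" using rat_comp[OF mobius_rat[OF mobius_cayley]] by blast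
  have e: "belyi m M = pow_map m \<circ> (cayley \<circ> pow_map M)" by (simp add: belyi_def comp_assoc)
  show "rat (belyi m M)" unfolding e by (rule rat_comp[OF r(1) r3])
  show "critical_values (belyi m M) = {Fin 0, Infty, Fin 1}"
    unfolding e critical_values_comp[OF r(1) r3] critical_points_mobius_comp(3)[OF mobius_cayley r(2)]
      critical_points_pow_map(2)[OF assms(2)] critical_points_pow_map(2)[OF assms(3)]
    using assms(1) by (auto simp: cayley_values)
qed

text \<open>For large \<open>m\<close> the points near \<open>v0\<close> have \<open>m\<close>-th roots arbitrarily close to any given point of the
  unit circle. As \<open>u ^ M\<close> is imaginary, its Cayley transform \<open>\<omega>\<close> lies on the unit circle, and a
  local inverse of the Cayley transform and the \<open>M\<close>-th power takes the roots close to \<open>\<omega>\<close> to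
  points close to \<open>u\<close>.\<close>

lemma belyi_section:
  assumes u: "u \<noteq> 0" "M \<ge> 1" "Re (u ^ M) = 0" and v0: "v0 \<noteq> 0" and \<epsilon>: "\<epsilon> > 0"
  shows "\<exists>m0. \<forall>m\<ge>m0. \<exists>\<sigma>. \<sigma> holomorphic_on ball v0 (cmod v0 / 2) \<and>
    (\<forall>v\<in>ball v0 (cmod v0 / 2). belyi m M (Fin (\<sigma> v)) = Fin v \<and> cmod (\<sigma> v - u) < \<epsilon>)"
proof -
  define c where "c = u ^ M"
  have c: "c \<noteq> 0" "Re c = 0" using u by (auto simp: c_def)
  have c1: "1 - c \<noteq> 0" "1 + c \<noteq> 0" using c(2) by (auto simp: complex_eq_iff)
  define \<omega> where "\<omega> = (1 + c) / (1 - c)"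
  have \<omega>n: "cmod \<omega> = 1"
  proof -
    have "cmod (1 + c) = cmod (1 - c)" using c(2) by (simp add: cmod_def)
    then show ?thesis using c1 by (simp add: \<omega>_def norm_divide)
  qed
  have \<omega>1: "\<omega> + 1 = 2 / (1 - c)" "\<omega> - 1 = 2 * c / (1 - c)" using c1 by (auto simp: \<omega>_def field_simps)
  then have \<omega>c: "(\<omega> - 1) / (\<omega> + 1) = c" using c1 by simp
  have \<omega>ne: "\<omega> + 1 \<noteq> 0" using \<omega>1 c1 by simp
  (* \<tau> e is the point near u that the M-th power and the Cayley transform take to \<omega> * exp e. *)
  define k where "k e = (\<omega> * exp e - 1) / (\<omega> * exp e + 1) / c" for e
  define \<tau> where "\<tau> e = u * exp (Ln (k e) / of_nat M)" for e
  have k0: "k 0 = 1" using \<omega>c c by (simp add: k_def)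
  have \<tau>0: "\<tau> 0 = u" by (simp add: \<tau>_def k0)
  have ck: "isCont k 0" unfolding k_def using \<omega>ne c(1) by (intro continuous_intros) auto
  have k0n: "k 0 \<notin> \<real>\<^sub>\<le>\<^sub>0" by (simp add: k0)
  have c\<tau>: "isCont \<tau> 0" unfolding \<tau>_def using ck k0n u(2) by (intro continuous_intros) auto
  have "\<forall>\<^sub>F e in nhds 0. \<omega> * exp e + 1 \<noteq> 0"
  proof -
    have "((\<lambda>e. \<omega> * exp e + 1) \<longlongrightarrow> \<omega> * exp 0 + 1) (nhds 0)" by (intro tendsto_intros filterlim_ident)
    then show ?thesis by (rule tendsto_imp_eventually_ne) (use \<omega>ne in simp)
  qed
  moreover have "\<forall>\<^sub>F e in nhds 0. k e \<in> - \<real>\<^sub>\<le>\<^sub>0"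
  proof (rule topological_tendstoD)
    show "(k \<longlongrightarrow> k 0) (nhds 0)" using ck by (simp add: isCont_def tendsto_at_iff_tendsto_nhds)
  qed (use k0n in \<open>auto simp: open_Compl\<close>)
  moreover have "\<forall>\<^sub>F e in nhds 0. dist (\<tau> e) u < \<epsilon>"
    using c\<tau> \<epsilon> unfolding \<tau>0[symmetric] isCont_def tendsto_at_iff_tendsto_nhds by (rule tendstoD)
  ultimately have "\<forall>\<^sub>F e in nhds 0. \<omega> * exp e + 1 \<noteq> 0 \<and> k e \<notin> \<real>\<^sub>\<le>\<^sub>0 \<and> dist (\<tau> e) u < \<epsilon>"
    by eventually_elim auto
  then obtain \<rho> where \<rho>: "\<rho> > 0" "\<And>e. cmod e < \<rho> \<Longrightarrow> \<omega> * exp e + 1 \<noteq> 0 \<and> k e \<notin> \<real>\<^sub>\<le>\<^sub>0 \<and> dist (\<tau> e) u < \<epsilon>"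
    by (auto simp: eventually_nhds_metric)
  have \<tau>hol: "\<tau> holomorphic_on ball 0 \<rho>"
  proof -
    have "k holomorphic_on ball 0 \<rho>" unfolding k_def using \<rho>(2) c(1) by (intro holomorphic_intros) auto
    then show ?thesis unfolding \<tau>_def using \<rho>(2) by (intro holomorphic_intros) (auto simp: u(2))
  qed
  have \<tau>M: "belyi m M (Fin (\<tau> e)) = Fin ((\<omega> * exp e) ^ m)" if "cmod e < \<rho>" for e m
  proof -
    have "k e \<noteq> 0" using \<rho>(2)[OF that] by auto
    have "\<tau> e ^ M = u ^ M * exp (of_nat M * (Ln (k e) / of_nat M))"
      unfolding \<tau>_def power_mult_distrib exp_of_nat_mult ..
    also have "\<dots> = c * k e" using u(2) \<open>k e \<noteq> 0\<close> by (simp add: c_def)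
    also have "\<dots> = (\<omega> * exp e - 1) / (\<omega> * exp e + 1)" using c(1) by (simp add: k_def)
    finally show ?thesis using cayley_inverse[of "\<omega> * exp e"] \<rho>(2)[OF that]
      by (simp add: belyi_def eq_neg_iff_add_eq_0)
  qed
  define C where "C = \<bar>ln (cmod v0)\<bar> + pi"
  obtain C1 where C1: "C1 > 0" "\<And>z. z \<in> cball 1 (1/2) \<Longrightarrow> cmod (Ln z) \<le> C1"
  proof -
    have "z \<notin> \<real>\<^sub>\<le>\<^sub>0" if "z \<in> cball 1 (1/2)" for z :: complex
    proof
      assume "z \<in> \<real>\<^sub>\<le>\<^sub>0"
      then have "Re z \<le> 0" by (simp add: complex_nonpos_Reals_iff)
      then have "cmod (1 - z) \<ge> 1" using complex_Re_le_cmod[of "1 - z"] by simp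
      then show False using that by (simp add: dist_norm)
    qed
    then have "continuous_on (cball 1 (1/2)) Ln" by (intro continuous_intros) auto
    then have "bounded (Ln ` cball 1 (1/2))" by (intro compact_imp_bounded compact_continuous_image) auto
    then show ?thesis using that by (auto simp: bounded_pos)
  qed
  obtain m0 :: nat where m0: "real m0 > (C1 + C) / \<rho>" using reals_Archimedean2 by blast
  have "\<exists>\<sigma>. \<sigma> holomorphic_on ball v0 (cmod v0 / 2) \<and>
    (\<forall>v\<in>ball v0 (cmod v0 / 2). belyi m M (Fin (\<sigma> v)) = Fin v \<and> cmod (\<sigma> v - u) < \<epsilon>)" if m: "m \<ge> Suc m0" for m
  proof -
    have m1: "real m > (C1 + C) / \<rho>" "m > 0" using m0 m by auto
    (* (\<omega> * exp (\<eta> v)) ^ m = v, and \<eta> v is small because the sum of logarithms is bounded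
       independently of m. *)
    define \<eta> where "\<eta> v = (Ln (v / v0) + Ln (v0 / \<omega> ^ m)) / of_nat m" for v
    have \<omega>m: "\<omega> ^ m \<noteq> 0" "cmod (\<omega> ^ m) = 1" using \<omega>n by (auto simp: norm_power)
    have ball: "v / v0 \<in> cball 1 (1/2)" if "v \<in> ball v0 (cmod v0 / 2)" for v
    proof -
      have "cmod (1 - v / v0) = cmod (v0 - v) / cmod v0" using v0 by (simp add: norm_divide[symmetric] diff_divide_distrib)
      also have "\<dots> \<le> 1 / 2" using that v0 by (simp add: dist_norm field_simps)
      finally show ?thesis by (simp add: dist_norm)
    qed
    have slit: "v / v0 \<notin> \<real>\<^sub>\<le>\<^sub>0" if "v \<in> ball v0 (cmod v0 / 2)" for v
    proof
      assume "v / v0 \<in> \<real>\<^sub>\<le>\<^sub>0"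
      then have "Re (v / v0) \<le> 0" by (simp add: complex_nonpos_Reals_iff)
      then have "cmod (1 - v / v0) \<ge> 1" using complex_Re_le_cmod[of "1 - v / v0"] by simp
      then show False using ball[OF that] by (simp add: dist_norm)
    qed
    have \<eta>hol: "\<eta> holomorphic_on ball v0 (cmod v0 / 2)"
      unfolding \<eta>_def using slit v0 m1(2) by (intro holomorphic_intros) auto
    have \<eta>small: "cmod (\<eta> v) < \<rho>" if "v \<in> ball v0 (cmod v0 / 2)" for v
    proof -
      have "cmod (Ln (v0 / \<omega> ^ m)) \<le> \<bar>Re (Ln (v0 / \<omega> ^ m))\<bar> + \<bar>Im (Ln (v0 / \<omega> ^ m))\<bar>" by (rule cmod_le)
      also have "\<dots> \<le> C"
      proof -
        have nz: "v0 / \<omega> ^ m \<noteq> 0" using v0 \<omega>m by simp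
        have "cmod (v0 / \<omega> ^ m) = cmod v0" using \<omega>m by (simp add: norm_divide)
        then have "Re (Ln (v0 / \<omega> ^ m)) = ln (cmod v0)" using Re_Ln[OF nz] by simp
        moreover have "\<bar>Im (Ln (v0 / \<omega> ^ m))\<bar> \<le> pi" using mpi_less_Im_Ln[OF nz] Im_Ln_le_pi[OF nz] by linarith
        ultimately show ?thesis by (simp add: C_def)
      qed
      finally have "cmod (Ln (v / v0) + Ln (v0 / \<omega> ^ m)) \<le> C1 + C"
        using C1(2)[OF ball[OF that]] norm_triangle_mono by blast
      also have "\<dots> < \<rho> * real m" using m1 \<rho>(1) by (simp add: field_simps)
      finally show ?thesis using m1(2) by (simp add: \<eta>_def norm_divide field_simps)
    qed
    have "(\<omega> * exp (\<eta> v)) ^ m = v" if "v \<in> ball v0 (cmod v0 / 2)" for v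
    proof -
      have "v / v0 \<noteq> 0" using slit[OF that] by auto
      have "(\<omega> * exp (\<eta> v)) ^ m = \<omega> ^ m * exp (of_nat m * \<eta> v)" unfolding power_mult_distrib exp_of_nat_mult ..
      also have "of_nat m * \<eta> v = Ln (v / v0) + Ln (v0 / \<omega> ^ m)" using m1(2) by (simp add: \<eta>_def)
      also have "\<omega> ^ m * exp \<dots> = v"
        using \<open>v / v0 \<noteq> 0\<close> v0 \<omega>m by (simp add: exp_add)
      finally show ?thesis .
    qed
    moreover have "(\<lambda>v. \<tau> (\<eta> v)) holomorphic_on ball v0 (cmod v0 / 2)"
    proof -
      have "\<eta> ` ball v0 (cmod v0 / 2) \<subseteq> ball 0 \<rho>" using \<eta>small by auto
      from holomorphic_on_compose_gen[OF \<eta>hol \<tau>hol this] show ?thesis by (simp add: o_def)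
    qed
    ultimately show ?thesis using \<tau>M \<eta>small \<rho>(2)
      by (intro exI[of _ "\<lambda>v. \<tau> (\<eta> v)"]) (auto simp: dist_norm)
  qed
  then show ?thesis by blast
qed

section \<open>Rigid maps from contracting families\<close>

lemma postcritical_forward: "f ` postcritical_set f \<subseteq> postcritical_set f"
proof -
  have "f ((f ^^ n) v) \<in> postcritical_set f" if "v \<in> critical_values f" for n v
    unfolding postcritical_set_def using that by (intro UN_I[of "Suc n"]) auto
  then show ?thesis by (auto simp: postcritical_set_def)
qed

lemma critical_values_subset: "critical_values f \<subseteq> postcritical_set f"
  unfolding postcritical_set_def by (intro UN_upper[of 0, THEN subset_trans[rotated]]) auto

lemma postcritical_eq:
  assumes "f ` critical_values f \<subseteq> critical_values f" shows "postcritical_set f = critical_values f"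
proof -
  have "(f ^^ n) ` critical_values f \<subseteq> critical_values f" for n
  proof (induction n)
    case (Suc n)
    have "(f ^^ Suc n) ` critical_values f = f ` (f ^^ n) ` critical_values f" by (simp add: image_comp)
    also have "\<dots> \<subseteq> critical_values f" using Suc assms by blast
    finally show ?case .
  qed simp
  then show ?thesis using critical_values_subset unfolding postcritical_set_def by blast
qed

text \<open>Counterexamples to rigidity for the tolerances \<open>1 / Suc n\<close> form a uniformly convergent sequence.\<close>

lemma rigidI:
  assumes "postcritically_finite f"
    and "\<And>g. cconv g f \<Longrightarrow> (\<And>n. postcritically_finite (g n)) \<Longrightarrow>
      (\<And>n. card (postcritical_set (g n)) = card (postcritical_set f)) \<Longrightarrow> \<exists>n. conformally_conjugate f (g n)"
  shows "rigid f"
proof (rule ccontr)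
  assume "\<not> rigid f"
  then have "\<exists>g. postcritically_finite g \<and> (\<forall>x. dist (g x) (f x) < \<epsilon>) \<and>
        card (postcritical_set g) = card (postcritical_set f) \<and> \<not> conformally_conjugate f g" if "\<epsilon> > 0" for \<epsilon>
    using assms(1) that unfolding rigid_def by blast
  then have "\<forall>n. \<exists>g. postcritically_finite g \<and> (\<forall>x. dist (g x) (f x) < 1 / Suc n) \<and>
        card (postcritical_set g) = card (postcritical_set f) \<and> \<not> conformally_conjugate f g"
    by (simp del: of_nat_Suc)
  then obtain g where g: "\<And>n. postcritically_finite (g n)" "\<And>n x. dist (g n x) (f x) < 1 / Suc n"
    "\<And>n. card (postcritical_set (g n)) = card (postcritical_set f)" "\<And>n. \<not> conformally_conjugate f (g n)" by metis
  have "cconv g f"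
  proof (rule cconvI_uniform)
    show "continuous_on UNIV f" using rat_continuous[OF postcritically_finite_rat[OF assms(1)]] .
    fix e :: real assume e: "e > 0"
    from eventually_inverse_Suc_less[OF e] show "\<forall>\<^sub>F n in sequentially. \<forall>x. dist (g n x) (f x) < e"
      by eventually_elim (use g(2) in \<open>meson order.strict_trans\<close>)
  qed
  then show False using assms(2) g by blast
qed

text \<open>What the construction has to provide: maps \<open>fam y\<close> with the entries of \<open>y\<close> as critical values,
  equivariant under Moebius transformations, and for each \<open>i\<close> a holomorphically varying point
  \<open>\<Phi> y i\<close> of the fibre over \<open>y (FI i)\<close>. At a fixed point of \<open>\<Phi>\<close> the critical values move according
  to \<open>FI\<close>. The image of \<open>\<Phi>\<close> lies well inside the polydisc, so that \<open>contracting_fixed_point\<close> applies.\<close>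

locale contracting_family =
  fixes N :: nat and u :: "nat \<Rightarrow> complex" and \<delta> :: real
    and fam :: "(nat \<Rightarrow> complex) \<Rightarrow> riemann_sphere \<Rightarrow> riemann_sphere"
    and \<Phi> :: "(nat \<Rightarrow> complex) \<Rightarrow> nat \<Rightarrow> complex" and FI :: "nat \<Rightarrow> nat"
  assumes N3: "N \<ge> 3" and \<delta>: "\<delta> > 0" and FI: "\<And>i. i < N \<Longrightarrow> FI i < N"
    and fam_rat: "\<And>y. tnear N u \<delta> y \<Longrightarrow> rat (fam y)"
    and fam_values: "\<And>y. tnear N u \<delta> y \<Longrightarrow> critical_values (fam y) = (\<lambda>i. Fin (y i)) ` {..<N}"
    and fam_inj: "\<And>y. tnear N u \<delta> y \<Longrightarrow> inj_on y {..<N}"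
    and fam_cconv: "\<And>y Y. tnear N u \<delta> y \<Longrightarrow> (\<And>i. i < N \<Longrightarrow> (\<lambda>k. Y k i) \<longlonglongrightarrow> y i) \<Longrightarrow> cconv (\<lambda>k. fam (Y k)) (fam y)"
    and fam_mobius: "\<And>y z M. tnear N u \<delta> y \<Longrightarrow> mobius M \<Longrightarrow> (\<And>i. i < N \<Longrightarrow> M (Fin (y i)) = Fin (z i)) \<Longrightarrow> fam z = M \<circ> fam y"
    and section_eq: "\<And>y i. tnear N u \<delta> y \<Longrightarrow> i < N \<Longrightarrow> fam y (Fin (\<Phi> y i)) = Fin (y (FI i))"
    and section_hol: "\<And>i. i < N \<Longrightarrow> thol_on N u \<delta> (\<lambda>y. \<Phi> y i)"
    and section_bound: "\<And>y i. tnear N u \<delta> y \<Longrightarrow> i < N \<Longrightarrow> cmod (\<Phi> y i - u i) < \<delta> / 8"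
begin

lemma section_continuous:
  assumes y: "tnear N u \<delta> y" "\<forall>i<N. \<Phi> y i = y i" and Y': "\<forall>i<N. (\<lambda>k. Y k i) \<longlonglongrightarrow> y i" and i: "i < N"
  shows "(\<lambda>k. \<Phi> (Y k) i) \<longlonglongrightarrow> y i"
proof (rule tendstoI)
  fix \<epsilon> :: real assume \<epsilon>: "\<epsilon> > 0"
  note Y = Y'[rule_format]
  have y8: "cmod (y i - u i) < \<delta> / 8" if "i < N" for i using section_bound[OF y(1) that] y(2)[rule_format, OF that] by simp
  define e where "e = min \<epsilon> (\<delta> / 4)"
  have e: "e > 0" "e \<le> \<delta> / 4" "e \<le> \<epsilon>" using \<epsilon> \<delta> by (auto simp: e_def)
  have "\<forall>\<^sub>F k in sequentially. \<forall>i\<in>{..<N}. cmod (Y k i - u i) < \<delta> / 8 \<and> dist (Y k i) (y i) < e"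
  proof (rule eventually_ball_finite, simp, rule ballI)
    fix i assume "i \<in> {..<N}"
    then have i: "i < N" by simp
    have "(\<lambda>k. cmod (Y k i - u i)) \<longlonglongrightarrow> cmod (y i - u i)" by (intro tendsto_intros Y i)
    from order_tendstoD(2)[OF this y8[OF i]] tendstoD[OF Y[OF i] e(1)]
    show "\<forall>\<^sub>F k in sequentially. cmod (Y k i - u i) < \<delta> / 8 \<and> dist (Y k i) (y i) < e" by (rule eventually_conj)
  qed
  then show "\<forall>\<^sub>F k in sequentially. dist (\<Phi> (Y k) i) (y i) < \<epsilon>"
  proof eventually_elim
    case (elim k)
    have "cmod (\<Phi> (Y k) i - \<Phi> y i) \<le> 4 * (\<delta> / 8) / \<delta> * e"
      by (rule thol_on_difference[OF section_hol[OF i], where b = "u i"])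
        (use section_bound i e elim y8 in \<open>auto simp: dist_norm less_imp_le\<close>)
    then show ?case using e \<delta> y(2)[rule_format, OF i] by (simp add: dist_norm)
  qed
qed

lemma fixed_point_dynamics:
  assumes y: "tnear N u \<delta> y" "\<forall>i<N. \<Phi> y i = y i"
  shows "\<And>i. i < N \<Longrightarrow> fam y (Fin (y i)) = Fin (y (FI i))"
    "postcritical_set (fam y) = (\<lambda>i. Fin (y i)) ` {..<N}"
    "card (postcritical_set (fam y)) = N" "postcritically_finite (fam y)"
proof -
  show dyn: "fam y (Fin (y i)) = Fin (y (FI i))" if "i < N" for i
    using section_eq[OF y(1) that] y(2)[rule_format, OF that] by simp
  note V = fam_values[OF y(1)]
  have "fam y ` critical_values (fam y) \<subseteq> critical_values (fam y)" unfolding V using dyn FI by auto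
  then show P: "postcritical_set (fam y) = (\<lambda>i. Fin (y i)) ` {..<N}" using postcritical_eq V by metis
  have "inj_on (\<lambda>i. Fin (y i)) {..<N}" using fam_inj[OF y(1)] by (auto simp: inj_on_def)
  then show "card (postcritical_set (fam y)) = N" unfolding P by (simp add: card_image)
  have "critical_values (fam y) \<noteq> {}" unfolding V using N3 by (auto simp: lessThan_empty_iff)
  then show "postcritically_finite (fam y)"
    unfolding postcritically_finite_def P using rat_degree_ge_2[OF fam_rat[OF y(1)]] by simp
qed

text \<open>Let \<open>g n\<close> converge to \<open>f = fam y\<close>, with as many postcritical points. Every critical value of \<open>f\<close>
  is a limit of critical values of \<open>g n\<close>, so these are, by the count, the whole postcritical set
  and form a tuple \<open>Y n\<close> near \<open>y\<close>. By \<open>equal_up_to_mobius\<close>, \<open>g n = fam (Y n) \<circ> M n\<close> with \<open>M n\<close> near the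
  identity. This is conjugate to \<open>M n \<circ> fam (Y n) = fam (Z n)\<close>, where \<open>Z n\<close> is the image of \<open>Y n\<close>
  under \<open>M n\<close>. Critical values being separated, \<open>fam (Z n)\<close> moves the entries of \<open>Z n\<close> according to
  \<open>FI\<close>, just as \<open>f\<close> moves those of \<open>y\<close>. So \<open>Z n i\<close> and \<open>\<Phi> (Z n) i\<close> are points near \<open>y i\<close> in the same
  fibre over a critical value, hence equal by \<open>fibre_point_unique\<close>. The fixed point \<open>Z n\<close> of \<open>\<Phi>\<close>
  can only be \<open>y\<close>, and \<open>g n\<close> is conjugate to \<open>f\<close>.\<close>

theorem fixed_point_rigid:
  assumes y: "tnear N u \<delta> y" "\<forall>i<N. \<Phi> y i = y i"
  shows "rigid (fam y)"
proof (rule rigidI)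
  let ?f = "fam y"
  note dyn = fixed_point_dynamics[OF y]
  show "postcritically_finite ?f" by (rule dyn(4))
  note V = fam_values[OF y(1)]
  have Vcard: "card (critical_values ?f) = N" using dyn(2,3) V by simp
  have infV: "Infty \<notin> critical_values ?f" unfolding V by auto
  have fr: "rat ?f" by (rule fam_rat[OF y(1)])
  have fin_inj: "inj_on (\<lambda>i. Fin (y i)) {..<N}" using fam_inj[OF y(1)] by (auto simp: inj_on_def)
  fix g0
  assume g0: "cconv g0 ?f" "\<And>n. postcritically_finite (g0 n)"
    "\<And>n. card (postcritical_set (g0 n)) = card (postcritical_set ?f)"
  have rg0: "rat (g0 n)" for n by (rule postcritically_finite_rat[OF g0(2)])
  have "\<forall>i. \<exists>s. i < N \<longrightarrow> s \<longlonglongrightarrow> Fin (y i) \<and> (\<forall>\<^sub>F n in sequentially. s n \<in> critical_values (g0 n))"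
  proof
    fix i
    show "\<exists>s. i < N \<longrightarrow> s \<longlonglongrightarrow> Fin (y i) \<and> (\<forall>\<^sub>F n in sequentially. s n \<in> critical_values (g0 n))"
    proof (cases "i < N")
      case True
      then have "Fin (y i) \<in> critical_values ?f" using V by auto
      from critical_value_sequence[OF fr infV g0(1) rg0 this] show ?thesis by blast
    qed simp
  qed
  from choice[OF this] obtain s where s: "\<And>i. i < N \<Longrightarrow> s i \<longlonglongrightarrow> Fin (y i)"
    "\<And>i. i < N \<Longrightarrow> \<forall>\<^sub>F n in sequentially. s i n \<in> critical_values (g0 n)" by blast
  define Y0 where "Y0 n i = (if i < N then fin_part (s i n) else y i)" for n i
  have Y0lim: "(\<lambda>n. Y0 n i) \<longlonglongrightarrow> y i" if "i < N" for i
    using eventually_finite(2)[OF s(1)[OF that]] that by (simp add: Y0_def)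
  have near_ev: "\<forall>\<^sub>F n in sequentially. tnear N u \<delta> (Z n)" if "\<forall>i<N. (\<lambda>n. Z n i) \<longlonglongrightarrow> y i" for Z
  proof -
    have "\<forall>\<^sub>F n in sequentially. \<forall>i\<in>{..<N}. cmod (Z n i - u i) < \<delta>"
    proof (rule eventually_ball_finite, simp, rule ballI)
      fix i assume "i \<in> {..<N}"
      then have i: "i < N" by simp
      have "(\<lambda>n. cmod (Z n i - u i)) \<longlonglongrightarrow> cmod (y i - u i)" by (intro tendsto_intros that[rule_format] i)
      then show "\<forall>\<^sub>F n in sequentially. cmod (Z n i - u i) < \<delta>"
        using y(1) i by (intro order_tendstoD(2)) (auto simp: tnear_def)
    qed
    then show ?thesis by eventually_elim (simp add: tnear_def)
  qed
  have "\<forall>\<^sub>F n in sequentially. \<forall>i\<in>{..<N}. s i n \<in> critical_values (g0 n) \<and> s i n = Fin (Y0 n i)"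
  proof (rule eventually_ball_finite, simp, rule ballI)
    fix i assume "i \<in> {..<N}"
    then have i: "i < N" by simp
    have "\<forall>\<^sub>F n in sequentially. s i n = Fin (Y0 n i)"
      using eventually_finite(3)[OF s(1)[OF i]] i by (simp add: Y0_def)
    with s(2)[OF i] show "\<forall>\<^sub>F n in sequentially. s i n \<in> critical_values (g0 n) \<and> s i n = Fin (Y0 n i)"
      by (rule eventually_conj)
  qed
  moreover have "\<forall>\<^sub>F n in sequentially. tnear N u \<delta> (Y0 n)" by (rule near_ev) (use Y0lim in blast)
  ultimately have "\<forall>\<^sub>F n in sequentially. tnear N u \<delta> (Y0 n) \<and> critical_values (g0 n) = (\<lambda>i. Fin (Y0 n i)) ` {..<N} \<and>
     postcritical_set (g0 n) = critical_values (g0 n)"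
  proof eventually_elim
    case (elim n)
    note elim = elim(2,1)
    have inj: "inj_on (\<lambda>i. Fin (Y0 n i)) {..<N}" using fam_inj[OF elim(1)] by (auto simp: inj_on_def)
    have finP: "finite (postcritical_set (g0 n))" using g0(2) by (simp add: postcritically_finite_def)
    have cardP: "card (postcritical_set (g0 n)) = N" using g0(3) dyn(3) by simp
    have sub: "(\<lambda>i. Fin (Y0 n i)) ` {..<N} \<subseteq> critical_values (g0 n)"
    proof
      fix v assume "v \<in> (\<lambda>i. Fin (Y0 n i)) ` {..<N}"
      then obtain i where i: "i \<in> {..<N}" "v = Fin (Y0 n i)" by blast
      have "s i n \<in> critical_values (g0 n) \<and> s i n = Fin (Y0 n i)" by (rule bspec[OF elim(2) i(1)])
      then show "v \<in> critical_values (g0 n)" using i(2) by metis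
    qed
    then have "(\<lambda>i. Fin (Y0 n i)) ` {..<N} = postcritical_set (g0 n)"
      using critical_values_subset by (intro card_subset_eq[OF finP]) (auto simp: card_image[OF inj] cardP)
    then show ?case using sub critical_values_subset[of "g0 n"] elim(1) by blast
  qed
  then obtain n0 where n0: "\<And>n. n \<ge> n0 \<Longrightarrow> tnear N u \<delta> (Y0 n) \<and> critical_values (g0 n) = (\<lambda>i. Fin (Y0 n i)) ` {..<N} \<and>
     postcritical_set (g0 n) = critical_values (g0 n)" by (auto simp: eventually_sequentially)
  (* From here on a tail of the sequence, for which the above holds without exception. *)
  define g where "g n = g0 (n + n0)" for n
  define Y where "Y n = Y0 (n + n0)" for n
  have gc: "cconv g ?f" unfolding g_def[abs_def] by (rule cconv_subseq[OF g0(1)]) (simp add: strict_mono_def)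
  have gr: "rat (g n)" for n using rg0 by (simp add: g_def)
  have Ynear: "tnear N u \<delta> (Y n)" and gV: "critical_values (g n) = (\<lambda>i. Fin (Y n i)) ` {..<N}"
    and gP: "postcritical_set (g n) = critical_values (g n)" for n
    using n0[of "n + n0"] by (simp_all add: g_def Y_def)
  have Ylim: "(\<lambda>n. Y n i) \<longlonglongrightarrow> y i" if "i < N" for i
    unfolding Y_def by (rule LIMSEQ_ignore_initial_segment[OF Y0lim[OF that]])
  define h where "h n = fam (Y n)" for n
  have hc: "cconv h ?f" unfolding h_def[abs_def] by (rule fam_cconv[OF y(1) Ylim])
  have hr: "rat (h n)" for n unfolding h_def by (rule fam_rat[OF Ynear])
  have hV: "critical_values (h n) = critical_values (g n)" for n unfolding h_def gV by (rule fam_values[OF Ynear])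
  have cardV: "card (critical_values (g n)) = card (critical_values ?f)" for n
  proof -
    have "inj_on (\<lambda>i. Fin (Y n i)) {..<N}" using fam_inj[OF Ynear] by (auto simp: inj_on_def)
    then show ?thesis unfolding gV Vcard by (simp add: card_image)
  qed
  have "card (critical_values ?f) \<ge> 3" using Vcard N3 by simp
  from equal_up_to_mobius[OF fr infV this gc gr hc hr hV[symmetric] cardV] obtain M where
    M: "\<And>n. mobius (M n)" "cconv M id" "\<forall>\<^sub>F n in sequentially. g n = h n \<circ> M n" by blast
  have gdyn: "\<forall>\<^sub>F n in sequentially. \<forall>i\<in>{..<N}. g n (Fin (Y n i)) = Fin (Y n (FI i))"
  proof (rule eventually_ball_finite, simp, rule ballI)
    fix i assume "i \<in> {..<N}"
    then have i: "i < N" by simp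
    have l: "(\<lambda>n. g n (Fin (Y n i))) \<longlonglongrightarrow> Fin (y (FI i))"
      using cconvD[OF gc tendsto_Fin[OF Ylim[OF i]]] dyn(1)[OF i] by simp
    have "Fin (y (FI i)) \<in> critical_values ?f" unfolding V using FI[OF i] by auto
    from critical_value_unique[OF fr infV gc gr cardV this, of "\<lambda>n. Fin (Y n (FI i))"]
    obtain \<eta> where \<eta>: "\<eta> > 0" "\<forall>\<^sub>F n in sequentially. \<forall>w\<in>critical_values (g n). dist w (Fin (y (FI i))) < \<eta> \<longrightarrow> w = Fin (Y n (FI i))"
      using Ylim[OF FI[OF i]] gV FI[OF i] by (auto simp: always_eventually)
    show "\<forall>\<^sub>F n in sequentially. g n (Fin (Y n i)) = Fin (Y n (FI i))"
      using \<eta>(2) tendstoD[OF l \<eta>(1)]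
    proof eventually_elim
      case (elim n)
      have "Fin (Y n i) \<in> postcritical_set (g n)" unfolding gP gV using i by auto
      then have "g n (Fin (Y n i)) \<in> critical_values (g n)" using postcritical_forward[of "g n"] gP[of n] by blast
      then show ?case using elim by blast
    qed
  qed
  (* The entries from N on are those of y, so that agreement of the first N entries is equality. *)
  define Z0 where "Z0 n i = (if i < N then fin_part (M n (Fin (Y n i))) else y i)" for n i
  have MY: "(\<lambda>n. M n (Fin (Y n i))) \<longlonglongrightarrow> Fin (y i)" if "i < N" for i
    using cconvD[OF M(2) tendsto_Fin[OF Ylim[OF that]]] by simp
  have Z0lim: "(\<lambda>n. Z0 n i) \<longlonglongrightarrow> y i" if "i < N" for i
    using eventually_finite(2)[OF MY[OF that]] that by (simp add: Z0_def)
  have evM: "\<forall>\<^sub>F n in sequentially. \<forall>i\<in>{..<N}. M n (Fin (Y n i)) = Fin (Z0 n i)"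
  proof (rule eventually_ball_finite, simp, rule ballI)
    fix i assume "i \<in> {..<N}"
    then show "\<forall>\<^sub>F n in sequentially. M n (Fin (Y n i)) = Fin (Z0 n i)"
      using eventually_finite(3)[OF MY, of i] by (simp add: Z0_def)
  qed
  have evZ0: "\<forall>\<^sub>F n in sequentially. tnear N u \<delta> (Z0 n)" by (rule near_ev) (use Z0lim in blast)
  (* The finitely many tuples outside the domain of the family are replaced by y. *)
  define Z where "Z n = (if tnear N u \<delta> (Z0 n) then Z0 n else y)" for n
  have Znear: "tnear N u \<delta> (Z n)" for n using y(1) by (simp add: Z_def)
  have evZ: "\<forall>\<^sub>F n in sequentially. Z n = Z0 n" using evZ0 by eventually_elim (simp add: Z_def)
  have Zlim: "(\<lambda>n. Z n i) \<longlonglongrightarrow> y i" if "i < N" for i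
    by (rule Lim_transform_eventually[OF Z0lim[OF that]]) (use evZ in eventually_elim, simp)
  define k where "k n = fam (Z n)" for n
  have kc: "cconv k ?f" unfolding k_def[abs_def] by (rule fam_cconv[OF y(1) Zlim])
  have kr: "rat (k n)" for n unfolding k_def by (rule fam_rat[OF Znear])
  have kV: "critical_values (k n) = (\<lambda>i. Fin (Z n i)) ` {..<N}" for n unfolding k_def by (rule fam_values[OF Znear])
  have kcard: "card (critical_values (k n)) = card (critical_values ?f)" for n
  proof -
    have "inj_on (\<lambda>i. Fin (Z n i)) {..<N}" using fam_inj[OF Znear] by (auto simp: inj_on_def)
    then show ?thesis unfolding kV Vcard by (simp add: card_image)
  qed
  have evk: "\<forall>\<^sub>F n in sequentially. k n = M n \<circ> h n"
    using evM evZ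
  proof eventually_elim
    case (elim n)
    show ?case unfolding k_def h_def by (rule fam_mobius[OF Ynear M(1)]) (use elim in simp)
  qed
  have kdyn: "\<forall>\<^sub>F n in sequentially. \<forall>i<N. k n (Fin (Z n i)) = Fin (Z n (FI i))"
    using evM evZ evk M(3) gdyn
  proof eventually_elim
    case (elim n)
    show ?case
    proof (intro allI impI)
      fix i assume i: "i < N"
      have "k n (Fin (Z n i)) = M n (h n (M n (Fin (Y n i))))" using elim(1,2,3) i by simp
      also have "\<dots> = M n (g n (Fin (Y n i)))" using elim(4) by simp
      also have "\<dots> = Fin (Z n (FI i))" using elim(1,2,5) i FI[OF i] by simp
      finally show "k n (Fin (Z n i)) = Fin (Z n (FI i))" .
    qed
  qed
  have "\<forall>\<^sub>F n in sequentially. \<forall>i\<in>{..<N}. Fin (\<Phi> (Z n) i) = Fin (Z n i)"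
  proof (rule eventually_ball_finite, simp, rule ballI)
    fix i assume "i \<in> {..<N}"
    then have i: "i < N" by simp
    show "\<forall>\<^sub>F n in sequentially. Fin (\<Phi> (Z n) i) = Fin (Z n i)"
    proof (rule fibre_point_unique[OF fr infV kc kr kcard])
      show "?f (Fin (y i)) \<in> critical_values ?f" using dyn(1)[OF i] FI[OF i] V by auto
      show "(\<lambda>n. Fin (\<Phi> (Z n) i)) \<longlonglongrightarrow> Fin (y i)" by (intro tendsto_Fin section_continuous[OF y _ i]) (use Zlim in blast)
      show "(\<lambda>n. Fin (Z n i)) \<longlonglongrightarrow> Fin (y i)" by (intro tendsto_Fin Zlim i)
      show "\<forall>\<^sub>F n in sequentially. k n (Fin (\<Phi> (Z n) i)) = k n (Fin (Z n i)) \<and> k n (Fin (\<Phi> (Z n) i)) \<in> critical_values (k n)"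
        using kdyn
      proof eventually_elim
        case (elim n)
        have "k n (Fin (\<Phi> (Z n) i)) = Fin (Z n (FI i))" unfolding k_def by (rule section_eq[OF Znear i])
        then show ?case using elim i kV FI[OF i] by auto
      qed
    qed
  qed
  with evZ evk M(3) have "\<forall>\<^sub>F n in sequentially. conformally_conjugate ?f (g n)"
  proof eventually_elim
    case (elim n)
    have "Z n i = y i" if "i < N" for i
      by (rule contracting_fixed_point(2)[where \<Phi> = \<Phi>, OF \<delta> section_hol _ Znear y(1) _ y(2)[rule_format] that])
        (use section_bound elim(4) in \<open>auto intro: less_imp_le\<close>)
    then have "Z n = y" using elim(1) by (auto simp: Z0_def fun_eq_iff)
    then have f: "?f = M n \<circ> h n" using elim(2) by (simp add: k_def)
    have "g n = inv (M n) \<circ> ?f \<circ> M n"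
    proof
      fix x show "g n x = (inv (M n) \<circ> ?f \<circ> M n) x"
        using elim(3) f mobius_inv_apply(2)[OF M(1), of n] by simp
    qed
    moreover have "inv (inv (M n)) = M n" using mobius_inv(4)[OF M(1)] by (rule inv_inv_eq)
    ultimately show ?case unfolding conformally_conjugate_def
      using mobius_automorphism[OF mobius_inv(1)[OF M(1), of n]] by (intro exI[of _ "inv (M n)"]) simp
  qed
  then obtain n where "conformally_conjugate ?f (g n)" by (auto simp: eventually_sequentially)
  then show "\<exists>n. conformally_conjugate ?f (g0 n)" unfolding g_def by blast
qed

end

section \<open>Existence of contracting families\<close>

text \<open>For large \<open>M\<close> it suffices to rotate \<open>x i\<close> by an angle of at most \<open>pi / M\<close> to make its \<open>M\<close>-th power a
  positive multiple of \<open>\<i>\<close>.\<close>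

lemma imaginary_power_approx:
  fixes x :: "nat \<Rightarrow> complex"
  assumes x: "\<And>i. i < N \<Longrightarrow> x i \<noteq> 0" "inj_on x {..<N}" and \<epsilon>: "\<epsilon> > 0"
  shows "\<exists>M u. M \<ge> 2 \<and> inj_on u {..<N} \<and> (\<forall>i<N. u i \<noteq> 0 \<and> Re (u i ^ M) = 0 \<and> cmod (u i - x i) < \<epsilon>)"
proof -
  define t where "t M i = \<i> * of_real (cmod (x i) ^ M) / x i ^ M" for M i
  define u where "u M i = x i * exp (\<i> * of_real (Arg (t M i) / real M))" for M i
  have power: "u M i ^ M = \<i> * of_real (cmod (x i) ^ M)" if "i < N" "M \<ge> 1" for M i
  proof -
    have tn: "cmod (t M i) = 1" "t M i \<noteq> 0" using x(1)[OF that(1)]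
      by (auto simp: t_def norm_mult norm_divide norm_power)
    have "u M i ^ M = x i ^ M * exp (of_nat M * (\<i> * of_real (Arg (t M i) / real M)))"
      unfolding u_def power_mult_distrib exp_of_nat_mult ..
    also have "of_nat M * (\<i> * of_real (Arg (t M i) / real M)) = \<i> * of_real (Arg (t M i))"
      using that(2) by simp
    also have "exp (\<i> * of_real (Arg (t M i))) = t M i"
      using Arg_eq[OF tn(2)] tn(1) by simp
    finally show ?thesis using x(1)[OF that(1)] by (simp add: t_def)
  qed
  have lim: "(\<lambda>M. u M i) \<longlonglongrightarrow> x i" for i
  proof -
    have "(\<lambda>M. Arg (t M i) / real M) \<longlonglongrightarrow> 0"
    proof (rule Lim_null_comparison)
      show "\<forall>\<^sub>F M in sequentially. norm (Arg (t M i) / real M) \<le> pi / real M"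
      proof (intro always_eventually allI)
        fix M
        have "\<bar>Arg (t M i)\<bar> \<le> pi" using Arg_bounded[of "t M i"] by linarith
        then show "norm (Arg (t M i) / real M) \<le> pi / real M" by (simp add: divide_right_mono)
      qed
      show "(\<lambda>M. pi / real M) \<longlonglongrightarrow> 0" by (rule lim_const_over_n)
    qed
    then have "(\<lambda>M. x i * exp (\<i> * of_real (Arg (t M i) / real M))) \<longlonglongrightarrow> x i * exp (\<i> * of_real 0)"
      by (intro tendsto_intros)
    then show ?thesis by (simp add: u_def)
  qed
  have "\<forall>\<^sub>F M in sequentially. \<forall>i\<in>{..<N}. cmod (u M i - x i) < \<epsilon> \<and> (\<forall>j\<in>{..<N}. i \<noteq> j \<longrightarrow> u M i \<noteq> u M j)"
  proof (rule eventually_ball_finite, simp, rule ballI)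
    fix i assume i: "i \<in> {..<N}"
    have "\<forall>\<^sub>F M in sequentially. cmod (u M i - x i) < \<epsilon>" using tendstoD[OF lim \<epsilon>, of i] by (simp add: dist_norm)
    moreover have "\<forall>\<^sub>F M in sequentially. \<forall>j\<in>{..<N}. i \<noteq> j \<longrightarrow> u M i \<noteq> u M j"
    proof (rule eventually_ball_finite, simp, rule ballI)
      fix j assume j: "j \<in> {..<N}"
      show "\<forall>\<^sub>F M in sequentially. i \<noteq> j \<longrightarrow> u M i \<noteq> u M j"
      proof (cases "i = j")
        case False
        then have "x i - x j \<noteq> 0" using inj_onD[OF x(2)] i j by auto
        then have "\<forall>\<^sub>F M in sequentially. u M i - u M j \<noteq> 0"
          by (rule tendsto_imp_eventually_ne[OF tendsto_diff[OF lim lim]])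
        then show ?thesis by eventually_elim auto
      qed simp
    qed
    ultimately show "\<forall>\<^sub>F M in sequentially. cmod (u M i - x i) < \<epsilon> \<and> (\<forall>j\<in>{..<N}. i \<noteq> j \<longrightarrow> u M i \<noteq> u M j)"
      by (rule eventually_conj)
  qed
  then obtain M0 where M0: "\<And>M. M \<ge> M0 \<Longrightarrow> \<forall>i\<in>{..<N}. cmod (u M i - x i) < \<epsilon> \<and> (\<forall>j\<in>{..<N}. i \<noteq> j \<longrightarrow> u M i \<noteq> u M j)"
    by (auto simp: eventually_sequentially)
  define M where "M = max M0 2"
  have "\<forall>i\<in>{..<N}. cmod (u M i - x i) < \<epsilon> \<and> (\<forall>j\<in>{..<N}. i \<noteq> j \<longrightarrow> u M i \<noteq> u M j)" by (rule M0) (simp add: M_def)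
  moreover have "M \<ge> 2" by (simp add: M_def)
  moreover have "Re (u M i ^ M) = 0" "u M i \<noteq> 0" if "i < N" for i
    using power[OF that, of M] \<open>M \<ge> 2\<close> x(1)[OF that] by (auto simp: u_def)
  ultimately show ?thesis by (intro exI[of _ M] exI[of _ "u M"]) (auto simp: inj_on_def)
qed

text \<open>The position of the entry \<open>y (i + 3)\<close> in the coordinate in which \<open>y 0\<close>, \<open>y 1\<close>, \<open>y 2\<close> are \<open>0\<close>,
  \<open>\<infinity>\<close>, \<open>1\<close>. It is invariant under Moebius transformations.\<close>

definition cross_ratio :: "(nat \<Rightarrow> complex) \<Rightarrow> nat \<Rightarrow> complex" where
  "cross_ratio y i = (y 1 - y 2) * (y (i + 3) - y 0) / ((y 2 - y 0) * (y 1 - y (i + 3)))"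

lemma mob3_cross_ratio:
  assumes "inj_on y {..<N}" "i + 3 < N"
  shows "mob3 (y 0) (y 1) (y 2) (Fin (cross_ratio y i)) = Fin (y (i + 3))"
proof -
  define a b c t where "a = y 0" and "b = y 1" and "c = y 2" and "t = y (i + 3)"
  have ne: "y k \<noteq> y l" if "k < N" "l < N" "k \<noteq> l" for k l using inj_onD[OF assms(1)] that by blast
  have "a \<noteq> b" "b \<noteq> c" "c \<noteq> a" "b \<noteq> t" using ne assms(2) by (auto simp: a_def b_def c_def t_def)
  then have nz: "b - a \<noteq> 0" "b - c \<noteq> 0" "c - a \<noteq> 0" "b - t \<noteq> 0" by auto
  define z where "z = (b - c) * (t - a) / ((c - a) * (b - t))"
  have cz: "(c - a) * z = (b - c) * (t - a) / (b - t)" using nz by (simp add: z_def)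
  have 1: "(c - a) * z + (b - c) = (b - c) * (b - a) / (b - t)"
    unfolding cz using nz(4) by (simp add: field_simps)
  have "b * (c - a) * z = b * ((b - c) * (t - a) / (b - t))" using cz by (simp only: mult.assoc)
  then have 2: "b * (c - a) * z + a * (b - c) = t * ((b - c) * (b - a) / (b - t))"
    using nz(4) by (simp add: field_simps)
  have "(b - c) * (b - a) / (b - t) \<noteq> 0" using nz by simp
  then have "mob3 a b c (Fin z) = Fin t" unfolding mob3_def mob_def by (simp only: riemann_sphere.case 1 2 if_False) simp
  moreover have "z = cross_ratio y i" by (simp add: z_def cross_ratio_def a_def b_def c_def t_def)
  ultimately show ?thesis by (simp add: a_def b_def c_def t_def)
qed

text \<open>In the coordinate \<open>A y\<close> taking \<open>0\<close>, \<open>\<infinity>\<close>, \<open>1\<close> to \<open>y 0\<close>, \<open>y 1\<close>, \<open>y 2\<close>, the other entries are the cross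
  ratios \<open>xx y\<close>, and \<open>A y \<circ> q (xx y) \<circ> belyi\<close> depends on \<open>y\<close> equivariantly because cross ratios are
  invariant. The sections of the tower, followed by inverse branches of the Belyi map, give
  \<open>\<Phi>\<close>. Its bound comes from \<open>belyi_section\<close>.\<close>

lemma exists_contracting_family:
  fixes x :: "nat \<Rightarrow> complex"
  assumes N3: "N \<ge> 3" and FI': "\<forall>i<N. FI i < N"
    and x: "\<And>i. i < N \<Longrightarrow> x i \<noteq> 0" "inj_on x {..<N}" and \<epsilon>: "\<epsilon> > 0"
  shows "\<exists>u \<delta> fam \<Phi>. contracting_family N u \<delta> fam \<Phi> FI \<and> \<delta> \<le> \<epsilon> \<and> (\<forall>i<N. cmod (u i - x i) < \<epsilon>)"
proof -
  note FI = FI'[rule_format]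
  obtain M u where M: "M \<ge> 2" and uinj: "inj_on u {..<N}"
    and u: "\<And>i. i < N \<Longrightarrow> u i \<noteq> 0" "\<And>i. i < N \<Longrightarrow> Re (u i ^ M) = 0" "\<And>i. i < N \<Longrightarrow> cmod (u i - x i) < \<epsilon>"
    using imaginary_power_approx[OF x \<epsilon>] by blast
  define m where "m = N - 3"
  have N: "N = m + 3" using N3 by (simp add: m_def)
  define xx where "xx y i = (if i < m then cross_ratio y i else 0)" for y i
  define A where "A y = mob3 (y 0) (y 1) (y 2)" for y :: "nat \<Rightarrow> complex"
  have ne: "y k \<noteq> y l" if "inj_on y {..<N}" "k < N" "l < N" "k \<noteq> l" for y :: "nat \<Rightarrow> complex" and k l
    using inj_onD[OF that(1)] that by blast
  have ne3: "y 0 \<noteq> y 1" "y 1 \<noteq> y 2" "y 2 \<noteq> y 0" if "inj_on y {..<N}" for y :: "nat \<Rightarrow> complex"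
    using ne[OF that] N by auto
  have Am: "mobius (A y)" "A y (Fin 0) = Fin (y 0)" "A y Infty = Fin (y 1)" "A y (Fin 1) = Fin (y 2)"
    if "inj_on y {..<N}" for y
    using mob3[OF ne3[OF that]] by (simp_all add: A_def)
  have Ainj: "A y a = A y b \<Longrightarrow> a = b" if "inj_on y {..<N}" for y a b
    using mobius_inv_apply(2)[OF Am(1)[OF that]] by metis
  have Ax: "A y (Fin (xx y i)) = Fin (y (i + 3))" if "inj_on y {..<N}" "i < m" for y i
    using mob3_cross_ratio[OF that(1), of i] that(2) N by (simp add: A_def xx_def)
  have Amarked: "A y (marked (xx y) i) = Fin (y i)" if "inj_on y {..<N}" "i < N" for y i
  proof -
    consider "i = 0" | "i = 1" | "i = 2" | "\<not> i < 3" by linarith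
    then show ?thesis
    proof cases
      case 4
      then show ?thesis using Ax[OF that(1), of "i - 3"] that(2) N by (simp add: marked_def)
    qed (use Am(2-4)[OF that(1)] in \<open>simp_all add: marked_def\<close>)
  qed
  have x0: "xx u i \<noteq> 0 \<and> xx u i \<noteq> 1" if "i < m" for i
    using Ax[OF uinj that] Am(2,4)[OF uinj] ne[OF uinj, of "i + 3" 0] ne[OF uinj, of "i + 3" 2] that N by auto
  have x0inj: "inj_on (xx u) {..<m}"
  proof (rule inj_onI)
    fix i j assume ij: "i \<in> {..<m}" "j \<in> {..<m}" "xx u i = xx u j"
    then have "u (i + 3) = u (j + 3)" using Ax[OF uinj, of i] Ax[OF uinj, of j] by simp
    then show "i = j" using ne[OF uinj, of "i + 3" "j + 3"] ij(1,2) N by auto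
  qed
  obtain q w where qw: "tower_family m m (xx u) q w" using tower_family_exists[OF order_refl x0 x0inj] by blast
  have xg: "tgerm N u (\<lambda>y. xx y i)" if "i < m" for i
  proof -
    have "(u 2 - u 0) * (u 1 - u (i + 3)) \<noteq> 0" using ne[OF uinj, of 2 0] ne[OF uinj, of 1 "i + 3"] that N by simp
    then have "tgerm N u (\<lambda>y. cross_ratio y i)" unfolding cross_ratio_def
      using that N by (intro tgerm_divide tgerm_binop tgerm_proj) auto
    then show ?thesis using that by (simp add: xx_def)
  qed
  define W where "W j y = w j (xx y)" for j y
  have Wg: "tgerm N u (W j)" "W j u \<noteq> 0" if "j < N" for j
    using tgerm_tuple_comp(1)[of m xx u "w j" N] xg qw that N unfolding W_def[abs_def] by (auto simp: tower_family_def)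
  have fl: "filterlim xx (tfilter m (xx u)) (tfilter N u)"
    by (rule filterlim_tfilter) (use xg in \<open>simp add: tgerm_def\<close>)
  have E1: "\<forall>\<^sub>F y in tfilter N u. inj_on y {..<N}"
  proof -
    have "\<forall>\<^sub>F y in tfilter N u. \<forall>i\<in>{..<N}. \<forall>j\<in>{..<N}. i \<noteq> j \<longrightarrow> y i \<noteq> y j"
    proof (rule eventually_ball_finite, simp, rule ballI, rule eventually_ball_finite, simp, rule ballI)
      fix i j assume ij: "i \<in> {..<N}" "j \<in> {..<N}"
      show "\<forall>\<^sub>F y in tfilter N u. i \<noteq> j \<longrightarrow> y i \<noteq> y j"
      proof (cases "i = j")
        case False
        have "((\<lambda>y. y i - y j) \<longlongrightarrow> u i - u j) (tfilter N u)" using ij by (intro tendsto_diff tendsto_tfilter_proj) auto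
        moreover have "u i - u j \<noteq> 0" using ne[OF uinj] ij False by auto
        ultimately have "\<forall>\<^sub>F y in tfilter N u. y i - y j \<noteq> 0" by (rule tendsto_imp_eventually_ne)
        then show ?thesis by eventually_elim auto
      qed simp
    qed
    then show ?thesis by eventually_elim (auto simp: inj_on_def)
  qed
  have E2: "\<forall>\<^sub>F y in tfilter N u. rat (q (xx y)) \<and>
       critical_values (q (xx y)) \<union> q (xx y) ` {Fin 0, Infty, Fin 1} = marked (xx y) ` {..<m + 3} \<and>
       (\<forall>i<m + 3. q (xx y) (Fin (w i (xx y))) = marked (xx y) i) \<and>
       (\<forall>X. (\<forall>i<m. (\<lambda>k. X k i) \<longlonglongrightarrow> xx y i) \<longrightarrow> cconv (\<lambda>k. q (X k)) (q (xx y)))"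
    using fl qw unfolding tower_family_def filterlim_iff by (elim conjE allE) (erule (1) mp)
  have E3: "\<forall>\<^sub>F y in tfilter N u. \<forall>j\<in>{..<N}. dist (W j y) (W j u) < cmod (W j u) / 2"
  proof (rule eventually_ball_finite, simp, rule ballI)
    fix j assume "j \<in> {..<N}"
    then have "(W j \<longlongrightarrow> W j u) (tfilter N u)" "cmod (W j u) / 2 > 0" using Wg by (auto simp: tgerm_def)
    then show "\<forall>\<^sub>F y in tfilter N u. dist (W j y) (W j u) < cmod (W j u) / 2" by (rule tendstoD)
  qed
  have E4: "\<forall>\<^sub>F y in tfilter N u. \<forall>i\<in>{..<m}. ((\<lambda>y. xx y i) \<longlongrightarrow> xx y i) (tfilter N y)"
    by (rule eventually_ball_finite, simp, rule ballI, rule tgerm_continuous_near, rule xg) simp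
  define Good where "Good y \<longleftrightarrow> inj_on y {..<N} \<and> (rat (q (xx y)) \<and>
       critical_values (q (xx y)) \<union> q (xx y) ` {Fin 0, Infty, Fin 1} = marked (xx y) ` {..<m + 3} \<and>
       (\<forall>i<m + 3. q (xx y) (Fin (w i (xx y))) = marked (xx y) i) \<and>
       (\<forall>X. (\<forall>i<m. (\<lambda>k. X k i) \<longlonglongrightarrow> xx y i) \<longrightarrow> cconv (\<lambda>k. q (X k)) (q (xx y)))) \<and>
      (\<forall>j\<in>{..<N}. dist (W j y) (W j u) < cmod (W j u) / 2) \<and>
      (\<forall>i\<in>{..<m}. ((\<lambda>y. xx y i) \<longlongrightarrow> xx y i) (tfilter N y))" for y
  have "\<forall>\<^sub>F y in tfilter N u. Good y"
    unfolding Good_def by (rule eventually_conj[OF E1 eventually_conj[OF E2 eventually_conj[OF E3 E4]]])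
  then obtain \<delta>1 where \<delta>1: "\<delta>1 > 0" and Good: "\<And>y. tnear N u \<delta>1 y \<Longrightarrow> Good y"
    unfolding eventually_tfilter by blast
  note good = Good[unfolded Good_def]
  obtain \<delta>2 where \<delta>2: "\<delta>2 > 0" "\<And>j. j < N \<Longrightarrow> thol_on N u \<delta>2 (W j)"
  proof -
    have "\<exists>\<delta>>0. \<forall>i<N. thol_on N u \<delta> (W i)" by (rule thol_common) (rule Wg(1))
    then show ?thesis using that by auto
  qed
  (* The polydisc is fixed first: the tower does not involve the exponent m' of the Belyi map,
     which can then be chosen so large that the inverse branches map into a disc of radius
     \<delta> / 8. *)
  define \<delta> where "\<delta> = min \<epsilon> (min \<delta>1 \<delta>2)"
  have \<delta>: "\<delta> > 0" "\<delta> \<le> \<epsilon>" "\<delta> \<le> \<delta>1" "\<delta> \<le> \<delta>2" using \<epsilon> \<delta>1 \<delta>2 by (auto simp: \<delta>_def)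
  have d8: "\<delta> / 8 > 0" using \<delta>(1) by simp
  define v0 where "v0 i = W (FI i) u" for i
  have v0: "v0 i \<noteq> 0" if "i < N" for i using Wg(2)[OF FI[OF that]] by (simp add: v0_def)
  have "\<forall>i. \<exists>m0. i < N \<longrightarrow> (\<forall>m'\<ge>m0. \<exists>\<sigma>. \<sigma> holomorphic_on ball (v0 i) (cmod (v0 i) / 2) \<and>
    (\<forall>v\<in>ball (v0 i) (cmod (v0 i) / 2). belyi m' M (Fin (\<sigma> v)) = Fin v \<and> cmod (\<sigma> v - u i) < \<delta> / 8))"
  proof
    fix i
    show "\<exists>m0. i < N \<longrightarrow> (\<forall>m'\<ge>m0. \<exists>\<sigma>. \<sigma> holomorphic_on ball (v0 i) (cmod (v0 i) / 2) \<and>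
    (\<forall>v\<in>ball (v0 i) (cmod (v0 i) / 2). belyi m' M (Fin (\<sigma> v)) = Fin v \<and> cmod (\<sigma> v - u i) < \<delta> / 8))"
    proof (cases "i < N")
      case True
      have "M \<ge> 1" using M by simp
      from belyi_section[OF u(1)[OF True] this u(2)[OF True] v0[OF True] d8] show ?thesis by blast
    qed simp
  qed
  from choice[OF this] obtain m0 where m0: "\<And>i m'. i < N \<Longrightarrow> m' \<ge> m0 i \<Longrightarrow> \<exists>\<sigma>. \<sigma> holomorphic_on ball (v0 i) (cmod (v0 i) / 2) \<and>
    (\<forall>v\<in>ball (v0 i) (cmod (v0 i) / 2). belyi m' M (Fin (\<sigma> v)) = Fin v \<and> cmod (\<sigma> v - u i) < \<delta> / 8)" by blast
  define m' where "m' = 2 * (sum m0 {..<N} + 1)"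
  have m': "even m'" "m' \<ge> 2" by (simp_all add: m'_def)
  have "m0 i \<le> m'" if "i < N" for i
  proof -
    have "m0 i \<le> sum m0 {..<N}" using that by (intro member_le_sum) auto
    then show ?thesis by (simp add: m'_def)
  qed
  then have "\<forall>i. \<exists>\<sigma>. i < N \<longrightarrow> \<sigma> holomorphic_on ball (v0 i) (cmod (v0 i) / 2) \<and>
    (\<forall>v\<in>ball (v0 i) (cmod (v0 i) / 2). belyi m' M (Fin (\<sigma> v)) = Fin v \<and> cmod (\<sigma> v - u i) < \<delta> / 8)"
    using m0 by blast
  from choice[OF this] obtain \<sigma> where \<sigma>: "\<And>i. i < N \<Longrightarrow> \<sigma> i holomorphic_on ball (v0 i) (cmod (v0 i) / 2)"
    "\<And>i v. i < N \<Longrightarrow> v \<in> ball (v0 i) (cmod (v0 i) / 2) \<Longrightarrow> belyi m' M (Fin (\<sigma> i v)) = Fin v \<and> cmod (\<sigma> i v - u i) < \<delta> / 8"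
    by blast
  define \<Phi> where "\<Phi> y i = \<sigma> i (W (FI i) y)" for y i
  define fam where "fam y = A y \<circ> (q (xx y) \<circ> belyi m' M)" for y
  have good': "tnear N u \<delta> y \<Longrightarrow> tnear N u \<delta>1 y" for y using tnear_mono \<delta>(3) by blast
  have Wball: "W (FI i) y \<in> ball (v0 i) (cmod (v0 i) / 2)" if "tnear N u \<delta> y" "i < N" for y i
    using good[OF good'[OF that(1)]] FI[OF that(2)] by (auto simp: v0_def dist_commute)
  note bel = belyi[OF m' M]
  have "contracting_family N u \<delta> fam \<Phi> FI"
  proof
    show "3 \<le> N" "0 < \<delta>" by fact+
    show "\<And>i. i < N \<Longrightarrow> FI i < N" by (rule FI)
    fix y assume y: "tnear N u \<delta> y"
    note gy = good[OF good'[OF y]]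
    have yinj: "inj_on y {..<N}" using gy by blast
    then show "inj_on y {..<N}" .
    have rq: "rat (q (xx y))" using gy by blast
    have rqb: "rat (q (xx y) \<circ> belyi m' M)" by (rule rat_comp[OF rq bel(1)])
    show "rat (fam y)" unfolding fam_def by (rule rat_comp[OF mobius_rat[OF Am(1)[OF yinj]] rqb])
    have "critical_values (fam y) = A y ` (critical_values (q (xx y)) \<union> q (xx y) ` {Fin 0, Infty, Fin 1})"
      unfolding fam_def critical_points_mobius_comp(3)[OF Am(1)[OF yinj] rqb] critical_values_comp[OF rq bel(1)] bel(2) ..
    also have "\<dots> = A y ` marked (xx y) ` {..<N}" using gy N by simp
    also have "\<dots> = (\<lambda>i. Fin (y i)) ` {..<N}" unfolding image_image using Amarked[OF yinj] by (intro image_cong) auto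
    finally show "critical_values (fam y) = (\<lambda>i. Fin (y i)) ` {..<N}" .
    {
      fix Y assume Y: "\<And>i. i < N \<Longrightarrow> (\<lambda>k. Y k i) \<longlonglongrightarrow> y i"
      have flY: "filterlim Y (tfilter N y) sequentially" by (rule filterlim_tfilter) (rule Y)
      have lx: "\<forall>i<m. (\<lambda>k. xx (Y k) i) \<longlonglongrightarrow> xx y i"
      proof (intro allI impI)
        fix i assume "i < m"
        then have "((\<lambda>y. xx y i) \<longlongrightarrow> xx y i) (tfilter N y)" using gy by auto
        from filterlim_compose[OF this flY] show "(\<lambda>k. xx (Y k) i) \<longlonglongrightarrow> xx y i" .
      qed
      have all: "\<forall>X. (\<forall>i<m. (\<lambda>k. X k i) \<longlonglongrightarrow> xx y i) \<longrightarrow> cconv (\<lambda>k. q (X k)) (q (xx y))" using gy by (elim conjE)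
      have cq: "cconv (\<lambda>k. q (xx (Y k))) (q (xx y))" by (rule all[THEN spec, of "\<lambda>k. xx (Y k)", THEN mp, OF lx])
      have l3: "(\<lambda>k. Y k 0) \<longlonglongrightarrow> y 0" "(\<lambda>k. Y k 1) \<longlonglongrightarrow> y 1" "(\<lambda>k. Y k 2) \<longlonglongrightarrow> y 2" using Y N by auto
      have cA: "cconv (\<lambda>k. A (Y k)) (A y)" unfolding A_def mob3_def
        by (intro mob_cconv_eventually tendsto_intros l3) (unfold mob3_det, use ne3[OF yinj] in simp)
      show "cconv (\<lambda>k. fam (Y k)) (fam y)" unfolding fam_def
        by (intro cconv_comp cA cq cconv_const rat_continuous bel(1))
    next
      fix z K assume K: "mobius K" "\<And>i. i < N \<Longrightarrow> K (Fin (y i)) = Fin (z i)"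
      have zinj: "inj_on z {..<N}"
      proof (rule inj_onI)
        fix i j assume ij: "i \<in> {..<N}" "j \<in> {..<N}" "z i = z j"
        then have "K (Fin (y i)) = K (Fin (y j))" using K(2) by simp
        then have "Fin (y i) = Fin (y j)" using mobius_inv_apply(2)[OF K(1)] by metis
        then show "i = j" using inj_onD[OF yinj] ij by simp
      qed
      have AK: "K \<circ> A y = A z" unfolding A_def[of z]
        by (rule mobius_eq_mob3[OF mobius_comp[OF K(1) Am(1)[OF yinj]]]) (use Am(2-4)[OF yinj] K(2) N in auto)
      have "xx z i = xx y i" for i
      proof (cases "i < m")
        case True
        have "A z (Fin (xx y i)) = K (Fin (y (i + 3)))" using Ax[OF yinj True] by (simp flip: AK)
        also have "\<dots> = A z (Fin (xx z i))" using K(2)[of "i + 3"] Ax[OF zinj True] True N by simp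
        finally have "Fin (xx y i) = Fin (xx z i)" by (rule Ainj[OF zinj])
        then show ?thesis by simp
      qed (simp add: xx_def)
      then have "xx z = xx y" by (rule ext)
      then show "fam z = K \<circ> fam y" unfolding fam_def by (simp add: comp_assoc flip: AK)
    next
      fix i assume i: "i < N"
      note s = \<sigma>(2)[OF i Wball[OF y i]]
      have "fam y (Fin (\<Phi> y i)) = A y (q (xx y) (Fin (w (FI i) (xx y))))" using s by (simp add: fam_def \<Phi>_def W_def)
      also have "\<dots> = A y (marked (xx y) (FI i))" using gy FI[OF i] N by simp
      also have "\<dots> = Fin (y (FI i))" by (rule Amarked[OF yinj FI[OF i]])
      finally show "fam y (Fin (\<Phi> y i)) = Fin (y (FI i))" .
      show "cmod (\<Phi> y i - u i) < \<delta> / 8" using s by (simp add: \<Phi>_def)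
    }
  next
    fix i assume i: "i < N"
    show "thol_on N u \<delta> (\<lambda>y. \<Phi> y i)" unfolding thol_on_def
    proof (intro allI impI)
      fix \<gamma> S assume a: "open S" "\<forall>i<N. (\<lambda>t. \<gamma> t i) holomorphic_on S" "\<forall>t\<in>S. tnear N u \<delta> (\<gamma> t)"
      have h: "(\<lambda>t. W (FI i) (\<gamma> t)) holomorphic_on S"
        by (rule thol_onD[OF thol_on_mono[OF \<delta>2(2)[OF FI[OF i]] \<delta>(4)] a(1)]) (use a in auto)
      have "(\<lambda>t. W (FI i) (\<gamma> t)) ` S \<subseteq> ball (v0 i) (cmod (v0 i) / 2)" using a(3) Wball[OF _ i] by blast
      from holomorphic_on_compose_gen[OF h \<sigma>(1)[OF i] this]
      show "(\<lambda>t. \<Phi> (\<gamma> t) i) holomorphic_on S" by (simp add: \<Phi>_def o_def)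
    qed
  qed
  then show ?thesis using \<delta>(2) u(3) by blast
qed

lemma finite_point_near:
  assumes "finite S" "e > 0" shows "\<exists>z. z \<notin> S \<and> dist (Fin z) x < e"
proof (rule ccontr)
  assume no: "\<not> ?thesis"
  obtain w :: "nat \<Rightarrow> complex" where w: "(\<lambda>n. Fin (w n)) \<longlonglongrightarrow> x" "inj w"
  proof (cases x)
    case (Fin a)
    have "(\<lambda>n. 1 / of_nat n :: complex) \<longlonglongrightarrow> 0" by (rule lim_1_over_n)
    then have "(\<lambda>n. 1 / of_nat (Suc n) :: complex) \<longlonglongrightarrow> 0" by (rule LIMSEQ_Suc)
    then have "(\<lambda>n. a + 1 / of_nat (Suc n)) \<longlonglongrightarrow> a + 0" by (intro tendsto_add tendsto_const)
    moreover have "inj (\<lambda>n::nat. a + 1 / of_nat (Suc n))" by (auto simp: inj_on_def)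
    ultimately show ?thesis using that[of "\<lambda>n. a + 1 / of_nat (Suc n)"] Fin by simp
  next
    case Infty
    have "filterlim (\<lambda>n. of_nat n :: complex) at_infinity sequentially" by (rule tendsto_of_nat)
    then show ?thesis using that[of of_nat] Infty tendsto_Infty_iff[of of_nat] inj_of_nat by blast
  qed
  have "\<forall>\<^sub>F n in sequentially. dist (Fin (w n)) x < e" using w(1) assms(2) by (rule tendstoD)
  then obtain n0 where n0: "\<And>n. n \<ge> n0 \<Longrightarrow> dist (Fin (w n)) x < e" by (auto simp: eventually_sequentially)
  then have "w ` {n0..} \<subseteq> S" using no by blast
  then have "finite (w ` {n0..})" using assms(1) finite_subset by blast
  then have "finite {n0..}" using w(2) finite_imageD inj_on_subset by blast
  then show False using infinite_Ici by blast
qed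

text \<open>Infinity and \<open>0\<close> have to be avoided first, which moves the points slightly. The fixed point of a
  contracting family near the new points gives the map.\<close>

theorem rigid_map_near:
  fixes X :: "nat \<Rightarrow> riemann_sphere"
  assumes N3: "N \<ge> 3" and FI: "\<And>i. i < N \<Longrightarrow> FI i < N" and X: "inj_on X {..<N}" and \<epsilon>: "\<epsilon> > 0"
  shows "\<exists>f y. rigid f \<and> postcritically_finite f \<and> postcritical_set f = y ` {..<N} \<and>
    card (postcritical_set f) = N \<and> (\<forall>i<N. f (y i) = y (FI i) \<and> dist (y i) (X i) < \<epsilon>)"
proof -
  have "finite (X ` {..<N})" by simp
  then obtain e where e: "e > 0" "\<And>x y. x \<in> X ` {..<N} \<Longrightarrow> y \<in> X ` {..<N} \<Longrightarrow> x \<noteq> y \<Longrightarrow> e \<le> dist x y"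
    using finite_separated by blast
  have "\<exists>z. z \<notin> {0} \<and> dist (Fin z) (X i) < min (\<epsilon> / 2) (e / 2)" for i
    by (rule finite_point_near) (use e \<epsilon> in auto)
  then obtain x where x: "\<And>i. x i \<noteq> 0" "\<And>i. dist (Fin (x i)) (X i) < min (\<epsilon> / 2) (e / 2)" by (auto) metis
  have xinj: "inj_on x {..<N}"
  proof (rule inj_onI, rule ccontr)
    fix i j assume ij: "i \<in> {..<N}" "j \<in> {..<N}" "x i = x j" "i \<noteq> j"
    have "dist (X i) (X j) \<le> dist (Fin (x i)) (X i) + dist (Fin (x j)) (X j)"
      using dist_triangle3[of "X i" "X j" "Fin (x i)"] ij(3) by simp
    moreover have "e \<le> dist (X i) (X j)" using e(2) X ij by (auto simp: inj_on_def)
    ultimately show False using x(2)[of i] x(2)[of j] by simp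
  qed
  have "\<forall>i\<in>{..<N}. \<forall>\<^sub>F r in at_right 0. \<forall>z. cmod (z - x i) < 2 * r \<longrightarrow> dist (Fin z) (Fin (x i)) < \<epsilon> / 2"
  proof
    fix i
    have "((\<lambda>z. Fin z) \<longlongrightarrow> Fin (x i)) (nhds (x i))" by (rule tendsto_Fin) (rule filterlim_ident)
    then have "\<forall>\<^sub>F z in nhds (x i). dist (Fin z) (Fin (x i)) < \<epsilon> / 2" by (rule tendstoD) (use \<epsilon> in simp)
    then obtain d where d: "d > 0" "\<And>z. dist z (x i) < d \<Longrightarrow> dist (Fin z) (Fin (x i)) < \<epsilon> / 2"
      by (auto simp: eventually_nhds_metric)
    have "d / 2 > 0" using d(1) by simp
    from eventually_at_right_real[OF this]
    show "\<forall>\<^sub>F r in at_right 0. \<forall>z. cmod (z - x i) < 2 * r \<longrightarrow> dist (Fin z) (Fin (x i)) < \<epsilon> / 2"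
      by eventually_elim (use d(2) in \<open>auto simp: dist_norm\<close>)
  qed
  then have "\<forall>\<^sub>F r in at_right 0. \<forall>i\<in>{..<N}. \<forall>z. cmod (z - x i) < 2 * r \<longrightarrow> dist (Fin z) (Fin (x i)) < \<epsilon> / 2"
    by (intro eventually_ball_finite) auto
  then have "\<forall>\<^sub>F r in at_right (0::real). r > 0 \<and> (\<forall>i\<in>{..<N}. \<forall>z. cmod (z - x i) < 2 * r \<longrightarrow> dist (Fin z) (Fin (x i)) < \<epsilon> / 2)"
    using eventually_at_right_less[of "0::real"] by eventually_elim auto
  then obtain r where r: "r > 0" "\<And>i z. i < N \<Longrightarrow> cmod (z - x i) < 2 * r \<Longrightarrow> dist (Fin z) (Fin (x i)) < \<epsilon> / 2"
    using eventually_happens[of _ "at_right (0::real)"] trivial_limit_at_right_real by blast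
  obtain u \<delta> fam \<Phi> where fam: "contracting_family N u \<delta> fam \<Phi> FI" "\<delta> \<le> r" "\<forall>i<N. cmod (u i - x i) < r"
    using exists_contracting_family[OF N3 _ x(1) xinj r(1), of FI] FI by blast
  interpret contracting_family N u \<delta> fam \<Phi> FI by fact
  obtain y where y: "tnear N u \<delta> y" "\<forall>i<N. \<Phi> y i = y i"
    using contracting_fixed_point(1)[where \<Phi> = \<Phi>, OF \<delta> section_hol less_imp_le[OF section_bound]] by blast
  have "dist (Fin (y i)) (X i) < \<epsilon>" if i: "i < N" for i
  proof -
    have "cmod (y i - x i) \<le> cmod (y i - u i) + cmod (u i - x i)" using norm_triangle_ineq[of "y i - u i" "u i - x i"] by simp
    also have "\<dots> < 2 * r" using y(1) fam(2,3) i by (fastforce simp: tnear_def)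
    finally have "dist (Fin (y i)) (Fin (x i)) < \<epsilon> / 2" by (rule r(2)[OF i])
    then show ?thesis using x(2)[of i] dist_triangle[of "Fin (y i)" "X i" "Fin (x i)"] by simp
  qed
  then show ?thesis using fixed_point_rigid[OF y] fixed_point_dynamics[OF y]
    by (intro exI[of _ "fam y"] exI[of _ "\<lambda>i. Fin (y i)"]) auto
qed

section \<open>Small homeomorphisms of the sphere\<close>

definition displace :: "(complex \<Rightarrow> complex) \<Rightarrow> riemann_sphere \<Rightarrow> riemann_sphere" where
  "displace D x = (case x of Infty \<Rightarrow> Infty | Fin z \<Rightarrow> Fin (z + D z))"

lemma displace_cconv:
  assumes R: "\<And>n z. cmod z \<ge> R \<Longrightarrow> D n z = 0"
    and lim: "\<And>z l. z \<longlonglongrightarrow> l \<Longrightarrow> (\<lambda>n. D n (z n)) \<longlonglongrightarrow> D' l"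
  shows "cconv (\<lambda>n. displace (D n)) (displace D')"
  unfolding cconv_def
proof (intro allI impI)
  fix x and l :: riemann_sphere assume x: "x \<longlonglongrightarrow> l"
  show "(\<lambda>n. displace (D n) (x n)) \<longlonglongrightarrow> displace D' l"
  proof (cases l)
    case (Fin c)
    note e = eventually_finite(2,3)[OF x[unfolded Fin]]
    have "(\<lambda>n. Fin (fin_part (x n) + D n (fin_part (x n)))) \<longlonglongrightarrow> Fin (c + D' c)"
      by (intro tendsto_intros e(1) lim)
    moreover have "\<forall>\<^sub>F n in sequentially. Fin (fin_part (x n) + D n (fin_part (x n))) = displace (D n) (x n)"
      using e(2)
    proof eventually_elim
      case (elim n) then show ?case by (cases "x n") (auto simp: displace_def)
    qed
    ultimately have "(\<lambda>n. displace (D n) (x n)) \<longlonglongrightarrow> Fin (c + D' c)" by (rule Lim_transform_eventually)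
    then show ?thesis using Fin by (simp add: displace_def)
  next
    case Infty
    have "(\<lambda>n. recip (x n)) \<longlonglongrightarrow> Fin 0" using tendsto_recip[OF x] Infty by simp
    from eventually_finite(2)[OF this] have r: "(\<lambda>n. fin_part (recip (x n))) \<longlonglongrightarrow> 0" .
    have "\<forall>\<^sub>F n in sequentially. dist (fin_part (recip (x n))) 0 < 1 / (\<bar>R\<bar> + 1)"
      by (rule tendstoD[OF r]) auto
    moreover have "\<forall>\<^sub>F n in sequentially. x n \<noteq> Fin 0"
      using x Infty by (intro tendsto_imp_eventually_ne[of x l]) auto
    ultimately have "\<forall>\<^sub>F n in sequentially. x n = displace (D n) (x n)"
    proof eventually_elim
      case (elim n)
      show ?case
      proof (cases "x n")
        case (Fin z)
        then have "z \<noteq> 0" "1 / cmod z < 1 / (\<bar>R\<bar> + 1)" using elim by (auto simp: norm_divide)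
        then have "\<bar>R\<bar> + 1 < cmod z" by (simp add: divide_less_cancel field_simps)
        then have "D n z = 0" by (intro R) linarith
        then show ?thesis using Fin by (simp add: displace_def)
      qed (simp add: displace_def)
    qed
    with x have "(\<lambda>n. displace (D n) (x n)) \<longlonglongrightarrow> l" by (rule Lim_transform_eventually)
    then show ?thesis using Infty by (simp add: displace_def)
  qed
qed

text \<open>The equation \<open>z + D z = w\<close> has a unique solution, the fixed point of the contraction taking \<open>z\<close> to
  \<open>w - D z\<close>. Continuity of the inverse follows from compactness.\<close>

lemma displace_homeomorphism:
  assumes R: "\<And>z. cmod z \<ge> R \<Longrightarrow> D z = 0"
    and L: "\<And>z w. cmod (D z - D w) \<le> cmod (z - w) / 2"
  shows "\<exists>\<psi>. homeomorphism UNIV UNIV (displace D) \<psi>"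
proof -
  have cD: "isCont D z" for z
  proof -
    have "(1/2)-lipschitz_on UNIV D"
      by (rule lipschitz_onI) (use L in \<open>auto simp: dist_norm\<close>)
    then show ?thesis using lipschitz_on_continuous_on by (metis continuous_on_eq_continuous_at open_UNIV UNIV_I)
  qed
  have "cconv (\<lambda>n. displace D) (displace D)"
    by (rule displace_cconv[where R = R]) (use R isCont_tendsto_compose[OF cD] in auto)
  then have cont: "continuous_on UNIV (displace D)" by (rule cconv_cont)
  have uniq: "\<exists>!z. z + D z = w" for w
  proof -
    have "\<exists>!z. w - D z = z"
      by (rule banach_fix_type[of "1/2"]) (use L in \<open>auto simp: dist_norm norm_minus_commute\<close>)
    moreover have "w - D z = z \<longleftrightarrow> z + D z = w" for z by (auto simp: algebra_simps)
    ultimately show ?thesis by simp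
  qed
  have "inj (displace D)"
  proof (rule injI)
    fix x y assume "displace D x = displace D y"
    then show "x = y" using uniq by (cases x; cases y) (auto simp: displace_def)
  qed
  moreover have "surj (displace D)"
  proof (rule surjI[of _ "\<lambda>y. case y of Infty \<Rightarrow> Infty | Fin w \<Rightarrow> Fin (THE z. z + D z = w)"])
    fix y show "displace D (case y of Infty \<Rightarrow> Infty | Fin w \<Rightarrow> Fin (THE z. z + D z = w)) = y"
      using theI'[OF uniq] by (cases y) (auto simp: displace_def)
  qed
  moreover have "compact (UNIV :: riemann_sphere set)"
    using seq_compact_sphere compact_eq_seq_compact_metric by blast
  ultimately show ?thesis using homeomorphism_compact[OF _ cont] by blast
qed

text \<open>Displace by a sum of bumps, each centred at one of the points, vanishing at all the others, and
  multiplied by the vector \<open>b n i - a i\<close>. The Lipschitz constant of the sum tends to \<open>0\<close>.\<close>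

lemma homeomorphisms_moving_finite_points:
  fixes a :: "nat \<Rightarrow> complex"
  assumes inj: "inj_on a {..<N}" and b: "\<And>i. i < N \<Longrightarrow> (\<lambda>n. b n i) \<longlonglongrightarrow> a i"
  shows "\<exists>\<phi>. (\<forall>\<^sub>F n in sequentially. (\<exists>\<psi>. homeomorphism UNIV UNIV (\<phi> n) \<psi>) \<and> (\<forall>i<N. \<phi> n (Fin (a i)) = Fin (b n i)))
     \<and> cconv \<phi> id"
proof -
  have "finite (a ` {..<N})" by simp
  then obtain e where e: "e > 0" "\<And>x y. x \<in> a ` {..<N} \<Longrightarrow> y \<in> a ` {..<N} \<Longrightarrow> x \<noteq> y \<Longrightarrow> e \<le> dist x y"
    using finite_separated by blast
  define bump where "bump i z = max 0 (1 - cmod (z - a i) / e)" for i z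
  have bump: "0 \<le> bump i z" "bump i z \<le> 1" "\<bar>bump i z - bump i w\<bar> \<le> cmod (z - w) / e" for i z w
  proof -
    show "0 \<le> bump i z" by (simp add: bump_def)
    show "bump i z \<le> 1" using e(1) by (simp add: bump_def)
    have "\<bar>cmod (z - a i) - cmod (w - a i)\<bar> \<le> cmod (z - w)" using norm_triangle_ineq3[of "z - a i" "w - a i"] by simp
    then have "\<bar>cmod (z - a i) / e - cmod (w - a i) / e\<bar> \<le> cmod (z - w) / e"
      using e(1) by (simp add: diff_divide_distrib[symmetric] divide_right_mono)
    then show "\<bar>bump i z - bump i w\<bar> \<le> cmod (z - w) / e" unfolding bump_def by linarith
  qed
  have bump_a: "bump i (a j) = (if i = j then 1 else 0)" if "i < N" "j < N" for i j
  proof (cases "i = j")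
    case False
    then have "a j \<noteq> a i" using inj_onD[OF inj, of j i] that by auto
    then have "e \<le> cmod (a j - a i)" using e(2)[of "a j" "a i"] that by (simp add: dist_norm)
    then show ?thesis using e(1) False by (simp add: bump_def)
  qed (simp add: bump_def)
  define D where "D n z = (\<Sum>i<N. (b n i - a i) * of_real (bump i z))" for n z
  define s where "s n = (\<Sum>i<N. cmod (b n i - a i))" for n
  have s: "s \<longlonglongrightarrow> 0"
  proof -
    have "s \<longlonglongrightarrow> (\<Sum>i<N. cmod (a i - a i))" unfolding s_def[abs_def]
      by (intro tendsto_sum tendsto_norm tendsto_diff tendsto_const b) auto
    then show ?thesis by simp
  qed
  define R where "R = (\<Sum>i<N. cmod (a i)) + e"
  have D0: "D n z = 0" if "cmod z \<ge> R" for n z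
  proof -
    have "bump i z = 0" if i: "i < N" for i
    proof -
      have "cmod (a i) \<le> (\<Sum>i<N. cmod (a i))" using i by (intro member_le_sum) auto
      then have "e \<le> cmod (z - a i)" using \<open>cmod z \<ge> R\<close> norm_triangle_ineq2[of z "a i"] by (simp add: R_def)
      then show ?thesis using e(1) by (simp add: bump_def)
    qed
    then show ?thesis by (simp add: D_def)
  qed
  have Ds: "cmod (D n z) \<le> s n" for n z
    unfolding D_def s_def by (rule sum_norm_le) (use bump in \<open>auto simp: norm_mult mult_left_le\<close>)
  have DL: "cmod (D n z - D n w) \<le> s n / e * cmod (z - w)" for n z w
  proof -
    have "D n z - D n w = (\<Sum>i<N. (b n i - a i) * of_real (bump i z - bump i w))"
      unfolding D_def sum_subtractf[symmetric] by (intro sum.cong) (auto simp: algebra_simps)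
    also have "cmod \<dots> \<le> (\<Sum>i<N. cmod (b n i - a i) * (cmod (z - w) / e))"
    proof (rule sum_norm_le)
      fix i
      have "cmod (of_real (bump i z - bump i w)) \<le> cmod (z - w) / e" using bump(3)[of i z w] by (simp only: norm_of_real)
      then show "cmod ((b n i - a i) * of_real (bump i z - bump i w)) \<le> cmod (b n i - a i) * (cmod (z - w) / e)"
        unfolding norm_mult by (rule mult_left_mono) simp
    qed
    also have "\<dots> = s n * (cmod (z - w) / e)" unfolding s_def sum_distrib_right ..
    also have "\<dots> = s n / e * cmod (z - w)" by simp
    finally show ?thesis .
  qed
  define \<phi> where "\<phi> n = displace (D n)" for n
  have "\<forall>\<^sub>F n in sequentially. s n < e / 2" using s e(1) by (intro order_tendstoD(2)) auto
  then have "\<forall>\<^sub>F n in sequentially. (\<exists>\<psi>. homeomorphism UNIV UNIV (\<phi> n) \<psi>) \<and> (\<forall>i<N. \<phi> n (Fin (a i)) = Fin (b n i))"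
  proof eventually_elim
    case (elim n)
    have "cmod (D n z - D n w) \<le> cmod (z - w) / 2" for z w
    proof -
      have "s n / e \<le> 1 / 2" using elim e(1) by (simp add: field_simps)
      then have "s n / e * cmod (z - w) \<le> 1 / 2 * cmod (z - w)" by (rule mult_right_mono) simp
      then have "cmod (D n z - D n w) \<le> 1 / 2 * cmod (z - w)" by (rule order_trans[OF DL])
      then show ?thesis by simp
    qed
    then have "\<exists>\<psi>. homeomorphism UNIV UNIV (\<phi> n) \<psi>" unfolding \<phi>_def using D0 by (intro displace_homeomorphism) auto
    moreover have "\<phi> n (Fin (a i)) = Fin (b n i)" if i: "i < N" for i
    proof -
      have "D n (a i) = (\<Sum>j<N. if j = i then b n i - a i else 0)"
        unfolding D_def using bump_a i by (intro sum.cong) auto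
      also have "\<dots> = b n i - a i" using i by simp
      finally show ?thesis by (simp add: \<phi>_def displace_def)
    qed
    ultimately show ?case by blast
  qed
  moreover have "cconv \<phi> (displace (\<lambda>z. 0))" unfolding \<phi>_def[abs_def]
  proof (rule displace_cconv[where R = R])
    show "\<And>n z. R \<le> cmod z \<Longrightarrow> D n z = 0" by (rule D0)
    fix z and l :: complex
    show "(\<lambda>n. D n (z n)) \<longlonglongrightarrow> 0" by (rule Lim_null_comparison[OF _ s]) (simp add: Ds)
  qed
  moreover have "displace (\<lambda>z. 0) = id" by (auto simp: displace_def fun_eq_iff split: riemann_sphere.split)
  ultimately show ?thesis by (intro exI[of _ \<phi>]) auto
qed

lemma mobius_homeomorphism: "mobius M \<Longrightarrow> homeomorphism UNIV UNIV M (inv M)"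
  by (rule homeomorphismI)
    (auto simp: mobius_inv_apply rat_continuous mobius_rat mobius_inv(1) intro: continuous_on_subset)

text \<open>A Moebius transformation moves all the points of \<open>X\<close> into the plane.\<close>

lemma homeomorphisms_moving_points:
  fixes X :: "nat \<Rightarrow> riemann_sphere"
  assumes inj: "inj_on X {..<N}" and y: "\<And>i. i < N \<Longrightarrow> (\<lambda>n. y n i) \<longlonglongrightarrow> X i"
  shows "\<exists>\<phi>. (\<forall>\<^sub>F n in sequentially. (\<exists>\<psi>. homeomorphism UNIV UNIV (\<phi> n) \<psi>) \<and> (\<forall>i<N. \<phi> n (X i) = y n i))
     \<and> uniform_limit UNIV \<phi> id sequentially"
proof -
  have "finite (Fin -` (X ` {..<N}))" by (rule finite_vimageI) (auto simp: inj_def)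
  then obtain c where c: "Fin c \<notin> X ` {..<N}" using infinite_UNIV_char_0 ex_new_if_finite by (metis vimageI)
  have det: "0 * (-c) - 1 * 1 \<noteq> (0::complex)" by simp
  define M where "M = mob 0 1 1 (-c)"
  have mM: "mobius M" unfolding M_def mobius_def using det by blast
  have Mc: "M (Fin c) = Infty" by (simp add: M_def mob_def)
  have fin: "M (X i) \<noteq> Infty" if "i < N" for i
  proof
    assume "M (X i) = Infty"
    then have "X i = Fin c" using Mc mobius_inv_apply(2)[OF mM] by metis
    then show False using c that by (metis imageI lessThan_iff)
  qed
  define a where "a i = fin_part (M (X i))" for i
  have a: "M (X i) = Fin (a i)" if "i < N" for i using fin[OF that] by (cases "M (X i)") (auto simp: a_def)
  have ainj: "inj_on a {..<N}"
  proof (rule inj_onI)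
    fix i j assume ij: "i \<in> {..<N}" "j \<in> {..<N}" "a i = a j"
    then have "M (X i) = M (X j)" using a by simp
    then have "X i = X j" using mobius_inv_apply(2)[OF mM] by metis
    then show "i = j" using inj_onD[OF inj] ij by blast
  qed
  have cM: "cconv (\<lambda>n. M) M" by (rule cconv_const[OF rat_continuous[OF mobius_rat[OF mM]]])
  have cM': "cconv (\<lambda>n. inv M) (inv M)" by (rule cconv_const[OF rat_continuous[OF mobius_rat[OF mobius_inv(1)[OF mM]]]])
  define b where "b n i = fin_part (M (y n i))" for n i
  have My: "(\<lambda>n. M (y n i)) \<longlonglongrightarrow> Fin (a i)" if "i < N" for i using cconvD[OF cM y[OF that]] a[OF that] by simp
  have blim: "(\<lambda>n. b n i) \<longlonglongrightarrow> a i" if "i < N" for i using eventually_finite(2)[OF My[OF that]] by (simp add: b_def)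
  have evb: "\<forall>\<^sub>F n in sequentially. \<forall>i\<in>{..<N}. M (y n i) = Fin (b n i)"
    by (rule eventually_ball_finite) (use eventually_finite(3)[OF My] in \<open>auto simp: b_def\<close>)
  obtain \<phi> where \<phi>: "\<forall>\<^sub>F n in sequentially. (\<exists>\<psi>. homeomorphism UNIV UNIV (\<phi> n) \<psi>) \<and> (\<forall>i<N. \<phi> n (Fin (a i)) = Fin (b n i))"
     "cconv \<phi> id" using homeomorphisms_moving_finite_points[OF ainj blim] by blast
  have ev: "\<forall>\<^sub>F n in sequentially. (\<exists>\<psi>. homeomorphism UNIV UNIV (inv M \<circ> \<phi> n \<circ> M) \<psi>) \<and> (\<forall>i<N. (inv M \<circ> \<phi> n \<circ> M) (X i) = y n i)"
    using evb \<phi>(1)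
  proof eventually_elim
    case (elim n)
    then obtain \<psi> where \<psi>: "homeomorphism UNIV UNIV (\<phi> n) \<psi>" by blast
    have "homeomorphism UNIV UNIV (inv M) (inv (inv M))" by (rule mobius_homeomorphism[OF mobius_inv(1)[OF mM]])
    from homeomorphism_compose[OF homeomorphism_compose[OF mobius_homeomorphism[OF mM] \<psi>] this]
    have "homeomorphism UNIV UNIV (inv M \<circ> (\<phi> n \<circ> M)) (inv M \<circ> \<psi> \<circ> inv (inv M))" .
    moreover have "(inv M \<circ> \<phi> n \<circ> M) (X i) = y n i" if "i < N" for i
    proof -
      have "\<phi> n (M (X i)) = M (y n i)" using elim a that by simp
      then show ?thesis by (simp add: mobius_inv_apply(2)[OF mM])
    qed
    ultimately show ?case by (auto simp: comp_assoc)
  qed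
  have "cconv (\<lambda>n. inv M \<circ> \<phi> n \<circ> M) (inv M \<circ> id \<circ> M)" by (intro cconv_comp cM cM' \<phi>(2))
  then have "cconv (\<lambda>n. inv M \<circ> \<phi> n \<circ> M) id" using mobius_inv(3)[OF mM] by simp
  then have "uniform_limit UNIV (\<lambda>n. inv M \<circ> \<phi> n \<circ> M) id sequentially"
    using cconv_uniform unfolding uniform_limit_iff by fastforce
  with ev show ?thesis by (intro exI[of _ "\<lambda>n. inv M \<circ> \<phi> n \<circ> M"] conjI)
qed

section \<open>Arbitrary dynamics on finite sets\<close>

theorem theorem1p3:
  fixes X :: "riemann_sphere set" and F :: "riemann_sphere \<Rightarrow> riemann_sphere"
  assumes "finite X" and "card X \<ge> 3" and "F ` X \<subseteq> X"
  shows "\<exists>f :: nat \<Rightarrow> riemann_sphere \<Rightarrow> riemann_sphere.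
           (\<forall>n. postcritically_finite (f n) \<and> rigid (f n) \<and>
                card (postcritical_set (f n)) = card X) \<and>
           postcritical_dynamics_converge f F X"
proof -
  define N where "N = card X"
  obtain h where h: "bij_betw h {..<N} X"
    using ex_bij_betw_nat_finite[OF assms(1)] unfolding N_def atLeast0LessThan by blast
  have hX: "h ` {..<N} = X" and hinj: "inj_on h {..<N}" using h by (auto simp: bij_betw_def)
  have N3: "N \<ge> 3" using assms(2) by (simp add: N_def)
  have "\<forall>i. \<exists>j. i < N \<longrightarrow> j < N \<and> F (h i) = h j"
  proof
    fix i
    show "\<exists>j. i < N \<longrightarrow> j < N \<and> F (h i) = h j"
    proof (cases "i < N")
      case True
      then have "F (h i) \<in> h ` {..<N}" using assms(3) hX by blast
      then show ?thesis by auto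
    qed simp
  qed
  from choice[OF this] obtain FI where FI: "\<And>i. i < N \<Longrightarrow> FI i < N \<and> F (h i) = h (FI i)" by blast
  have "\<exists>f y. rigid f \<and> postcritically_finite f \<and> postcritical_set f = y ` {..<N} \<and>
    card (postcritical_set f) = N \<and> (\<forall>i<N. f (y i) = y (FI i) \<and> dist (y i) (h i) < 1 / Suc n)" for n
    by (rule rigid_map_near[OF N3 _ hinj]) (use FI in auto)
  then obtain f y where f: "\<And>n. rigid (f n)" "\<And>n. postcritically_finite (f n)" "\<And>n. postcritical_set (f n) = y n ` {..<N}"
    "\<And>n. card (postcritical_set (f n)) = N" "\<And>n i. i < N \<Longrightarrow> f n (y n i) = y n (FI i)"
    "\<And>n i. i < N \<Longrightarrow> dist (y n i) (h i) < 1 / Suc n" by metis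
  have "(\<lambda>n. y n i) \<longlonglongrightarrow> h i" if i: "i < N" for i
  proof (rule tendstoI)
    fix e :: real assume e: "e > 0"
    from eventually_inverse_Suc_less[OF e] show "\<forall>\<^sub>F n in sequentially. dist (y n i) (h i) < e"
      by eventually_elim (use f(6)[OF i] in \<open>meson order.strict_trans\<close>)
  qed
  from homeomorphisms_moving_points[OF hinj this] obtain \<phi> where
    \<phi>: "\<forall>\<^sub>F n in sequentially. (\<exists>\<psi>. homeomorphism UNIV UNIV (\<phi> n) \<psi>) \<and> (\<forall>i<N. \<phi> n (h i) = y n i)"
     "uniform_limit UNIV \<phi> id sequentially" by blast
  have "\<forall>\<^sub>F n in sequentially. (\<exists>\<psi>. homeomorphism UNIV UNIV (\<phi> n) \<psi>) \<and>
           \<phi> n ` X = postcritical_set (f n) \<and> (\<forall>x\<in>X. f n (\<phi> n x) = \<phi> n (F x))"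
    using \<phi>(1)
  proof eventually_elim
    case (elim n)
    have "\<phi> n ` X = postcritical_set (f n)" unfolding hX[symmetric] image_image f(3) using elim by (intro image_cong) auto
    moreover have "f n (\<phi> n x) = \<phi> n (F x)" if "x \<in> X" for x
    proof -
      obtain i where i: "i < N" "x = h i" using \<open>x \<in> X\<close>[folded hX] by blast
      show ?thesis using elim i FI[OF i(1)] f(5)[OF i(1)] by simp
    qed
    ultimately show ?case using elim by blast
  qed
  then have "postcritical_dynamics_converge f F X"
    unfolding postcritical_dynamics_converge_def using \<phi>(2) by blast
  then show ?thesis using f(1,2,4) unfolding N_def by blast
qed

end
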